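(* Let $(M,g)$ be a smooth Riemannian manifold of dimension at least $2$. Then the Kobayashi-Royden pseudometric $F_M : TM \to [0,+\infty)$ is an upper semi-continuous function on the tangent bundle $TM$.
   Context: All structures are $C^\infty$. $\mathbb{D}$ denotes the open unit disc in $\mathbb{R}^2\cong\mathbb{C}$, with standard metric $ds^2$, standard Lebesgue measure $dm$, and $e_1=(1,0)\in\mathbb{R}^2$. A smooth map $u:\mathbb{D}\to M$ is harmonic if it is a critical point of the energy $E(u)=\int_{\mathbb{D}}|du|^2\,dm$, i.e. it satisfies the associated Euler-Lagrange (harmonic map) equation, which in local coordinates on $M$ reads $\frac{\partial^2 u^i}{\partial z\partial\bar z}+\Gamma^i_{jk}(u)\frac{\partial u^j}{\partial z}\frac{\partial u^k}{\partial\bar z}=0$, with $\Gamma^i_{jk}$ the Christoffel symbols of $g$. A smooth map $u:\mathbb{D}\to M$ is conformal if $u^*g=e^{\phi}ds^2$ on $\mathbb{D}$ for some smooth function $\phi$. A conformal harmonic immersion is an immersion $u:\mathbb{D}\to M$ that is both conformal and harmonic. Kobayashi-Royden pseudometric: for $p\in M$ and $\xi\in T_pM$, $F_M(p,\xi):=\inf\frac1r$, where $r$ runs over all positive real numbers for which there exists a conformal harmonic immersion $u:\mathbb{D}\to M$ with $u(0)=p$ and $du(0)\cdot e_1=r\xi$. For $\xi=0$ one sets $F_M(p,0)=0$. *)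

theory Defs
  imports "HOL-Analysis.Analysis"
begin

section \<open>Smooth maps between Euclidean spaces\<close>

primrec Ck_on ::
  "nat \<Rightarrow> ('a::euclidean_space) set \<Rightarrow> ('a \<Rightarrow> 'b::real_normed_vector) \<Rightarrow> bool" where
  "Ck_on 0 S f \<longleftrightarrow> continuous_on S f"
| "Ck_on (Suc k) S f \<longleftrightarrow>
     (\<forall>x\<in>S. f differentiable (at x)) \<and> (\<forall>v. Ck_on k S (\<lambda>x. frechet_derivative f (at x) v))"

text \<open>Only used for open \<^term>\<open>S\<close>.\<close>

definition smooth_on :: "('a::euclidean_space) set \<Rightarrow> ('a \<Rightarrow> 'b::real_normed_vector) \<Rightarrow> bool" where
  "smooth_on S f \<longleftrightarrow> (\<forall>k. Ck_on k S f)"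

section \<open>Smooth manifolds\<close>

text \<open>A chart is a pair \<open>(U, \<phi>)\<close>; the values of \<open>\<phi>\<close> outside \<open>U\<close> are irrelevant.\<close>

type_synonym ('a, 'n) chart = "'a set \<times> ('a \<Rightarrow> real ^ 'n)"

definition chart_image :: "('a, 'n::finite) chart \<Rightarrow> (real ^ 'n) set" where
  "chart_image c = snd c ` fst c"

definition chart_inv :: "('a, 'n::finite) chart \<Rightarrow> real ^ 'n \<Rightarrow> 'a" where
  "chart_inv c = inv_into (fst c) (snd c)"

definition transition :: "('a, 'n::finite) chart \<Rightarrow> ('a, 'n) chart \<Rightarrow> real ^ 'n \<Rightarrow> real ^ 'n" where
  "transition c d = snd d \<circ> chart_inv c"

text \<open>The atlas \<open>A\<close> need not be maximal: it stands for the smooth structure it generates.\<close>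

locale smooth_manifold =
  fixes X :: "'a topology" and A :: "('a, 'n::finite) chart set"
  assumes hausdorff: "Hausdorff_space X"
    and second_countable: "second_countable X"
    and covers: "(\<Union>c\<in>A. fst c) = topspace X"
    and chart_open: "c \<in> A \<Longrightarrow> openin X (fst c)"
    and chart_image_open: "c \<in> A \<Longrightarrow> open (chart_image c)"
    and chart_homeo: "c \<in> A \<Longrightarrow>
          homeomorphic_map (subtopology X (fst c)) (top_of_set (chart_image c)) (snd c)"
    and compatible: "c \<in> A \<Longrightarrow> d \<in> A \<Longrightarrow> smooth_on (snd c ` (fst c \<inter> fst d)) (transition c d)"

section \<open>The tangent bundle\<close>

text \<open>A tangent vector at \<open>p\<close> is the family of its components in all charts around \<open>p\<close>, related
  to each other by the Jacobians of the transition maps. The entries at charts not containing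
  \<open>p\<close> are set to \<open>0\<close>, so that equal tangent vectors are equal functions.\<close>

type_synonym ('a, 'n) tvec = "('a, 'n) chart \<Rightarrow> real ^ 'n"

definition tangent_space :: "('a, 'n::finite) chart set \<Rightarrow> 'a \<Rightarrow> ('a, 'n) tvec set" where
  "tangent_space A p = {v.
     (\<forall>c. \<not> (c \<in> A \<and> p \<in> fst c) \<longrightarrow> v c = 0) \<and>
     (\<forall>c\<in>A. \<forall>d\<in>A. p \<in> fst c \<and> p \<in> fst d \<longrightarrow>
        v d = frechet_derivative (transition c d) (at (snd c p)) (v c))}"

definition tvec_zero :: "('a, 'n::finite) tvec" where
  "tvec_zero = (\<lambda>c. 0)"

definition tvec_add :: "('a, 'n::finite) tvec \<Rightarrow> ('a, 'n) tvec \<Rightarrow> ('a, 'n) tvec" where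
  "tvec_add v w = (\<lambda>c. v c + w c)"

definition tvec_scale :: "real \<Rightarrow> ('a, 'n::finite) tvec \<Rightarrow> ('a, 'n) tvec" where
  "tvec_scale r v = (\<lambda>c. r *\<^sub>R v c)"

text \<open>The tangent vector at \<open>p\<close> with components \<open>w\<close> in the chart \<open>c\<close>, i.e. \<open>\<Sum>\<^sub>i w\<^sub>i \<partial>/\<partial>x\<^sub>i\<close>.\<close>

definition tvec_of_coords ::
  "('a, 'n::finite) chart set \<Rightarrow> ('a, 'n) chart \<Rightarrow> 'a \<Rightarrow> real ^ 'n \<Rightarrow> ('a, 'n) tvec" where
  "tvec_of_coords A c p w =
     (\<lambda>d. if d \<in> A \<and> p \<in> fst d then frechet_derivative (transition c d) (at (snd c p)) w else 0)"

definition tangent_bundle ::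
  "'a topology \<Rightarrow> ('a, 'n::finite) chart set \<Rightarrow> ('a \<times> ('a, 'n) tvec) set" where
  "tangent_bundle X A = (SIGMA p:topspace X. tangent_space A p)"

text \<open>The inverse \<open>\<phi>(U) \<times> \<real>\<^sup>n \<rightarrow> TU\<close> of the bundle chart induced by a chart \<open>(U, \<phi>)\<close>.\<close>

definition bundle_param ::
  "('a, 'n::finite) chart set \<Rightarrow> ('a, 'n) chart \<Rightarrow> (real ^ 'n) \<times> (real ^ 'n) \<Rightarrow> 'a \<times> ('a, 'n) tvec" where
  "bundle_param A c = (\<lambda>(x, w). (chart_inv c x, tvec_of_coords A c (chart_inv c x) w))"

text \<open>A subset of \<open>TM\<close> is open iff it is open in all bundle charts.\<close>

definition tangent_bundle_topology ::
  "'a topology \<Rightarrow> ('a, 'n::finite) chart set \<Rightarrow> ('a \<times> ('a, 'n) tvec) topology" where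
  "tangent_bundle_topology X A = topology (\<lambda>W. W \<subseteq> tangent_bundle X A \<and>
     (\<forall>c\<in>A. open ((chart_image c \<times> UNIV) \<inter> bundle_param A c -` W)))"

section \<open>Riemannian metrics\<close>

text \<open>The matrix \<open>g\<^sub>i\<^sub>j\<close> of the metric in a chart, as a function of the coordinates.\<close>

definition metric_matrix ::
  "('a, 'n::finite) chart set \<Rightarrow> ('a \<Rightarrow> ('a, 'n) tvec \<Rightarrow> ('a, 'n) tvec \<Rightarrow> real) \<Rightarrow>
   ('a, 'n) chart \<Rightarrow> real ^ 'n \<Rightarrow> real ^ 'n ^ 'n" where
  "metric_matrix A g c x =
     (\<chi> i j. g (chart_inv c x) (tvec_of_coords A c (chart_inv c x) (axis i 1))
                               (tvec_of_coords A c (chart_inv c x) (axis j 1)))"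

text \<open>Only the values of \<open>g p\<close> on the tangent space at \<open>p\<close> matter.\<close>

locale riemannian_manifold = smooth_manifold X A
  for X :: "'a topology" and A :: "('a, 'n::finite) chart set" +
  fixes g :: "'a \<Rightarrow> ('a, 'n) tvec \<Rightarrow> ('a, 'n) tvec \<Rightarrow> real"
  assumes metric_sym: "p \<in> topspace X \<Longrightarrow> v \<in> tangent_space A p \<Longrightarrow> w \<in> tangent_space A p \<Longrightarrow>
            g p v w = g p w v"
    and metric_add: "p \<in> topspace X \<Longrightarrow> v \<in> tangent_space A p \<Longrightarrow> v' \<in> tangent_space A p \<Longrightarrow>
            w \<in> tangent_space A p \<Longrightarrow> g p (tvec_add v v') w = g p v w + g p v' w"
    and metric_scale: "p \<in> topspace X \<Longrightarrow> v \<in> tangent_space A p \<Longrightarrow> w \<in> tangent_space A p \<Longrightarrow>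
            g p (tvec_scale r v) w = r * g p v w"
    and metric_pos: "p \<in> topspace X \<Longrightarrow> v \<in> tangent_space A p \<Longrightarrow> v \<noteq> tvec_zero \<Longrightarrow> g p v v > 0"
    and metric_smooth: "c \<in> A \<Longrightarrow> smooth_on (chart_image c) (metric_matrix A g c)"

definition metric_partial ::
  "('a, 'n::finite) chart set \<Rightarrow> ('a \<Rightarrow> ('a, 'n) tvec \<Rightarrow> ('a, 'n) tvec \<Rightarrow> real) \<Rightarrow>
   ('a, 'n) chart \<Rightarrow> real ^ 'n \<Rightarrow> 'n \<Rightarrow> 'n \<Rightarrow> 'n \<Rightarrow> real" where
  "metric_partial A g c x k i j =
     frechet_derivative (\<lambda>y. metric_matrix A g c y $ i $ j) (at x) (axis k 1)"

text \<open>\<open>\<Gamma>\<^sup>i\<^sub>j\<^sub>k = 1/2 \<Sum>\<^sub>l g\<^sup>i\<^sup>l (\<partial>\<^sub>j g\<^sub>k\<^sub>l + \<partial>\<^sub>k g\<^sub>j\<^sub>l - \<partial>\<^sub>l g\<^sub>j\<^sub>k)\<close>\<close>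

definition christoffel ::
  "('a, 'n::finite) chart set \<Rightarrow> ('a \<Rightarrow> ('a, 'n) tvec \<Rightarrow> ('a, 'n) tvec \<Rightarrow> real) \<Rightarrow>
   ('a, 'n) chart \<Rightarrow> real ^ 'n \<Rightarrow> 'n \<Rightarrow> 'n \<Rightarrow> 'n \<Rightarrow> real" where
  "christoffel A g c x i j k =
     (\<Sum>l\<in>UNIV. matrix_inv (metric_matrix A g c x) $ i $ l *
        (metric_partial A g c x j k l + metric_partial A g c x k j l - metric_partial A g c x l j k)) / 2"

section \<open>Maps from the unit disc\<close>

text \<open>The disc is \<^term>\<open>ball (0::complex) 1\<close>; the vector \<open>e\<^sub>1 = (1, 0)\<close> is \<^term>\<open>1::complex\<close>.
  Values of a map outside the disc are irrelevant.\<close>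

abbreviation unit_disc :: "complex set" where
  "unit_disc \<equiv> ball 0 1"

definition smooth_disc_map ::
  "'a topology \<Rightarrow> ('a, 'n::finite) chart set \<Rightarrow> (complex \<Rightarrow> 'a) \<Rightarrow> bool" where
  "smooth_disc_map X A u \<longleftrightarrow>
     continuous_map (top_of_set unit_disc) X u \<and>
     (\<forall>c\<in>A. smooth_on {z \<in> unit_disc. u z \<in> fst c} (\<lambda>z. snd c (u z)))"

definition differential ::
  "('a, 'n::finite) chart set \<Rightarrow> (complex \<Rightarrow> 'a) \<Rightarrow> complex \<Rightarrow> complex \<Rightarrow> ('a, 'n) tvec" where
  "differential A u z e =
     (\<lambda>c. if c \<in> A \<and> u z \<in> fst c then frechet_derivative (\<lambda>w. snd c (u w)) (at z) e else 0)"

definition immersion :: "('a, 'n::finite) chart set \<Rightarrow> (complex \<Rightarrow> 'a) \<Rightarrow> bool" where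
  "immersion A u \<longleftrightarrow> (\<forall>z\<in>unit_disc. inj (differential A u z))"

text \<open>\<open>u\<^sup>*g = e\<^sup>\<phi> ds\<^sup>2\<close> with \<open>\<phi>\<close> smooth\<close>

definition conformal ::
  "('a, 'n::finite) chart set \<Rightarrow> ('a \<Rightarrow> ('a, 'n) tvec \<Rightarrow> ('a, 'n) tvec \<Rightarrow> real) \<Rightarrow>
   (complex \<Rightarrow> 'a) \<Rightarrow> bool" where
  "conformal A g u \<longleftrightarrow>
     (\<exists>\<phi> :: complex \<Rightarrow> real. smooth_on unit_disc \<phi> \<and>
        (\<forall>z\<in>unit_disc. \<forall>v w.
           g (u z) (differential A u z v) (differential A u z w) = exp (\<phi> z) * (v \<bullet> w)))"

text \<open>Wirtinger derivatives of real-differentiable functions.\<close>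

definition d_dz :: "(complex \<Rightarrow> complex) \<Rightarrow> complex \<Rightarrow> complex" where
  "d_dz f z = (frechet_derivative f (at z) 1 - \<i> * frechet_derivative f (at z) \<i>) / 2"

definition d_dzbar :: "(complex \<Rightarrow> complex) \<Rightarrow> complex \<Rightarrow> complex" where
  "d_dzbar f z = (frechet_derivative f (at z) 1 + \<i> * frechet_derivative f (at z) \<i>) / 2"

definition coord :: "('a, 'n::finite) chart \<Rightarrow> (complex \<Rightarrow> 'a) \<Rightarrow> 'n \<Rightarrow> complex \<Rightarrow> complex" where
  "coord c u i z = complex_of_real (snd c (u z) $ i)"

text \<open>The Euler-Lagrange equation of the energy \<open>\<integral> |du|\<^sup>2 dm\<close>, written in the charts of the atlas.\<close>

definition harmonic ::
  "('a, 'n::finite) chart set \<Rightarrow> ('a \<Rightarrow> ('a, 'n) tvec \<Rightarrow> ('a, 'n) tvec \<Rightarrow> real) \<Rightarrow>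
   (complex \<Rightarrow> 'a) \<Rightarrow> bool" where
  "harmonic A g u \<longleftrightarrow>
     (\<forall>c\<in>A. \<forall>z\<in>unit_disc. u z \<in> fst c \<longrightarrow>
        (\<forall>i. d_dz (d_dzbar (coord c u i)) z +
             (\<Sum>j\<in>UNIV. \<Sum>k\<in>UNIV. complex_of_real (christoffel A g c (snd c (u z)) i j k) *
                d_dz (coord c u j) z * d_dzbar (coord c u k) z) = 0))"

definition conformal_harmonic_immersion ::
  "'a topology \<Rightarrow> ('a, 'n::finite) chart set \<Rightarrow>
   ('a \<Rightarrow> ('a, 'n) tvec \<Rightarrow> ('a, 'n) tvec \<Rightarrow> real) \<Rightarrow> (complex \<Rightarrow> 'a) \<Rightarrow> bool" where
  "conformal_harmonic_immersion X A g u \<longleftrightarrow>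
     smooth_disc_map X A u \<and> immersion A u \<and> conformal A g u \<and> harmonic A g u"

section \<open>The Kobayashi-Royden pseudometric\<close>

text \<open>The values are taken in \<^typ>\<open>ennreal\<close>, so that the infimum of the empty set is \<open>\<infinity>\<close> and
  finiteness is a genuine assertion.\<close>

definition kobayashi_royden ::
  "'a topology \<Rightarrow> ('a, 'n::finite) chart set \<Rightarrow>
   ('a \<Rightarrow> ('a, 'n) tvec \<Rightarrow> ('a, 'n) tvec \<Rightarrow> real) \<Rightarrow> 'a \<times> ('a, 'n) tvec \<Rightarrow> ennreal" where
  "kobayashi_royden X A g = (\<lambda>(p, \<xi>).
     if \<xi> = tvec_zero then 0
     else Inf {ennreal (1 / r) | r. r > 0 \<and>
       (\<exists>u. conformal_harmonic_immersion X A g u \<and> u 0 = p \<and>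
            differential A u 0 1 = tvec_scale r \<xi>)})"

definition upper_semicontinuous_map :: "'b topology \<Rightarrow> ('b \<Rightarrow> 'c::linorder) \<Rightarrow> bool" where
  "upper_semicontinuous_map T f \<longleftrightarrow> (\<forall>a. openin T {x \<in> topspace T. f x < a})"

section \<open>Well-definedness of the topology of the tangent bundle\<close>

lemma openin_tangent_bundle_topology:
  "openin (tangent_bundle_topology X A) W \<longleftrightarrow> W \<subseteq> tangent_bundle X A \<and>
     (\<forall>c\<in>A. open ((chart_image c \<times> UNIV) \<inter> bundle_param A c -` W))"
proof -
  define Q where "Q c W = ((chart_image c \<times> UNIV) \<inter> bundle_param A c -` W)" for c W
  have Int: "Q c (S \<inter> T) = Q c S \<inter> Q c T" and Un: "Q c (\<Union>K) = (\<Union>W\<in>K. Q c W)" for c S T K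
    unfolding Q_def by auto
  have "istopology (\<lambda>W. W \<subseteq> tangent_bundle X A \<and> (\<forall>c\<in>A. open (Q c W)))"
    unfolding istopology_def Int Un by (blast intro: open_Int open_UN)
  then show ?thesis
    unfolding tangent_bundle_topology_def Q_def by (simp add: topology_inverse')
qed

context smooth_manifold
begin

lemma chart_inv_in: "x \<in> chart_image c \<Longrightarrow> chart_inv c x \<in> fst c"
  unfolding chart_image_def chart_inv_def by (rule inv_into_into)

lemma chart_chart_inv: "x \<in> chart_image c \<Longrightarrow> snd c (chart_inv c x) = x"
  unfolding chart_image_def chart_inv_def by (rule f_inv_into_f)

lemma chart_subset: "c \<in> A \<Longrightarrow> fst c \<subseteq> topspace X"
  using covers by auto

lemma chart_inj: "c \<in> A \<Longrightarrow> inj_on (snd c) (fst c)"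
  using chart_homeo[of c] chart_subset[of c]
  by (auto simp: homeomorphic_map_def Int_absorb1)

lemma chart_inv_chart: "c \<in> A \<Longrightarrow> p \<in> fst c \<Longrightarrow> chart_inv c (snd c p) = p"
  unfolding chart_inv_def by (rule inv_into_f_f[OF chart_inj])

lemma overlap_open:
  assumes "c \<in> A" "d \<in> A" shows "open (snd c ` (fst c \<inter> fst d))"
proof -
  have "openin (subtopology X (fst c)) (fst c \<inter> fst d)"
    using chart_open[OF assms(2)] by (auto simp: openin_subtopology)
  then have "openin (top_of_set (chart_image c)) (snd c ` (fst c \<inter> fst d))"
    using homeomorphic_imp_open_map[OF chart_homeo[OF assms(1)]] by (auto simp: open_map_def)
  then show ?thesis
    using chart_image_open[OF assms(1)] openin_open_eq by blast
qed

lemma transition_has_derivative: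
  assumes "c \<in> A" "d \<in> A" "p \<in> fst c" "p \<in> fst d"
  shows "(transition c d has_derivative frechet_derivative (transition c d) (at (snd c p)))
           (at (snd c p))"
proof -
  have "Ck_on (Suc 0) (snd c ` (fst c \<inter> fst d)) (transition c d)"
    using compatible[OF assms(1,2)] unfolding smooth_on_def by blast
  then show ?thesis
    using assms by (auto simp: frechet_derivative_works[symmetric])
qed

lemma transition_cocycle:
  assumes "c \<in> A" "d \<in> A" "e \<in> A" "p \<in> fst c" "p \<in> fst d" "p \<in> fst e"
  shows "frechet_derivative (transition c e) (at (snd c p)) w =
    frechet_derivative (transition d e) (at (snd d p))
      (frechet_derivative (transition c d) (at (snd c p)) w)"
proof -
  let ?x = "snd c p"
  have x: "transition c d ?x = snd d p"
    using assms by (simp add: transition_def chart_inv_chart)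
  have comp: "(transition d e \<circ> transition c d has_derivative
      frechet_derivative (transition d e) (at (snd d p)) \<circ>
      frechet_derivative (transition c d) (at ?x)) (at ?x)"
    using diff_chain_at[OF transition_has_derivative[OF assms(1,2,4,5)]]
      transition_has_derivative[OF assms(2,3,5,6)] x by simp
  have eq: "(transition d e \<circ> transition c d) y = transition c e y"
    if y: "y \<in> snd c ` (fst c \<inter> fst d)" for y
    using y assms by (auto simp: transition_def chart_inv_chart)
  have mem: "?x \<in> snd c ` (fst c \<inter> fst d)"
    using assms by blast
  show ?thesis
    using frechet_derivative_at[OF has_derivative_transform_within_open
        [OF comp overlap_open[OF assms(1,2)] mem eq]]
    by (metis comp_apply)
qed

lemma tvec_of_coords_in_tangent_space:
  assumes "c \<in> A" "p \<in> fst c"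
  shows "tvec_of_coords A c p w \<in> tangent_space A p"
proof -
  let ?v = "tvec_of_coords A c p w"
  have v: "?v d = frechet_derivative (transition c d) (at (snd c p)) w"
    if "d \<in> A" "p \<in> fst d" for d
    using that by (simp add: tvec_of_coords_def)
  have "?v e = frechet_derivative (transition d e) (at (snd d p)) (?v d)"
    if "d \<in> A" "e \<in> A" "p \<in> fst d" "p \<in> fst e" for d e
    unfolding v[OF that(1,3)] v[OF that(2,4)]
    by (rule transition_cocycle[OF assms(1) that(1,2) assms(2) that(3,4)])
  moreover have "?v d = 0" if "\<not> (d \<in> A \<and> p \<in> fst d)" for d
    using that by (auto simp: tvec_of_coords_def)
  ultimately show ?thesis
    unfolding tangent_space_def by blast
qed

lemma topspace_tangent_bundle_topology:
  "topspace (tangent_bundle_topology X A) = tangent_bundle X A"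
proof -
  have "bundle_param A c xw \<in> tangent_bundle X A"
    if "c \<in> A" "xw \<in> chart_image c \<times> UNIV" for c xw
  proof -
    have "chart_inv c (fst xw) \<in> fst c"
      using that(2) by (auto intro: chart_inv_in)
    then show ?thesis
      using chart_subset[OF that(1)]
        tvec_of_coords_in_tangent_space[OF that(1), of "chart_inv c (fst xw)" "snd xw"]
      unfolding tangent_bundle_def bundle_param_def split_beta by blast
  qed
  then have "(chart_image c \<times> UNIV) \<inter> bundle_param A c -` tangent_bundle X A = chart_image c \<times> UNIV"
    if "c \<in> A" for c
    using that by blast
  then have "openin (tangent_bundle_topology X A) (tangent_bundle X A)"
    unfolding openin_tangent_bundle_topology by (auto intro!: open_Times chart_image_open)
  then show ?thesis
    using openin_subset[of "tangent_bundle_topology X A"] openin_topspace[of "tangent_bundle_topology X A"]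
    unfolding openin_tangent_bundle_topology by blast
qed

end

end

theory Submission
  imports Defs
begin

text \<open>
  The heart of the matter is that a conformal harmonic disc survives small changes of its 1-jet at
  the centre. In coordinates in which the given disc is a piece of a coordinate plane, a disc \<open>U\<close> is
  conformal and harmonic iff \<open>w = \<partial>U/\<partial>z\<close> is a null vector of the metric with
  \<open>\<partial>w/\<partial>z\<^sup>- = - \<Gamma>(w, w\<^sup>-)\<close>. Solving the null condition for one component of \<open>w\<close>, recovering \<open>U\<close> from
  \<open>w\<close> by integration along rays, and inverting \<open>\<partial>/\<partial>z\<^sup>-\<close> by a Cauchy transform twisted by a Gaussian
  gives a fixed point equation; in the sup-norm weighted by the Gaussian it is a contraction, however
  large the disc is. The one component of the equation that was dropped, and the identity
  \<open>w = \<partial>U/\<partial>z\<close>, hold afterwards because their defects satisfy a Gronwall inequality along rays.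

  A slightly shrunk disc in a manifold is brought into such coordinates by transporting a chart at
  its centre along the rays, in small steps each of which takes place within a single chart. As the
  1-jet then varies over an open set, \<open>F\<^sub>M\<close> is upper semicontinuous at nonzero vectors. Dilating a
  chart turns the metric into a perturbation of a constant one, for which coordinate planes are
  conformal and harmonic; hence \<open>F\<^sub>M\<close> is finite. At zero vectors semicontinuity follows from the
  homogeneity of \<open>F\<^sub>M\<close> and the compactness of the unit sphere.
\<close>

section \<open>Calculus of smooth maps\<close>

text \<open>Only the 1-jet at the centre is prescribed, without boundary values, and the right-hand
  side of the equation for \<open>w\<close> contains no derivatives; so the unknown can be sought
  among continuous functions and its smoothness recovered afterwards. In the weighted norm both
  integral operators have norm of order \<open>1/M\<close>, while the Lipschitz constant of the
  cut-off right-hand side does not depend on \<open>M\<close>; this replaces the usual shrinking of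
  the domain. Being null and satisfying all components of the first-order system is one complex
  equation too many, hence the dropped component. Differentiating the null condition and comparing
  with the Koszul formula ties its defect and that of \<open>w = \<partial>U/\<partial>z\<close>
  together in a nondegenerate linear system. The disc may cross itself and need not lie in a chart;
  therefore the metric is pulled back along a map that is only a local diffeomorphism. Passing to a
  smaller disc costs nothing, because \<open>F\<^sub>M\<close> is an infimum and an inequality
  \<open>1/r < a\<close> leaves room.\<close>

lemma frechet_derivativeI:
  assumes "(f has_derivative f') (at x)"
  shows "frechet_derivative f (at x) = f'"
  using frechet_derivative_at[OF assms] by simp

lemma Ck_on_cong:
  fixes f g :: "'a::euclidean_space \<Rightarrow> 'b::real_normed_vector"
  assumes "open S" "\<And>x. x \<in> S \<Longrightarrow> f x = g x"
  shows "Ck_on k S f \<longleftrightarrow> Ck_on k S g"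
  using assms(2)
proof (induction k arbitrary: f g)
  case 0
  then show ?case by (auto intro: continuous_on_cong)
next
  case (Suc k)
  have d: "(f has_derivative D) (at x) \<longleftrightarrow> (g has_derivative D) (at x)" if "x \<in> S" for x D
    using Suc.prems assms(1) that
    by (metis has_derivative_transform_within_open)
  have "frechet_derivative f (at x) = frechet_derivative g (at x)" if "x \<in> S" for x
    unfolding frechet_derivative_def d[OF that] ..
  then have "Ck_on k S (\<lambda>x. frechet_derivative f (at x) v) = Ck_on k S (\<lambda>x. frechet_derivative g (at x) v)" for v
    by (intro Suc.IH) auto
  moreover have "f differentiable (at x) \<longleftrightarrow> g differentiable (at x)" if "x \<in> S" for x
    unfolding differentiable_def d[OF that] ..
  ultimately show ?case by auto
qed

lemma Ck_on_subset: "Ck_on k S f \<Longrightarrow> T \<subseteq> S \<Longrightarrow> Ck_on k T f"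
  by (induction k arbitrary: f) (auto intro: continuous_on_subset)

lemma Ck_on_SucD: "Ck_on (Suc k) S f \<Longrightarrow> Ck_on k S f"
proof (induction k arbitrary: f)
  case 0
  then show ?case
    by (auto intro!: continuous_at_imp_continuous_on differentiable_imp_continuous_within)
next
  case (Suc k)
  then show ?case by (metis Ck_on.simps(2))
qed

lemma Ck_on_le: "Ck_on k S f \<Longrightarrow> l \<le> k \<Longrightarrow> Ck_on l S f"
  by (induction k) (auto simp: le_Suc_eq simp del: Ck_on.simps dest: Ck_on_SucD)

lemma Ck_on_continuous: "Ck_on k S f \<Longrightarrow> continuous_on S f"
  using Ck_on_le[of k S f 0] by simp

lemma Ck_on_has_derivative:
  "Ck_on (Suc k) S f \<Longrightarrow> x \<in> S \<Longrightarrow> (f has_derivative frechet_derivative f (at x)) (at x)"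
  by (auto simp: frechet_derivative_works)

lemma Ck_on_SucI:
  fixes f :: "'a::euclidean_space \<Rightarrow> 'b::real_normed_vector"
  assumes "open S" "\<And>x. x \<in> S \<Longrightarrow> (f has_derivative f' x) (at x)"
    and "\<And>v. Ck_on k S (\<lambda>x. f' x v)"
  shows "Ck_on (Suc k) S f"
proof -
  have "Ck_on k S (\<lambda>x. frechet_derivative f (at x) v)" for v
    using assms(3)[of v] Ck_on_cong[OF assms(1), of "\<lambda>x. frechet_derivative f (at x) v" "\<lambda>x. f' x v" k]
      frechet_derivativeI[OF assms(2)] by simp
  then show ?thesis using assms(2) by (auto simp: differentiable_def)
qed

lemma Ck_on_local:
  assumes "\<And>x. x \<in> S \<Longrightarrow> \<exists>U. open U \<and> x \<in> U \<and> Ck_on k U f"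
  shows "Ck_on k S f"
  using assms
proof (induction k arbitrary: f)
  case 0
  have "continuous (at x) f" if "x \<in> S" for x
    using 0[OF that] by (auto simp: continuous_on_eq_continuous_at)
  then show ?case by (simp add: continuous_at_imp_continuous_on)
next
  case (Suc k)
  have "f differentiable (at x)" if "x \<in> S" for x
    using Suc.prems[OF that] by auto
  moreover have "Ck_on k S (\<lambda>x. frechet_derivative f (at x) v)" for v
    by (rule Suc.IH) (metis Suc.prems Ck_on.simps(2))
  ultimately show ?case by simp
qed

lemma Ck_on_const: "Ck_on k S (\<lambda>x. c)"
  by (induction k arbitrary: c) auto

lemma Ck_on_linear_comp:
  fixes f :: "'a::euclidean_space \<Rightarrow> 'b::real_normed_vector"
  assumes "bounded_linear L" "open S" "Ck_on k S f"
  shows "Ck_on k S (\<lambda>x. L (f x))"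
  using assms(3)
proof (induction k arbitrary: f)
  case 0
  then show ?case using assms(1) by (auto intro: bounded_linear.continuous_on)
next
  case (Suc k)
  show ?case
    by (rule Ck_on_SucI[OF assms(2), where f'="\<lambda>x v. L (frechet_derivative f (at x) v)"])
      (use Suc in \<open>auto intro!: bounded_linear.has_derivative[OF assms(1)] simp: frechet_derivative_works\<close>)
qed

lemma Ck_on_bounded_linear:
  fixes L :: "'a::euclidean_space \<Rightarrow> 'b::real_normed_vector"
  assumes "bounded_linear L" "open S" shows "Ck_on k S L"
proof (cases k)
  case 0
  then show ?thesis using assms by (auto intro: linear_continuous_on)
next
  case (Suc j)
  then show ?thesis
    by (auto intro!: Ck_on_SucI[OF assms(2), where f'="\<lambda>x v. L v"] Ck_on_const
        bounded_linear_imp_has_derivative assms simp del: Ck_on.simps)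
qed

lemma Ck_on_add:
  fixes f g :: "'a::euclidean_space \<Rightarrow> 'b::real_normed_vector"
  assumes "open S" "Ck_on k S f" "Ck_on k S g"
  shows "Ck_on k S (\<lambda>x. f x + g x)"
  using assms(2,3)
proof (induction k arbitrary: f g)
  case 0
  then show ?case by (auto intro: continuous_intros)
next
  case (Suc k)
  show ?case
    by (rule Ck_on_SucI[OF assms(1), where f'="\<lambda>x v. frechet_derivative f (at x) v + frechet_derivative g (at x) v"])
      (use Suc in \<open>auto intro!: has_derivative_add simp: frechet_derivative_works\<close>)
qed

lemma Ck_on_Pair:
  assumes "open S" "Ck_on k S f" "Ck_on k S g" shows "Ck_on k S (\<lambda>x. (f x, g x))"
  using Ck_on_add[OF assms(1) Ck_on_linear_comp[OF bounded_linear_Pair[OF bounded_linear_ident bounded_linear_zero] assms(1,2)]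
    Ck_on_linear_comp[OF bounded_linear_Pair[OF bounded_linear_zero bounded_linear_ident] assms(1,3)]]
  by simp

lemma Ck_on_bilinear:
  fixes f :: "'a::euclidean_space \<Rightarrow> 'b::real_normed_vector" and g :: "'a \<Rightarrow> 'c::real_normed_vector"
  assumes "bounded_bilinear B" "open S" "Ck_on k S f" "Ck_on k S g"
  shows "Ck_on k S (\<lambda>x. B (f x) (g x))"
  using assms(3,4)
proof (induction k arbitrary: f g)
  case 0
  then show ?case using assms(1) by (auto intro: bounded_bilinear.continuous_on)
next
  case (Suc k)
  show ?case
  proof (rule Ck_on_SucI[OF assms(2), where
        f'="\<lambda>x v. B (f x) (frechet_derivative g (at x) v) + B (frechet_derivative f (at x) v) (g x)"])
    show "((\<lambda>x. B (f x) (g x)) has_derivative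
        (\<lambda>v. B (f x) (frechet_derivative g (at x) v) + B (frechet_derivative f (at x) v) (g x))) (at x)"
      if "x \<in> S" for x
      using that Suc.prems by (intro bounded_bilinear.FDERIV[OF assms(1)] Ck_on_has_derivative)
    show "Ck_on k S (\<lambda>x. B (f x) (frechet_derivative g (at x) v) + B (frechet_derivative f (at x) v) (g x))" for v
      using Suc.prems Ck_on_SucD[OF Suc.prems(1)] Ck_on_SucD[OF Suc.prems(2)]
      by (intro Ck_on_add assms(2) Suc.IH) auto
  qed
qed

lemma Ck_on_sum:
  fixes f :: "'i \<Rightarrow> 'a::euclidean_space \<Rightarrow> 'b::real_normed_vector"
  assumes "open S" "\<And>i. i \<in> I \<Longrightarrow> Ck_on k S (f i)"
  shows "Ck_on k S (\<lambda>x. \<Sum>i\<in>I. f i x)"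
  using assms(2)
  by (induction I rule: infinite_finite_induct) (auto intro: Ck_on_add[OF assms(1)] Ck_on_const)

lemma Ck_on_euclidean:
  fixes f :: "'a::euclidean_space \<Rightarrow> 'b::euclidean_space"
  assumes "open S" "\<And>b. b \<in> Basis \<Longrightarrow> Ck_on k S (\<lambda>x. f x \<bullet> b)"
  shows "Ck_on k S f"
proof -
  have "Ck_on k S (\<lambda>x. \<Sum>b\<in>Basis. (f x \<bullet> b) *\<^sub>R b)"
    by (intro Ck_on_sum assms Ck_on_linear_comp[of "\<lambda>r. r *\<^sub>R _"] bounded_linear_scaleR_left)
  then show ?thesis by (simp add: euclidean_representation)
qed

lemma linear_eq_sum_Basis:
  fixes x :: "'a::euclidean_space"
  assumes "linear L" shows "L x = (\<Sum>b\<in>Basis. (x \<bullet> b) *\<^sub>R L b)"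
proof -
  have "L (\<Sum>b\<in>Basis. (x \<bullet> b) *\<^sub>R b) = (\<Sum>b\<in>Basis. (x \<bullet> b) *\<^sub>R L b)"
    using assms by (simp add: linear_sum linear_scale)
  then show ?thesis by (simp add: euclidean_representation)
qed

text \<open>\<open>Ck_on\<close> speaks of derivatives in a fixed direction, whereas the chain rule
  applies the derivative of \<open>f\<close> to the varying vector \<open>g' x v\<close>. Expanding
  that vector in \<open>Basis\<close> gives sums of products of functions of one order less, so the
  induction closes without multilinear derivatives.\<close>

lemma Ck_on_comp:
  fixes f :: "'b::euclidean_space \<Rightarrow> 'c::real_normed_vector" and g :: "'a::euclidean_space \<Rightarrow> 'b"
  assumes "open S" "open T" "Ck_on k T f" "Ck_on k S g" "\<And>x. x \<in> S \<Longrightarrow> g x \<in> T"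
  shows "Ck_on k S (\<lambda>x. f (g x))"
  using assms(3,4)
proof (induction k arbitrary: f)
  case 0
  then show ?case using assms(5) by (auto intro: continuous_on_compose2)
next
  case (Suc k)
  let ?f' = "\<lambda>x. frechet_derivative f (at x)" and ?g' = "\<lambda>x. frechet_derivative g (at x)"
  have d: "((\<lambda>x. f (g x)) has_derivative (\<lambda>v. ?f' (g x) (?g' x v))) (at x)" if "x \<in> S" for x
    using diff_chain_at[OF Ck_on_has_derivative[OF Suc.prems(2) that] Ck_on_has_derivative[OF Suc.prems(1) assms(5)[OF that]]]
    by (simp add: o_def)
  have lin: "linear (?f' (g x))" if "x \<in> S" for x
    using Ck_on_has_derivative[OF Suc.prems(1) assms(5)[OF that]] has_derivative_linear by blast
  have "Ck_on k S (\<lambda>x. \<Sum>b\<in>Basis. (?g' x v \<bullet> b) *\<^sub>R ?f' (g x) b)" for v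
  proof (intro Ck_on_sum assms(1) Ck_on_bilinear[OF bounded_bilinear_scaleR])
    fix b :: 'b
    show "Ck_on k S (\<lambda>x. ?g' x v \<bullet> b)"
      using Suc.prems(2) by (intro Ck_on_linear_comp[OF bounded_linear_inner_left] assms(1)) simp
    show "Ck_on k S (\<lambda>x. ?f' (g x) b)"
      using Suc.prems Ck_on_SucD[OF Suc.prems(2)] by (intro Suc.IH) auto
  qed
  then have "Ck_on k S (\<lambda>x. ?f' (g x) (?g' x v))" for v
    by (subst Ck_on_cong[OF assms(1) linear_eq_sum_Basis[OF lin]])
  then show ?case using Ck_on_SucI[OF assms(1) d] by blast
qed

lemma smooth_onD: "smooth_on S f \<Longrightarrow> Ck_on k S f"
  by (simp add: smooth_on_def)

lemma smooth_on_has_derivative: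
  "smooth_on S f \<Longrightarrow> x \<in> S \<Longrightarrow> (f has_derivative frechet_derivative f (at x)) (at x)"
  using Ck_on_has_derivative[OF smooth_onD] by blast

lemma smooth_on_linear_frechet:
  "smooth_on S f \<Longrightarrow> x \<in> S \<Longrightarrow> linear (frechet_derivative f (at x))"
  using smooth_on_has_derivative has_derivative_linear by blast

lemma smooth_on_frechet:
  "smooth_on S f \<Longrightarrow> smooth_on S (\<lambda>x. frechet_derivative f (at x) v)"
  unfolding smooth_on_def by (metis Ck_on.simps(2))

lemma smooth_onI:
  fixes f :: "'a::euclidean_space \<Rightarrow> 'b::real_normed_vector"
  assumes "open S" "\<And>x. x \<in> S \<Longrightarrow> (f has_derivative f' x) (at x)"
    and "\<And>v. smooth_on S (\<lambda>x. f' x v)"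
  shows "smooth_on S f"
proof -
  have "Ck_on (Suc k) S f" for k
    using assms by (intro Ck_on_SucI) (auto simp: smooth_on_def)
  then show ?thesis unfolding smooth_on_def using Ck_on_SucD by blast
qed

lemma smooth_on_continuous: "smooth_on S f \<Longrightarrow> continuous_on S f"
  using Ck_on_continuous smooth_onD by blast

lemma smooth_on_cong:
  fixes f g :: "'a::euclidean_space \<Rightarrow> 'b::real_normed_vector"
  shows "smooth_on S f \<Longrightarrow> open S \<Longrightarrow> (\<And>x. x \<in> S \<Longrightarrow> g x = f x) \<Longrightarrow> smooth_on S g"
  unfolding smooth_on_def by (subst Ck_on_cong[of S g f]) auto

lemma smooth_on_subset: "smooth_on S f \<Longrightarrow> T \<subseteq> S \<Longrightarrow> smooth_on T f"
  unfolding smooth_on_def using Ck_on_subset by blast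

lemma smooth_on_local:
  assumes "\<And>x. x \<in> S \<Longrightarrow> \<exists>U. open U \<and> x \<in> U \<and> smooth_on U f"
  shows "smooth_on S f"
  unfolding smooth_on_def
proof (intro allI Ck_on_local)
  show "\<exists>U. open U \<and> x \<in> U \<and> Ck_on k U f" if "x \<in> S" for x k
    using assms[OF that] smooth_onD by blast
qed

lemma smooth_on_Un:
  assumes "open S" "open T" "smooth_on S f" "smooth_on T f"
  shows "smooth_on (S \<union> T) f"
  by (rule smooth_on_local) (use assms in auto)

lemma smooth_on_const [simp, intro]: "smooth_on S (\<lambda>x. c)"
  unfolding smooth_on_def using Ck_on_const by blast

lemma smooth_on_bounded_linear: "bounded_linear L \<Longrightarrow> open S \<Longrightarrow> smooth_on S L"
  by (simp add: smooth_on_def Ck_on_bounded_linear)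

lemma smooth_on_linear_comp: "bounded_linear L \<Longrightarrow> open S \<Longrightarrow> smooth_on S f \<Longrightarrow> smooth_on S (\<lambda>x. L (f x))"
  by (simp add: smooth_on_def Ck_on_linear_comp)

lemma smooth_on_ident: "open S \<Longrightarrow> smooth_on S (\<lambda>x. x)"
  by (intro smooth_on_bounded_linear bounded_linear_ident)

lemma smooth_on_add: "open S \<Longrightarrow> smooth_on S f \<Longrightarrow> smooth_on S g \<Longrightarrow> smooth_on S (\<lambda>x. f x + g x)"
  by (simp add: smooth_on_def Ck_on_add)

lemma smooth_on_bilinear:
  "bounded_bilinear B \<Longrightarrow> open S \<Longrightarrow> smooth_on S f \<Longrightarrow> smooth_on S g \<Longrightarrow> smooth_on S (\<lambda>x. B (f x) (g x))"
  by (simp add: smooth_on_def Ck_on_bilinear)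

lemma smooth_on_sum: "open S \<Longrightarrow> (\<And>i. i \<in> I \<Longrightarrow> smooth_on S (f i)) \<Longrightarrow> smooth_on S (\<lambda>x. \<Sum>i\<in>I. f i x)"
  by (simp add: smooth_on_def Ck_on_sum)

lemma smooth_on_comp:
  fixes f :: "'b::euclidean_space \<Rightarrow> 'c::real_normed_vector" and g :: "'a::euclidean_space \<Rightarrow> 'b"
  shows "open S \<Longrightarrow> open T \<Longrightarrow> smooth_on T f \<Longrightarrow> smooth_on S g \<Longrightarrow> (\<And>x. x \<in> S \<Longrightarrow> g x \<in> T) \<Longrightarrow>
    smooth_on S (\<lambda>x. f (g x))"
  by (simp add: smooth_on_def Ck_on_comp[of S T])

lemma smooth_on_euclidean:
  fixes f :: "'a::euclidean_space \<Rightarrow> 'b::euclidean_space"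
  assumes "open S" "\<And>b. b \<in> Basis \<Longrightarrow> smooth_on S (\<lambda>x. f x \<bullet> b)"
  shows "smooth_on S f"
  using assms unfolding smooth_on_def by (auto intro: Ck_on_euclidean)

lemmas smooth_on_scaleR = smooth_on_bilinear[OF bounded_bilinear_scaleR]
lemmas smooth_on_mult = smooth_on_bilinear[OF bounded_bilinear_mult]
lemmas smooth_on_inner = smooth_on_bilinear[OF bounded_bilinear_inner]
lemmas smooth_on_of_real = smooth_on_linear_comp[OF bounded_linear_of_real]
lemmas smooth_on_fst = smooth_on_linear_comp[OF bounded_linear_fst]
lemmas smooth_on_snd = smooth_on_linear_comp[OF bounded_linear_snd]
lemmas smooth_on_minus = smooth_on_linear_comp[OF bounded_linear_minus[OF bounded_linear_ident]]
lemmas smooth_on_vec_nth = smooth_on_linear_comp[OF bounded_linear_vec_nth]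

lemma smooth_on_diff:
  "open S \<Longrightarrow> smooth_on S f \<Longrightarrow> smooth_on S g \<Longrightarrow> smooth_on S (\<lambda>x. f x - g x)"
  using smooth_on_add[of S f "\<lambda>x. - g x"] smooth_on_minus[of S g] by simp

lemma smooth_on_Pair:
  assumes "open S" "smooth_on S f" "smooth_on S g" shows "smooth_on S (\<lambda>x. (f x, g x))"
  using assms by (simp add: smooth_on_def Ck_on_Pair)

lemma smooth_on_vec_lambda:
  fixes f :: "'i::finite \<Rightarrow> 'a::euclidean_space \<Rightarrow> 'b::euclidean_space"
  assumes "open S" "\<And>i. smooth_on S (f i)" shows "smooth_on S (\<lambda>x. \<chi> i. f i x)"
proof (rule smooth_on_euclidean[OF assms(1)])
  fix b :: "'b ^ 'i" assume "b \<in> Basis"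
  then obtain i c where "b = axis i c" unfolding Basis_vec_def by auto
  then show "smooth_on S (\<lambda>x. (\<chi> i. f i x) \<bullet> b)"
    using assms by (auto simp: inner_axis intro!: smooth_on_inner)
qed

lemma smooth_on_prod:
  fixes f :: "'i \<Rightarrow> 'a::euclidean_space \<Rightarrow> 'b::{real_normed_algebra,comm_ring_1}"
  assumes "open S" "\<And>i. i \<in> I \<Longrightarrow> smooth_on S (f i)"
  shows "smooth_on S (\<lambda>x. \<Prod>i\<in>I. f i x)"
  using assms(2)
  by (induction I rule: infinite_finite_induct) (auto intro!: smooth_on_mult[OF assms(1)])

text \<open>The derivative is a product of values of \<open>inverse\<close> itself, so the induction
  hypothesis feeds its own next step. The same mechanism works for \<open>csqrt\<close>
  below.\<close>

lemma Ck_on_inverse: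
  fixes S :: "'a::{real_normed_field,euclidean_space} set"
  assumes "open S" "0 \<notin> S" shows "Ck_on k S inverse"
proof (induction k)
  case 0
  then show ?case using assms(2) by (auto intro!: continuous_on_inverse continuous_on_id)
next
  case (Suc k)
  show ?case
    by (rule Ck_on_SucI[OF assms(1), where f'="\<lambda>x v. - (inverse x * v * inverse x)"])
      (use assms(2) in \<open>auto intro!: has_derivative_inverse' Ck_on_linear_comp[OF bounded_linear_minus[OF bounded_linear_ident]]
        Ck_on_bilinear[OF bounded_bilinear_mult] Ck_on_const Suc assms(1)\<close>)
qed

lemma smooth_on_inverse:
  fixes f :: "'a::euclidean_space \<Rightarrow> 'b::{real_normed_field,euclidean_space}"
  assumes "open S" "smooth_on S f" "\<And>x. x \<in> S \<Longrightarrow> f x \<noteq> 0"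
  shows "smooth_on S (\<lambda>x. inverse (f x))"
  by (rule smooth_on_comp[OF assms(1), of "- {0}"])
    (use assms in \<open>auto simp: smooth_on_def intro: Ck_on_inverse\<close>)

lemma smooth_on_divide:
  fixes f g :: "'a::euclidean_space \<Rightarrow> 'b::{real_normed_field,euclidean_space}"
  assumes "open S" "smooth_on S f" "smooth_on S g" "\<And>x. x \<in> S \<Longrightarrow> g x \<noteq> 0"
  shows "smooth_on S (\<lambda>x. f x / g x)"
  unfolding divide_inverse by (intro smooth_on_mult smooth_on_inverse assms)

lemma smooth_on_ln:
  fixes f :: "'a::euclidean_space \<Rightarrow> real"
  assumes "open S" "smooth_on S f" "\<And>x. x \<in> S \<Longrightarrow> f x > 0" shows "smooth_on S (\<lambda>x. ln (f x))"
proof -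
  have "smooth_on {0<..} (ln :: real \<Rightarrow> real)"
    by (rule smooth_onI[where f'="\<lambda>x v. v * inverse x"])
      (auto intro!: derivative_eq_intros smooth_on_mult smooth_on_inverse smooth_on_ident simp: divide_inverse)
  then show ?thesis
    by (rule smooth_on_comp[OF assms(1) open_greaterThan]) (use assms in auto)
qed

lemma Ck_on_csqrt: "Ck_on k (- \<real>\<^sub>\<le>\<^sub>0) csqrt"
proof (induction k)
  case 0
  then show ?case by (auto intro: continuous_on_csqrt)
next
  case (Suc k)
  have o: "open (- \<real>\<^sub>\<le>\<^sub>0 :: complex set)" by (simp add: open_Compl)
  have nz: "csqrt z \<noteq> 0" if "z \<in> - \<real>\<^sub>\<le>\<^sub>0" for z using that by auto
  show ?case
  proof (rule Ck_on_SucI[OF o, where f'="\<lambda>x v. inverse (2 * csqrt x) * v"])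
    show "(csqrt has_derivative ((*) (inverse (2 * csqrt x)))) (at x)" if "x \<in> - \<real>\<^sub>\<le>\<^sub>0" for x
      using that has_field_derivative_csqrt[of x] by (simp add: has_field_derivative_def)
    show "Ck_on k (- \<real>\<^sub>\<le>\<^sub>0) (\<lambda>x. inverse (2 * csqrt x) * v)" for v
      by (intro Ck_on_bilinear[OF bounded_bilinear_mult] o Ck_on_const
          Ck_on_comp[OF o, of "- {0}" _ inverse "\<lambda>x. 2 * csqrt x"] Ck_on_inverse Suc)
        (use nz in auto)
  qed
qed

lemma smooth_on_csqrt:
  fixes f :: "'a::euclidean_space \<Rightarrow> complex"
  assumes "open S" "smooth_on S f" "\<And>x. x \<in> S \<Longrightarrow> f x \<notin> \<real>\<^sub>\<le>\<^sub>0" shows "smooth_on S (\<lambda>x. csqrt (f x))"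
  by (rule smooth_on_comp[OF assms(1), of "- \<real>\<^sub>\<le>\<^sub>0"])
    (use assms in \<open>auto simp: smooth_on_def intro: Ck_on_csqrt\<close>)

lemma smooth_on_det:
  fixes M :: "'a::euclidean_space \<Rightarrow> real^'n^'n"
  assumes "open S" "\<And>i j. smooth_on S (\<lambda>x. M x $ i $ j)" shows "smooth_on S (\<lambda>x. det (M x))"
  unfolding det_def by (intro smooth_on_sum smooth_on_mult smooth_on_prod smooth_on_const assms)

lemma matrix_inv_right:
  fixes A :: "real^'n^'n"
  assumes "invertible A" shows "A ** matrix_inv A = mat 1"
  using someI_ex[OF assms[unfolded invertible_def]] by (simp add: matrix_inv_def)

text \<open>By Cramer's rule each entry of the inverse is a quotient of determinants, and these are
  polynomials in the entries.\<close>

lemma smooth_on_matrix_inv: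
  fixes M :: "'a::euclidean_space \<Rightarrow> real^'n^'n"
  assumes "open S" "\<And>i j. smooth_on S (\<lambda>x. M x $ i $ j)" "\<And>x. x \<in> S \<Longrightarrow> invertible (M x)"
  shows "smooth_on S (\<lambda>x. matrix_inv (M x) $ i $ j)"
proof (rule smooth_on_cong[OF _ assms(1)])
  let ?N = "\<lambda>x. (\<chi> k l. if l = i then (if k = j then 1 else 0) else M x $ k $ l) :: real^'n^'n"
  show "matrix_inv (M x) $ i $ j = det (?N x) / det (M x)" if "x \<in> S" for x
  proof -
    have inv: "M x ** matrix_inv (M x) = mat 1" and "det (M x) \<noteq> 0"
      using assms(3)[OF that] by (auto simp: matrix_inv_right invertible_det_nz)
    have "M x *v (matrix_inv (M x) *v axis j 1) = axis j 1"
      by (simp add: matrix_vector_mul_assoc inv)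
    then have "matrix_inv (M x) *v axis j 1 =
        (\<chi> k. det (\<chi> a b. if b = k then (axis j 1 :: real^'n) $ a else M x $ a $ b) / det (M x))"
      using cramer[OF \<open>det (M x) \<noteq> 0\<close>] by blast
    then have "(matrix_inv (M x) *v axis j 1) $ i = det (?N x) / det (M x)"
      by (simp add: axis_def if_distrib cong: if_cong)
    then show ?thesis
      by (simp add: matrix_vector_mult_def axis_def if_distrib sum.delta cong: if_cong)
  qed
  have "smooth_on S (\<lambda>x. ?N x $ k $ l)" for k l
    using assms(2) by (cases "l = i"; cases "k = j") auto
  then show "smooth_on S (\<lambda>x. det (?N x) / det (M x))"
    using assms by (intro smooth_on_divide smooth_on_det) (auto simp: invertible_det_nz)
qed

section \<open>Integral operators on the plane\<close>

text \<open>The Leibniz rule for a derivative that is only known to be continuous in each fixed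
  direction, the form in which \<open>Ck_on\<close> supplies it. In finite dimension this already
  gives continuity as a map into bounded linear functions.\<close>

lemma param_integral_has_derivative:
  fixes \<phi> :: "'z::euclidean_space \<Rightarrow> 'p::euclidean_space \<Rightarrow> 'b::euclidean_space"
  assumes d: "\<And>z p. p \<in> cbox a b \<Longrightarrow> ((\<lambda>z. \<phi> z p) has_derivative D z p) (at z)"
    and c: "continuous_on (UNIV \<times> cbox a b) (\<lambda>(z, p). \<phi> z p)"
    and cD: "\<And>v. continuous_on (UNIV \<times> cbox a b) (\<lambda>(z, p). D z p v)"
  shows "((\<lambda>z. integral (cbox a b) (\<phi> z)) has_derivative (\<lambda>v. integral (cbox a b) (\<lambda>p. D z p v))) (at z)"
proof -
  have bl: "blinfun_apply (Blinfun (D z p)) = D z p" if "p \<in> cbox a b" for z p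
    using d[OF that] has_derivative_bounded_linear bounded_linear_Blinfun_apply by blast
  have cB: "continuous_on (UNIV \<times> cbox a b) (\<lambda>(z, p). Blinfun (D z p))"
  proof -
    have "continuous_on (UNIV \<times> cbox a b) (\<lambda>x. Blinfun (D (fst x) (snd x)))"
    proof (rule continuous_on_blinfun_componentwise)
      fix i :: 'z
      have "continuous_on (UNIV \<times> cbox a b) (\<lambda>x. D (fst x) (snd x) i)"
        using cD[of i] by (simp add: split_beta)
      then show "continuous_on (UNIV \<times> cbox a b) (\<lambda>x. blinfun_apply (Blinfun (D (fst x) (snd x))) i)"
        by (rule continuous_on_eq) (auto simp: bl)
    qed
    then show ?thesis by (simp add: split_beta)
  qed
  have ci: "continuous_on (cbox a b) (\<lambda>p. f z p)" if "continuous_on (UNIV \<times> cbox a b) (\<lambda>(z, p). f z p)"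
    for f :: "'z \<Rightarrow> 'p \<Rightarrow> 'q::topological_space" and z
    using continuous_on_compose2[OF that continuous_on_Pair[OF continuous_on_const[of _ z] continuous_on_id], of "cbox a b"]
    by auto
  have "((\<lambda>z. integral (cbox a b) (\<phi> z)) has_derivative
      blinfun_apply (integral (cbox a b) (\<lambda>p. Blinfun (D z p)))) (at z within UNIV)"
    by (rule leibniz_rule) (use d bl cB ci[OF c] in \<open>auto intro!: integrable_continuous\<close>)
  moreover have "blinfun_apply (integral (cbox a b) (\<lambda>p. Blinfun (D z p))) =
      (\<lambda>v. integral (cbox a b) (\<lambda>p. D z p v))"
  proof
    fix v
    have "blinfun_apply (integral (cbox a b) (\<lambda>p. Blinfun (D z p))) v =
        integral (cbox a b) (\<lambda>p. blinfun_apply (Blinfun (D z p)) v)"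
      by (intro blinfun_apply_integral integrable_continuous ci[OF cB])
    also have "\<dots> = integral (cbox a b) (\<lambda>p. D z p v)"
      by (intro integral_cong) (simp add: bl)
    finally show "blinfun_apply (integral (cbox a b) (\<lambda>p. Blinfun (D z p))) v = \<dots>" .
  qed
  ultimately show ?thesis by simp
qed

lemma continuous_on_UNIV_comp:
  "continuous_on UNIV f \<Longrightarrow> continuous_on S g \<Longrightarrow> continuous_on S (\<lambda>x. f (g x))"
  by (rule continuous_on_compose2[of UNIV f]) auto

lemma C1_continuous_derivative:
  assumes "Ck_on (Suc k) UNIV f"
  shows "continuous_on UNIV (\<lambda>x. frechet_derivative f (at x) v)"
  using assms Ck_on_continuous[of k UNIV "\<lambda>x. frechet_derivative f (at x) v"] by simp

lemma C1_continuous_derivative2: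
  fixes f :: "'a::euclidean_space \<Rightarrow> 'b::real_normed_vector"
  assumes f: "Ck_on (Suc k) UNIV f" and "continuous_on S g" "continuous_on S w"
  shows "continuous_on S (\<lambda>x. frechet_derivative f (at (g x)) (w x))"
proof -
  have "frechet_derivative f (at (g x)) (w x) = (\<Sum>b\<in>Basis. (w x \<bullet> b) *\<^sub>R frechet_derivative f (at (g x)) b)" for x
    using linear_eq_sum_Basis has_derivative_linear[OF Ck_on_has_derivative[OF f]] by blast
  then show ?thesis
    using assms by (auto intro!: continuous_intros continuous_on_UNIV_comp[OF C1_continuous_derivative[OF f]])
qed

subsection \<open>Integration along rays\<close>

text \<open>The power \<open>s ^ j\<close> records how often the function has been differentiated:
  each derivative of \<open>f (s *\<^sub>R z)\<close> in \<open>z\<close> releases a factor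
  \<open>s\<close>.\<close>

definition ray_int :: "nat \<Rightarrow> (complex \<Rightarrow> 'b::euclidean_space) \<Rightarrow> complex \<Rightarrow> 'b" where
  "ray_int j f z = integral (cbox 0 1) (\<lambda>s::real. s ^ j *\<^sub>R f (s *\<^sub>R z))"

lemma ray_int_integrable:
  fixes f :: "complex \<Rightarrow> 'b::euclidean_space"
  shows "continuous_on UNIV f \<Longrightarrow> (\<lambda>s::real. s ^ j *\<^sub>R f (s *\<^sub>R z)) integrable_on cbox 0 1"
  by (rule integrable_continuous, rule continuous_on_scaleR, intro continuous_intros,
    rule continuous_on_UNIV_comp[of f], assumption, intro continuous_intros)

lemma ray_int_continuous:
  assumes "continuous_on UNIV f" shows "continuous_on UNIV (ray_int j f)"
proof -
  have "continuous_on UNIV (\<lambda>z. integral (cbox 0 1) (\<lambda>s::real. s ^ j *\<^sub>R f (s *\<^sub>R z)))"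
    by (rule integral_continuous_on_param)
      (auto simp: split_beta intro!: continuous_intros continuous_on_UNIV_comp[OF assms])
  then show ?thesis by (simp add: ray_int_def[abs_def])
qed

lemma ray_int_diff:
  "continuous_on UNIV f \<Longrightarrow> continuous_on UNIV g \<Longrightarrow>
    ray_int j (\<lambda>z. f z - g z) z = ray_int j f z - ray_int j g z"
  using integral_diff[OF ray_int_integrable[of f j z] ray_int_integrable[of g j z]]
  by (simp only: ray_int_def scaleR_diff_right)

lemma ray_int_has_derivative:
  assumes "Ck_on (Suc k) UNIV f"
  shows "(ray_int j f has_derivative (\<lambda>v. ray_int (Suc j) (\<lambda>z. frechet_derivative f (at z) v) z)) (at z)"
proof -
  have lin: "linear (frechet_derivative f (at z))" for z
    using has_derivative_linear[OF Ck_on_has_derivative[OF assms]] by blast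
  have "((\<lambda>z. integral (cbox 0 1) (\<lambda>s::real. s ^ j *\<^sub>R f (s *\<^sub>R z))) has_derivative
      (\<lambda>v. integral (cbox 0 1) (\<lambda>s::real. s ^ j *\<^sub>R frechet_derivative f (at (s *\<^sub>R z)) (s *\<^sub>R v)))) (at z)"
  proof (rule param_integral_has_derivative)
    fix z and s :: real
    have "((\<lambda>z. f (s *\<^sub>R z)) has_derivative (\<lambda>v. frechet_derivative f (at (s *\<^sub>R z)) (s *\<^sub>R v))) (at z)"
      by (rule diff_chain_at[unfolded o_def])
        (auto intro!: derivative_eq_intros Ck_on_has_derivative[OF assms])
    then show "((\<lambda>z. s ^ j *\<^sub>R f (s *\<^sub>R z)) has_derivative
        (\<lambda>v. s ^ j *\<^sub>R frechet_derivative f (at (s *\<^sub>R z)) (s *\<^sub>R v))) (at z)"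
      by (rule has_derivative_scaleR_right)
  qed (auto simp: split_beta intro!: continuous_intros C1_continuous_derivative2[OF assms]
        continuous_on_UNIV_comp[OF Ck_on_continuous[OF assms]])
  then show ?thesis
    unfolding ray_int_def[abs_def] by (simp add: linear_scale[OF lin] mult.commute)
qed

lemma ray_int_Ck: "Ck_on k UNIV f \<Longrightarrow> Ck_on k UNIV (ray_int j f)"
proof (induction k arbitrary: f j)
  case 0
  then show ?case by (simp add: ray_int_continuous)
next
  case (Suc k)
  show ?case
    by (rule Ck_on_SucI[OF open_UNIV ray_int_has_derivative[OF Suc.prems]]) (use Suc in auto)
qed

text \<open>A Bielecki weight fitted to two operators at once. It grows along rays, so that
  integration along a ray gains a factor \<open>1/M\<close>; and being Gaussian it merges with the
  exponential in \<open>cauchy_kernel\<close> into the decaying factor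
  \<open>exp (- M\<^sup>2 r\<^sup>2 / 2)\<close>.\<close>

definition weight :: "real \<Rightarrow> complex \<Rightarrow> real" where
  "weight M z = exp (M\<^sup>2 * (norm z)\<^sup>2 / 2)"

lemma weight_pos [simp]: "weight M z > 0" "weight M z \<noteq> 0" "weight M z \<ge> 0"
  by (simp_all add: weight_def)

lemma weight_ge_1: "1 \<le> weight M z"
  by (simp add: weight_def)

lemma weight_mono: "norm z \<le> norm w \<Longrightarrow> weight M z \<le> weight M w"
  by (simp add: weight_def mult_left_mono power_mono)

lemma weight_continuous: "continuous_on S (weight M)"
  unfolding weight_def[abs_def] by (intro continuous_intros) auto

text \<open>The integrand is the elementary majorant of a Gaussian:
  \<open>- t\<^sup>2 / 2 \<le> 1/2 - t\<close> because \<open>(t - 1)\<^sup>2\<close> is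
  nonnegative. The \<open>2\<close> in the bound majorizes \<open>exp (1/2)\<close>.\<close>

lemma exp_decay_integral_le:
  fixes a R :: real
  assumes "a > 0" "R \<ge> 0"
  shows "integral (cbox 0 R) (\<lambda>r. exp (1/2 - a * r)) \<le> 2 / a"
proof -
  have "((\<lambda>r. exp (1/2 - a * r)) has_integral
      (- exp (1/2 - a * R) / a) - (- exp (1/2 - a * 0) / a)) {0..R}"
    using assms by (intro fundamental_theorem_of_calculus)
      (auto intro!: derivative_eq_intros simp: has_real_derivative_iff_has_vector_derivative[symmetric])
  then have "integral (cbox 0 R) (\<lambda>r. exp (1/2 - a * r)) = (exp (1/2) - exp (1/2 - a * R)) / a"
    by (simp add: integral_unique diff_divide_distrib)
  also have "\<dots> \<le> exp (1/2) / a"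
    using assms by (intro divide_right_mono) auto
  also have "exp (1/2::real) \<le> 2"
    using exp_bound_half[of "1/2::real"] by simp
  finally show ?thesis using assms by (simp add: divide_right_mono)
qed

text \<open>With \<open>a = M * norm z\<close>, the weight at \<open>s *\<^sub>R z\<close> is at
  most the weight at \<open>z\<close> times \<open>exp (1/2 - a * (1 - s))\<close>, whose integral
  over \<open>s\<close> is at most \<open>2 / a\<close>. The factor \<open>norm z\<close> on the
  left, the length of the ray, turns this into \<open>2 / M\<close>, whatever the size of
  \<open>z\<close>.\<close>

lemma ray_int_bound:
  assumes f: "continuous_on UNIV f" and b: "\<And>z. norm (f z) \<le> c * weight M z" and M: "M > 0" and c: "c \<ge> 0"
  shows "norm z * norm (ray_int j f z) \<le> 2 / M * c * weight M z"
proof (cases "z = 0")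
  case True
  then show ?thesis using M c by simp
next
  case False
  define a where "a = M * norm z"
  have a: "a > 0" using False M by (simp add: a_def)
  have "norm (ray_int j f z) \<le> integral (cbox 0 1) (\<lambda>s. c * weight M z * exp (1/2 - a * (1 - s)))"
    unfolding ray_int_def
  proof (rule integral_norm_bound_integral[OF ray_int_integrable[OF f]])
    show "(\<lambda>s. c * weight M z * exp (1/2 - a * (1 - s))) integrable_on cbox 0 1"
      by (intro integrable_continuous continuous_intros)
    show "norm (s ^ j *\<^sub>R f (s *\<^sub>R z)) \<le> c * weight M z * exp (1/2 - a * (1 - s))" if "s \<in> cbox 0 1" for s :: real
    proof -
      have s: "0 \<le> s" "s \<le> 1" using that by auto
      have "norm (s ^ j *\<^sub>R f (s *\<^sub>R z)) \<le> 1 * (c * weight M (s *\<^sub>R z))"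
        unfolding norm_scaleR using s by (intro mult_mono b) (auto simp: power_le_one)
      also have "1 * (c * weight M (s *\<^sub>R z)) \<le> c * (weight M z * exp (1/2 - a * (1 - s)))"
      proof -
        have "- t\<^sup>2 / 2 \<le> 1/2 - t" for t :: real
          using zero_le_power2[of "t - 1"] by (simp add: power2_eq_square algebra_simps)
        from this[of "a * (1 - s)"] have "- (a\<^sup>2 * (1 - s)\<^sup>2) / 2 \<le> 1/2 - a * (1 - s)"
          by (simp add: power_mult_distrib)
        \<comment> \<open>On the unit interval \<open>s\<^sup>2 + (1 - s)\<^sup>2 \<le> 1\<close>.
          This splits the exponent at \<open>s *\<^sub>R z\<close> into the one at \<open>z\<close>
          and a Gaussian in \<open>1 - s\<close>.\<close>
        moreover have "a\<^sup>2 * s\<^sup>2 \<le> a\<^sup>2 * (1 - (1 - s)\<^sup>2)"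
        proof (rule mult_left_mono)
          have "s * s \<le> 1 * s" using s by (intro mult_right_mono) auto
          then show "s\<^sup>2 \<le> 1 - (1 - s)\<^sup>2" by (simp add: power2_eq_square algebra_simps)
        qed simp
        ultimately have "a\<^sup>2 * s\<^sup>2 / 2 \<le> a\<^sup>2 / 2 + (1/2 - a * (1 - s))"
          by (simp add: algebra_simps)
        then have "weight M (s *\<^sub>R z) \<le> weight M z * exp (1/2 - a * (1 - s))"
          using s by (simp add: weight_def a_def power_mult_distrib mult_exp_exp mult_ac)
        then show ?thesis using c by (simp add: mult_left_mono)
      qed
      finally show ?thesis using c by (simp add: mult.assoc)
    qed
  qed
  also have "\<dots> = c * weight M z * integral (cbox 0 1) (\<lambda>s. exp (1/2 - a * (1 - s)))"
    by simp
  also have "integral (cbox 0 1) (\<lambda>s. exp (1/2 - a * (1 - s))) \<le> 2 / a"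
  proof -
    have "((\<lambda>s. exp (1/2 - a * (1 - s))) has_integral
        (exp (1/2 - a * (1 - 1)) / a) - (exp (1/2 - a * (1 - 0)) / a)) {0..1}"
      using a by (intro fundamental_theorem_of_calculus)
        (auto intro!: derivative_eq_intros simp: has_real_derivative_iff_has_vector_derivative[symmetric])
    then have "integral (cbox 0 1) (\<lambda>s. exp (1/2 - a * (1 - s))) = (exp (1/2) - exp (1/2 - a)) / a"
      by (simp add: integral_unique diff_divide_distrib)
    also have "\<dots> \<le> exp (1/2) / a"
      using a by (intro divide_right_mono) auto
    also have "exp (1/2::real) \<le> 2"
      using exp_bound_half[of "1/2::real"] by simp
    finally show ?thesis using a by (simp add: divide_right_mono)
  qed
  finally have "norm (ray_int j f z) \<le> c * weight M z * (2 / a)"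
    using c by (simp add: mult_left_mono)
  then have "norm z * norm (ray_int j f z) \<le> norm z * (c * weight M z * (2 / a))"
    by (intro mult_left_mono) auto
  then show ?thesis using False M by (simp add: a_def field_simps)
qed

lemma ray_int_sup_bound:
  assumes f: "continuous_on UNIV f" and b: "\<And>z. norm (f z) \<le> c"
  shows "norm (ray_int j f z) \<le> c"
proof -
  have "c \<ge> 0" using b[of 0] norm_ge_zero order_trans by blast
  have "norm (ray_int j f z) \<le> integral (cbox 0 1) (\<lambda>s::real. c)"
    unfolding ray_int_def
  proof (rule integral_norm_bound_integral[OF ray_int_integrable[OF f]])
    show "norm (s ^ j *\<^sub>R f (s *\<^sub>R z)) \<le> c" if "s \<in> cbox 0 1" for s :: real
    proof -
      have "norm (s ^ j *\<^sub>R f (s *\<^sub>R z)) \<le> 1 * c"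
        unfolding norm_scaleR using that \<open>c \<ge> 0\<close> by (intro mult_mono b) (auto simp: power_le_one)
      then show ?thesis by simp
    qed
  qed (intro integrable_continuous continuous_intros)
  then show ?thesis by simp
qed

subsection \<open>A twisted Cauchy transform\<close>

lemma norm_vec_smult: "norm (c *s (v :: complex ^ 'n)) = norm c * norm v"
  unfolding norm_vec_def by (simp add: norm_mult L2_set_right_distrib)

lemma bounded_bilinear_vec_smult: "bounded_bilinear ((*s) :: complex \<Rightarrow> complex ^ 'n \<Rightarrow> complex ^ 'n)"
proof
  show "\<exists>K. \<forall>a b. norm (a *s (b :: complex ^ 'n)) \<le> norm a * norm b * K"
    by (intro exI[of _ 1]) (simp add: norm_vec_smult)
qed (simp_all add: vec_eq_iff algebra_simps)

lemmas continuous_on_vec_smult = bounded_bilinear.continuous_on[OF bounded_bilinear_vec_smult]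
lemmas bounded_linear_vec_smult_right = bounded_bilinear.bounded_linear_right[OF bounded_bilinear_vec_smult]

definition polar :: "real \<times> real \<Rightarrow> complex" where
  "polar p = fst p *\<^sub>R cis (snd p)"

text \<open>In polar coordinates the Jacobian cancels the singularity \<open>1/y\<close> of the Cauchy kernel. The
  factor \<open>exp (M\<^sup>2 (cnj z - cnj y) y)\<close> equals \<open>1\<close> at \<open>y = 0\<close> and, in terms of \<open>\<zeta> = z - y\<close>, is
  holomorphic in \<open>z\<close>; it makes the operator small with respect to the weight
  \<open>exp (M\<^sup>2 \<bar>z\<bar>\<^sup>2 / 2)\<close>. The power \<open>m\<close> appears on differentiating in \<open>z\<close>.\<close>

definition cauchy_kernel :: "nat \<Rightarrow> real \<Rightarrow> complex \<Rightarrow> real \<times> real \<Rightarrow> complex" where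
  "cauchy_kernel m M z p =
     cnj (cis (snd p)) * polar p ^ m * exp (of_real (M\<^sup>2) * (cnj z - cnj (polar p)) * polar p)"

text \<open>Up to the twist this is convolution with \<open>1 / (pi y)\<close>, the fundamental
  solution of \<open>\<partial>/\<partial>z\<^sup>-\<close>, over the disc of radius
  \<open>R\<close>. The truncation is harmless at points from which the circle of radius
  \<open>R\<close> does not meet the support of \<open>f\<close>.\<close>

definition cauchy_int ::
  "nat \<Rightarrow> real \<Rightarrow> real \<Rightarrow> (complex \<Rightarrow> complex ^ 'n::finite) \<Rightarrow> complex \<Rightarrow> complex ^ 'n" where
  "cauchy_int m M R f z = (1 / pi) *\<^sub>R
     integral (cbox (0, 0) (R, 2 * pi)) (\<lambda>p. cauchy_kernel m M z p *s f (z - polar p))"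

lemma continuous_on_polar: "continuous_on S g \<Longrightarrow> continuous_on S (\<lambda>x. polar (g x))"
  unfolding polar_def by (intro continuous_intros)

lemma continuous_on_cauchy_kernel:
  "continuous_on S f \<Longrightarrow> continuous_on S g \<Longrightarrow> continuous_on S (\<lambda>x. cauchy_kernel m M (f x) (g x))"
  unfolding cauchy_kernel_def by (intro continuous_intros continuous_on_polar)

lemma continuous_on_cauchy_integrand:
  assumes "continuous_on UNIV f" "continuous_on S z" "continuous_on S g"
  shows "continuous_on S (\<lambda>x. cauchy_kernel m M (z x) (g x) *s f (z x - polar (g x)))"
  using assms by (intro continuous_on_vec_smult continuous_on_cauchy_kernel)
    (auto intro!: continuous_on_UNIV_comp[OF assms(1)] continuous_intros continuous_on_polar)

lemma cauchy_int_integrable: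
  assumes "continuous_on UNIV f"
  shows "(\<lambda>p. cauchy_kernel m M z p *s f (z - polar p)) integrable_on cbox (0, 0) (R, 2 * pi)"
  by (intro integrable_continuous continuous_on_cauchy_integrand[OF assms] continuous_intros)

lemma cauchy_int_continuous:
  assumes "continuous_on UNIV f" shows "continuous_on UNIV (cauchy_int m M R f)"
proof -
  have "continuous_on UNIV (\<lambda>z. integral (cbox (0, 0) (R, 2 * pi))
      (\<lambda>p. cauchy_kernel m M z p *s f (z - polar p)))"
    by (rule integral_continuous_on_param)
      (auto simp: split_beta intro!: continuous_intros continuous_on_cauchy_integrand[OF assms])
  then show ?thesis unfolding cauchy_int_def[abs_def] by (intro continuous_intros)
qed

lemma cauchy_int_diff:
  assumes "continuous_on UNIV f" "continuous_on UNIV g"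
  shows "cauchy_int m M R (\<lambda>z. f z - g z) z = cauchy_int m M R f z - cauchy_int m M R g z"
  using integral_diff[OF cauchy_int_integrable[OF assms(1), of m M z R] cauchy_int_integrable[OF assms(2), of m M z R]]
  by (simp only: cauchy_int_def scaleR_diff_right vector_ssub_ldistrib)

lemma cauchy_int_add:
  assumes "continuous_on UNIV f" "continuous_on UNIV g"
  shows "cauchy_int m M R (\<lambda>z. f z + g z) z = cauchy_int m M R f z + cauchy_int m M R g z"
  using integral_add[OF cauchy_int_integrable[OF assms(1), of m M z R] cauchy_int_integrable[OF assms(2), of m M z R]]
  by (simp only: cauchy_int_def scaleR_add_right vector_add_ldistrib)

lemma vec_smult_scaleR: "c *s (r *\<^sub>R v) = r *\<^sub>R (c *s (v :: complex ^ 'n))"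
  by (simp add: vec_eq_iff)

lemma scaleR_vec_smult: "(r *\<^sub>R c) *s v = r *\<^sub>R (c *s (v :: complex ^ 'n))"
  by (simp add: vec_eq_iff)

lemma cauchy_int_smult:
  assumes "continuous_on UNIV f"
  shows "cauchy_int m M R (\<lambda>z. c *s f z) z = c *s cauchy_int m M R f z"
  using integral_linear[OF cauchy_int_integrable[OF assms, of m M z R] bounded_linear_vec_smult_right[of c]]
  by (simp add: cauchy_int_def o_def vec_smult_scaleR mult.commute)

text \<open>In convolution form the derivative falls on \<open>f\<close>. The only other dependence
  on \<open>z\<close> is through \<open>cnj z\<close> in the exponent, and differentiating it brings
  down one factor \<open>polar p\<close>, which raises \<open>m\<close>.\<close>

lemma cauchy_int_has_derivative:
  assumes "Ck_on (Suc k) UNIV f"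
  shows "(cauchy_int m M R f has_derivative
    (\<lambda>v. cauchy_int m M R (\<lambda>z. frechet_derivative f (at z) v) z +
         (of_real (M\<^sup>2) * cnj v) *s cauchy_int (Suc m) M R f z)) (at z)"
proof -
  let ?D = "\<lambda>z p v. cauchy_kernel m M z p *s frechet_derivative f (at (z - polar p)) v +
      (cauchy_kernel m M z p * (of_real (M\<^sup>2) * cnj v * polar p)) *s f (z - polar p)"
  have fc: "continuous_on UNIV f" using Ck_on_continuous[OF assms] .
  have 1: "((\<lambda>z. integral (cbox (0, 0) (R, 2 * pi)) (\<lambda>p. cauchy_kernel m M z p *s f (z - polar p)))
      has_derivative (\<lambda>v. integral (cbox (0, 0) (R, 2 * pi)) (\<lambda>p. ?D z p v))) (at z)"
  proof (rule param_integral_has_derivative)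
    fix z p
    have k: "((\<lambda>z. cauchy_kernel m M z p) has_derivative
        (\<lambda>v. cauchy_kernel m M z p * (of_real (M\<^sup>2) * cnj v * polar p))) (at z)"
    proof -
      have "((\<lambda>z. of_real (M\<^sup>2) * (cnj z - cnj (polar p)) * polar p) has_derivative
          (\<lambda>v. of_real (M\<^sup>2) * cnj v * polar p)) (at z)"
        by (auto intro!: derivative_eq_intros bounded_linear.has_derivative[OF bounded_linear_cnj] simp: mult_ac)
      from has_derivative_compose[OF this DERIV_exp[unfolded has_field_derivative_def]]
      have "((\<lambda>z. exp (of_real (M\<^sup>2) * (cnj z - cnj (polar p)) * polar p)) has_derivative
          (\<lambda>v. exp (of_real (M\<^sup>2) * (cnj z - cnj (polar p)) * polar p) * (of_real (M\<^sup>2) * cnj v * polar p))) (at z)" .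
      from has_derivative_mult_right[OF this, of "cnj (cis (snd p)) * polar p ^ m"]
      show ?thesis unfolding cauchy_kernel_def by (simp only: mult.assoc)
    qed
    have "((\<lambda>z. f (z - polar p)) has_derivative frechet_derivative f (at (z - polar p))) (at z)"
      by (rule has_derivative_compose[of _ "\<lambda>v. v" _ _ f, OF _ Ck_on_has_derivative[OF assms]])
        (auto intro!: derivative_eq_intros)
    from bounded_bilinear.FDERIV[OF bounded_bilinear_vec_smult k this]
    show "((\<lambda>z. cauchy_kernel m M z p *s f (z - polar p)) has_derivative ?D z p) (at z)" .
  next
    show "continuous_on (UNIV \<times> cbox (0, 0) (R, 2 * pi)) (\<lambda>(z, p). cauchy_kernel m M z p *s f (z - polar p))"
      unfolding split_beta by (intro continuous_on_cauchy_integrand fc continuous_intros)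
    show "continuous_on (UNIV \<times> cbox (0, 0) (R, 2 * pi)) (\<lambda>(z, p). ?D z p v)" for v
      unfolding split_beta
      by (intro continuous_on_add continuous_on_vec_smult continuous_on_cauchy_kernel
          continuous_on_mult continuous_on_polar C1_continuous_derivative2[OF assms]
          continuous_on_UNIV_comp[OF fc] continuous_intros)
  qed
  have "(1 / pi) *\<^sub>R integral (cbox (0, 0) (R, 2 * pi)) (\<lambda>p. ?D z p v) =
      cauchy_int m M R (\<lambda>z. frechet_derivative f (at z) v) z +
      (of_real (M\<^sup>2) * cnj v) *s cauchy_int (Suc m) M R f z" for v
  proof -
    have "(of_real (M\<^sup>2) * cnj v) *s cauchy_int (Suc m) M R f z = (1 / pi) *\<^sub>R integral (cbox (0, 0) (R, 2 * pi))
        (\<lambda>p. (of_real (M\<^sup>2) * cnj v) *s (cauchy_kernel (Suc m) M z p *s f (z - polar p)))"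
      using integral_linear[OF cauchy_int_integrable[OF fc, of "Suc m" M z R]
          bounded_linear_vec_smult_right[of "of_real (M\<^sup>2) * cnj v"]]
      by (simp only: cauchy_int_def o_def vec_smult_scaleR)
    also have "(\<lambda>p. (of_real (M\<^sup>2) * cnj v) *s (cauchy_kernel (Suc m) M z p *s f (z - polar p))) =
        (\<lambda>p. (cauchy_kernel m M z p * (of_real (M\<^sup>2) * cnj v * polar p)) *s f (z - polar p))"
      by (simp add: cauchy_kernel_def vector_smult_assoc mult_ac)
    finally show ?thesis
      unfolding cauchy_int_def[of m]
      by (subst integral_add)
        (auto simp: scaleR_add_right intro!: integrable_continuous continuous_on_vec_smult
          continuous_on_cauchy_kernel continuous_on_mult continuous_on_polar
          C1_continuous_derivative2[OF assms] continuous_on_UNIV_comp[OF fc] continuous_intros)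
  qed
  then show ?thesis
    using has_derivative_scaleR_right[OF 1, of "1 / pi"] unfolding cauchy_int_def[of m] by simp
qed

lemma cauchy_int_Ck: "Ck_on k UNIV f \<Longrightarrow> Ck_on k UNIV (cauchy_int m M R f)"
proof (induction k arbitrary: f m)
  case 0
  then show ?case by (simp add: cauchy_int_continuous)
next
  case (Suc k)
  show ?case
    by (rule Ck_on_SucI[OF open_UNIV cauchy_int_has_derivative[OF Suc.prems]])
      (use Suc Ck_on_SucD[OF Suc.prems] in \<open>auto intro!: Ck_on_add Ck_on_linear_comp[OF bounded_linear_vec_smult_right]\<close>)
qed

text \<open>Since \<open>2 * Re ((cnj z - cnj y) * y)\<close> equals
  \<open>|z|\<^sup>2 - |z - y|\<^sup>2 - |y|\<^sup>2\<close>, the modulus of the twisting factor is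
  a quotient of two weights times a Gaussian in \<open>y\<close>. This identity is the reason for
  the choice of the twist.\<close>

lemma norm_cauchy_kernel:
  assumes "fst p \<ge> 0"
  shows "norm (cauchy_kernel m M z p) * weight M (z - polar p) =
    fst p ^ m * exp (- (M\<^sup>2 * (fst p)\<^sup>2 / 2)) * weight M z"
proof -
  have "2 * Re ((cnj z - cnj y) * y) = (norm z)\<^sup>2 - (norm (z - y))\<^sup>2 - (norm y)\<^sup>2" for y
    unfolding cmod_power2 by (simp add: power2_eq_square algebra_simps)
  moreover have np: "norm (polar p) = fst p" using assms by (simp add: polar_def)
  ultimately have t: "Re ((cnj z - cnj (polar p)) * polar p) =
      ((norm z)\<^sup>2 - (norm (z - polar p))\<^sup>2 - (fst p)\<^sup>2) / 2"
    by (metis nonzero_mult_div_cancel_left zero_neq_numeral)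
  have "M\<^sup>2 * (Re ((cnj z - cnj (polar p)) * polar p)) + M\<^sup>2 * (norm (z - polar p))\<^sup>2 / 2 =
      M\<^sup>2 * (norm z)\<^sup>2 / 2 - M\<^sup>2 * (fst p)\<^sup>2 / 2"
    unfolding t by (simp add: field_simps)
  then have "exp (M\<^sup>2 * (Re ((cnj z - cnj (polar p)) * polar p))) * exp (M\<^sup>2 * (norm (z - polar p))\<^sup>2 / 2) =
      exp (- (M\<^sup>2 * (fst p)\<^sup>2 / 2)) * exp (M\<^sup>2 * (norm z)\<^sup>2 / 2)"
    by (simp only: mult_exp_exp) simp
  moreover have "Re (of_real (M\<^sup>2) * (cnj z - cnj (polar p)) * polar p) = M\<^sup>2 * Re ((cnj z - cnj (polar p)) * polar p)"
    unfolding mult.assoc by (metis Re_complex_of_real Im_complex_of_real mult_zero_left diff_zero times_complex.sel(1))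
  ultimately show ?thesis
    unfolding cauchy_kernel_def weight_def norm_mult norm_exp_eq_Re
    by (simp add: norm_power mult_ac np)
qed

text \<open>After the weights cancel, a Gaussian in the radius remains; its integral is at most
  \<open>2 / M\<close>, and the angle contributes \<open>2 * pi\<close> against the prefactor
  \<open>1 / pi\<close>. The bound does not involve \<open>R\<close>.\<close>

lemma cauchy_int_bound:
  assumes f: "continuous_on UNIV f" and b: "\<And>z. norm (f z) \<le> c * weight M z"
    and M: "M > 0" and R: "R \<ge> 0" and c: "c \<ge> 0"
  shows "norm (cauchy_int 0 M R f z) \<le> 4 / M * c * weight M z"
proof -
  have bnd: "norm (cauchy_kernel 0 M z p *s f (z - polar p)) \<le> c * weight M z * exp (1/2 - M * fst p)"
    if "p \<in> cbox (0, 0) (R, 2 * pi)" for p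
  proof -
    have p: "fst p \<ge> 0" using that by (cases p) (auto simp: cbox_Pair_eq)
    have "norm (cauchy_kernel 0 M z p *s f (z - polar p)) \<le>
        norm (cauchy_kernel 0 M z p) * (c * weight M (z - polar p))"
      unfolding norm_vec_smult by (intro mult_left_mono b) auto
    also have "\<dots> = c * weight M z * exp (- (M\<^sup>2 * (fst p)\<^sup>2 / 2))"
      using norm_cauchy_kernel[OF p, of 0 M z] by (simp add: mult_ac)
    also have "exp (- (M\<^sup>2 * (fst p)\<^sup>2 / 2)) \<le> exp (1/2 - M * fst p)"
      using zero_le_power2[of "M * fst p - 1"] by (simp add: power2_eq_square algebra_simps)
    finally show ?thesis using c by (simp add: mult_left_mono)
  qed
  have "norm (cauchy_int 0 M R f z) \<le> (1 / pi) * integral (cbox (0, 0) (R, 2 * pi)) (\<lambda>p. c * weight M z * exp (1/2 - M * fst p))"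
    unfolding cauchy_int_def norm_scaleR
    by (intro mult_mono integral_norm_bound_integral cauchy_int_integrable f bnd integrable_continuous)
      (auto intro!: continuous_intros)
  also have "integral (cbox (0, 0) (R, 2 * pi)) (\<lambda>p. c * weight M z * exp (1/2 - M * fst p)) =
      integral (cbox 0 R) (\<lambda>r. integral (cbox 0 (2 * pi)) (\<lambda>\<theta>. c * weight M z * exp (1/2 - M * r)))"
    by (subst integral_prod_continuous) (auto intro!: continuous_intros)
  also have "\<dots> = 2 * pi * c * weight M z * integral (cbox 0 R) (\<lambda>r. exp (1/2 - M * r))"
    by (simp add: mult_ac)
  also have "(1 / pi) * \<dots> \<le> (1 / pi) * (2 * pi * c * weight M z * (2 / M))"
    by (intro mult_left_mono exp_decay_integral_le M R) (use c in auto)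
  finally show ?thesis by (simp add: mult_ac)
qed

lemma cauchy_int_sup_bound:
  assumes f: "continuous_on UNIV f" and b: "\<And>z. norm (f z) \<le> c"
  shows "norm (cauchy_int m M R f z) \<le>
    (1 / pi) * integral (cbox (0, 0) (R, 2 * pi)) (\<lambda>p. norm (cauchy_kernel m M z p)) * c"
proof -
  have "norm (cauchy_int m M R f z) \<le> (1 / pi) * integral (cbox (0, 0) (R, 2 * pi)) (\<lambda>p. norm (cauchy_kernel m M z p) * c)"
    unfolding cauchy_int_def norm_scaleR
    by (intro mult_mono integral_norm_bound_integral cauchy_int_integrable f integrable_continuous)
      (auto simp: norm_vec_smult b intro!: continuous_intros continuous_on_cauchy_kernel mult_left_mono)
  then show ?thesis by simp
qed

text \<open>Serves the terms in which the kernel was differentiated. They only have to converge, not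
  to contract, so a constant depending on \<open>r\<close>, \<open>m\<close>, \<open>M\<close> and
  \<open>R\<close> is good enough.\<close>

lemma cauchy_int_sup_bound':
  "\<exists>C\<ge>0. \<forall>f :: complex \<Rightarrow> complex ^ 'n::finite. \<forall>c. continuous_on UNIV f \<longrightarrow> (\<forall>z. norm (f z) \<le> c) \<longrightarrow>
    (\<forall>z\<in>cball 0 r. norm (cauchy_int m M R f z) \<le> C * c)"
proof -
  let ?I = "\<lambda>z. (1 / pi) * integral (cbox (0, 0) (R, 2 * pi)) (\<lambda>p. norm (cauchy_kernel m M z p))"
  have "continuous_on UNIV ?I"
    by (intro continuous_on_mult continuous_on_const integral_continuous_on_param)
      (auto simp: split_beta intro!: continuous_intros continuous_on_cauchy_kernel)
  then have "compact (?I ` cball 0 r)"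
    by (intro compact_continuous_image) (auto intro: continuous_on_subset)
  then have "\<exists>C. \<forall>x\<in>?I ` cball 0 r. norm x \<le> C"
    unfolding bounded_iff[symmetric] by (rule compact_imp_bounded)
  then obtain C where C': "\<forall>x\<in>?I ` cball 0 r. norm x \<le> C" ..
  have C: "\<bar>?I z\<bar> \<le> C" if "z \<in> cball 0 r" for z
    using bspec[OF C' imageI[OF that]] unfolding real_norm_def .
  show ?thesis
  proof (intro exI[of _ "max C 0"] conjI allI impI ballI)
    fix f :: "complex \<Rightarrow> complex ^ 'n" and c :: real and z :: complex
    assume f: "continuous_on UNIV f" "\<forall>z. norm (f z) \<le> c" and z: "z \<in> cball 0 r"
    have "c \<ge> 0" using f(2) norm_ge_zero order_trans by blast
    have "norm (cauchy_int m M R f z) \<le> ?I z * c"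
      using cauchy_int_sup_bound[OF f(1)] f(2) by blast
    also have "\<dots> \<le> max C 0 * c"
      using order_trans[OF order_trans[OF abs_ge_self C[OF z]] max.cobounded1] \<open>c \<ge> 0\<close> by (intro mult_right_mono)
    finally show "norm (cauchy_int m M R f z) \<le> max C 0 * c" .
  qed simp
qed

subsection \<open>The transform inverts the Cauchy-Riemann operator\<close>

text \<open>The scalar form of the identity \<open>exp (- \<i> \<theta>) (\<partial>\<^sub>x + \<i>
  \<partial>\<^sub>y) = \<partial>\<^sub>r + (\<i> / r) \<partial>\<^sub>\<theta>\<close>, applied
  to the product of the exponential \<open>E\<close> and the shifted function. The overall sign
  comes from the argument \<open>z - y\<close>, and the term with \<open>2 * m\<close> from the
  dependence of \<open>E\<close> on \<open>cnj z\<close>.\<close>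

lemma cauchy_integrand_split:
  fixes a b F E m y w :: complex and \<theta> :: real
  defines "e \<equiv> cis \<theta>"
  shows "cnj e * E * (a + \<i> * b) + 2 * m * (cnj e * y * E) * F =
    - ((E * (m * (- cnj e * y + w * e))) * F + E * (- (cos \<theta> * a + sin \<theta> * b))
       + \<i> * ((E * (m * (\<i> * cnj e * y + w * (\<i> * e)))) * F + E * (- (- sin \<theta> * a + cos \<theta> * b))))"
proof -
  have *: "cnj e = cos \<theta> - \<i> * sin \<theta>" by (simp add: e_def complex_eq_iff)
  show ?thesis unfolding * by (simp add: algebra_simps)
qed

text \<open>In polar coordinates the integrand becomes a radial derivative plus \<open>\<i>\<close>
  times an angular derivative divided by the radius. The first integrates to \<open>- f z\<close> on
  every ray, by the condition on the circle of radius \<open>R\<close> and because the twist is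
  \<open>1\<close> at \<open>y = 0\<close>; the second integrates to \<open>0\<close> by
  periodicity. The factor \<open>2\<close> is that of \<open>\<partial>\<^sub>x + \<i>
  \<partial>\<^sub>y = 2 \<partial>/\<partial>z\<^sup>-\<close>.\<close>

lemma cauchy_int_dbar:
  fixes f :: "complex \<Rightarrow> complex ^ 'n::finite"
  assumes f: "Ck_on (Suc 0) UNIV f" and R: "R \<ge> 0" and supp: "\<And>\<theta>. f (z - R *\<^sub>R cis \<theta>) = 0"
  shows "frechet_derivative (cauchy_int 0 M R f) (at z) 1 +
    \<i> *s frechet_derivative (cauchy_int 0 M R f) (at z) \<i> = 2 *\<^sub>R f z"
proof -
  define e where "e = cis"
  define E where "E r \<theta> = exp (of_real (M\<^sup>2) * (cnj z - r * cnj (e \<theta>)) * (r * e \<theta>))" for r :: real and \<theta>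
  define f' where "f' = (\<lambda>x. frechet_derivative f (at x))"
  \<comment> \<open>\<open>Gr\<close> is the radial derivative of \<open>G\<close>. \<open>K\<close>
    is its angular derivative divided by \<open>r\<close>, with the division carried out in the
    formula, so that it is continuous up to \<open>r = 0\<close>.\<close>
  define G where "G r \<theta> = E r \<theta> *s f (z - r *\<^sub>R e \<theta>)" for r \<theta>
  define Gr where "Gr r \<theta> = (E r \<theta> * (of_real (M\<^sup>2) * (- cnj (e \<theta>) * (r * e \<theta>) + (cnj z - r * cnj (e \<theta>)) * e \<theta>))) *s f (z - r *\<^sub>R e \<theta>)
    + E r \<theta> *s f' (z - r *\<^sub>R e \<theta>) (- e \<theta>)" for r :: real and \<theta>
  define K where "K r \<theta> = (E r \<theta> * (of_real (M\<^sup>2) * (\<i> * cnj (e \<theta>) * (r * e \<theta>) + (cnj z - r * cnj (e \<theta>)) * (\<i> * e \<theta>)))) *s f (z - r *\<^sub>R e \<theta>)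
    + E r \<theta> *s f' (z - r *\<^sub>R e \<theta>) (- (\<i> * e \<theta>))" for r :: real and \<theta>
  let ?B = "cbox (0, 0) (R, 2 * pi)"
  have fc: "continuous_on UNIV f" using Ck_on_continuous[OF f] .
  have fd: "(f has_derivative f' x) (at x)" for x
    unfolding f'_def by (rule Ck_on_has_derivative[OF f]) simp
  have lin: "linear (f' x)" for x using fd has_derivative_linear by blast
  have f'c: "continuous_on UNIV (\<lambda>x. f' x v)" for v
    unfolding f'_def by (rule C1_continuous_derivative[OF f])
  have Gr: "((\<lambda>r. G r \<theta>) has_vector_derivative Gr r \<theta>) (at r)" for r \<theta>
  proof -
    have 1: "((\<lambda>r. E r \<theta>) has_derivative (\<lambda>h. h *\<^sub>R (E r \<theta> *
        (of_real (M\<^sup>2) * (- cnj (e \<theta>) * (r * e \<theta>) + (cnj z - r * cnj (e \<theta>)) * e \<theta>))))) (at r)"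
    proof -
      have "((\<lambda>r. of_real (M\<^sup>2) * (cnj z - of_real r * cnj (e \<theta>)) * (of_real r * e \<theta>)) has_derivative
        (\<lambda>h. h *\<^sub>R (of_real (M\<^sup>2) * (- cnj (e \<theta>) * (r * e \<theta>) + (cnj z - r * cnj (e \<theta>)) * e \<theta>)))) (at r)"
        by (auto intro!: derivative_eq_intros simp: scaleR_conv_of_real algebra_simps)
      from has_derivative_compose[OF this DERIV_exp[unfolded has_field_derivative_def]]
      show ?thesis unfolding E_def by simp
    qed
    have 2: "((\<lambda>r. f (z - r *\<^sub>R e \<theta>)) has_derivative (\<lambda>h. f' (z - r *\<^sub>R e \<theta>) (- h *\<^sub>R e \<theta>))) (at r)"
      by (rule has_derivative_compose[OF _ fd]) (auto intro!: derivative_eq_intros)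
    have "f' (z - r *\<^sub>R e \<theta>) (- h *\<^sub>R e \<theta>) = h *\<^sub>R f' (z - r *\<^sub>R e \<theta>) (- e \<theta>)" for h
      using linear_scale[OF lin, of _ h "- e \<theta>"] by simp
    with bounded_bilinear.FDERIV[OF bounded_bilinear_vec_smult 1 2] show ?thesis
      unfolding has_vector_derivative_def G_def Gr_def
      by (simp add: scaleR_add_right vec_smult_scaleR scaleR_vec_smult add.commute)
  qed
  have K: "((\<lambda>\<theta>. G r \<theta>) has_vector_derivative r *\<^sub>R K r \<theta>) (at \<theta>)" for r \<theta>
  proof -
    have e': "(e has_derivative (\<lambda>h. h *\<^sub>R (\<i> * e \<theta>))) (at \<theta>)"
    proof -
      have "((\<lambda>\<theta>. of_real (cos \<theta>) + \<i> * of_real (sin \<theta>)) has_derivative (\<lambda>h. h *\<^sub>R (\<i> * e \<theta>))) (at \<theta>)"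
        by (auto intro!: derivative_eq_intros simp: e_def complex_eq_iff)
      moreover have "e = (\<lambda>\<theta>. of_real (cos \<theta>) + \<i> * of_real (sin \<theta>))"
        by (auto simp: e_def complex_eq_iff)
      ultimately show ?thesis by simp
    qed
    have 1: "((\<lambda>\<theta>. E r \<theta>) has_derivative (\<lambda>h. h *\<^sub>R (r *\<^sub>R (E r \<theta> *
        (of_real (M\<^sup>2) * (\<i> * cnj (e \<theta>) * (r * e \<theta>) + (cnj z - r * cnj (e \<theta>)) * (\<i> * e \<theta>))))))) (at \<theta>)"
    proof -
      have "((\<lambda>\<theta>. of_real (M\<^sup>2) * (cnj z - of_real r * cnj (e \<theta>)) * (of_real r * e \<theta>)) has_derivative
        (\<lambda>h. h *\<^sub>R (r *\<^sub>R (of_real (M\<^sup>2) * (\<i> * cnj (e \<theta>) * (r * e \<theta>) + (cnj z - r * cnj (e \<theta>)) * (\<i> * e \<theta>)))))) (at \<theta>)"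
        by (auto intro!: derivative_eq_intros e' simp: scaleR_conv_of_real algebra_simps)
      from has_derivative_compose[OF this DERIV_exp[unfolded has_field_derivative_def]]
      show ?thesis unfolding E_def by simp
    qed
    have 2: "((\<lambda>\<theta>. f (z - r *\<^sub>R e \<theta>)) has_derivative (\<lambda>h. f' (z - r *\<^sub>R e \<theta>) (- r *\<^sub>R h *\<^sub>R (\<i> * e \<theta>)))) (at \<theta>)"
      by (rule has_derivative_compose[OF _ fd]) (auto intro!: derivative_eq_intros e')
    have "f' (z - r *\<^sub>R e \<theta>) (- r *\<^sub>R h *\<^sub>R (\<i> * e \<theta>)) = h *\<^sub>R r *\<^sub>R f' (z - r *\<^sub>R e \<theta>) (- (\<i> * e \<theta>))" for h
      using linear_scale[OF lin, of _ "h * r" "- (\<i> * e \<theta>)"] by (simp add: mult.commute)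
    with bounded_bilinear.FDERIV[OF bounded_bilinear_vec_smult 1 2] show ?thesis
      unfolding has_vector_derivative_def G_def K_def
      by (simp add: scaleR_add_right vec_smult_scaleR scaleR_vec_smult add.commute)
  qed
  have Ec: "continuous_on S (\<lambda>p. E (fst p) (snd p))" for S
    unfolding E_def e_def by (intro continuous_intros)
  have Grc: "continuous_on S (\<lambda>p. Gr (fst p) (snd p))" and Kc: "continuous_on S (\<lambda>p. K (fst p) (snd p))" for S
    unfolding Gr_def K_def f'_def e_def
    by (intro continuous_on_add continuous_on_vec_smult continuous_on_mult Ec[unfolded e_def]
        C1_continuous_derivative2[OF f] continuous_on_UNIV_comp[OF fc] continuous_intros)+
  have Gr_int: "integral ?B (\<lambda>p. Gr (fst p) (snd p)) = - (2 * pi) *\<^sub>R f z"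
  proof -
    have "integral ?B (\<lambda>p. Gr (fst p) (snd p)) = integral (cbox 0 R) (\<lambda>r. integral (cbox 0 (2 * pi)) (Gr r))"
      by (subst integral_prod_continuous[OF Grc]) simp
    also have "\<dots> = integral (cbox 0 (2 * pi)) (\<lambda>\<theta>. integral (cbox 0 R) (\<lambda>r. Gr r \<theta>))"
      by (rule integral_swap_continuous) (use Grc in \<open>simp add: split_beta\<close>)
    also have "\<dots> = integral (cbox 0 (2 * pi)) (\<lambda>\<theta>. - f z)"
    proof (rule integral_cong)
      fix \<theta> :: real
      have "((\<lambda>r. Gr r \<theta>) has_integral G R \<theta> - G 0 \<theta>) {0..R}"
        by (rule fundamental_theorem_of_calculus[OF R]) (rule has_vector_derivative_at_within[OF Gr])
      moreover have "G R \<theta> = 0" "G 0 \<theta> = f z"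
        using supp by (simp_all add: G_def E_def e_def)
      ultimately show "integral (cbox 0 R) (\<lambda>r. Gr r \<theta>) = - f z" by (simp add: integral_unique)
    qed
    also have "\<dots> = - (2 * pi) *\<^sub>R f z" by simp
    finally show ?thesis .
  qed
  have K_int: "integral ?B (\<lambda>p. K (fst p) (snd p)) = 0"
  proof -
    \<comment> \<open>Only \<open>r *\<^sub>R K r\<close> is an exact derivative, so the circle of
      radius \<open>0\<close> has to be excluded; it is a null set in the outer integral.\<close>
    have K0: "integral (cbox 0 (2 * pi)) (K r) = 0" if "r \<noteq> 0" for r
    proof -
      have "((\<lambda>\<theta>. r *\<^sub>R K r \<theta>) has_integral G r (2 * pi) - G r 0) {0..2 * pi}"
        by (rule fundamental_theorem_of_calculus) (auto intro: has_vector_derivative_at_within[OF K])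
      moreover have "G r (2 * pi) - G r 0 = 0" by (simp add: G_def E_def e_def)
      ultimately have "((\<lambda>\<theta>. (1 / r) *\<^sub>R r *\<^sub>R K r \<theta>) has_integral (1 / r) *\<^sub>R 0) {0..2 * pi}"
        by (intro has_integral_cmul) simp
      then show ?thesis using that by (simp add: integral_unique)
    qed
    have "((\<lambda>r. integral (cbox 0 (2 * pi)) (K r)) has_integral 0) (cbox 0 R)"
    proof (rule has_integral_spike[OF negligible_sing[of 0] _ has_integral_0])
      show "integral (cbox 0 (2 * pi)) (K r) = 0" if "r \<in> cbox 0 R - {0}" for r
        using that by (intro K0) simp
    qed
    then have "integral (cbox 0 R) (\<lambda>r. integral (cbox 0 (2 * pi)) (K r)) = 0"
      by (rule integral_unique)
    then show ?thesis
      using integral_prod_continuous[OF Kc, of 0 0 R "2 * pi"] by (simp only: fst_conv snd_conv)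
  qed
  have eq: "cauchy_kernel 0 M z p *s (f' (z - polar p) 1 + \<i> *s f' (z - polar p) \<i>)
      + (2 * of_real (M\<^sup>2)) *s (cauchy_kernel (Suc 0) M z p *s f (z - polar p)) =
      - (Gr (fst p) (snd p) + \<i> *s K (fst p) (snd p))" for p
  proof -
    have cis_eq: "cis \<theta> = cos \<theta> *\<^sub>R 1 + sin \<theta> *\<^sub>R \<i>" "\<i> * cis \<theta> = (- sin \<theta>) *\<^sub>R 1 + cos \<theta> *\<^sub>R \<i>" for \<theta>
      by (simp_all add: complex_eq_iff)
    have 1: "f' x (- cis \<theta>) = - (cos \<theta> *\<^sub>R f' x 1 + sin \<theta> *\<^sub>R f' x \<i>)" for x \<theta>
      using lin by (simp only: cis_eq linear_neg linear_add linear_scale)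
    have 2: "f' x (- (\<i> * cis \<theta>)) = - ((- sin \<theta>) *\<^sub>R f' x 1 + cos \<theta> *\<^sub>R f' x \<i>)" for x \<theta>
      unfolding cis_eq(2) using lin by (simp only: linear_neg linear_add linear_scale)
    define r \<theta> where "r = fst p" and "\<theta> = snd p"
    have pol: "polar p = r * e \<theta>" by (simp add: polar_def r_def \<theta>_def e_def scaleR_conv_of_real)
    have pol': "r *\<^sub>R e \<theta> = polar p" by (simp add: polar_def r_def \<theta>_def e_def)
    have k0: "cauchy_kernel 0 M z p = cnj (e \<theta>) * E r \<theta>"
      and k1: "cauchy_kernel (Suc 0) M z p = cnj (e \<theta>) * (r * e \<theta>) * E r \<theta>"
      unfolding cauchy_kernel_def E_def pol by (simp_all add: e_def \<theta>_def)
    define F a b where "F = f (z - polar p)" and "a = f' (z - polar p) 1" and "b = f' (z - polar p) \<i>"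
    have g: "Gr r \<theta> = (E r \<theta> * (of_real (M\<^sup>2) * (- cnj (e \<theta>) * (r * e \<theta>) + (cnj z - r * cnj (e \<theta>)) * e \<theta>))) *s F
        + E r \<theta> *s (- (cos \<theta> *\<^sub>R a + sin \<theta> *\<^sub>R b))"
      unfolding Gr_def pol' F_def a_def b_def unfolding e_def 1 ..
    have k: "K r \<theta> = (E r \<theta> * (of_real (M\<^sup>2) * (\<i> * cnj (e \<theta>) * (r * e \<theta>) + (cnj z - r * cnj (e \<theta>)) * (\<i> * e \<theta>)))) *s F
        + E r \<theta> *s (- ((- sin \<theta>) *\<^sub>R a + cos \<theta> *\<^sub>R b))"
      unfolding K_def pol' F_def a_def b_def unfolding e_def 2 ..
    show ?thesis
      unfolding r_def[symmetric] \<theta>_def[symmetric] k0 k1 g k F_def[symmetric] a_def[symmetric] b_def[symmetric]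
      unfolding vec_eq_iff vector_add_component vector_smult_component vector_uminus_component
        vector_scaleR_component
      unfolding scaleR_conv_of_real mult.assoc
      using cauchy_integrand_split[of \<theta> "E r \<theta>" _ _ "of_real (M\<^sup>2)" "r * e \<theta>" _ "cnj z - r * cnj (e \<theta>)"]
      unfolding e_def[symmetric] mult.assoc by simp
  qed
  have f'c2: "continuous_on UNIV (\<lambda>x. f' x 1 + \<i> *s f' x \<i>)"
    by (rule continuous_on_add[OF f'c continuous_on_vec_smult[OF continuous_on_const f'c]])
  have A: "cauchy_int 0 M R (\<lambda>x. f' x 1 + \<i> *s f' x \<i>) z =
      cauchy_int 0 M R (\<lambda>x. f' x 1) z + \<i> *s cauchy_int 0 M R (\<lambda>x. f' x \<i>) z"
  proof -
    have c: "continuous_on UNIV (\<lambda>x. \<i> *s f' x \<i>)"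
      by (rule continuous_on_vec_smult[OF continuous_on_const f'c])
    show ?thesis
      unfolding cauchy_int_add[of "\<lambda>x. f' x 1" "\<lambda>x. \<i> *s f' x \<i>" 0 M R z, OF f'c c]
        cauchy_int_smult[of "\<lambda>x. f' x \<i>" 0 M R \<i> z, OF f'c] ..
  qed
  have D: "frechet_derivative (cauchy_int 0 M R f) (at z) = (\<lambda>v. cauchy_int 0 M R (\<lambda>z. f' z v) z +
         (of_real (M\<^sup>2) * cnj v) *s cauchy_int (Suc 0) M R f z)"
    unfolding f'_def by (rule frechet_derivativeI[OF cauchy_int_has_derivative[OF f]])
  have "frechet_derivative (cauchy_int 0 M R f) (at z) 1 + \<i> *s frechet_derivative (cauchy_int 0 M R f) (at z) \<i> =
      cauchy_int 0 M R (\<lambda>x. f' x 1 + \<i> *s f' x \<i>) z + (2 * of_real (M\<^sup>2)) *s cauchy_int (Suc 0) M R f z"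
    unfolding D A by (simp add: vec_eq_iff algebra_simps)
  also have "\<dots> = (1 / pi) *\<^sub>R integral ?B (\<lambda>p. cauchy_kernel 0 M z p *s (f' (z - polar p) 1 + \<i> *s f' (z - polar p) \<i>)
      + (2 * of_real (M\<^sup>2)) *s (cauchy_kernel (Suc 0) M z p *s f (z - polar p)))"
  proof -
    have "(2 * of_real (M\<^sup>2)) *s integral ?B (\<lambda>p. cauchy_kernel (Suc 0) M z p *s f (z - polar p)) =
        integral ?B (\<lambda>p. (2 * of_real (M\<^sup>2)) *s (cauchy_kernel (Suc 0) M z p *s f (z - polar p)))"
      using integral_linear[OF cauchy_int_integrable[OF fc, of "Suc 0" M z R]
          bounded_linear_vec_smult_right[of "2 * of_real (M\<^sup>2)"]] by (simp add: o_def)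
    moreover have "(\<lambda>p. (2 * of_real (M\<^sup>2)) *s (cauchy_kernel (Suc 0) M z p *s f (z - polar p))) integrable_on ?B"
      by (intro integrable_continuous continuous_on_vec_smult[OF continuous_on_const] continuous_on_cauchy_integrand fc continuous_intros)
    ultimately show ?thesis
      using integral_add[OF cauchy_int_integrable[OF f'c2, of 0 M z R]]
      by (simp add: cauchy_int_def vec_smult_scaleR scaleR_add_right)
  qed
  also have "\<dots> = (1 / pi) *\<^sub>R integral ?B (\<lambda>p. - (Gr (fst p) (snd p) + \<i> *s K (fst p) (snd p)))"
    by (simp only: eq)
  also have "integral ?B (\<lambda>p. - (Gr (fst p) (snd p) + \<i> *s K (fst p) (snd p))) =
      - (integral ?B (\<lambda>p. Gr (fst p) (snd p)) + \<i> *s integral ?B (\<lambda>p. K (fst p) (snd p)))"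
  proof (rule integral_unique, intro has_integral_neg has_integral_add)
    show "((\<lambda>p. Gr (fst p) (snd p)) has_integral integral ?B (\<lambda>p. Gr (fst p) (snd p))) ?B"
      by (rule integrable_integral[OF integrable_continuous[OF Grc]])
    show "((\<lambda>p. \<i> *s K (fst p) (snd p)) has_integral \<i> *s integral ?B (\<lambda>p. K (fst p) (snd p))) ?B"
      using has_integral_linear[of "\<lambda>p. K (fst p) (snd p)" "integral ?B (\<lambda>p. K (fst p) (snd p))" ?B "(*s) \<i>",
          OF integrable_integral[OF integrable_continuous[OF Kc]] bounded_linear_vec_smult_right]
      unfolding o_def .
  qed
  also have "(1 / pi) *\<^sub>R \<dots> = 2 *\<^sub>R f z"
    unfolding Gr_int K_int by simp
  finally show ?thesis .
qed

lemma Ck_on_frechet_apply: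
  fixes f :: "'b::euclidean_space \<Rightarrow> 'c::real_normed_vector" and g w :: "'a::euclidean_space \<Rightarrow> 'b"
  assumes "open S" "open T" and f: "Ck_on (Suc k) T f" and g: "Ck_on k S g" and w: "Ck_on k S w"
    and T: "\<And>x. x \<in> S \<Longrightarrow> g x \<in> T"
  shows "Ck_on k S (\<lambda>x. frechet_derivative f (at (g x)) (w x))"
proof -
  have "Ck_on k S (\<lambda>x. \<Sum>b\<in>Basis. (w x \<bullet> b) *\<^sub>R frechet_derivative f (at (g x)) b)"
  proof (intro Ck_on_sum Ck_on_bilinear[OF bounded_bilinear_scaleR] assms(1))
    show "Ck_on k S (\<lambda>x. w x \<bullet> b)" for b
      by (rule Ck_on_linear_comp[OF bounded_linear_inner_left assms(1) w])
    show "Ck_on k S (\<lambda>x. frechet_derivative f (at (g x)) b)" for b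
      by (rule Ck_on_comp[OF assms(1,2) _ g T]) (use f in simp)
  qed
  moreover have "frechet_derivative f (at (g x)) (w x) =
      (\<Sum>b\<in>Basis. (w x \<bullet> b) *\<^sub>R frechet_derivative f (at (g x)) b)" if "x \<in> S" for x
    by (rule linear_eq_sum_Basis[OF has_derivative_linear[OF Ck_on_has_derivative[OF f T[OF that]]]])
  ultimately show ?thesis
    using Ck_on_cong[OF assms(1), of "\<lambda>x. frechet_derivative f (at (g x)) (w x)"] by simp
qed

lemma smooth_on_frechet_apply:
  fixes f :: "'b::euclidean_space \<Rightarrow> 'c::real_normed_vector" and g w :: "'a::euclidean_space \<Rightarrow> 'b"
  assumes "open S" "open T" "smooth_on T f" "smooth_on S g" "smooth_on S w" "\<And>x. x \<in> S \<Longrightarrow> g x \<in> T"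
  shows "smooth_on S (\<lambda>x. frechet_derivative f (at (g x)) (w x))"
  unfolding smooth_on_def
  by (intro allI Ck_on_frechet_apply[OF assms(1,2)] smooth_onD assms)

section \<open>A fixed point equation and the regularity of its solution\<close>

text \<open>A recursion \<open>c \<mapsto> q * c + e\<close> whose inhomogeneity can be made
  arbitrarily small from some index on drives the error to \<open>0\<close>. \<open>P m c\<close>
  stands for a bound \<open>c\<close> on the error of the iterate \<open>m\<close>; a predicate is
  used because the errors are functions measured in a weighted norm.\<close>

lemma eventually_contraction:
  fixes P :: "nat \<Rightarrow> real \<Rightarrow> bool"
  assumes ex: "\<And>m. \<exists>c\<ge>0. P m c" and mono: "\<And>m c c'. P m c \<Longrightarrow> c \<le> c' \<Longrightarrow> P m c'"
    and step: "\<And>e. e > 0 \<Longrightarrow> \<forall>\<^sub>F m in sequentially. \<forall>c\<ge>0. P m c \<longrightarrow> P (Suc m) (q * c + e)"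
    and q: "0 \<le> q" "q < 1" and e: "e > 0"
  shows "\<forall>\<^sub>F m in sequentially. P m e"
proof -
  \<comment> \<open>Chosen such that \<open>e / 2\<close> is the fixed point of
    \<open>c \<mapsto> q * c + e'\<close>.\<close>
  define e' where "e' = e * (1 - q) / 2"
  have "e' > 0" using q e by (simp add: e'_def)
  then obtain m0 where m0: "\<And>m c. m \<ge> m0 \<Longrightarrow> c \<ge> 0 \<Longrightarrow> P m c \<Longrightarrow> P (Suc m) (q * c + e')"
    using step[of e'] unfolding eventually_sequentially by auto
  obtain c where c: "c \<ge> 0" "P m0 c" using ex[of m0] by auto
  have P: "P (m0 + n) (q ^ n * c + e / 2)" for n
  proof (induction n)
    case 0
    then show ?case using c e by (auto intro: mono)
  next
    case (Suc n)
    have "P (Suc (m0 + n)) (q * (q ^ n * c + e / 2) + e')"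
      using m0[OF _ _ Suc] q c e by simp
    moreover have "q * (q ^ n * c + e / 2) + e' = q ^ Suc n * c + e / 2"
      by (simp add: e'_def field_simps)
    ultimately show ?case by simp
  qed
  have "(\<lambda>n. q ^ n * c) \<longlonglongrightarrow> 0"
    using tendsto_mult_right[OF LIMSEQ_power_zero[of q], of c] q by simp
  then have "\<forall>\<^sub>F n in sequentially. q ^ n * c < e / 2"
    using e by (intro order_tendstoD) auto
  then obtain n0 where n0: "\<And>n. n \<ge> n0 \<Longrightarrow> q ^ n * c < e / 2"
    unfolding eventually_sequentially by auto
  have "P m e" if "m \<ge> m0 + n0" for m
  proof (rule mono)
    show "P m (q ^ (m - m0) * c + e / 2)" using P[of "m - m0"] that by simp
    have "n0 \<le> m - m0" using that by linarith
    from n0[OF this] show "q ^ (m - m0) * c + e / 2 \<le> e" by linarith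
  qed
  then show ?thesis unfolding eventually_sequentially by blast
qed

lemma weighted_bound_exists:
  fixes E :: "complex \<Rightarrow> 'e::real_normed_vector"
  assumes "continuous_on (cball 0 r) E"
  shows "\<exists>c\<ge>0. \<forall>z\<in>cball 0 r. norm (E z) \<le> c * weight M z"
proof -
  have "compact (E ` cball 0 r)" using assms by (intro compact_continuous_image) auto
  then have "\<exists>c. \<forall>x\<in>E ` cball 0 r. norm x \<le> c"
    unfolding bounded_iff[symmetric] by (rule compact_imp_bounded)
  then obtain c where c: "\<forall>x\<in>E ` cball 0 r. norm x \<le> c" ..
  show ?thesis
  proof (intro exI[of _ "max c 0"] conjI ballI)
    fix z :: complex assume z: "z \<in> cball 0 r"
    have "norm (E z) \<le> max c 0 * 1" using bspec[OF c imageI[OF z]] by simp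
    also have "\<dots> \<le> max c 0 * weight M z" by (intro mult_left_mono weight_ge_1) simp
    finally show "norm (E z) \<le> max c 0 * weight M z" .
  qed simp
qed

text \<open>Compactness provides a best constant \<open>c\<close>; applied to it, the implication
  gives \<open>c \<le> d + q * c\<close>, which can be solved for \<open>c\<close>.\<close>

lemma weighted_absorb:
  fixes E :: "complex \<Rightarrow> 'e::real_normed_vector"
  assumes E: "continuous_on (cball 0 \<rho>) E" and q: "q < 1"
    and step: "\<And>c. 0 \<le> c \<Longrightarrow> \<forall>z\<in>cball 0 \<rho>. norm (E z) \<le> c * weight M z \<Longrightarrow>
      \<forall>z\<in>cball 0 \<rho>. norm (E z) \<le> (d + q * c) * weight M z"
    and z: "z \<in> cball 0 \<rho>"
  shows "norm (E z) \<le> d / (1 - q) * weight M z"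
proof -
  have "continuous_on (cball 0 \<rho>) (\<lambda>z. norm (E z) / weight M z)"
    by (intro continuous_on_divide continuous_on_norm E weight_continuous) auto
  then have "\<exists>x\<in>cball 0 \<rho>. \<forall>y\<in>cball 0 \<rho>. norm (E y) / weight M y \<le> norm (E x) / weight M x"
    by (rule continuous_attains_sup[OF compact_cball, rotated]) (use z in blast)
  then obtain z0 where z0: "z0 \<in> cball 0 \<rho>"
    and max: "\<forall>y\<in>cball 0 \<rho>. norm (E y) / weight M y \<le> norm (E z0) / weight M z0" ..
  define c where "c = norm (E z0) / weight M z0"
  have c: "norm (E y) \<le> c * weight M y" if "y \<in> cball 0 \<rho>" for y
    using bspec[OF max that] by (simp add: c_def[symmetric] divide_le_eq)
  have "norm (E z0) \<le> (d + q * c) * weight M z0"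
    using step[of c] c z0 by (auto simp: c_def)
  then have "c \<le> d + q * c" by (simp add: c_def divide_le_eq)
  then have "c \<le> d / (1 - q)" using q by (simp add: field_simps)
  then have "c * weight M z \<le> d / (1 - q) * weight M z" by (intro mult_right_mono) auto
  then show ?thesis using c[OF z] by linarith
qed

text \<open>Source and target types differ because in the application a pair \<open>(U, w)\<close>
  is rebuilt from three densities: two for the integral along rays and one for the Cauchy
  transform.\<close>

locale contracting_op =
  fixes \<Lambda> :: "(complex \<Rightarrow> 'g::euclidean_space) \<Rightarrow> complex \<Rightarrow> 'e::euclidean_space" and M \<kappa> :: real
  assumes op_cont: "continuous_on UNIV f \<Longrightarrow> continuous_on UNIV (\<Lambda> f)"
    and op_diff: "continuous_on UNIV f \<Longrightarrow> continuous_on UNIV g \<Longrightarrow> \<Lambda> (\<lambda>z. f z - g z) z = \<Lambda> f z - \<Lambda> g z"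
    and op_bound: "continuous_on UNIV f \<Longrightarrow> 0 \<le> c \<Longrightarrow> (\<And>z. norm (f z) \<le> c * weight M z) \<Longrightarrow>
      norm (\<Lambda> f z) \<le> \<kappa> * c * weight M z"
    and kappa_nonneg: "0 \<le> \<kappa>"
begin

lemma op_diff_bound:
  assumes "continuous_on UNIV f" "continuous_on UNIV g" "0 \<le> c" "\<And>z. norm (f z - g z) \<le> c * weight M z"
  shows "norm (\<Lambda> f z - \<Lambda> g z) \<le> \<kappa> * c * weight M z"
  using op_bound[of "\<lambda>z. f z - g z" c z] assms op_diff[OF assms(1,2)] by (simp add: continuous_on_diff)

text \<open>Banach's theorem in the weighted sup norm, with contraction constant
  \<open>\<kappa> * B\<close>.\<close>

lemma fixpoint:
  fixes h :: "complex \<times> 'e \<Rightarrow> 'g"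
  assumes D: "continuous_on UNIV D" and h: "continuous_on UNIV h"
    and supp: "\<And>z x. norm z > \<rho> \<Longrightarrow> h (z, x) = 0"
    and lip: "\<And>z x y. norm (h (z, x) - h (z, y)) \<le> B * norm (x - y)" and B: "0 \<le> B" "\<kappa> * B < 1"
  shows "\<exists>F. continuous_on UNIV F \<and> (\<forall>z. F z = D z + \<Lambda> (\<lambda>z. h (z, F z)) z)"
proof -
  define r where "r = max \<rho> 0"
  \<comment> \<open>Only values over the support of \<open>h\<close> enter the operator. Composing
    with the projection onto a disc that contains it makes all iterates bounded, whatever
    \<open>D\<close> does at infinity.\<close>
  define \<pi> where "\<pi> = closest_point (cball (0::complex) r)"
  have ne: "cball (0::complex) r \<noteq> {}" by (simp add: r_def)
  have \<pi>c: "continuous_on UNIV \<pi>"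
    unfolding \<pi>_def by (rule continuous_on_closest_point) (use ne in auto)
  have \<pi>in: "\<pi> z \<in> cball 0 r" for z unfolding \<pi>_def by (rule closest_point_in_set) (use ne in auto)
  have \<pi>id: "\<pi> z = z" if "z \<in> cball 0 r" for z unfolding \<pi>_def by (rule closest_point_self[OF that])
  \<comment> \<open>The iteration acts on the unknown divided by the weight, so that the sup norm of
    bounded continuous functions becomes the weighted norm.\<close>
  define w where "w G z = weight M z *\<^sub>R apply_bcontfun G z" for G :: "complex \<Rightarrow>\<^sub>C 'e" and z
  have wc: "continuous_on UNIV (\<lambda>z. h (z, w G z))" for G
    unfolding w_def by (rule continuous_on_UNIV_comp[OF h]) (intro continuous_intros weight_continuous continuous_on_apply_bcontfun)
  define Q where "Q G z = (1 / weight M z) *\<^sub>R (D z + \<Lambda> (\<lambda>z. h (z, w G z)) z)" for G z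
  have Qc: "continuous_on UNIV (Q G)" for G
    unfolding Q_def[abs_def] by (intro continuous_intros weight_continuous D op_cont wc) auto
  have Pb: "(\<lambda>z. Q G (\<pi> z)) \<in> bcontfun" for G
  proof -
    have "bounded (Q G ` cball 0 r)"
      by (intro compact_imp_bounded compact_continuous_image continuous_on_subset[OF Qc]) auto
    then have "bounded (range (\<lambda>z. Q G (\<pi> z)))"
      by (rule bounded_subset) (use \<pi>in in auto)
    then show ?thesis using continuous_on_UNIV_comp[OF Qc \<pi>c] by (simp add: bcontfun_def)
  qed
  define P where "P G = Bcontfun (\<lambda>z. Q G (\<pi> z))" for G
  have Papp: "apply_bcontfun (P G) z = Q G (\<pi> z)" for G z
    unfolding P_def using Bcontfun_inverse[OF Pb] by simp
  have "dist (P G) (P G') \<le> \<kappa> * B * dist G G'" for G G'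
  proof (rule dist_bound)
    fix z
    have "norm (h (y, w G y) - h (y, w G' y)) \<le> B * dist G G' * weight M y" for y
    proof -
      have "norm (h (y, w G y) - h (y, w G' y)) \<le> B * norm (weight M y *\<^sub>R (G y - G' y))"
        using lip[of y "w G y" "w G' y"] by (simp add: w_def scaleR_diff_right)
      also have "\<dots> = B * (weight M y * dist (G y) (G' y))" by (simp add: dist_norm)
      also have "\<dots> \<le> B * (weight M y * dist G G')"
        by (intro mult_left_mono dist_bounded B) auto
      finally show ?thesis by (simp add: mult_ac)
    qed
    then have "norm (\<Lambda> (\<lambda>z. h (z, w G z)) (\<pi> z) - \<Lambda> (\<lambda>z. h (z, w G' z)) (\<pi> z)) \<le> \<kappa> * (B * dist G G') * weight M (\<pi> z)"
      using B by (intro op_diff_bound wc) auto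
    then show "dist (P G z) (P G' z) \<le> \<kappa> * B * dist G G'"
      unfolding Papp Q_def dist_norm scaleR_diff_right[symmetric] add_diff_cancel_left norm_scaleR
      by (simp add: divide_le_eq mult_ac)
  qed
  then obtain G where G: "P G = G"
    using banach_fix_type[of "\<kappa> * B" P] B kappa_nonneg by auto
  define F where "F z = D z + \<Lambda> (\<lambda>z. h (z, w G z)) z" for z
  have "h (z, F z) = h (z, w G z)" for z
  proof (cases "norm z > \<rho>")
    case True
    then show ?thesis by (simp add: supp)
  next
    case False
    then have "z \<in> cball 0 r" by (simp add: r_def)
    then have "apply_bcontfun G z = Q G z" using Papp[of G z] \<pi>id by (simp add: G)
    then show ?thesis by (simp add: w_def F_def Q_def)
  qed
  moreover have "continuous_on UNIV F"
    unfolding F_def[abs_def] by (intro continuous_intros D op_cont wc)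
  ultimately show ?thesis unfolding F_def[symmetric] by (intro exI[of _ F]) (simp add: F_def)
qed

text \<open>As \<open>h\<close> vanishes at \<open>0\<close>, its Lipschitz bound gives
  \<open>norm (h (z, F z)) \<le> B * norm (F z)\<close>, and the term with \<open>\<Lambda>\<close>
  can be absorbed. This makes the solution small when \<open>D\<close> is.\<close>

lemma fixpoint_bound:
  fixes h :: "complex \<times> 'e \<Rightarrow> 'g"
  assumes F: "continuous_on UNIV F" "\<And>z. F z = D z + \<Lambda> (\<lambda>z. h (z, F z)) z"
    and h: "continuous_on UNIV h"
    and supp: "\<And>z x. norm z > \<rho> \<Longrightarrow> h (z, x) = 0"
    and lip: "\<And>z x y. norm (h (z, x) - h (z, y)) \<le> B * norm (x - y)" and B: "0 \<le> B" "\<kappa> * B < 1"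
    and h0: "\<And>z. h (z, 0) = 0" and d: "\<And>z. norm (D z) \<le> d" and z: "z \<in> cball 0 \<rho>"
  shows "norm (F z) \<le> d / (1 - \<kappa> * B) * weight M z"
proof (rule weighted_absorb[OF _ B(2) _ z])
  show "continuous_on (cball 0 \<rho>) F" using F(1) by (rule continuous_on_subset) simp
  fix c :: real assume c: "0 \<le> c" "\<forall>z\<in>cball 0 \<rho>. norm (F z) \<le> c * weight M z"
  have hc: "continuous_on UNIV (\<lambda>z. h (z, F z))"
    by (rule continuous_on_UNIV_comp[OF h]) (intro continuous_intros F)
  have "norm (h (y, F y)) \<le> B * c * weight M y" for y
  proof (cases "norm y > \<rho>")
    case True
    then show ?thesis using supp B c by simp
  next
    case False
    have "norm (h (y, F y)) \<le> B * norm (F y)" using lip[of y "F y" 0] h0 by simp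
    also have "\<dots> \<le> B * (c * weight M y)" using c False B by (intro mult_left_mono) auto
    finally show ?thesis by (simp add: mult_ac)
  qed
  then have *: "norm (\<Lambda> (\<lambda>z. h (z, F z)) y) \<le> \<kappa> * (B * c) * weight M y" for y
    using B c by (intro op_bound hc) auto
  show "\<forall>z\<in>cball 0 \<rho>. norm (F z) \<le> (d + \<kappa> * B * c) * weight M z"
  proof
    fix y :: complex
    have "d \<ge> 0" using d[of 0] norm_ge_zero order_trans by blast
    have "norm (F y) \<le> norm (D y) + norm (\<Lambda> (\<lambda>z. h (z, F z)) y)"
      using norm_triangle_ineq F(2)[of y] by metis
    also have "\<dots> \<le> d * weight M y + \<kappa> * B * c * weight M y"
      using d[of y] *[of y] mult_left_mono[OF weight_ge_1 \<open>d \<ge> 0\<close>, of M y] by (simp add: mult.assoc)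
    finally show "norm (F y) \<le> (d + \<kappa> * B * c) * weight M y" by (simp add: distrib_right)
  qed
qed


end

text \<open>Only increments in the direction \<open>v\<close> are restricted: the right-hand sides
  are Lipschitz with constant \<open>B\<close> in the unknown alone, and only the partial derivative
  in the unknown inherits \<open>B\<close>.\<close>

lemma norm_derivative_le_Lipschitz:
  assumes d: "(f has_derivative f') (at x)" and lip: "\<And>t. norm (f (x + t *\<^sub>R v) - f x) \<le> B * norm (t *\<^sub>R v)"
  shows "norm (f' v) \<le> B * norm v"
proof -
  have "norm (f' v) \<le> B * norm v + e" if "e > 0" for e
  proof (cases "v = 0")
    case True
    then show ?thesis using linear_0[OF has_derivative_linear[OF d]] that by simp
  next
    case False
    define e' where "e' = e / norm v"
    have "e' > 0" using that False by (simp add: e'_def)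
    then obtain \<delta> where \<delta>: "\<delta> > 0" "\<And>y. norm (y - x) < \<delta> \<Longrightarrow> norm (f y - f x - f' (y - x)) \<le> e' * norm (y - x)"
      using d unfolding has_derivative_at_alt by blast
    define t where "t = \<delta> / (2 * norm v)"
    have t: "t > 0" "norm (t *\<^sub>R v) < \<delta>" using \<delta> False by (simp_all add: t_def)
    have "norm (f' (t *\<^sub>R v)) \<le> norm (f (x + t *\<^sub>R v) - f x) + norm (f (x + t *\<^sub>R v) - f x - f' (t *\<^sub>R v))"
      by norm
    also have "\<dots> \<le> B * norm (t *\<^sub>R v) + e' * norm (t *\<^sub>R v)"
      using \<delta>(2)[of "x + t *\<^sub>R v"] t by (intro add_mono lip) simp
    also have "norm (f' (t *\<^sub>R v)) = t * norm (f' v)"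
      using linear_scale[OF has_derivative_linear[OF d]] t by simp
    finally have "t * norm (f' v) \<le> t * (B * norm v + e)"
      using t False by (simp add: e'_def algebra_simps)
    then show ?thesis using t by simp
  qed
  then show ?thesis by (rule field_le_epsilon)
qed

text \<open>\<open>N j v\<close> collects the terms of the derivative of \<open>L j f\<close> in the direction \<open>v\<close> in which \<open>f\<close> is not
  differentiated. That the other term involves \<open>L (Suc j)\<close>, with the same contraction constant,
  allows a bootstrap over all \<open>j\<close> simultaneously.\<close>

locale smoothing_ops =
  fixes L :: "nat \<Rightarrow> (complex \<Rightarrow> 'g::euclidean_space) \<Rightarrow> complex \<Rightarrow> 'e::euclidean_space"
    and N :: "nat \<Rightarrow> complex \<Rightarrow> (complex \<Rightarrow> 'g) \<Rightarrow> complex \<Rightarrow> 'e"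
    and M \<kappa> :: real
  assumes L_op: "\<And>j. contracting_op (L j) M \<kappa>"
    and N_diff: "continuous_on UNIV f \<Longrightarrow> continuous_on UNIV g \<Longrightarrow> N j v (\<lambda>z. f z - g z) z = N j v f z - N j v g z"
    and N_bound: "\<exists>C\<ge>0. \<forall>f c. continuous_on UNIV f \<longrightarrow> (\<forall>z. norm (f z) \<le> c) \<longrightarrow>
        (\<forall>z\<in>cball 0 r. norm (N j v f z) \<le> C * c)"
    and L_deriv: "Ck_on (Suc 0) UNIV f \<Longrightarrow>
        (L j f has_derivative (\<lambda>v. L (Suc j) (\<lambda>z. frechet_derivative f (at z) v) z + N j v f z)) (at z)"
    and L_Ck: "Ck_on k UNIV f \<Longrightarrow> Ck_on k UNIV (L j f)"
    and N_Ck: "Ck_on k UNIV f \<Longrightarrow> Ck_on k UNIV (N j v f)"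
begin

text \<open>The solution is only known to be continuous, so the equation cannot be differentiated
  directly. Instead the Picard iterates, which are of class C1, are shown to converge to
  \<open>F\<close> together with their derivatives; the limits of the derivatives solve the formally
  differentiated equation.\<close>

lemma solution_C1:
  fixes h :: "complex \<times> 'e \<Rightarrow> 'g"
  assumes h: "Ck_on (Suc 0) UNIV h" and D: "Ck_on (Suc 0) UNIV D"
    and supp: "\<And>z x. norm z > \<rho> \<Longrightarrow> h (z, x) = 0"
    and lip: "\<And>z x y. norm (h (z, x) - h (z, y)) \<le> B * norm (x - y)" and B: "0 \<le> B" "\<kappa> * B < 1"
    and F: "continuous_on UNIV F" and Feq: "\<And>z. F z = D z + L j (\<lambda>z. h (z, F z)) z"
  shows "Ck_on (Suc 0) UNIV F"
proof -
  interpret Lj: contracting_op "L j" M \<kappa> by (rule L_op)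
  interpret Lj1: contracting_op "L (Suc j)" M \<kappa> by (rule L_op)
  define q where "q = \<kappa> * B"
  have q: "0 \<le> q" "q < 1" using B Lj.kappa_nonneg by (simp_all add: q_def)
  \<comment> \<open>The margin \<open>1\<close> makes \<open>ball 0 r\<close> and the exterior
    \<open>norm z > \<rho>\<close> an open cover of the plane.\<close>
  define r where "r = max \<rho> 0 + 1"
  have r: "r > \<rho>" "r > 0" by (simp_all add: r_def)
  define h' where "h' p = frechet_derivative h (at p)" for p
  have hd: "(h has_derivative h' p) (at p)" for p
    unfolding h'_def by (rule Ck_on_has_derivative[OF h]) simp
  have hlin: "linear (h' p)" for p by (rule has_derivative_linear[OF hd])
  have hc: "continuous_on UNIV h" by (rule Ck_on_continuous[OF h])
  have h'c: "continuous_on S (\<lambda>x. h' (g x) (w x))" if "continuous_on S g" "continuous_on S w" for g w and S :: "'s::euclidean_space set"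
    unfolding h'_def by (rule C1_continuous_derivative2[OF h that])
  have h'B: "norm (h' (z, x) (0, y)) \<le> B * norm y" for z x y
  proof -
    have "norm (h' (z, x) (0, y)) \<le> B * norm (0 :: complex, y)"
    proof (rule norm_derivative_le_Lipschitz[OF hd])
      show "norm (h ((z, x) + t *\<^sub>R (0, y)) - h (z, x)) \<le> B * norm (t *\<^sub>R (0 :: complex, y))" for t
        using lip[of z "x + t *\<^sub>R y" x] by (simp add: norm_Pair)
    qed
    then show ?thesis by (simp add: norm_Pair)
  qed
  have h'0: "h' (z, x) v = 0" if "norm z > \<rho>" for z x v
  proof -
    have "open {p :: complex \<times> 'e. norm (fst p) > \<rho>}"
      by (intro open_Collect_less continuous_intros)
    then have "((\<lambda>_. 0) has_derivative h' (z, x)) (at (z, x))"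
      by (rule has_derivative_transform_within_open[OF hd]) (use that supp in auto)
    then show ?thesis using has_derivative_unique[OF has_derivative_const] by (metis (full_types))
  qed
  have hcF: "continuous_on UNIV (\<lambda>z. h (z, G z))" if "continuous_on UNIV G" for G
    by (rule continuous_on_UNIV_comp[OF hc]) (intro continuous_intros that)
  define step where "step G z = D z + L j (\<lambda>z. h (z, G z)) z" for G z
  define Fs where "Fs m = (step ^^ m) (\<lambda>_. 0)" for m
  have Fs_Suc: "Fs (Suc m) = step (Fs m)" for m by (simp add: Fs_def)
  have hG: "Ck_on (Suc 0) UNIV (\<lambda>z. h (z, G z))" if "Ck_on (Suc 0) UNIV G" for G
    by (rule Ck_on_comp[OF open_UNIV open_UNIV h Ck_on_Pair[OF open_UNIV Ck_on_bounded_linear[OF bounded_linear_ident open_UNIV] that] UNIV_I])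
  have stepC: "Ck_on (Suc 0) UNIV (step G)" if "Ck_on (Suc 0) UNIV G" for G
    unfolding step_def[abs_def] by (intro Ck_on_add open_UNIV D L_Ck hG that)
  have FsC: "Ck_on (Suc 0) UNIV (Fs m)" for m
    by (induction m) (auto simp: Fs_Suc Fs_def[of 0] simp del: Ck_on.simps intro: stepC Ck_on_const)
  have Fsc: "continuous_on UNIV (Fs m)" for m by (rule Ck_on_continuous[OF FsC])
  have hGd: "frechet_derivative (\<lambda>z. h (z, G z)) (at z) v = h' (z, G z) (v, frechet_derivative G (at z) v)"
    if "Ck_on (Suc 0) UNIV G" for G z v
  proof -
    have "((\<lambda>z. (z, G z)) has_derivative (\<lambda>v. (v, frechet_derivative G (at z) v))) (at z)"
      by (intro has_derivative_Pair has_derivative_ident Ck_on_has_derivative[OF that]) simp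
    from frechet_derivativeI[OF has_derivative_compose[OF this hd]] show ?thesis by simp
  qed
  have stepd: "(step G has_derivative (\<lambda>v. frechet_derivative D (at z) v +
      (L (Suc j) (\<lambda>z. h' (z, G z) (v, frechet_derivative G (at z) v)) z + N j v (\<lambda>z. h (z, G z)) z))) (at z)"
    if "Ck_on (Suc 0) UNIV G" for G z
    using has_derivative_add[OF Ck_on_has_derivative[OF D] L_deriv[OF hG[OF that]]]
    unfolding step_def[abs_def] hGd[OF that] by simp
  obtain c0 where c0: "c0 \<ge> 0" "\<And>z. z \<in> cball 0 r \<Longrightarrow> norm (F z) \<le> c0 * weight M z"
    using weighted_bound_exists[of r F M] continuous_on_subset[OF F] by auto
  have conv: "norm (Fs m z - F z) \<le> c0 * q ^ m * weight M z" if "z \<in> cball 0 r" for m z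
    using that
  proof (induction m arbitrary: z)
    case 0
    then show ?case using c0 by (simp add: Fs_def)
  next
    case (Suc m)
    have "norm (h (y, Fs m y) - h (y, F y)) \<le> B * (c0 * q ^ m) * weight M y" for y
    proof (cases "y \<in> cball 0 r")
      case True
      have "norm (h (y, Fs m y) - h (y, F y)) \<le> B * norm (Fs m y - F y)" by (rule lip)
      also have "\<dots> \<le> B * (c0 * q ^ m * weight M y)" by (intro mult_left_mono Suc.IH True B)
      finally show ?thesis by (simp add: mult_ac)
    next
      case False
      then have "norm y > \<rho>" using r by simp
      then show ?thesis using supp B c0 q by simp
    qed
    then have "norm (L j (\<lambda>z. h (z, Fs m z)) z - L j (\<lambda>z. h (z, F z)) z) \<le> \<kappa> * (B * (c0 * q ^ m)) * weight M z"
      using B c0 q by (intro Lj.op_diff_bound hcF F Fsc) auto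
    then show ?case by (simp add: Fs_Suc step_def Feq[of z] q_def mult_ac)
  qed
  define W where "W = weight M (of_real r)"
  have W: "W > 0" "\<And>z. z \<in> cball 0 r \<Longrightarrow> weight M z \<le> W"
    using r by (auto simp: W_def intro!: weight_mono)
  have lim0: "(\<lambda>m. C * q ^ m) \<longlonglongrightarrow> 0" for C :: real
    using tendsto_mult_left[OF LIMSEQ_power_zero[of q], of C] q by simp
  have ev0: "\<forall>\<^sub>F m in sequentially. C * q ^ m < e" if "e > 0" for C e :: real
    using lim0[of C] that by (rule order_tendstoD)
  have conv': "norm (Fs m z - F z) \<le> c0 * W * q ^ m" if "z \<in> cball 0 r" for m z
  proof -
    have "c0 * q ^ m * weight M z \<le> c0 * q ^ m * W" using c0 q by (intro mult_left_mono W that) auto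
    then show ?thesis using conv[OF that, of m] by (simp add: mult_ac)
  qed
  \<comment> \<open>\<open>Y v\<close> solves the equation that the derivative of \<open>F\<close>
    in direction \<open>v\<close> would have to satisfy. It is affine in the unknown with Lipschitz
    constant \<open>B\<close>, so a solution exists before \<open>F\<close> is known to be
    differentiable.\<close>
  have "\<exists>Y. continuous_on UNIV Y \<and> (\<forall>z. Y z = (frechet_derivative D (at z) v + N j v (\<lambda>z. h (z, F z)) z) +
      L (Suc j) (\<lambda>z. h' (z, F z) (v, Y z)) z)" for v
  proof -
    have "\<exists>Y. continuous_on UNIV Y \<and> (\<forall>z. Y z = (frechet_derivative D (at z) v + N j v (\<lambda>z. h (z, F z)) z) +
        L (Suc j) (\<lambda>z. (\<lambda>p. h' (fst p, F (fst p)) (v, snd p)) (z, Y z)) z)"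
    proof (rule Lj1.fixpoint[where \<rho>=\<rho> and B=B])
      show "continuous_on UNIV (\<lambda>z. frechet_derivative D (at z) v + N j v (\<lambda>z. h (z, F z)) z)"
        using N_Ck[of 0 "\<lambda>z. h (z, F z)"] hcF[OF F] by (intro continuous_on_add C1_continuous_derivative[OF D]) simp
      show "continuous_on UNIV (\<lambda>p. h' (fst p, F (fst p)) (v, snd p))"
        by (intro h'c continuous_intros continuous_on_UNIV_comp[OF F])
      show "norm ((\<lambda>p. h' (fst p, F (fst p)) (v, snd p)) (z, x) - (\<lambda>p. h' (fst p, F (fst p)) (v, snd p)) (z, y)) \<le> B * norm (x - y)" for z x y
        using h'B[of z "F z" "x - y"] linear_diff[OF hlin, of "(z, F z)" "(v, x)" "(v, y)"] by simp
    qed (use B h'0 in auto)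
    then show ?thesis by simp
  qed
  then obtain Y where Yc: "\<And>v. continuous_on UNIV (Y v)"
    and Y: "\<And>v z. Y v z = (frechet_derivative D (at z) v + N j v (\<lambda>z. h (z, F z)) z) +
      L (Suc j) (\<lambda>z. h' (z, F z) (v, Y v z)) z"
    by metis
  \<comment> \<open>The derivatives of the iterates obey the equation for \<open>Y v\<close> up to
    two errors: \<open>h'\<close> is taken at \<open>Fs m\<close> instead of at \<open>F\<close>,
    and so is the argument of \<open>N\<close>. Uniform continuity on a compact set controls the
    first, geometric convergence of \<open>Fs\<close> the second.\<close>
  have dconv: "\<forall>\<^sub>F m in sequentially. \<forall>z\<in>cball 0 r. norm (frechet_derivative (Fs m) (at z) v - Y v z) \<le> e * weight M z"
    if "e > 0" for v e
  proof (rule eventually_contraction[OF _ _ _ q that])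
    show "\<exists>c\<ge>0. \<forall>z\<in>cball 0 r. norm (frechet_derivative (Fs m) (at z) v - Y v z) \<le> c * weight M z" for m
      by (intro weighted_bound_exists continuous_on_subset[OF continuous_on_diff[OF C1_continuous_derivative[OF FsC] Yc]]) simp
    show "\<forall>z\<in>cball 0 r. norm (frechet_derivative (Fs m) (at z) v - Y v z) \<le> c' * weight M z"
      if "\<forall>z\<in>cball 0 r. norm (frechet_derivative (Fs m) (at z) v - Y v z) \<le> c * weight M z" "c \<le> c'" for m c c'
    proof
      fix z :: complex assume "z \<in> cball 0 r"
      then have "norm (frechet_derivative (Fs m) (at z) v - Y v z) \<le> c * weight M z" using that by blast
      also have "\<dots> \<le> c' * weight M z" using that by (intro mult_right_mono) auto
      finally show "norm (frechet_derivative (Fs m) (at z) v - Y v z) \<le> c' * weight M z" .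
    qed
    fix e :: real assume e: "e > 0"
    obtain C where C: "C \<ge> 0" "\<And>f c z. continuous_on UNIV f \<Longrightarrow> (\<And>z. norm (f z) \<le> c) \<Longrightarrow> z \<in> cball 0 r \<Longrightarrow> norm (N j v f z) \<le> C * c"
      using N_bound[of r j v] by blast
    have ev1: "\<forall>\<^sub>F m in sequentially. (C * (B * (c0 * W))) * q ^ m < e / 2"
      using e by (intro ev0) simp
    define e2 where "e2 = e / 2 / (\<kappa> + 1)"
    have e2: "e2 > 0" "\<kappa> * e2 \<le> e / 2" using e Lj.kappa_nonneg by (simp_all add: e2_def field_simps)
    have ev2: "\<forall>\<^sub>F m in sequentially. \<forall>z\<in>cball 0 r. norm (h' (z, Fs m z) (v, Y v z) - h' (z, F z) (v, Y v z)) \<le> e2"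
    proof -
      have "compact (F ` cball 0 r)" by (intro compact_continuous_image continuous_on_subset[OF F]) auto
      then have "bounded (F ` cball 0 r)" by (rule compact_imp_bounded)
      then obtain S where S: "\<And>z. z \<in> cball 0 r \<Longrightarrow> norm (F z) \<le> S" unfolding bounded_iff by (metis imageI)
      have "uniformly_continuous_on (cball 0 r \<times> cball 0 (S + 1)) (\<lambda>p. h' p (v, Y v (fst p)))"
        by (intro compact_uniformly_continuous h'c compact_Times compact_cball continuous_intros continuous_on_UNIV_comp[OF Yc])
      then obtain d where d: "d > 0" "\<And>p p'. p \<in> cball 0 r \<times> cball 0 (S + 1) \<Longrightarrow> p' \<in> cball 0 r \<times> cball 0 (S + 1) \<Longrightarrow>
          dist p' p < d \<Longrightarrow> dist (h' p' (v, Y v (fst p'))) (h' p (v, Y v (fst p))) < e2"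
        unfolding uniformly_continuous_on_def using e2(1) by meson
      have "\<forall>\<^sub>F m in sequentially. (c0 * W) * q ^ m < min d 1" using d by (intro ev0) simp
      then show ?thesis
      proof eventually_elim
        case (elim m)
        show ?case
        proof
          fix z :: complex assume z: "z \<in> cball 0 r"
          have n: "norm (Fs m z - F z) < min d 1" using conv'[OF z, of m] elim by linarith
          have "norm (Fs m z) \<le> norm (F z) + norm (Fs m z - F z)" by norm
          then have "(z, Fs m z) \<in> cball 0 r \<times> cball 0 (S + 1)" "(z, F z) \<in> cball 0 r \<times> cball 0 (S + 1)"
            using S[OF z] n z by auto
          from d(2)[OF this(2,1)] show "norm (h' (z, Fs m z) (v, Y v z) - h' (z, F z) (v, Y v z)) \<le> e2"
            using n by (simp add: dist_Pair_Pair dist_norm)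
        qed
      qed
    qed
    show "\<forall>\<^sub>F m in sequentially. \<forall>c\<ge>0. (\<forall>z\<in>cball 0 r. norm (frechet_derivative (Fs m) (at z) v - Y v z) \<le> c * weight M z) \<longrightarrow>
        (\<forall>z\<in>cball 0 r. norm (frechet_derivative (Fs (Suc m)) (at z) v - Y v z) \<le> (q * c + e) * weight M z)"
      using ev1 ev2
    proof eventually_elim
      case (elim m)
      show ?case
      proof (intro allI impI ballI)
        fix c :: real and z :: complex
        assume c: "c \<ge> 0" and IH: "\<forall>z\<in>cball 0 r. norm (frechet_derivative (Fs m) (at z) v - Y v z) \<le> c * weight M z"
          and z: "z \<in> cball 0 r"
        let ?a = "\<lambda>z. h' (z, Fs m z) (v, frechet_derivative (Fs m) (at z) v)" and ?b = "\<lambda>z. h' (z, F z) (v, Y v z)"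
        have eq: "frechet_derivative (Fs (Suc m)) (at z) v - Y v z =
            (L (Suc j) ?a z - L (Suc j) ?b z) + (N j v (\<lambda>z. h (z, Fs m z)) z - N j v (\<lambda>z. h (z, F z)) z)"
          unfolding Fs_Suc frechet_derivativeI[OF stepd[OF FsC]] by (simp add: Y[of v z])
        have "norm (?a y - ?b y) \<le> (B * c + e2) * weight M y" for y
        proof (cases "y \<in> cball 0 r")
          case True
          have "?a y - ?b y = h' (y, Fs m y) (0, frechet_derivative (Fs m) (at y) v - Y v y) +
              (h' (y, Fs m y) (v, Y v y) - h' (y, F y) (v, Y v y))"
            using linear_diff[OF hlin, of "(y, Fs m y)" "(v, frechet_derivative (Fs m) (at y) v)" "(v, Y v y)"] by simp
          then have "norm (?a y - ?b y) \<le> norm (h' (y, Fs m y) (0, frechet_derivative (Fs m) (at y) v - Y v y)) +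
              norm (h' (y, Fs m y) (v, Y v y) - h' (y, F y) (v, Y v y))"
            using norm_triangle_ineq by metis
          also have "\<dots> \<le> B * (c * weight M y) + e2 * weight M y"
          proof (rule add_mono)
            show "norm (h' (y, Fs m y) (0, frechet_derivative (Fs m) (at y) v - Y v y)) \<le> B * (c * weight M y)"
              using h'B IH True B(1) mult_left_mono order_trans by meson
            have "norm (h' (y, Fs m y) (v, Y v y) - h' (y, F y) (v, Y v y)) \<le> e2 * 1" using elim(2) True by simp
            also have "\<dots> \<le> e2 * weight M y" using e2 by (intro mult_left_mono weight_ge_1) simp
            finally show "norm (h' (y, Fs m y) (v, Y v y) - h' (y, F y) (v, Y v y)) \<le> e2 * weight M y" .
          qed
          finally show ?thesis by (simp add: algebra_simps)
        next
          case False
          then have "norm y > \<rho>" using r by simp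
          then show ?thesis using h'0 B c e2 by simp
        qed
        then have "norm (L (Suc j) ?a z - L (Suc j) ?b z) \<le> \<kappa> * (B * c + e2) * weight M z"
          using B c e2 by (intro Lj1.op_diff_bound h'c continuous_intros Fsc F Yc C1_continuous_derivative[OF FsC]) auto
        also have "\<dots> \<le> (q * c + e / 2) * weight M z"
          using e2(2) by (intro mult_right_mono) (auto simp: q_def algebra_simps)
        finally have 1: "norm (L (Suc j) ?a z - L (Suc j) ?b z) \<le> (q * c + e / 2) * weight M z" .
        have "norm (h (y, Fs m y) - h (y, F y)) \<le> B * (c0 * W) * q ^ m" for y
        proof (cases "y \<in> cball 0 r")
          case True
          have "norm (h (y, Fs m y) - h (y, F y)) \<le> B * (c0 * W * q ^ m)"
            using lip conv'[OF True, of m] B(1) mult_left_mono order_trans by meson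
          then show ?thesis by (simp add: mult_ac)
        next
          case False
          then have "norm y > \<rho>" using r by simp
          then show ?thesis using supp B c0 W q by simp
        qed
        then have "norm (N j v (\<lambda>z. h (z, Fs m z) - h (z, F z)) z) \<le> C * (B * (c0 * W) * q ^ m)"
          by (intro C(2) continuous_on_diff hcF Fsc F z)
        also have "\<dots> \<le> e / 2 * 1" using elim(1) by (simp add: mult_ac)
        also have "\<dots> \<le> e / 2 * weight M z" using e by (intro mult_left_mono weight_ge_1) simp
        finally have 2: "norm (N j v (\<lambda>z. h (z, Fs m z)) z - N j v (\<lambda>z. h (z, F z)) z) \<le> e / 2 * weight M z"
          by (simp add: N_diff[OF hcF[OF Fsc] hcF[OF F]])
        show "norm (frechet_derivative (Fs (Suc m)) (at z) v - Y v z) \<le> (q * c + e) * weight M z"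
          unfolding eq using order_trans[OF norm_triangle_ineq add_mono[OF 1 2]] by (simp add: algebra_simps)
      qed
    qed
  qed
  \<comment> \<open>Nothing shows directly that \<open>Y v\<close> is linear in \<open>v\<close>, so
    the candidate differential is assembled from the directions \<open>1\<close> and
    \<open>\<i>\<close>.\<close>
  define Y' where "Y' z v = Re v *\<^sub>R Y 1 z + Im v *\<^sub>R Y \<i> z" for z v
  have "\<exists>g. \<forall>x\<in>ball 0 r. (\<lambda>n. Fs n x) \<longlonglongrightarrow> g x \<and> (g has_derivative Y' x) (at x within ball 0 r)"
  proof (rule has_derivative_sequence)
    show "(Fs n has_derivative frechet_derivative (Fs n) (at x)) (at x within ball 0 r)" for n x
      by (rule has_derivative_at_withinI, rule Ck_on_has_derivative[OF FsC]) simp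
    show "0 \<in> ball (0::complex) r" using r by simp
    show "(\<lambda>n. Fs n 0) \<longlonglongrightarrow> F 0"
    proof (rule LIM_zero_cancel, rule tendsto_0_le[OF lim0[of "c0 * W"], of _ 1])
      show "\<forall>\<^sub>F n in sequentially. norm (Fs n 0 - F 0) \<le> norm (c0 * W * q ^ n) * 1"
        using conv'[of 0] r W c0 q by (simp add: abs_mult)
    qed
    fix e :: real assume e: "e > 0"
    define e' where "e' = e / 2 / W"
    have e': "e' > 0" using e W by (simp add: e'_def)
    show "\<forall>\<^sub>F n in sequentially. \<forall>x\<in>ball 0 r. \<forall>v. norm (frechet_derivative (Fs n) (at x) v - Y' x v) \<le> e * norm v"
      using dconv[OF e', of 1] dconv[OF e', of \<i>]
    proof eventually_elim
      case (elim n)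
      show ?case
      proof (intro ballI allI)
        fix z v :: complex assume z: "z \<in> ball 0 r"
        then have z': "z \<in> cball 0 r" by simp
        let ?E = "\<lambda>v. frechet_derivative (Fs n) (at z) v - Y v z"
        have "frechet_derivative (Fs n) (at z) v = Re v *\<^sub>R frechet_derivative (Fs n) (at z) 1 + Im v *\<^sub>R frechet_derivative (Fs n) (at z) \<i>"
          using linear_eq_sum_Basis[OF has_derivative_linear[OF Ck_on_has_derivative[OF FsC]], of z n v]
          by (simp add: Basis_complex_def inner_complex_def)
        then have "frechet_derivative (Fs n) (at z) v - Y' z v = Re v *\<^sub>R ?E 1 + Im v *\<^sub>R ?E \<i>"
          by (simp add: Y'_def algebra_simps)
        then have "norm (frechet_derivative (Fs n) (at z) v - Y' z v) \<le> norm (Re v *\<^sub>R ?E 1) + norm (Im v *\<^sub>R ?E \<i>)"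
          using norm_triangle_ineq by metis
        also have "\<dots> \<le> norm v * (e / 2) + norm v * (e / 2)"
        proof -
          have "e' * weight M z \<le> e / 2"
            using mult_left_mono[OF W(2)[OF z'], of e'] e' W by (simp add: e'_def)
          then have "norm (?E 1) \<le> e / 2" "norm (?E \<i>) \<le> e / 2" using elim z' order_trans by blast+
          then show ?thesis
            unfolding norm_scaleR using e by (intro add_mono mult_mono) (auto simp: abs_Re_le_cmod abs_Im_le_cmod)
        qed
        finally show "norm (frechet_derivative (Fs n) (at z) v - Y' z v) \<le> e * norm v" by (simp add: mult_ac)
      qed
    qed
  qed simp
  then obtain g where g: "\<And>x. x \<in> ball 0 r \<Longrightarrow> (\<lambda>n. Fs n x) \<longlonglongrightarrow> g x"
    "\<And>x. x \<in> ball 0 r \<Longrightarrow> (g has_derivative Y' x) (at x within ball 0 r)" by blast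
  have gF: "g z = F z" if "z \<in> ball 0 r" for z
  proof (rule LIMSEQ_unique[OF g(1)[OF that]], rule LIM_zero_cancel, rule tendsto_0_le[OF lim0[of "c0 * W"], of _ 1])
    show "\<forall>\<^sub>F n in sequentially. norm (Fs n z - F z) \<le> norm (c0 * W * q ^ n) * 1"
      using conv'[of z] that W c0 q by (simp add: abs_mult)
  qed
  have Fd: "(F has_derivative Y' z) (at z)" if "z \<in> ball 0 r" for z
  proof -
    have "(g has_derivative Y' z) (at z)" using g(2)[OF that] unfolding at_within_open[OF that open_ball] .
    then show ?thesis by (rule has_derivative_transform_within_open[OF _ open_ball that gF])
  qed
  have C1: "Ck_on (Suc 0) (ball 0 r) F"
    by (rule Ck_on_SucI[OF open_ball Fd])
      (use Yc in \<open>auto simp: Y'_def intro!: continuous_intros intro: continuous_on_subset\<close>)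
  \<comment> \<open>Differentiability of \<open>F\<close> is now known inside
    \<open>ball 0 r\<close>. Outside the support \<open>h (z, F z)\<close> is \<open>0\<close>,
    hence it is of class C1 everywhere, and the equation transfers this to \<open>F\<close>.\<close>
  have "Ck_on (Suc 0) UNIV (\<lambda>z. h (z, F z))"
  proof (rule Ck_on_local)
    fix z :: complex
    show "\<exists>U. open U \<and> z \<in> U \<and> Ck_on (Suc 0) U (\<lambda>z. h (z, F z))"
    proof (cases "z \<in> ball 0 r")
      case True
      have "Ck_on (Suc 0) (ball 0 r) (\<lambda>z. h (z, F z))"
        by (rule Ck_on_comp[OF open_ball open_UNIV h Ck_on_Pair[OF open_ball Ck_on_bounded_linear[OF bounded_linear_ident open_ball] C1] UNIV_I])
      then show ?thesis using True open_ball by blast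
    next
      case False
      have o: "open {z::complex. norm z > \<rho>}" by (intro open_Collect_less continuous_intros)
      have "Ck_on (Suc 0) {z. norm z > \<rho>} (\<lambda>z. h (z, F z))"
        by (subst Ck_on_cong[OF o, of _ "\<lambda>_. 0"]) (use supp Ck_on_const in \<open>simp_all del: Ck_on.simps\<close>)
      moreover have "z \<in> {z. norm z > \<rho>}" using False r by simp
      ultimately show ?thesis using o by blast
    qed
  qed
  then have "Ck_on (Suc 0) UNIV (\<lambda>z. D z + L j (\<lambda>z. h (z, F z)) z)"
    by (rule Ck_on_add[OF open_UNIV D L_Ck])
  then show ?thesis by (subst Ck_on_cong[OF open_UNIV Feq])
qed

text \<open>A directional derivative of a solution solves an equation of the same kind, with
  \<open>Suc j\<close> for \<open>j\<close> and the linearized right-hand side, whose Lipschitz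
  constant in the unknown is again \<open>B\<close>. The new inhomogeneity contains \<open>F\<close>
  itself, which is \<open>Ck\<close> by the induction hypothesis, so each round gains one
  order.\<close>

theorem solution_Ck:
  fixes h :: "complex \<times> 'e \<Rightarrow> 'g"
  assumes "Ck_on k UNIV h" "Ck_on k UNIV D"
    and "\<And>z x. norm z > \<rho> \<Longrightarrow> h (z, x) = 0"
    and "\<And>z x y. norm (h (z, x) - h (z, y)) \<le> B * norm (x - y)" and B: "0 \<le> B" "\<kappa> * B < 1"
    and "continuous_on UNIV F" and "\<And>z. F z = D z + L j (\<lambda>z. h (z, F z)) z"
  shows "Ck_on k UNIV F"
  using assms(1-4,7,8)
proof (induction k arbitrary: h D F j)
  case 0
  show ?case using 0(5) by simp
next
  case (Suc k)
  have le: "Suc 0 \<le> Suc k" by simp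
  have h1: "Ck_on (Suc 0) UNIV h" by (rule Ck_on_le[OF Suc.prems(1) le])
  have D1: "Ck_on (Suc 0) UNIV D" by (rule Ck_on_le[OF Suc.prems(2) le])
  have F1: "Ck_on (Suc 0) UNIV F"
    by (rule solution_C1[OF h1 D1 Suc.prems(3,4) B Suc.prems(5,6)])
  have Fk: "Ck_on k UNIV F"
    by (rule Suc.IH[OF Ck_on_SucD[OF Suc.prems(1)] Ck_on_SucD[OF Suc.prems(2)] Suc.prems(3-6)])
  define h' where "h' p = frechet_derivative h (at p)" for p
  have hd: "(h has_derivative h' p) (at p)" for p
    unfolding h'_def by (rule Ck_on_has_derivative[OF h1]) simp
  have hF: "Ck_on l UNIV (\<lambda>z. h (z, F z))" if "Ck_on l UNIV F" "Ck_on l UNIV h" for l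
    by (rule Ck_on_comp[OF open_UNIV open_UNIV that(2) Ck_on_Pair[OF open_UNIV Ck_on_bounded_linear[OF bounded_linear_ident open_UNIV] that(1)] UNIV_I])
  have "Ck_on k UNIV (\<lambda>z. frechet_derivative F (at z) v)" for v
  proof (rule Suc.IH[where h="\<lambda>p. h' (fst p, F (fst p)) (v, snd p)" and j="Suc j" and
        D="\<lambda>z. frechet_derivative D (at z) v + N j v (\<lambda>z. h (z, F z)) z"])
    show "Ck_on k UNIV (\<lambda>p. h' (fst p, F (fst p)) (v, snd p))"
      unfolding h'_def
    proof (rule Ck_on_frechet_apply[OF open_UNIV open_UNIV Suc.prems(1) _ _ UNIV_I])
      show "Ck_on k UNIV (\<lambda>p :: complex \<times> 'e. (fst p, F (fst p)))"
        by (rule Ck_on_Pair[OF open_UNIV Ck_on_bounded_linear[OF bounded_linear_fst open_UNIV]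
              Ck_on_comp[OF open_UNIV open_UNIV Fk Ck_on_bounded_linear[OF bounded_linear_fst open_UNIV] UNIV_I]])
      show "Ck_on k UNIV (\<lambda>p :: complex \<times> 'e. (v, snd p))"
        by (rule Ck_on_Pair[OF open_UNIV Ck_on_const Ck_on_bounded_linear[OF bounded_linear_snd open_UNIV]])
    qed
    show "Ck_on k UNIV (\<lambda>z. frechet_derivative D (at z) v + N j v (\<lambda>z. h (z, F z)) z)"
      using Suc.prems(2) Ck_on_SucD[OF Suc.prems(1)] by (intro Ck_on_add open_UNIV N_Ck hF Fk) auto
    show "h' (fst (z, x), F (fst (z, x))) (v, snd (z, x)) = 0" if "norm z > \<rho>" for z x
    proof -
      have "open {p :: complex \<times> 'e. norm (fst p) > \<rho>}"
        by (intro open_Collect_less continuous_intros)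
      then have "((\<lambda>_. 0) has_derivative h' (z, F z)) (at (z, F z))"
        by (rule has_derivative_transform_within_open[OF hd]) (use that Suc.prems(3) in auto)
      then show ?thesis using has_derivative_unique[OF has_derivative_const] by (metis (full_types) fst_conv)
    qed
    show "norm (h' (fst (z, x), F (fst (z, x))) (v, snd (z, x)) - h' (fst (z, y), F (fst (z, y))) (v, snd (z, y))) \<le> B * norm (x - y)" for z x y
    proof -
      have "norm (h' (z, F z) (0, x - y)) \<le> B * norm (0 :: complex, x - y)"
      proof (rule norm_derivative_le_Lipschitz[OF hd])
        show "norm (h ((z, F z) + t *\<^sub>R (0, x - y)) - h (z, F z)) \<le> B * norm (t *\<^sub>R (0 :: complex, x - y))" for t
          using Suc.prems(4)[of z "F z + t *\<^sub>R (x - y)" "F z"] by (simp add: norm_Pair)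
      qed
      then show ?thesis
        using linear_diff[OF has_derivative_linear[OF hd], of "(z, F z)" "(v, x)" "(v, y)"] by (simp add: norm_Pair)
    qed
    show "continuous_on UNIV (\<lambda>z. frechet_derivative F (at z) v)" by (rule C1_continuous_derivative[OF F1])
    show "frechet_derivative F (at z) v = frechet_derivative D (at z) v + N j v (\<lambda>z. h (z, F z)) z +
        L (Suc j) (\<lambda>z. h' (fst (z, frechet_derivative F (at z) v), F (fst (z, frechet_derivative F (at z) v)))
          (v, snd (z, frechet_derivative F (at z) v))) z" for z
    proof -
      have e: "frechet_derivative (\<lambda>z. h (z, F z)) (at y) v = h' (y, F y) (v, frechet_derivative F (at y) v)" for y
      proof -
        have "((\<lambda>z. (z, F z)) has_derivative (\<lambda>v. (v, frechet_derivative F (at y) v))) (at y)"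
          by (intro has_derivative_Pair has_derivative_ident Ck_on_has_derivative[OF F1]) simp
        from frechet_derivativeI[OF has_derivative_compose[OF this hd]] show ?thesis by simp
      qed
      have "((\<lambda>z. D z + L j (\<lambda>z. h (z, F z)) z) has_derivative (\<lambda>v. frechet_derivative D (at z) v +
          (L (Suc j) (\<lambda>z. frechet_derivative (\<lambda>z. h (z, F z)) (at z) v) z + N j v (\<lambda>z. h (z, F z)) z))) (at z)"
        by (intro has_derivative_add Ck_on_has_derivative[OF D1] L_deriv hF F1 h1) simp
      then have "frechet_derivative F (at z) v = frechet_derivative D (at z) v +
          (L (Suc j) (\<lambda>z. frechet_derivative (\<lambda>z. h (z, F z)) (at z) v) z + N j v (\<lambda>z. h (z, F z)) z)"
        unfolding arg_cong[where f="\<lambda>G. frechet_derivative G (at z) v", OF ext[OF Suc.prems(6)]]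
        by (simp only: frechet_derivativeI)
      then show ?thesis by (simp add: e)
    qed
  qed
  then show ?case using F1 by simp
qed

end

text \<open>For the first two components \<open>a\<close>, \<open>b\<close> of \<open>f\<close> this
  integrates the one-form \<open>a dx + b dy\<close> along the segment from \<open>0\<close> to
  \<open>z\<close> when \<open>j = 0\<close>. It is a primitive only if the form is closed.\<close>

definition ray_op :: "nat \<Rightarrow> (complex \<Rightarrow> ('u::euclidean_space \<times> 'u) \<times> 't::euclidean_space) \<Rightarrow> complex \<Rightarrow> 'u" where
  "ray_op j f z = Re z *\<^sub>R ray_int j (\<lambda>z. fst (fst (f z))) z + Im z *\<^sub>R ray_int j (\<lambda>z. snd (fst (f z))) z"

definition disc_op ::
  "real \<Rightarrow> real \<Rightarrow> nat \<Rightarrow> (complex \<Rightarrow> ('u::euclidean_space \<times> 'u) \<times> (complex ^ 'n::finite)) \<Rightarrow> complex \<Rightarrow> 'u \<times> (complex ^ 'n)" where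
  "disc_op M R j f z = (ray_op j f z, cauchy_int 0 M R (\<lambda>z. snd (f z)) z)"

text \<open>Subtracting the value at \<open>0\<close> prescribes the second component at the centre.
  Existence and smallness are obtained with this operator; regularity is obtained with
  \<open>disc_op\<close>, whose derivative has the structure required by
  \<open>smoothing_ops\<close>.\<close>

definition disc_op_normalized ::
  "real \<Rightarrow> real \<Rightarrow> (complex \<Rightarrow> ('u::euclidean_space \<times> 'u) \<times> (complex ^ 'n::finite)) \<Rightarrow> complex \<Rightarrow> 'u \<times> (complex ^ 'n)" where
  "disc_op_normalized M R f z =
     (ray_op 0 f z, cauchy_int 0 M R (\<lambda>z. snd (f z)) z - cauchy_int 0 M R (\<lambda>z. snd (f z)) 0)"

definition disc_op_commutator ::
  "real \<Rightarrow> real \<Rightarrow> nat \<Rightarrow> complex \<Rightarrow> (complex \<Rightarrow> ('u::euclidean_space \<times> 'u) \<times> (complex ^ 'n::finite)) \<Rightarrow> complex \<Rightarrow> 'u \<times> (complex ^ 'n)" where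
  "disc_op_commutator M R j v f z =
     (Re v *\<^sub>R ray_int j (\<lambda>z. fst (fst (f z))) z + Im v *\<^sub>R ray_int j (\<lambda>z. snd (fst (f z))) z,
      (of_real (M\<^sup>2) * cnj v) *s cauchy_int (Suc 0) M R (\<lambda>z. snd (f z)) z)"

context
  fixes f :: "complex \<Rightarrow> ('u::euclidean_space \<times> 'u) \<times> 't::euclidean_space"
  assumes f: "continuous_on UNIV f"
begin

lemma component_continuous:
  "continuous_on UNIV (\<lambda>z. fst (fst (f z)))" "continuous_on UNIV (\<lambda>z. snd (fst (f z)))"
  "continuous_on UNIV (\<lambda>z. snd (f z))"
  using f by (auto intro: continuous_intros)

lemma ray_op_continuous: "continuous_on UNIV (ray_op j f)"
  unfolding ray_op_def[abs_def] by (intro continuous_intros ray_int_continuous component_continuous)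

end

lemma norm_components:
  "norm (fst (fst x)) \<le> norm x" "norm (snd (fst x)) \<le> norm x" "norm (snd x) \<le> norm x"
  using norm_fst_le[of "fst x" "snd x"] norm_snd_le[of "snd x" "fst x"]
    norm_fst_le[of "fst (fst x)" "snd (fst x)"] norm_snd_le[of "snd (fst x)" "fst (fst x)"] by auto

lemma ray_op_diff:
  assumes "continuous_on UNIV f" "continuous_on UNIV g"
  shows "ray_op j (\<lambda>z. f z - g z) z = ray_op j f z - ray_op j g z"
  by (simp add: ray_op_def ray_int_diff[OF component_continuous(1)[OF assms(1)] component_continuous(1)[OF assms(2)], of j z]
    ray_int_diff[OF component_continuous(2)[OF assms(1)] component_continuous(2)[OF assms(2)], of j z] scaleR_diff_right)

lemma ray_op_bound:
  assumes f: "continuous_on UNIV f" and c: "0 \<le> c" "\<And>z. norm (f z) \<le> c * weight M z" and M: "M > 0"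
  shows "norm (ray_op j f z) \<le> 4 / M * c * weight M z"
proof -
  have "norm (Re z *\<^sub>R ray_int j (\<lambda>z. fst (fst (f z))) z) \<le> 2 / M * c * weight M z"
  proof -
    have "norm (Re z *\<^sub>R ray_int j (\<lambda>z. fst (fst (f z))) z) \<le> norm z * norm (ray_int j (\<lambda>z. fst (fst (f z))) z)"
      by (simp add: mult_right_mono abs_Re_le_cmod)
    also have "\<dots> \<le> 2 / M * c * weight M z"
      by (rule ray_int_bound[OF component_continuous(1)[OF f] _ M c(1)]) (rule order_trans[OF norm_components(1) c(2)])
    finally show ?thesis .
  qed
  moreover have "norm (Im z *\<^sub>R ray_int j (\<lambda>z. snd (fst (f z))) z) \<le> 2 / M * c * weight M z"
  proof -
    have "norm (Im z *\<^sub>R ray_int j (\<lambda>z. snd (fst (f z))) z) \<le> norm z * norm (ray_int j (\<lambda>z. snd (fst (f z))) z)"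
      by (simp add: mult_right_mono abs_Im_le_cmod)
    also have "\<dots> \<le> 2 / M * c * weight M z"
      by (rule ray_int_bound[OF component_continuous(2)[OF f] _ M c(1)]) (rule order_trans[OF norm_components(2) c(2)])
    finally show ?thesis .
  qed
  ultimately have "norm (ray_op j f z) \<le> 2 / M * c * weight M z + 2 / M * c * weight M z"
    unfolding ray_op_def by (intro order_trans[OF norm_triangle_ineq] add_mono)
  then show ?thesis by simp
qed

text \<open>The constant \<open>12\<close> is \<open>4\<close> from the two ray integrals,
  \<open>4\<close> from the Cauchy transform at \<open>z\<close> and \<open>4\<close> from its value
  at \<open>0\<close>, where the weight is smallest.\<close>

lemma disc_op_normalized_contracting:
  assumes M: "M > 0" and R: "R \<ge> 0"
  shows "contracting_op (disc_op_normalized M R :: (complex \<Rightarrow> ('u::euclidean_space \<times> 'u) \<times> (complex ^ 'n::finite)) \<Rightarrow> _) M (12 / M)"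
proof
  fix f g :: "complex \<Rightarrow> ('u \<times> 'u) \<times> (complex ^ 'n)" and c z
  assume f: "continuous_on UNIV f"
  note fc = component_continuous[OF f]
  show "continuous_on UNIV (disc_op_normalized M R f)"
    unfolding disc_op_normalized_def[abs_def]
    by (intro continuous_intros ray_op_continuous f cauchy_int_continuous fc)
  show "disc_op_normalized M R (\<lambda>z. f z - g z) z = disc_op_normalized M R f z - disc_op_normalized M R g z"
    if g: "continuous_on UNIV g"
    using cauchy_int_diff[OF fc(3) component_continuous(3)[OF g], of 0 M R z]
      cauchy_int_diff[OF fc(3) component_continuous(3)[OF g], of 0 M R 0]
    by (simp add: disc_op_normalized_def ray_op_diff[OF f g])
  assume c: "0 \<le> c" "\<And>z. norm (f z) \<le> c * weight M z"
  have T: "norm (cauchy_int 0 M R (\<lambda>z. snd (f z)) z) \<le> 4 / M * c * weight M z" for z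
    by (rule cauchy_int_bound[OF fc(3) _ M R c(1)]) (rule order_trans[OF norm_components(3) c(2)])
  have "norm (cauchy_int 0 M R (\<lambda>z. snd (f z)) 0) \<le> 4 / M * c * weight M z"
    by (rule order_trans[OF T mult_left_mono[OF weight_mono]]) (use M c in auto)
  then have "norm (cauchy_int 0 M R (\<lambda>z. snd (f z)) z - cauchy_int 0 M R (\<lambda>z. snd (f z)) 0) \<le>
      4 / M * c * weight M z + 4 / M * c * weight M z"
    by (intro order_trans[OF norm_triangle_ineq4] add_mono T)
  then have "norm (disc_op_normalized M R f z) \<le> 4 / M * c * weight M z + (4 / M * c * weight M z + 4 / M * c * weight M z)"
    unfolding disc_op_normalized_def using ray_op_bound[OF f c M, of 0 z] 
    by (intro order_trans[OF norm_Pair_le] add_mono)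
  then show "norm (disc_op_normalized M R f z) \<le> 12 / M * c * weight M z" by simp
qed (use M in simp)

lemma disc_op_smoothing:
  assumes M: "M > 0" and R: "R \<ge> 0"
  shows "smoothing_ops (disc_op M R :: nat \<Rightarrow> (complex \<Rightarrow> ('u::euclidean_space \<times> 'u) \<times> (complex ^ 'n::finite)) \<Rightarrow> _)
    (disc_op_commutator M R) M (12 / M)"
proof
  fix f g :: "complex \<Rightarrow> ('u \<times> 'u) \<times> (complex ^ 'n)" and c z j
  assume f: "continuous_on UNIV f"
  note fc = component_continuous[OF f]
  show "continuous_on UNIV (disc_op M R j f)"
    unfolding disc_op_def[abs_def]
    by (intro continuous_intros ray_op_continuous f cauchy_int_continuous fc)
  show "disc_op M R j (\<lambda>z. f z - g z) z = disc_op M R j f z - disc_op M R j g z"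
    if g: "continuous_on UNIV g"
    using cauchy_int_diff[OF fc(3) component_continuous(3)[OF g], of 0 M R z]
    by (simp add: disc_op_def ray_op_diff[OF f g])
  assume c: "0 \<le> c" "\<And>z. norm (f z) \<le> c * weight M z"
  have "norm (cauchy_int 0 M R (\<lambda>z. snd (f z)) z) \<le> 4 / M * c * weight M z"
    by (rule cauchy_int_bound[OF fc(3) _ M R c(1)]) (rule order_trans[OF norm_components(3) c(2)])
  then have "norm (disc_op M R j f z) \<le> 4 / M * c * weight M z + 4 / M * c * weight M z"
    unfolding disc_op_def using ray_op_bound[OF f c M, of j z]
    by (intro order_trans[OF norm_Pair_le] add_mono)
  \<comment> \<open>Relaxed to the constant of the normalized operator, so that one choice of
    \<open>M\<close> serves existence and regularity alike.\<close>
  also have "\<dots> \<le> 12 / M * c * weight M z"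
    using M mult_nonneg_nonneg[OF c(1) weight_pos(3)[of M z]] by (simp add: field_simps)
  finally show "norm (disc_op M R j f z) \<le> 12 / M * c * weight M z" .
next
  fix f g :: "complex \<Rightarrow> ('u \<times> 'u) \<times> (complex ^ 'n)" and j v z
  assume f: "continuous_on UNIV f" and g: "continuous_on UNIV g"
  note fc = component_continuous[OF f] and gc = component_continuous[OF g]
  show "disc_op_commutator M R j v (\<lambda>z. f z - g z) z = disc_op_commutator M R j v f z - disc_op_commutator M R j v g z"
    by (simp add: disc_op_commutator_def cauchy_int_diff[OF fc(3) gc(3), of "Suc 0" M R z] ray_int_diff[OF fc(1) gc(1), of j z]
      ray_int_diff[OF fc(2) gc(2), of j z] vector_ssub_ldistrib scaleR_diff_right)
next
  fix r j v
  obtain C where C: "C \<ge> 0" "\<And>(f :: complex \<Rightarrow> complex ^ 'n) c z. continuous_on UNIV f \<Longrightarrow> (\<And>z. norm (f z) \<le> c) \<Longrightarrow>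
      z \<in> cball 0 r \<Longrightarrow> norm (cauchy_int (Suc 0) M R f z) \<le> C * c"
    using cauchy_int_sup_bound'[where ?'n='n, of r "Suc 0" M R] by blast
  show "\<exists>C\<ge>0. \<forall>(f :: complex \<Rightarrow> ('u \<times> 'u) \<times> (complex ^ 'n)) c. continuous_on UNIV f \<longrightarrow> (\<forall>z. norm (f z) \<le> c) \<longrightarrow>
        (\<forall>z\<in>cball 0 r. norm (disc_op_commutator M R j v f z) \<le> C * c)"
  proof (intro exI[of _ "2 * norm v + norm (of_real (M\<^sup>2) * cnj v) * C"] conjI allI impI ballI)
    fix f :: "complex \<Rightarrow> ('u \<times> 'u) \<times> (complex ^ 'n)" and c :: real and z :: complex
    assume f: "continuous_on UNIV f" and c: "\<forall>z. norm (f z) \<le> c" and z: "z \<in> cball 0 r"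
    note fc = component_continuous[OF f]
    have c0: "c \<ge> 0" using c norm_ge_zero order_trans by blast
    have 1: "norm (Re v *\<^sub>R ray_int j (\<lambda>z. fst (fst (f z))) z) \<le> norm v * c"
      unfolding norm_scaleR
      by (intro mult_mono ray_int_sup_bound fc abs_Re_le_cmod order_trans[OF norm_components(1) spec[OF c]]) simp_all
    have 2: "norm (Im v *\<^sub>R ray_int j (\<lambda>z. snd (fst (f z))) z) \<le> norm v * c"
      unfolding norm_scaleR
      by (intro mult_mono ray_int_sup_bound fc abs_Im_le_cmod order_trans[OF norm_components(2) spec[OF c]]) simp_all
    have "norm (cauchy_int (Suc 0) M R (\<lambda>z. snd (f z)) z) \<le> C * c"
      by (rule C(2)[OF fc(3) _ z]) (use c order_trans[OF norm_components(3)] in blast)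
    then have 3: "norm ((of_real (M\<^sup>2) * cnj v) *s cauchy_int (Suc 0) M R (\<lambda>z. snd (f z)) z) \<le> norm (of_real (M\<^sup>2) * cnj v) * (C * c)"
      unfolding norm_vec_smult by (intro mult_left_mono) auto
    have "norm (disc_op_commutator M R j v f z) \<le> (norm v * c + norm v * c) + norm (of_real (M\<^sup>2) * cnj v) * (C * c)"
      unfolding disc_op_commutator_def
      by (rule order_trans[OF norm_Pair_le add_mono[OF order_trans[OF norm_triangle_ineq add_mono[OF 1 2]] 3]])
    then show "norm (disc_op_commutator M R j v f z) \<le> (2 * norm v + norm (of_real (M\<^sup>2) * cnj v) * C) * c"
      by (simp add: algebra_simps)
  qed (use C in simp)
next
  fix f :: "complex \<Rightarrow> ('u \<times> 'u) \<times> (complex ^ 'n)" and j z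
  assume f: "Ck_on (Suc 0) UNIV f"
  let ?f' = "\<lambda>z v. frechet_derivative f (at z) v"
  have fd: "(f has_derivative ?f' z) (at z)" for z by (rule Ck_on_has_derivative[OF f]) simp
  have C: "Ck_on (Suc 0) UNIV (\<lambda>z. fst (fst (f z)))" "Ck_on (Suc 0) UNIV (\<lambda>z. snd (fst (f z)))" "Ck_on (Suc 0) UNIV (\<lambda>z. snd (f z))"
    by (intro Ck_on_linear_comp[OF bounded_linear_fst] Ck_on_linear_comp[OF bounded_linear_snd] open_UNIV f)+
  have d: "frechet_derivative (\<lambda>z. fst (fst (f z))) (at z) v = fst (fst (?f' z v))"
    "frechet_derivative (\<lambda>z. snd (fst (f z))) (at z) v = snd (fst (?f' z v))"
    "frechet_derivative (\<lambda>z. snd (f z)) (at z) v = snd (?f' z v)" for z v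
    by (simp_all add: frechet_derivativeI[OF has_derivative_fst[OF has_derivative_fst[OF fd]]]
      frechet_derivativeI[OF has_derivative_snd[OF has_derivative_fst[OF fd]]] frechet_derivativeI[OF has_derivative_snd[OF fd]])
  have r1: "((\<lambda>z. Re z *\<^sub>R ray_int j (\<lambda>z. fst (fst (f z))) z) has_derivative
      (\<lambda>v. Re z *\<^sub>R ray_int (Suc j) (\<lambda>z. fst (fst (?f' z v))) z + Re v *\<^sub>R ray_int j (\<lambda>z. fst (fst (f z))) z)) (at z)"
    using has_derivative_scaleR[OF bounded_linear_imp_has_derivative[OF bounded_linear_Re] ray_int_has_derivative[OF C(1)]]
    by (simp only: d)
  have r2: "((\<lambda>z. Im z *\<^sub>R ray_int j (\<lambda>z. snd (fst (f z))) z) has_derivative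
      (\<lambda>v. Im z *\<^sub>R ray_int (Suc j) (\<lambda>z. snd (fst (?f' z v))) z + Im v *\<^sub>R ray_int j (\<lambda>z. snd (fst (f z))) z)) (at z)"
    using has_derivative_scaleR[OF bounded_linear_imp_has_derivative[OF bounded_linear_Im] ray_int_has_derivative[OF C(2)]]
    by (simp only: d)
  have c: "(cauchy_int 0 M R (\<lambda>z. snd (f z)) has_derivative
    (\<lambda>v. cauchy_int 0 M R (\<lambda>z. snd (?f' z v)) z +
         (of_real (M\<^sup>2) * cnj v) *s cauchy_int (Suc 0) M R (\<lambda>z. snd (f z)) z)) (at z)"
    using cauchy_int_has_derivative[OF C(3)] by (simp only: d)
  show "(disc_op M R j f has_derivative (\<lambda>v. disc_op M R (Suc j) (\<lambda>z. ?f' z v) z + disc_op_commutator M R j v f z)) (at z)"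
    using has_derivative_Pair[OF has_derivative_add[OF r1 r2] c]
    unfolding disc_op_def[abs_def] disc_op_commutator_def ray_op_def by (simp add: algebra_simps)
next
  fix f :: "complex \<Rightarrow> ('u \<times> 'u) \<times> (complex ^ 'n)" and k j v
  assume f: "Ck_on k UNIV f"
  have C: "Ck_on k UNIV (\<lambda>z. fst (fst (f z)))" "Ck_on k UNIV (\<lambda>z. snd (fst (f z)))" "Ck_on k UNIV (\<lambda>z. snd (f z))"
    by (intro Ck_on_linear_comp[OF bounded_linear_fst] Ck_on_linear_comp[OF bounded_linear_snd] open_UNIV f)+
  show "Ck_on k UNIV (disc_op M R j f)"
    unfolding disc_op_def[abs_def] ray_op_def
    by (intro Ck_on_Pair Ck_on_add Ck_on_bilinear[OF bounded_bilinear_scaleR] open_UNIV ray_int_Ck cauchy_int_Ck C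
        Ck_on_bounded_linear bounded_linear_Re bounded_linear_Im)
  show "Ck_on k UNIV (disc_op_commutator M R j v f)"
    unfolding disc_op_commutator_def[abs_def]
    by (intro Ck_on_Pair Ck_on_add Ck_on_linear_comp[OF bounded_linear_scaleR_right] Ck_on_linear_comp[OF bounded_linear_vec_smult_right]
        open_UNIV ray_int_Ck cauchy_int_Ck C)
qed (use M in simp)

section \<open>Small solutions of the coupled Cauchy-Riemann and ray system\<close>

lemma compact_support_Lipschitz:
  fixes h :: "'a::euclidean_space \<Rightarrow> 'b::real_normed_vector"
  assumes h: "Ck_on (Suc 0) UNIV h" and K: "compact K" and supp: "\<And>x. x \<notin> K \<Longrightarrow> h x = 0"
  shows "\<exists>B\<ge>0. \<forall>x y. norm (h x - h y) \<le> B * norm (x - y)"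
proof -
  define h' where "h' x = frechet_derivative h (at x)" for x
  have hd: "(h has_derivative h' x) (at x)" for x
    unfolding h'_def by (rule Ck_on_has_derivative[OF h]) simp
  have h'0: "h' x v = 0" if "x \<notin> K" for x v
  proof -
    have "open (- K)" using K by (simp add: compact_imp_closed open_Compl)
    then have "((\<lambda>_. 0) has_derivative h' x) (at x)"
      by (rule has_derivative_transform_within_open[OF hd]) (use that supp in auto)
    then show ?thesis using has_derivative_unique[OF has_derivative_const] by (metis (full_types))
  qed
  have "\<exists>C\<ge>0. \<forall>x. norm (h' x b) \<le> C" for b
  proof -
    have "compact ((\<lambda>x. h' x b) ` K)"
      unfolding h'_def by (intro compact_continuous_image continuous_on_subset[OF C1_continuous_derivative[OF h]] K) simp
    then have "\<exists>C. \<forall>y\<in>(\<lambda>x. h' x b) ` K. norm y \<le> C"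
      unfolding bounded_iff[symmetric] by (rule compact_imp_bounded)
    then obtain C where C: "\<forall>y\<in>(\<lambda>x. h' x b) ` K. norm y \<le> C" ..
    have "norm (h' x b) \<le> max C 0" for x
      using bspec[OF C imageI[of x K "\<lambda>x. h' x b"]] h'0[of x b] by (cases "x \<in> K") auto
    then show ?thesis by (intro exI[of _ "max C 0"]) auto
  qed
  then obtain C where C: "\<And>b. C b \<ge> 0" "\<And>b x. norm (h' x b) \<le> C b" by metis
  have "norm (h' x v) \<le> (\<Sum>b\<in>Basis. C b) * norm v" for x v
  proof -
    have "norm (h' x v) \<le> (\<Sum>b\<in>Basis. norm ((v \<bullet> b) *\<^sub>R h' x b))"
      unfolding linear_eq_sum_Basis[OF has_derivative_linear[OF hd], of x v] by (rule norm_sum)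
    also have "\<dots> \<le> (\<Sum>b\<in>Basis. norm v * C b)"
      unfolding norm_scaleR by (intro sum_mono mult_mono C) (auto simp: Basis_le_norm)
    finally show ?thesis by (simp add: sum_distrib_left mult.commute)
  qed
  then have "norm (h x - h y) \<le> (\<Sum>b\<in>Basis. C b) * norm (x - y)" for x y
    by (intro differentiable_bound[OF convex_UNIV, of h h'] onorm_bound)
      (use hd C in \<open>auto intro!: sum_nonneg has_derivative_at_withinI\<close>)
  then show ?thesis using C by (intro exI[of _ "\<Sum>b\<in>Basis. C b"]) (auto intro: sum_nonneg)
qed

text \<open>For \<open>x0 = 0\<close> the zero function is a solution, because
  \<open>h (z, 0) = 0\<close>; the theorem continues it to all small initial values. Compact support
  supplies a global Lipschitz constant, after which \<open>M\<close> is chosen.\<close>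

theorem cauchy_riemann_ray_system:
  fixes h :: "complex \<times> ('u::euclidean_space \<times> (complex ^ 'n::finite)) \<Rightarrow> ('u \<times> 'u) \<times> (complex ^ 'n)"
  assumes h: "smooth_on UNIV h" and h0: "\<And>z. h (z, 0) = 0"
    and supp: "\<And>z x. norm z > \<rho> \<or> norm x > s \<Longrightarrow> h (z, x) = 0"
    and \<epsilon>: "\<epsilon> > 0" and \<rho>: "\<rho> \<ge> 0"
  shows "\<exists>\<delta>>0. \<forall>x0. norm x0 < \<delta> \<longrightarrow> (\<exists>F. smooth_on UNIV F \<and> (\<forall>z\<in>cball 0 \<rho>. norm (F z) < \<epsilon>) \<and>
    (\<forall>z. fst (F z) = fst x0 + ray_op 0 (\<lambda>z. h (z, F z)) z) \<and> snd (F 0) = snd x0 \<and>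
    (\<forall>z\<in>cball 0 \<rho>. frechet_derivative (\<lambda>z. snd (F z)) (at z) 1 +
        \<i> *s frechet_derivative (\<lambda>z. snd (F z)) (at z) \<i> = 2 *\<^sub>R snd (h (z, F z))))"
proof -
  have hk: "Ck_on k UNIV h" for k by (rule smooth_onD[OF h])
  have hc: "continuous_on UNIV h" by (rule smooth_on_continuous[OF h])
  have "compact (cball (0::complex) \<rho> \<times> cball (0 :: 'u \<times> (complex ^ 'n)) s)"
    by (intro compact_Times compact_cball)
  then obtain B where B: "B \<ge> 0" "\<And>p p'. norm (h p - h p') \<le> B * norm (p - p')"
    using compact_support_Lipschitz[OF hk[of "Suc 0"], of "cball 0 \<rho> \<times> cball 0 s"] supp by force
  have lip: "norm (h (z, x) - h (z, y)) \<le> B * norm (x - y)" for z x y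
    using B(2)[of "(z, x)" "(z, y)"] by (simp add: norm_Pair)
  \<comment> \<open>Makes the contraction constant equal to \<open>B / (B + 1)\<close>.\<close>
  define M where "M = 12 * (B + 1)"
  \<comment> \<open>For \<open>norm z \<le> \<rho>\<close> the circle of radius \<open>R\<close>
    around \<open>z\<close> stays outside the support of \<open>h\<close>, as
    \<open>cauchy_int_dbar\<close> requires.\<close>
  define R where "R = 2 * \<rho> + 1"
  have M: "M > 0" and R: "R \<ge> 0" using B \<rho> by (simp_all add: M_def R_def)
  have q: "12 / M * B < 1" using B(1) by (simp add: M_def field_simps)
  interpret NL: contracting_op "disc_op_normalized M R :: (complex \<Rightarrow> ('u \<times> 'u) \<times> (complex ^ 'n)) \<Rightarrow> _" M "12 / M"
    by (rule disc_op_normalized_contracting[OF M R])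
  interpret S: smoothing_ops "disc_op M R :: nat \<Rightarrow> (complex \<Rightarrow> ('u \<times> 'u) \<times> (complex ^ 'n)) \<Rightarrow> _" "disc_op_commutator M R" M "12 / M"
    by (rule disc_op_smoothing[OF M R])
  define W where "W = weight M (of_real \<rho>)"
  \<comment> \<open>Inverts the estimate of \<open>fixpoint_bound\<close>, with the weight replaced
    by its maximum \<open>W\<close> on the disc.\<close>
  define \<delta> where "\<delta> = \<epsilon> * (1 - 12 / M * B) / W"
  have W: "W > 0" by (simp add: W_def)
  have "\<delta> > 0" using \<epsilon> q W by (simp add: \<delta>_def)
  show ?thesis
  proof (intro exI[of _ \<delta>] conjI allI impI \<open>\<delta> > 0\<close>)
    fix x0 :: "'u \<times> (complex ^ 'n)" assume x0: "norm x0 < \<delta>"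
    have supp1: "h (z, x) = 0" if "norm z > \<rho>" for z x using supp that by blast
    have "\<exists>F. continuous_on UNIV F \<and> (\<forall>z. F z = (\<lambda>_. x0) z + disc_op_normalized M R (\<lambda>z. h (z, F z)) z)"
      by (rule NL.fixpoint[OF continuous_on_const hc supp1 lip B(1) q])
    then obtain F where F: "continuous_on UNIV F" and Feq: "\<And>z. F z = x0 + disc_op_normalized M R (\<lambda>z. h (z, F z)) z"
      by blast
    have hF: "continuous_on UNIV (\<lambda>z. h (z, F z))"
      by (rule continuous_on_UNIV_comp[OF hc]) (intro continuous_intros F)
    define T where "T = cauchy_int 0 M R (\<lambda>z. snd (h (z, F z)))"
    \<comment> \<open>The normalization only moves the constant \<open>T 0\<close> into the
      inhomogeneity, which brings the equation into the form treated by the bootstrap.\<close>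
    have Feq': "F z = (x0 - (0, T 0)) + disc_op M R 0 (\<lambda>z. h (z, F z)) z" for z
      unfolding Feq[of z] disc_op_normalized_def disc_op_def T_def
      by (cases x0) simp
    have Fk: "Ck_on k UNIV F" for k
      by (rule S.solution_Ck[OF hk Ck_on_const supp1 lip B(1) q F Feq'])
    then have Fs: "smooth_on UNIV F" by (simp add: smooth_on_def)
    have bound: "norm (F z) < \<epsilon>" if z: "z \<in> cball 0 \<rho>" for z
    proof -
      have "norm (F z) \<le> norm x0 / (1 - 12 / M * B) * weight M z"
        by (rule NL.fixpoint_bound[OF F Feq hc supp1 lip B(1) q h0 order_refl z])
      also have "\<dots> \<le> norm x0 / (1 - 12 / M * B) * W"
        unfolding W_def using q z \<rho> by (intro mult_left_mono weight_mono) auto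
      also have "\<dots> < \<epsilon>" using x0 q W by (simp add: \<delta>_def field_simps)
      finally show ?thesis .
    qed
    have eq1: "fst (F z) = fst x0 + ray_op 0 (\<lambda>z. h (z, F z)) z" for z
      by (subst Feq) (simp add: disc_op_normalized_def)
    have eq2: "snd (F z) = (snd x0 - T 0) + T z" for z
      by (subst Feq') (simp add: disc_op_def T_def)
    have sh: "Ck_on k UNIV (\<lambda>z. snd (h (z, F z)))" for k
      by (rule Ck_on_linear_comp[OF bounded_linear_snd open_UNIV Ck_on_comp[OF open_UNIV open_UNIV hk
        Ck_on_Pair[OF open_UNIV Ck_on_bounded_linear[OF bounded_linear_ident open_UNIV] Fk] UNIV_I]])
    have dT: "frechet_derivative (\<lambda>z. snd (F z)) (at z) = frechet_derivative T (at z)" for z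
    proof -
      have "((\<lambda>z. (snd x0 - T 0) + T z) has_derivative frechet_derivative T (at z)) (at z)"
        using has_derivative_add[OF has_derivative_const Ck_on_has_derivative[OF cauchy_int_Ck[OF sh[of "Suc 0"]] UNIV_I]]
        unfolding T_def by simp
      then show ?thesis unfolding eq2[symmetric] by (rule frechet_derivativeI)
    qed
    have cr: "frechet_derivative (\<lambda>z. snd (F z)) (at z) 1 +
        \<i> *s frechet_derivative (\<lambda>z. snd (F z)) (at z) \<i> = 2 *\<^sub>R snd (h (z, F z))" if z: "z \<in> cball 0 \<rho>" for z
      unfolding dT unfolding T_def
    proof (rule cauchy_int_dbar[OF sh R])
      fix \<theta>
      have "R \<le> norm z + norm (z - R *\<^sub>R cis \<theta>)"
        using norm_triangle_ineq4[of z "z - R *\<^sub>R cis \<theta>"] R by simp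
      then have "norm (z - R *\<^sub>R cis \<theta>) > \<rho>" using z by (simp add: R_def)
      then show "snd (h (z - R *\<^sub>R cis \<theta>, F (z - R *\<^sub>R cis \<theta>))) = 0" by (simp add: supp1)
    qed
    show "\<exists>F. smooth_on UNIV F \<and> (\<forall>z\<in>cball 0 \<rho>. norm (F z) < \<epsilon>) \<and>
      (\<forall>z. fst (F z) = fst x0 + ray_op 0 (\<lambda>z. h (z, F z)) z) \<and> snd (F 0) = snd x0 \<and>
      (\<forall>z\<in>cball 0 \<rho>. frechet_derivative (\<lambda>z. snd (F z)) (at z) 1 +
          \<i> *s frechet_derivative (\<lambda>z. snd (F z)) (at z) \<i> = 2 *\<^sub>R snd (h (z, F z)))"
    proof (rule exI[of _ F], intro conjI)
      show "\<forall>z\<in>cball 0 \<rho>. norm (F z) < \<epsilon>" using bound by blast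
      show "\<forall>z. fst (F z) = fst x0 + ray_op 0 (\<lambda>z. h (z, F z)) z" using eq1 by blast
      show "snd (F 0) = snd x0" using eq2[of 0] by simp
      show "\<forall>z\<in>cball 0 \<rho>. frechet_derivative (\<lambda>z. snd (F z)) (at z) 1 +
          \<i> *s frechet_derivative (\<lambda>z. snd (F z)) (at z) \<i> = 2 *\<^sub>R snd (h (z, F z))" using cr by blast
    qed (rule Fs)
  qed
qed

section \<open>Second derivatives\<close>

lemma second_difference:
  fixes \<phi> :: "'a::euclidean_space \<Rightarrow> real"
  assumes \<phi>: "Ck_on (Suc (Suc 0)) (ball x r) \<phi>" and h: "0 < h" "h * (norm a + norm b) < r"
  shows "\<exists>p. norm (p - x) \<le> h * (norm a + norm b) \<and>
    \<phi> (x + h *\<^sub>R a + h *\<^sub>R b) - \<phi> (x + h *\<^sub>R a) - \<phi> (x + h *\<^sub>R b) + \<phi> x =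
    h * h * frechet_derivative (\<lambda>y. frechet_derivative \<phi> (at y) a) (at p) b"
proof -
  have nrm: "norm (s *\<^sub>R a + t *\<^sub>R b) \<le> h * (norm a + norm b)" if "0 \<le> s" "s \<le> h" "0 \<le> t" "t \<le> h" for s t
  proof -
    have "norm (s *\<^sub>R a + t *\<^sub>R b) \<le> s * norm a + t * norm b"
      using that norm_triangle_ineq[of "s *\<^sub>R a" "t *\<^sub>R b"] by simp
    also have "\<dots> \<le> h * norm a + h * norm b" using that by (intro add_mono mult_right_mono) auto
    finally show ?thesis by (simp add: distrib_left)
  qed
  have inb: "x + s *\<^sub>R a + t *\<^sub>R b \<in> ball x r" if "0 \<le> s" "s \<le> h" "0 \<le> t" "t \<le> h" for s t
  proof -
    have "dist x (x + s *\<^sub>R a + t *\<^sub>R b) = norm (s *\<^sub>R a + t *\<^sub>R b)"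
      by (simp add: dist_norm norm_minus_commute algebra_simps)
    then show ?thesis using nrm[OF that] h(2) by simp
  qed
  have line: "((\<lambda>s. f (y + s *\<^sub>R v)) has_real_derivative frechet_derivative f (at (y + s *\<^sub>R v)) v) (at s)"
    if "f differentiable (at (y + s *\<^sub>R v))" for f :: "'a \<Rightarrow> real" and y v and s :: real
  proof -
    have d: "(f has_derivative frechet_derivative f (at (y + s *\<^sub>R v))) (at (y + s *\<^sub>R v))"
      using that by (simp add: frechet_derivative_works)
    have "((\<lambda>s. f (y + s *\<^sub>R v)) has_derivative (\<lambda>t. frechet_derivative f (at (y + s *\<^sub>R v)) (t *\<^sub>R v))) (at s)"
      by (rule has_derivative_compose[of "\<lambda>s. y + s *\<^sub>R v" "\<lambda>t. t *\<^sub>R v" s UNIV f, OF _ d]) (auto intro!: derivative_eq_intros)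
    then show ?thesis
      unfolding has_field_derivative_def linear_scale[OF has_derivative_linear[OF d]] by (simp add: mult_commute_abs)
  qed
  have D1: "\<phi> differentiable (at y)" "(\<lambda>y. frechet_derivative \<phi> (at y) a) differentiable (at y)" if "y \<in> ball x r" for y
    using \<phi> that by auto
  let ?\<psi> = "\<lambda>s. \<phi> (x + h *\<^sub>R b + s *\<^sub>R a) - \<phi> (x + s *\<^sub>R a)"
  let ?\<phi>a = "\<lambda>y. frechet_derivative \<phi> (at y) a"
  have "\<exists>s>0. s < h \<and> ?\<psi> h - ?\<psi> 0 = (h - 0) * (?\<phi>a (x + h *\<^sub>R b + s *\<^sub>R a) - ?\<phi>a (x + s *\<^sub>R a))"
  proof (rule MVT2[OF h(1)])
    fix s assume s: "0 \<le> s" "s \<le> h"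
    have "x + h *\<^sub>R b + s *\<^sub>R a \<in> ball x r" "x + s *\<^sub>R a \<in> ball x r"
      using inb[of s h] inb[of s 0] s h by (simp_all add: algebra_simps)
    then show "(?\<psi> has_real_derivative ?\<phi>a (x + h *\<^sub>R b + s *\<^sub>R a) - ?\<phi>a (x + s *\<^sub>R a)) (at s)"
      by (intro DERIV_diff line D1)
  qed
  then obtain s where s: "0 < s" "s < h" and 1: "?\<psi> h - ?\<psi> 0 = h * (?\<phi>a (x + s *\<^sub>R a + h *\<^sub>R b) - ?\<phi>a (x + s *\<^sub>R a))"
    by (auto simp: algebra_simps)
  have "\<exists>t>0. t < h \<and> ?\<phi>a (x + s *\<^sub>R a + h *\<^sub>R b) - ?\<phi>a (x + s *\<^sub>R a + 0 *\<^sub>R b) =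
      (h - 0) * frechet_derivative ?\<phi>a (at (x + s *\<^sub>R a + t *\<^sub>R b)) b"
    by (rule MVT2[OF h(1)]) (use inb[of s] s in \<open>auto intro!: line D1\<close>)
  then obtain t where t: "0 < t" "t < h" and 2: "?\<phi>a (x + s *\<^sub>R a + h *\<^sub>R b) - ?\<phi>a (x + s *\<^sub>R a) =
      h * frechet_derivative ?\<phi>a (at (x + s *\<^sub>R a + t *\<^sub>R b)) b"
    by auto
  show ?thesis
  proof (intro exI[of _ "x + s *\<^sub>R a + t *\<^sub>R b"] conjI)
    show "norm (x + s *\<^sub>R a + t *\<^sub>R b - x) \<le> h * (norm a + norm b)"
      using nrm[of s t] s t by (simp add: add.assoc)
    show "\<phi> (x + h *\<^sub>R a + h *\<^sub>R b) - \<phi> (x + h *\<^sub>R a) - \<phi> (x + h *\<^sub>R b) + \<phi> x =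
      h * h * frechet_derivative ?\<phi>a (at (x + s *\<^sub>R a + t *\<^sub>R b)) b"
      using 1 unfolding 2 by (simp add: algebra_simps)
  qed
qed

text \<open>The mixed second difference is symmetric in \<open>a\<close> and \<open>b\<close>, and
  two applications of the mean value theorem express it as \<open>h * h\<close> times either mixed
  derivative at a point near \<open>x\<close>. Continuity of both then gives equality at
  \<open>x\<close>.\<close>

lemma second_derivative_symmetric_real:
  fixes \<phi> :: "'a::euclidean_space \<Rightarrow> real"
  assumes "Ck_on (Suc (Suc 0)) S \<phi>" "open S" "x \<in> S"
  shows "frechet_derivative (\<lambda>y. frechet_derivative \<phi> (at y) a) (at x) b =
    frechet_derivative (\<lambda>y. frechet_derivative \<phi> (at y) b) (at x) a" (is "?g x = ?k x")
proof -
  obtain r where r: "r > 0" "ball x r \<subseteq> S" using assms openE by blast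
  have \<phi>: "Ck_on (Suc (Suc 0)) (ball x r) \<phi>" by (rule Ck_on_subset[OF assms(1) r(2)])
  have cont: "continuous (at x) ?g" "continuous (at x) ?k"
    using \<phi> r(1) by (auto simp: continuous_on_eq_continuous_at)
  have "\<bar>?g x - ?k x\<bar> \<le> 0 + e" if e: "e > 0" for e
  proof -
    obtain d1 where d1: "d1 > 0" "\<And>y. norm (y - x) < d1 \<Longrightarrow> \<bar>?g y - ?g x\<bar> < e / 2"
      using cont(1) e unfolding continuous_at_eps_delta dist_norm real_norm_def by (meson half_gt_zero)
    obtain d2 where d2: "d2 > 0" "\<And>y. norm (y - x) < d2 \<Longrightarrow> \<bar>?k y - ?k x\<bar> < e / 2"
      using cont(2) e unfolding continuous_at_eps_delta dist_norm real_norm_def by (meson half_gt_zero)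
    define \<delta> where "\<delta> = min r (min d1 d2)"
    define h where "h = \<delta> / (norm a + norm b + 1)"
    have \<delta>: "\<delta> > 0" using r d1 d2 by (simp add: \<delta>_def)
    have n: "norm a + norm b + 1 > 0" by (smt (verit) norm_ge_zero)
    have h: "h > 0" using \<delta> n by (simp add: h_def)
    have hl: "h * (norm a + norm b) < \<delta>" using \<delta> n by (simp add: h_def field_simps)
    obtain p where p: "norm (p - x) \<le> h * (norm a + norm b)"
      "\<phi> (x + h *\<^sub>R a + h *\<^sub>R b) - \<phi> (x + h *\<^sub>R a) - \<phi> (x + h *\<^sub>R b) + \<phi> x = h * h * ?g p"
      using second_difference[OF \<phi> h, of a b] hl by (auto simp: \<delta>_def)
    obtain p' where p': "norm (p' - x) \<le> h * (norm a + norm b)"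
      "\<phi> (x + h *\<^sub>R b + h *\<^sub>R a) - \<phi> (x + h *\<^sub>R b) - \<phi> (x + h *\<^sub>R a) + \<phi> x = h * h * ?k p'"
      using second_difference[OF \<phi> h, of b a] hl by (auto simp: \<delta>_def add.commute)
    have "h * h * ?g p = h * h * ?k p'"
      unfolding p(2)[symmetric] p'(2)[symmetric] by (simp add: algebra_simps)
    then have "?g p = ?k p'" using h by simp
    moreover have "\<bar>?g p - ?g x\<bar> < e / 2" using p(1) hl by (intro d1(2)) (simp add: \<delta>_def)
    moreover have "\<bar>?k p' - ?k x\<bar> < e / 2" using p'(1) hl by (intro d2(2)) (simp add: \<delta>_def)
    ultimately show ?thesis by linarith
  qed
  then have "\<bar>?g x - ?k x\<bar> \<le> 0" by (rule field_le_epsilon)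
  then show ?thesis by simp
qed

lemma frechet_derivative_inner:
  assumes "f differentiable (at x)"
  shows "frechet_derivative (\<lambda>y. f y \<bullet> c) (at x) v = frechet_derivative f (at x) v \<bullet> c"
proof -
  have "((\<lambda>y. f y \<bullet> c) has_derivative (\<lambda>v. frechet_derivative f (at x) v \<bullet> c)) (at x)"
    using assms by (intro has_derivative_inner_left) (simp add: frechet_derivative_works)
  then show ?thesis by (simp add: frechet_derivativeI)
qed

lemma second_derivative_symmetric:
  fixes f :: "'a::euclidean_space \<Rightarrow> 'b::euclidean_space"
  assumes f: "Ck_on (Suc (Suc 0)) S f" and S: "open S" "x \<in> S"
  shows "frechet_derivative (\<lambda>y. frechet_derivative f (at y) a) (at x) b =
    frechet_derivative (\<lambda>y. frechet_derivative f (at y) b) (at x) a"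
proof (rule euclidean_eqI)
  fix c :: 'b
  have d: "f differentiable (at y)" "(\<lambda>y. frechet_derivative f (at y) v) differentiable (at y)" if "y \<in> S" for y v
    using f that by auto
  have e: "frechet_derivative (\<lambda>y. frechet_derivative (\<lambda>y. f y \<bullet> c) (at y) v) (at x) w =
      frechet_derivative (\<lambda>y. frechet_derivative f (at y) v) (at x) w \<bullet> c" for v w
  proof -
    have "frechet_derivative (\<lambda>y. frechet_derivative (\<lambda>y. f y \<bullet> c) (at y) v) (at x) =
        frechet_derivative (\<lambda>y. frechet_derivative f (at y) v \<bullet> c) (at x)"
    proof (rule frechet_derivative_transform_within_open[OF _ S])
      show "(\<lambda>y. frechet_derivative (\<lambda>y. f y \<bullet> c) (at y) v) differentiable (at x)"
        using Ck_on_linear_comp[OF bounded_linear_inner_left S(1) f, of c] S(2) by auto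
    qed (simp add: frechet_derivative_inner d)
    then show ?thesis using frechet_derivative_inner[OF d(2)[OF S(2)]] by simp
  qed
  show "frechet_derivative (\<lambda>y. frechet_derivative f (at y) a) (at x) b \<bullet> c =
      frechet_derivative (\<lambda>y. frechet_derivative f (at y) b) (at x) a \<bullet> c"
    unfolding e[symmetric]
    by (rule second_derivative_symmetric_real[OF Ck_on_linear_comp[OF bounded_linear_inner_left S(1) f] S])
qed

text \<open>A product rule in which both the base point and the vector vary. Over
  \<open>Basis\<close> it is the rule for scalar times vector; reassembling the sum turns the
  derivatives in basis directions into one in direction \<open>w x\<close>, held fixed.\<close>

lemma frechet_apply_has_derivative:
  fixes f :: "'b::euclidean_space \<Rightarrow> 'c::real_normed_vector" and g w :: "'a::euclidean_space \<Rightarrow> 'b"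
  assumes f: "Ck_on (Suc (Suc 0)) T f" "open T" and gT: "\<And>y. y \<in> S \<Longrightarrow> g y \<in> T" and S: "open S" "x \<in> S"
    and g: "(g has_derivative g') (at x)" and w: "(w has_derivative w') (at x)"
  shows "((\<lambda>x. frechet_derivative f (at (g x)) (w x)) has_derivative
    (\<lambda>h. frechet_derivative (\<lambda>y. frechet_derivative f (at y) (w x)) (at (g x)) (g' h) +
         frechet_derivative f (at (g x)) (w' h))) (at x)"
proof -
  let ?f' = "\<lambda>y. frechet_derivative f (at y)"
  let ?f'' = "\<lambda>y b. frechet_derivative (\<lambda>y. ?f' y b) (at y)"
  have lin: "linear (?f' y)" if "y \<in> T" for y
    using has_derivative_linear[OF Ck_on_has_derivative[OF f(1) that]] .
  have d2: "((\<lambda>y. ?f' y b) has_derivative ?f'' y b) (at y)" if "y \<in> T" for y b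
    using f that by (auto simp: frechet_derivative_works)
  have *: "((\<lambda>x. \<Sum>b\<in>Basis. (w x \<bullet> b) *\<^sub>R ?f' (g x) b) has_derivative
      (\<lambda>h. \<Sum>b\<in>Basis. (w x \<bullet> b) *\<^sub>R ?f'' (g x) b (g' h) + (w' h \<bullet> b) *\<^sub>R ?f' (g x) b)) (at x)"
    by (intro has_derivative_sum has_derivative_scaleR has_derivative_inner_left w
        has_derivative_compose[OF g d2] gT S)
  have "((\<lambda>x. ?f' (g x) (w x)) has_derivative
      (\<lambda>h. \<Sum>b\<in>Basis. (w x \<bullet> b) *\<^sub>R ?f'' (g x) b (g' h) + (w' h \<bullet> b) *\<^sub>R ?f' (g x) b)) (at x)"
    by (rule has_derivative_transform_within_open[OF * S]) (simp add: linear_eq_sum_Basis[OF lin[OF gT], symmetric])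
  moreover have "(\<Sum>b\<in>Basis. (w x \<bullet> b) *\<^sub>R ?f'' (g x) b (g' h) + (w' h \<bullet> b) *\<^sub>R ?f' (g x) b) =
      ?f'' (g x) (w x) (g' h) + ?f' (g x) (w' h)" for h
  proof -
    have gx: "g x \<in> T" using gT S by blast
    have "((\<lambda>y. \<Sum>b\<in>Basis. (w x \<bullet> b) *\<^sub>R ?f' y b) has_derivative (\<lambda>h. \<Sum>b\<in>Basis. (w x \<bullet> b) *\<^sub>R ?f'' (g x) b h)) (at (g x))"
      by (intro has_derivative_sum has_derivative_scaleR_right d2 gx)
    then have "((\<lambda>y. ?f' y (w x)) has_derivative (\<lambda>h. \<Sum>b\<in>Basis. (w x \<bullet> b) *\<^sub>R ?f'' (g x) b h)) (at (g x))"
      by (rule has_derivative_transform_within_open[OF _ f(2) gx]) (simp add: linear_eq_sum_Basis[OF lin, symmetric])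
    then show ?thesis
      by (simp add: frechet_derivativeI sum.distrib linear_eq_sum_Basis[OF lin[OF gx], of "w' h", symmetric])
  qed
  ultimately show ?thesis by simp
qed

section \<open>Metrics on open subsets of Euclidean space\<close>

definition posdef :: "real^'n^'n \<Rightarrow> bool" where
  "posdef A \<longleftrightarrow> (\<forall>i j. A $ i $ j = A $ j $ i) \<and> (\<forall>v. v \<noteq> 0 \<longrightarrow> 0 < v \<bullet> (A *v v))"

lemma posdef_sym: "posdef A \<Longrightarrow> v \<bullet> (A *v w) = w \<bullet> (A *v v)"
proof -
  assume "posdef A"
  then have "transpose A = A" by (simp add: posdef_def transpose_def vec_eq_iff)
  then show ?thesis by (metis dot_lmul_matrix inner_commute transpose_matrix_vector)
qed

lemma posdef_pos: "posdef A \<Longrightarrow> v \<noteq> 0 \<Longrightarrow> 0 < v \<bullet> (A *v v)"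
  by (simp add: posdef_def)

lemma posdef_cancel:
  fixes A :: "real^'n^'n"
  assumes A: "posdef A" and eq: "\<And>l. l \<bullet> (A *v v) = l \<bullet> (A *v w)"
  shows "v = w"
proof (rule ccontr)
  assume "v \<noteq> w"
  then have "0 < (v - w) \<bullet> (A *v (v - w))" by (intro posdef_pos[OF A]) simp
  then show False using eq[of "v - w"] by (simp add: matrix_vector_mult_diff_distrib inner_diff_right)
qed

lemma posdef_invertible:
  fixes A :: "real^'n^'n"
  assumes "posdef A" shows "invertible A"
proof -
  have "v = 0" if "A *v v = 0" for v
    using posdef_pos[OF assms, of v] that by fastforce
  then have "\<exists>B. B ** A = mat 1" using matrix_left_invertible_ker by blast
  then show ?thesis using invertible_left_inverse by blast
qed

definition metric_deriv :: "(real^'n \<Rightarrow> real^'n^'n) \<Rightarrow> real^'n \<Rightarrow> 'n \<Rightarrow> 'n \<Rightarrow> 'n \<Rightarrow> real" where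
  "metric_deriv G x k i j = frechet_derivative (\<lambda>y. G y $ i $ j) (at x) (axis k 1)"

definition christoffel_sym :: "(real^'n \<Rightarrow> real^'n^'n) \<Rightarrow> real^'n \<Rightarrow> 'n \<Rightarrow> 'n \<Rightarrow> 'n \<Rightarrow> real" where
  "christoffel_sym G x i j k = (\<Sum>l\<in>UNIV. matrix_inv (G x) $ i $ l *
     (metric_deriv G x j k l + metric_deriv G x k j l - metric_deriv G x l j k)) / 2"

text \<open>The vector \<open>\<Gamma>(a, a)\<close>. Polarization is avoided: for
  \<open>w = a + \<i> b\<close> symmetry gives
  \<open>\<Gamma>(w, cnj w) = \<Gamma>(a, a) + \<Gamma>(b, b)\<close>.\<close>

definition christoffel_quad :: "(real^'n \<Rightarrow> real^'n^'n) \<Rightarrow> real^'n \<Rightarrow> real^'n \<Rightarrow> real^'n" where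
  "christoffel_quad G x a = (\<chi> i. \<Sum>j\<in>UNIV. \<Sum>k\<in>UNIV. christoffel_sym G x i j k * a $ j * a $ k)"

lemma metric_deriv_eq:
  assumes "(G has_derivative G') (at x)"
  shows "metric_deriv G x k i j = G' (axis k 1) $ i $ j"
proof -
  have "((\<lambda>y. G y $ i $ j) has_derivative (\<lambda>h. G' h $ i $ j)) (at x)"
    using bounded_linear.has_derivative[OF bounded_linear_vec_nth bounded_linear.has_derivative[OF bounded_linear_vec_nth assms]] .
  then show ?thesis unfolding metric_deriv_def by (simp add: frechet_derivativeI)
qed

lemma linear_axis_sum:
  fixes L :: "real^'n \<Rightarrow> 'b::real_vector"
  assumes "linear L" shows "L a = (\<Sum>k\<in>UNIV. (a $ k) *\<^sub>R L (axis k 1))"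
proof -
  have "L a = L (\<Sum>k\<in>UNIV. (a $ k) *\<^sub>R axis k 1)"
    using basis_expansion[of a] by (simp add: scalar_mult_eq_scaleR)
  then show ?thesis using assms by (simp add: linear_sum linear_scale)
qed

text \<open>Lowering the index cancels the inverse matrix and leaves first derivatives of the metric
  only. The transformation law and the analysis of the defects use the Christoffel symbols through
  this formula.\<close>

lemma koszul:
  fixes G :: "real^'n \<Rightarrow> real^'n^'n"
  assumes d: "(G has_derivative G') (at x)" and inv: "invertible (G x)"
  shows "2 * (l \<bullet> (G x *v christoffel_quad G x a)) = 2 * (a \<bullet> (G' a *v l)) - a \<bullet> (G' l *v a)"
proof -
  define D where "D k = G' (axis k 1)" for k
  define K :: "real^'n" where "K = (\<chi> p. \<Sum>j\<in>UNIV. \<Sum>k\<in>UNIV. (D j $ k $ p + D k $ j $ p - D p $ j $ k) * a $ j * a $ k / 2)"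
  have lin: "linear G'" by (rule has_derivative_linear[OF d])
  have comp: "G' h $ i $ j = (\<Sum>k\<in>UNIV. h $ k * D k $ i $ j)" for h i j
    using arg_cong[OF linear_axis_sum[OF lin, of h], of "\<lambda>A. A $ i $ j"] by (simp add: D_def)
  have q: "christoffel_sym G x i j k * a $ j * a $ k = (\<Sum>l\<in>UNIV. matrix_inv (G x) $ i $ l *
      ((D j $ k $ l + D k $ j $ l - D l $ j $ k) * a $ j * a $ k / 2))" for i j k
    unfolding christoffel_sym_def metric_deriv_eq[OF d, folded D_def] sum_divide_distrib sum_distrib_right
    by (intro sum.cong refl) simp
  have "christoffel_quad G x a $ i = (matrix_inv (G x) *v K) $ i" for i
  proof -
    have "christoffel_quad G x a $ i = (\<Sum>j\<in>UNIV. \<Sum>k\<in>UNIV. \<Sum>l\<in>UNIV. matrix_inv (G x) $ i $ l *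
        ((D j $ k $ l + D k $ j $ l - D l $ j $ k) * a $ j * a $ k / 2))"
      unfolding christoffel_quad_def vec_lambda_beta q ..
    also have "\<dots> = (\<Sum>j\<in>UNIV. \<Sum>l\<in>UNIV. \<Sum>k\<in>UNIV. matrix_inv (G x) $ i $ l * ((D j $ k $ l + D k $ j $ l - D l $ j $ k) * a $ j * a $ k / 2))"
      by (intro sum.cong refl sum.swap)
    also have "\<dots> = (\<Sum>l\<in>UNIV. \<Sum>j\<in>UNIV. \<Sum>k\<in>UNIV. matrix_inv (G x) $ i $ l * ((D j $ k $ l + D k $ j $ l - D l $ j $ k) * a $ j * a $ k / 2))"
      by (rule sum.swap)
    also have "\<dots> = (matrix_inv (G x) *v K) $ i"
      unfolding K_def matrix_vector_mult_def vec_lambda_beta sum_distrib_left ..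
    finally show ?thesis .
  qed
  then have "christoffel_quad G x a = matrix_inv (G x) *v K" by (intro vec_eq_iff[THEN iffD2] allI)
  then have "G x *v christoffel_quad G x a = K"
    by (simp add: matrix_vector_mul_assoc matrix_inv_right[OF inv])
  moreover have "2 * (l \<bullet> K) = 2 * (a \<bullet> (G' a *v l)) - a \<bullet> (G' l *v a)"
  proof -
    have e1: "a \<bullet> (G' a *v l) = (\<Sum>p\<in>UNIV. \<Sum>j\<in>UNIV. \<Sum>k\<in>UNIV. l $ p * (D j $ k $ p * a $ j * a $ k))"
    proof -
      have "a \<bullet> (G' a *v l) = (\<Sum>k\<in>UNIV. \<Sum>p\<in>UNIV. \<Sum>j\<in>UNIV. l $ p * (D j $ k $ p * a $ j * a $ k))"
        unfolding inner_vec_def matrix_vector_mult_def comp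
        by (simp add: sum_distrib_left sum_distrib_right mult_ac)
      also have "\<dots> = (\<Sum>p\<in>UNIV. \<Sum>k\<in>UNIV. \<Sum>j\<in>UNIV. l $ p * (D j $ k $ p * a $ j * a $ k))"
        by (rule sum.swap)
      also have "\<dots> = (\<Sum>p\<in>UNIV. \<Sum>j\<in>UNIV. \<Sum>k\<in>UNIV. l $ p * (D j $ k $ p * a $ j * a $ k))"
        by (intro sum.cong refl sum.swap)
      finally show ?thesis .
    qed
    have e2: "a \<bullet> (G' a *v l) = (\<Sum>p\<in>UNIV. \<Sum>j\<in>UNIV. \<Sum>k\<in>UNIV. l $ p * (D k $ j $ p * a $ j * a $ k))"
    proof -
      have "(\<Sum>j\<in>UNIV. \<Sum>k\<in>UNIV. l $ p * (D j $ k $ p * a $ j * a $ k)) =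
          (\<Sum>k\<in>UNIV. \<Sum>j\<in>UNIV. l $ p * (D j $ k $ p * a $ j * a $ k))" for p by (rule sum.swap)
      then show ?thesis unfolding e1 by (simp add: mult_ac)
    qed
    have e3: "a \<bullet> (G' l *v a) = (\<Sum>p\<in>UNIV. \<Sum>j\<in>UNIV. \<Sum>k\<in>UNIV. l $ p * (D p $ j $ k * a $ j * a $ k))"
    proof -
      have "a \<bullet> (G' l *v a) = (\<Sum>j\<in>UNIV. \<Sum>k\<in>UNIV. \<Sum>p\<in>UNIV. l $ p * (D p $ j $ k * a $ j * a $ k))"
        unfolding inner_vec_def matrix_vector_mult_def comp
        by (simp add: sum_distrib_left sum_distrib_right mult_ac)
      also have "\<dots> = (\<Sum>j\<in>UNIV. \<Sum>p\<in>UNIV. \<Sum>k\<in>UNIV. l $ p * (D p $ j $ k * a $ j * a $ k))"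
        by (intro sum.cong refl sum.swap)
      also have "\<dots> = (\<Sum>p\<in>UNIV. \<Sum>j\<in>UNIV. \<Sum>k\<in>UNIV. l $ p * (D p $ j $ k * a $ j * a $ k))"
        by (rule sum.swap)
      finally show ?thesis .
    qed
    have "2 * (l \<bullet> K) = (\<Sum>p\<in>UNIV. \<Sum>j\<in>UNIV. \<Sum>k\<in>UNIV.
        l $ p * (D j $ k $ p * a $ j * a $ k) + l $ p * (D k $ j $ p * a $ j * a $ k) - l $ p * (D p $ j $ k * a $ j * a $ k))"
      unfolding inner_vec_def K_def vec_lambda_beta
      by (simp add: sum_distrib_left sum_divide_distrib[symmetric] algebra_simps)
    also have "\<dots> = a \<bullet> (G' a *v l) + a \<bullet> (G' a *v l) - a \<bullet> (G' l *v a)"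
      unfolding sum.distrib sum_subtractf e1[symmetric] e2[symmetric] e3[symmetric] ..
    finally show ?thesis by simp
  qed
  ultimately show ?thesis by simp
qed

lemma bounded_bilinear_matrix_vector: "bounded_bilinear ((*v) :: real^'n^'m \<Rightarrow> real^'n \<Rightarrow> real^'m)"
  unfolding bilinear_conv_bounded_bilinear[symmetric] bilinear_def
  by (auto simp: linear_iff matrix_vector_right_distrib matrix_vector_mult_add_rdistrib
      matrix_vector_mult_scaleR scaleR_matrix_vector_assoc)

text \<open>The transformation law of the Christoffel symbols. Differentiating the pullback relation
  and inserting it into \<open>koszul\<close> on both sides leaves one term with second derivatives
  of \<open>\<Phi>\<close>. The test vector \<open>D l\<close> is arbitrary because \<open>D\<close>
  is surjective, and it is cancelled by nondegeneracy.\<close>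

lemma christoffel_quad_pullback:
  fixes \<Phi> :: "real^'n \<Rightarrow> real^'n"
  assumes \<Phi>: "Ck_on (Suc (Suc 0)) T \<Phi>" "open T" "x \<in> T"
    and g: "(g has_derivative g') (at (\<Phi> x))" and G: "(G has_derivative G') (at x)"
    and pos: "posdef (G x)" "posdef (g (\<Phi> x))"
    and eq: "\<And>y a b. y \<in> T \<Longrightarrow> a \<bullet> (G y *v b) =
      frechet_derivative \<Phi> (at y) a \<bullet> (g (\<Phi> y) *v frechet_derivative \<Phi> (at y) b)"
  shows "frechet_derivative \<Phi> (at x) (christoffel_quad G x a) =
    christoffel_quad g (\<Phi> x) (frechet_derivative \<Phi> (at x) a) +
    frechet_derivative (\<lambda>y. frechet_derivative \<Phi> (at y) a) (at x) a"
proof -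
  define D where "D = frechet_derivative \<Phi> (at x)"
  define H where "H h b = frechet_derivative (\<lambda>y. frechet_derivative \<Phi> (at y) b) (at x) h" for h b
  define m where "m = g (\<Phi> x)"
  have Dd: "(\<Phi> has_derivative D) (at x)" unfolding D_def by (rule Ck_on_has_derivative[OF \<Phi>(1,3)])
  have linD: "linear D" by (rule has_derivative_linear[OF Dd])
  have Hd: "((\<lambda>y. frechet_derivative \<Phi> (at y) b) has_derivative (\<lambda>h. H h b)) (at x)" for b
    unfolding H_def using \<Phi> by (auto simp: frechet_derivative_works)
  have Hsym: "H h b = H b h" for h b unfolding H_def by (rule second_derivative_symmetric[OF \<Phi>])
  have eqx: "b \<bullet> (G x *v c) = D b \<bullet> (m *v D c)" for b c unfolding D_def m_def by (rule eq[OF \<Phi>(3)])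
  have sym: "v \<bullet> (m *v w) = w \<bullet> (m *v v)" for v w using posdef_sym[OF pos(2)] by (simp add: m_def)
  have DG: "b \<bullet> (G' h *v c) = H h b \<bullet> (m *v D c) + D b \<bullet> (g' (D h) *v D c) + D b \<bullet> (m *v H h c)" for b c h
  proof -
    have "((\<lambda>y. b \<bullet> (G y *v c)) has_derivative (\<lambda>h. b \<bullet> (G' h *v c))) (at x)"
      by (intro has_derivative_inner_right bounded_linear.has_derivative[OF bounded_bilinear.bounded_linear_left[OF bounded_bilinear_matrix_vector]] G)
    moreover have "((\<lambda>y. b \<bullet> (G y *v c)) has_derivative
        (\<lambda>h. D b \<bullet> (m *v H h c + g' (D h) *v D c) + H h b \<bullet> (m *v D c))) (at x)"
    proof (rule has_derivative_transform_within_open[OF _ \<Phi>(2,3) eq[symmetric]])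
      show "((\<lambda>y. frechet_derivative \<Phi> (at y) b \<bullet> (g (\<Phi> y) *v frechet_derivative \<Phi> (at y) c)) has_derivative
          (\<lambda>h. D b \<bullet> (m *v H h c + g' (D h) *v D c) + H h b \<bullet> (m *v D c))) (at x)"
        unfolding D_def m_def
        by (rule has_derivative_inner[OF Hd bounded_bilinear.FDERIV[OF bounded_bilinear_matrix_vector has_derivative_compose[OF Dd g] Hd], unfolded D_def])
    qed
    ultimately have "(\<lambda>h. b \<bullet> (G' h *v c)) = (\<lambda>h. D b \<bullet> (m *v H h c + g' (D h) *v D c) + H h b \<bullet> (m *v D c))"
      by (rule has_derivative_unique)
    from fun_cong[OF this, of h] show ?thesis by (simp add: inner_add_right)
  qed
  have inj: "inj D"
  proof -
    have "v = 0" if "D v = 0" for v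
      using posdef_pos[OF pos(1), of v] that eqx[of v v] by fastforce
    then show ?thesis using linD by (simp add: linear_injective_0)
  qed
  have surj: "surj D" by (rule linear_inj_imp_surj[OF linD inj])
  have "D l \<bullet> (m *v D (christoffel_quad G x a)) = D l \<bullet> (m *v (christoffel_quad g (\<Phi> x) (D a) + H a a))" for l
  proof -
    have "2 * (D l \<bullet> (m *v D (christoffel_quad G x a))) = 2 * (a \<bullet> (G' a *v l)) - a \<bullet> (G' l *v a)"
      using koszul[OF G posdef_invertible[OF pos(1)], of l a] by (simp add: eqx)
    \<comment> \<open>The second derivatives \<open>H a l\<close> and \<open>H l a\<close> agree and
      drop out in this combination; only \<open>H a a\<close> survives.\<close>
    also have "\<dots> = 2 * (D a \<bullet> (g' (D a) *v D l)) - D a \<bullet> (g' (D l) *v D a) + 2 * (D l \<bullet> (m *v H a a))"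
      unfolding DG using Hsym[of l a] sym[of "H a l" "D a"] sym[of "H a a" "D l"] by simp
    also have "\<dots> = 2 * (D l \<bullet> (m *v christoffel_quad g (\<Phi> x) (D a))) + 2 * (D l \<bullet> (m *v H a a))"
      using koszul[OF g posdef_invertible[OF pos(2)], of "D l" "D a"] by (simp add: m_def)
    finally show ?thesis by (simp add: matrix_vector_right_distrib inner_add_right)
  qed
  then have "D (christoffel_quad G x a) = christoffel_quad g (\<Phi> x) (D a) + H a a"
    using posdef_cancel[of m] pos(2) surj unfolding m_def by (metis surjD)
  then show ?thesis unfolding D_def H_def .
qed

text \<open>The tension field in coordinates: the Laplacian of \<open>v\<close> plus the Christoffel
  terms of its two partial derivatives. It is four times the left-hand side of the harmonic map
  equation.\<close>

definition tension :: "(real^'n \<Rightarrow> real^'n^'n) \<Rightarrow> (complex \<Rightarrow> real^'n) \<Rightarrow> complex \<Rightarrow> real^'n" where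
  "tension G v z =
     frechet_derivative (\<lambda>z. frechet_derivative v (at z) 1) (at z) 1 +
     frechet_derivative (\<lambda>z. frechet_derivative v (at z) \<i>) (at z) \<i> +
     christoffel_quad G (v z) (frechet_derivative v (at z) 1) +
     christoffel_quad G (v z) (frechet_derivative v (at z) \<i>)"

lemma frechet_comp:
  assumes "f differentiable (at (g x))" "g differentiable (at x)"
  shows "frechet_derivative (\<lambda>x. f (g x)) (at x) v = frechet_derivative f (at (g x)) (frechet_derivative g (at x) v)"
  using frechet_derivative_compose[OF assms(2,1)] by (simp add: o_def fun_eq_iff)

text \<open>The chain rule produces the second derivative of \<open>\<Phi>\<close> in the directions
  of both partial derivatives. This is exactly the inhomogeneous term in the transformation law of
  the Christoffel symbols, so the tension transforms like a vector.\<close>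

lemma tension_comp:
  fixes \<Phi> :: "real^'n \<Rightarrow> real^'n"
  assumes \<Phi>: "Ck_on (Suc (Suc 0)) T \<Phi>" "open T" and v: "Ck_on (Suc (Suc 0)) S v" "open S" "z \<in> S"
    and vT: "\<And>z. z \<in> S \<Longrightarrow> v z \<in> T"
    and g: "g differentiable (at (\<Phi> (v z)))" and G: "G differentiable (at (v z))"
    and pos: "posdef (G (v z))" "posdef (g (\<Phi> (v z)))"
    and eq: "\<And>y a b. y \<in> T \<Longrightarrow> a \<bullet> (G y *v b) =
      frechet_derivative \<Phi> (at y) a \<bullet> (g (\<Phi> y) *v frechet_derivative \<Phi> (at y) b)"
  shows "tension g (\<lambda>z. \<Phi> (v z)) z = frechet_derivative \<Phi> (at (v z)) (tension G v z)"
proof -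
  let ?D = "\<lambda>y. frechet_derivative \<Phi> (at y)" and ?v = "\<lambda>z. frechet_derivative v (at z)"
  have vz: "v z \<in> T" by (rule vT[OF v(3)])
  have linD: "linear (?D (v z))" by (rule has_derivative_linear[OF Ck_on_has_derivative[OF \<Phi>(1) vz]])
  have d1: "frechet_derivative (\<lambda>z. \<Phi> (v z)) (at y) e = ?D (v y) (?v y e)" if "y \<in> S" for y e
    by (rule frechet_comp) (use \<Phi> v vT[OF that] that in auto)
  have d2: "frechet_derivative (\<lambda>y. frechet_derivative (\<lambda>z. \<Phi> (v z)) (at y) e) (at z) e =
      frechet_derivative (\<lambda>y. ?D y (?v z e)) (at (v z)) (?v z e) + ?D (v z) (frechet_derivative (\<lambda>y. ?v y e) (at z) e)" for e
  proof -
    have "((\<lambda>y. ?D (v y) (?v y e)) has_derivative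
      (\<lambda>h. frechet_derivative (\<lambda>y. ?D y (?v z e)) (at (v z)) (?v z h) + ?D (v z) (frechet_derivative (\<lambda>y. ?v y e) (at z) h))) (at z)"
      by (rule frechet_apply_has_derivative[OF \<Phi> vT v(2,3)]) (use v in \<open>auto simp: frechet_derivative_works[symmetric]\<close>)
    then have "((\<lambda>y. frechet_derivative (\<lambda>z. \<Phi> (v z)) (at y) e) has_derivative
      (\<lambda>h. frechet_derivative (\<lambda>y. ?D y (?v z e)) (at (v z)) (?v z h) + ?D (v z) (frechet_derivative (\<lambda>y. ?v y e) (at z) h))) (at z)"
      by (rule has_derivative_transform_within_open[OF _ v(2,3)]) (simp add: d1)
    then show ?thesis by (simp add: frechet_derivativeI)
  qed
  have q: "?D (v z) (christoffel_quad G (v z) a) = christoffel_quad g (\<Phi> (v z)) (?D (v z) a) +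
      frechet_derivative (\<lambda>y. ?D y a) (at (v z)) a" for a
    by (rule christoffel_quad_pullback[OF \<Phi> vz _ _ pos eq]) (use g G in \<open>auto simp: frechet_derivative_works\<close>)
  show ?thesis
    unfolding tension_def d2 d1[OF v(3)] linear_add[OF linD] q by simp
qed

lemma christoffel_sym_commute:
  assumes "open T" "x \<in> T" "\<And>y. y \<in> T \<Longrightarrow> posdef (G y)"
  shows "christoffel_sym G x i j k = christoffel_sym G x i k j"
proof -
  have "metric_deriv G x l j k = metric_deriv G x l k j" for l j k
  proof -
    have d: "((\<lambda>y. G y $ j $ k) has_derivative D) (at x) \<longleftrightarrow> ((\<lambda>y. G y $ k $ j) has_derivative D) (at x)" for D
      using assms has_derivative_transform_within_open[OF _ assms(1,2)] unfolding posdef_def by (smt (verit))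
    show ?thesis unfolding metric_deriv_def frechet_derivative_def d ..
  qed
  then show ?thesis unfolding christoffel_sym_def by (intro arg_cong2[where f="(/)"] sum.cong refl) (simp add: add.commute)
qed

text \<open>The imaginary part vanishes for two reasons of symmetry: mixed second derivatives
  commute, and the Christoffel symbols are symmetric in the lower indices.\<close>

lemma harmonic_expression:
  fixes v :: "complex \<Rightarrow> real^'n"
  assumes v: "Ck_on (Suc (Suc 0)) S v" "open S" "z \<in> S"
    and sym: "\<And>j k. christoffel_sym G (v z) i j k = christoffel_sym G (v z) i k j"
  shows "d_dz (d_dzbar (\<lambda>z. complex_of_real (v z $ i))) z +
      (\<Sum>j\<in>UNIV. \<Sum>k\<in>UNIV. complex_of_real (christoffel_sym G (v z) i j k) *
        d_dz (\<lambda>z. complex_of_real (v z $ j)) z * d_dzbar (\<lambda>z. complex_of_real (v z $ k)) z) =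
    complex_of_real (tension G v z $ i) / 4"
proof -
  let ?v = "\<lambda>z. frechet_derivative v (at z)"
  let ?w = "\<lambda>e h. frechet_derivative (\<lambda>z. ?v z e) (at z) h"
  have c: "frechet_derivative (\<lambda>z. complex_of_real (v z $ j)) (at y) e = of_real (?v y e $ j)" if "y \<in> S" for y e j
  proof -
    have "((\<lambda>z. complex_of_real (v z $ j)) has_derivative (\<lambda>e. of_real (?v y e $ j))) (at y)"
      by (intro bounded_linear.has_derivative[OF bounded_linear_of_real] bounded_linear.has_derivative[OF bounded_linear_vec_nth]
          Ck_on_has_derivative[OF v(1) that])
    then show ?thesis by (simp add: frechet_derivativeI)
  qed
  have z1: "d_dz (\<lambda>z. complex_of_real (v z $ j)) y = (of_real (?v y 1 $ j) - \<i> * of_real (?v y \<i> $ j)) / 2" if "y \<in> S" for y j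
    unfolding d_dz_def c[OF that] ..
  have z2: "d_dzbar (\<lambda>z. complex_of_real (v z $ j)) y = (of_real (?v y 1 $ j) + \<i> * of_real (?v y \<i> $ j)) / 2" if "y \<in> S" for y j
    unfolding d_dzbar_def c[OF that] ..
  have wd: "((\<lambda>z. ?v z e) has_derivative ?w e) (at z)" for e
    using v by (auto simp: frechet_derivative_works)
  have "((\<lambda>y. d_dzbar (\<lambda>z. complex_of_real (v z $ i)) y) has_derivative
      (\<lambda>h. (of_real (?w 1 h $ i) + \<i> * of_real (?w \<i> h $ i)) / 2)) (at z)"
  proof (rule has_derivative_transform_within_open[OF _ v(2,3) z2[symmetric]])
    show "((\<lambda>y. (complex_of_real (?v y 1 $ i) + \<i> * of_real (?v y \<i> $ i)) / 2) has_derivative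
      (\<lambda>h. (of_real (?w 1 h $ i) + \<i> * of_real (?w \<i> h $ i)) / 2)) (at z)"
      by (intro bounded_linear.has_derivative[OF bounded_linear_divide] has_derivative_add has_derivative_mult_right bounded_linear.has_derivative[OF bounded_linear_of_real]
          bounded_linear.has_derivative[OF bounded_linear_vec_nth] wd)
  qed
  then have zz: "d_dz (d_dzbar (\<lambda>z. complex_of_real (v z $ i))) z =
      ((of_real (?w 1 1 $ i) + \<i> * of_real (?w \<i> 1 $ i)) / 2 - \<i> * ((of_real (?w 1 \<i> $ i) + \<i> * of_real (?w \<i> \<i> $ i)) / 2)) / 2"
    unfolding d_dz_def[of "d_dzbar _"] by (simp add: frechet_derivativeI)
  have "?w \<i> 1 = ?w 1 \<i>" by (rule second_derivative_symmetric[OF v])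
  then have zz': "d_dz (d_dzbar (\<lambda>z. complex_of_real (v z $ i))) z = of_real ((?w 1 1 + ?w \<i> \<i>) $ i) / 4"
    unfolding zz by (simp add: field_simps)
  let ?\<Gamma> = "christoffel_sym G (v z) i" and ?a = "?v z 1" and ?b = "?v z \<i>"
  have "(\<Sum>j\<in>UNIV. \<Sum>k\<in>UNIV. complex_of_real (?\<Gamma> j k) *
        d_dz (\<lambda>z. complex_of_real (v z $ j)) z * d_dzbar (\<lambda>z. complex_of_real (v z $ k)) z) =
      (\<Sum>j\<in>UNIV. \<Sum>k\<in>UNIV. of_real (?\<Gamma> j k * ?a $ j * ?a $ k) / 4 + of_real (?\<Gamma> j k * ?b $ j * ?b $ k) / 4 +
        (\<i> / 4 * of_real (?\<Gamma> j k * ?a $ j * ?b $ k) - \<i> / 4 * of_real (?\<Gamma> j k * ?b $ j * ?a $ k)))"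
    unfolding z1[OF v(3)] z2[OF v(3)] by (intro sum.cong refl) (simp add: field_simps)
  also have "\<dots> = of_real (\<Sum>j\<in>UNIV. \<Sum>k\<in>UNIV. ?\<Gamma> j k * ?a $ j * ?a $ k) / 4 + of_real (\<Sum>j\<in>UNIV. \<Sum>k\<in>UNIV. ?\<Gamma> j k * ?b $ j * ?b $ k) / 4 +
      \<i> / 4 * of_real ((\<Sum>j\<in>UNIV. \<Sum>k\<in>UNIV. ?\<Gamma> j k * ?a $ j * ?b $ k) - (\<Sum>j\<in>UNIV. \<Sum>k\<in>UNIV. ?\<Gamma> j k * ?b $ j * ?a $ k))"
    by (simp add: sum.distrib sum_subtractf sum_divide_distrib[symmetric] sum_distrib_left[symmetric] right_diff_distrib)
  also have "(\<Sum>j\<in>UNIV. \<Sum>k\<in>UNIV. ?\<Gamma> j k * ?b $ j * ?a $ k) = (\<Sum>j\<in>UNIV. \<Sum>k\<in>UNIV. ?\<Gamma> j k * ?a $ j * ?b $ k)"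
    by (subst sum.swap) (simp add: sym mult_ac)
  finally show ?thesis
    unfolding zz' tension_def christoffel_quad_def by (simp add: add_divide_distrib)
qed

section \<open>Cut-off functions\<close>

text \<open>The powers make the family closed under differentiation up to linear combinations, so
  that smoothness is a single induction over all \<open>m\<close> at once.\<close>

definition flat_exp :: "nat \<Rightarrow> real \<Rightarrow> real" where
  "flat_exp m t = (if t > 0 then (inverse t) ^ m * exp (- inverse t) else 0)"

text \<open>With \<open>x = 1 / t\<close> and \<open>n = m + 2\<close> this is
  \<open>(x / n) ^ n \<le> exp x\<close>. The quadratic decay gives the derivative \<open>0\<close>
  at the origin.\<close>

lemma flat_exp_le: "\<bar>flat_exp m t\<bar> \<le> real (m + 2) ^ (m + 2) * t\<^sup>2"
proof (cases "t > 0")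
  case True
  define x n where "x = inverse t" and "n = m + 2"
  have x: "x > 0" and n: "n > 0" using True by (simp_all add: x_def n_def)
  have "(x / real n) ^ n \<le> (1 + x / real n) ^ n" using x by (intro power_mono) auto
  also have "\<dots> \<le> exp x" using x n by (intro exp_ge_one_plus_x_over_n_power_n) auto
  finally have "x ^ n \<le> real n ^ n * exp x" using n by (simp add: power_divide divide_le_eq mult.commute)
  then have "x ^ m * exp (- x) * (x\<^sup>2 * exp x) \<le> real n ^ n * exp x"
    by (simp add: n_def power_add power2_eq_square exp_minus field_simps)
  then have "x ^ m * exp (- x) * x\<^sup>2 \<le> real n ^ n" by simp
  then show ?thesis using True by (simp add: flat_exp_def x_def n_def field_simps)
qed (simp add: flat_exp_def)

lemma flat_exp_has_derivative:
  "(flat_exp m has_derivative (\<lambda>v. (flat_exp (m + 2) t - real m * flat_exp (m + 1) t) * v)) (at t)"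
proof -
  consider "t > 0" | "t < 0" | "t = 0" by linarith
  then show ?thesis
  proof cases
    case 1
    have "((\<lambda>t. (inverse t) ^ m * exp (- inverse t)) has_real_derivative
        ((inverse t) ^ (m + 2) * exp (- inverse t) - real m * ((inverse t) ^ (m + 1) * exp (- inverse t)))) (at t)"
    proof -
      define x where "x = inverse t"
      have g: "(inverse has_real_derivative - (x * x)) (at t)"
        using 1 by (auto intro!: derivative_eq_intros simp: x_def power2_eq_square)
      have d: "((\<lambda>t. (inverse t) ^ m * exp (- inverse t)) has_real_derivative
          real m * (- (x * x) * x ^ (m - Suc 0)) * exp (- x) + exp (- x) * (x * x) * x ^ m) (at t)"
        unfolding x_def
        by (rule DERIV_cong[OF DERIV_mult[OF DERIV_power[OF g] DERIV_fun_exp[OF DERIV_minus[OF g]]]]) (simp add: x_def mult_ac)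
      have e: "real m * (- (x * x) * x ^ (m - Suc 0)) * exp (- x) + exp (- x) * (x * x) * x ^ m =
          x ^ (m + 2) * exp (- x) - real m * (x ^ (m + 1) * exp (- x))"
        by (cases m) (simp_all add: algebra_simps)
      show ?thesis using d unfolding e unfolding x_def .
    qed
    then have "(flat_exp m has_real_derivative (flat_exp (m + 2) t - real m * flat_exp (m + 1) t)) (at t)"
      using has_field_derivative_transform_within_open[of _ _ t "{0<..}" "flat_exp m"] 1 by (simp add: flat_exp_def)
    then show ?thesis by (simp add: has_field_derivative_def)
  next
    case 2
    have "((\<lambda>_. 0) has_derivative (\<lambda>v. 0)) (at t)" by simp
    then have "(flat_exp m has_derivative (\<lambda>v. 0)) (at t)"
      by (rule has_derivative_transform_within_open[of _ _ t UNIV "{..<0}"]) (use 2 in \<open>auto simp: flat_exp_def\<close>)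
    then show ?thesis using 2 by (simp add: flat_exp_def)
  next
    case 3
    define C where "C = real (m + 2) ^ (m + 2)"
    have C: "C > 0" by (simp add: C_def)
    have "(flat_exp m has_derivative (\<lambda>v. 0)) (at 0)"
      unfolding has_derivative_at_alt
    proof (intro conjI allI impI)
      fix e :: real assume e: "e > 0"
      show "\<exists>d>0. \<forall>y. norm (y - 0) < d \<longrightarrow> norm (flat_exp m y - flat_exp m 0 - 0) \<le> e * norm (y - 0)"
      proof (intro exI[of _ "e / C"] conjI allI impI)
        fix y :: real assume y: "norm (y - 0) < e / C"
        have "\<bar>flat_exp m y\<bar> \<le> C * \<bar>y\<bar> * \<bar>y\<bar>" using flat_exp_le[of m y] by (simp add: C_def power2_eq_square)
        also have "\<dots> \<le> e * \<bar>y\<bar>" using y C by (intro mult_right_mono) (auto simp: field_simps)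
        finally show "norm (flat_exp m y - flat_exp m 0 - 0) \<le> e * norm (y - 0)" by (simp add: flat_exp_def)
      qed (use e C in simp)
    qed simp
    then show ?thesis using 3 by (simp add: flat_exp_def)
  qed
qed

lemma flat_exp_smooth: "smooth_on UNIV (flat_exp m)"
proof -
  have "Ck_on k UNIV (flat_exp m)" for k m
  proof (induction k arbitrary: m)
    case 0
    show ?case
      by (auto intro!: continuous_at_imp_continuous_on has_derivative_continuous[OF flat_exp_has_derivative])
  next
    case (Suc k)
    show ?case
    proof (rule Ck_on_SucI[OF open_UNIV flat_exp_has_derivative])
      fix v
      have "Ck_on k UNIV (\<lambda>t. flat_exp (m + 2) t + (- real m) * flat_exp (m + 1) t)"
        by (intro Ck_on_add Ck_on_linear_comp[OF bounded_linear_mult_right] open_UNIV Suc)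
      then show "Ck_on k UNIV (\<lambda>t. (flat_exp (m + 2) t - real m * flat_exp (m + 1) t) * v)"
        using Ck_on_linear_comp[OF bounded_linear_mult_left[of v] open_UNIV] by fastforce
    qed
  qed
  then show ?thesis by (simp add: smooth_on_def)
qed

definition bump :: "real \<Rightarrow> real" where
  "bump t = flat_exp 0 (2 - t) / (flat_exp 0 (2 - t) + flat_exp 0 (t - 1))"

lemma bump_denominator: "flat_exp 0 (2 - t) + flat_exp 0 (t - 1) > 0"
  by (cases "t < 2") (auto simp: flat_exp_def add_pos_nonneg add_nonneg_pos)

lemma bump_eq_1: "t \<le> 1 \<Longrightarrow> bump t = 1"
  by (simp add: bump_def flat_exp_def)

lemma bump_eq_0: "t \<ge> 2 \<Longrightarrow> bump t = 0"
  by (simp add: bump_def flat_exp_def)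

lemma bump_nonneg: "bump t \<ge> 0"
  by (simp add: bump_def flat_exp_def)

lemma bump_le_1: "bump t \<le> 1"
  using bump_denominator[of t] by (simp add: bump_def divide_le_eq flat_exp_def)

lemma bump_smooth: "smooth_on UNIV bump"
proof -
  have s: "smooth_on UNIV (\<lambda>t. flat_exp 0 (2 - t))" "smooth_on UNIV (\<lambda>t. flat_exp 0 (t - 1))"
    by (intro smooth_on_comp[OF open_UNIV open_UNIV flat_exp_smooth] smooth_on_diff smooth_on_const smooth_on_ident open_UNIV UNIV_I)+
  show ?thesis
    unfolding bump_def[abs_def]
    by (intro smooth_on_divide smooth_on_add s open_UNIV) (use bump_denominator in \<open>simp add: less_imp_neq[symmetric]\<close>)
qed

lemma smooth_on_bump:
  fixes f :: "'a::euclidean_space \<Rightarrow> real"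
  shows "open S \<Longrightarrow> smooth_on S f \<Longrightarrow> smooth_on S (\<lambda>x. bump (f x))"
  using smooth_on_comp[OF _ open_UNIV bump_smooth] by blast

lemma smooth_on_norm_sq:
  fixes f :: "'a::euclidean_space \<Rightarrow> 'b::euclidean_space"
  assumes "open S" "smooth_on S f" shows "smooth_on S (\<lambda>x. (norm (f x))\<^sup>2)"
  unfolding power2_norm_eq_inner by (intro smooth_on_inner assms)

text \<open>Near a point of \<open>K\<close> both factors are smooth. Near any other point the
  product is identically \<open>0\<close>, so nothing is required of \<open>f\<close> there.\<close>

lemma smooth_on_cutoff:
  fixes f :: "'a::euclidean_space \<Rightarrow> 'b::real_normed_vector"
  assumes \<psi>: "smooth_on S \<psi>" "open S" and f: "smooth_on T f" "open T" and K: "closed K" "S \<inter> K \<subseteq> T"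
    and 0: "\<And>x. x \<notin> K \<Longrightarrow> \<psi> x = 0"
  shows "smooth_on S (\<lambda>x. \<psi> x *\<^sub>R f x)"
proof (rule smooth_on_local)
  fix x assume x: "x \<in> S"
  show "\<exists>U. open U \<and> x \<in> U \<and> smooth_on U (\<lambda>x. \<psi> x *\<^sub>R f x)"
  proof (cases "x \<in> K")
    case True
    have "smooth_on (S \<inter> T) (\<lambda>x. \<psi> x *\<^sub>R f x)"
      using assms by (intro smooth_on_scaleR open_Int) (auto intro: smooth_on_subset)
    then show ?thesis using True x K assms by (intro exI[of _ "S \<inter> T"]) auto
  next
    case False
    have "smooth_on (- K) (\<lambda>x. \<psi> x *\<^sub>R f x)"
      by (rule smooth_on_cong[OF smooth_on_const[of _ 0]]) (use K 0 in auto)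
    then show ?thesis using False K by (intro exI[of _ "- K"]) auto
  qed
qed

section \<open>Primitives along rays\<close>

lemma ray_int_linear_comp:
  assumes "bounded_linear T" "continuous_on UNIV f"
  shows "T (ray_int j f z) = ray_int j (\<lambda>z. T (f z)) z"
proof -
  interpret T: bounded_linear T by fact
  show ?thesis
    using integral_linear[OF ray_int_integrable[OF assms(2), of j z] assms(1)]
    by (simp add: ray_int_def o_def T.scaleR)
qed

lemma ray_int_add:
  assumes "continuous_on UNIV f" "continuous_on UNIV g"
  shows "ray_int j (\<lambda>z. f z + g z) z = ray_int j f z + ray_int j g z"
  using integral_add[OF ray_int_integrable[OF assms(1), of j z] ray_int_integrable[OF assms(2), of j z]]
  by (simp only: ray_int_def scaleR_add_right)

text \<open>Obtained by integrating the derivative of \<open>s *\<^sub>R f (s *\<^sub>R z)\<close>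
  over the unit interval.\<close>

lemma ray_int_radial:
  fixes f :: "complex \<Rightarrow> 'b::euclidean_space"
  assumes f: "Ck_on (Suc 0) UNIV f"
  shows "f z = ray_int 0 f z + (Re z *\<^sub>R ray_int 1 (\<lambda>y. frechet_derivative f (at y) 1) z +
    Im z *\<^sub>R ray_int 1 (\<lambda>y. frechet_derivative f (at y) \<i>) z)"
proof -
  let ?f' = "\<lambda>y. frechet_derivative f (at y)"
  have fd: "(f has_derivative ?f' y) (at y)" for y by (rule Ck_on_has_derivative[OF f]) simp
  have lin: "linear (?f' y)" for y by (rule has_derivative_linear[OF fd])
  have fc: "continuous_on UNIV f" and f'c: "continuous_on UNIV (\<lambda>y. ?f' y v)" for v
    using Ck_on_continuous[OF f] C1_continuous_derivative[OF f] by auto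
  have dz: "?f' y z = Re z *\<^sub>R ?f' y 1 + Im z *\<^sub>R ?f' y \<i>" for y
    using linear_eq_sum_Basis[OF lin, of y z] by (simp add: Basis_complex_def inner_complex_def)
  have vd: "((\<lambda>s. s *\<^sub>R f (s *\<^sub>R z)) has_vector_derivative f (s *\<^sub>R z) + s *\<^sub>R ?f' (s *\<^sub>R z) z) (at s)" for s :: real
  proof -
    have "((\<lambda>s. f (s *\<^sub>R z)) has_derivative (\<lambda>h. ?f' (s *\<^sub>R z) (h *\<^sub>R z))) (at s)"
      by (rule has_derivative_compose[of "\<lambda>s. s *\<^sub>R z" "\<lambda>h. h *\<^sub>R z" s UNIV f, OF _ fd]) (auto intro!: derivative_eq_intros)
    from has_derivative_scaleR[OF has_derivative_ident this]
    show ?thesis unfolding has_vector_derivative_def by (simp add: linear_scale[OF lin] algebra_simps)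
  qed
  have "((\<lambda>s. f (s *\<^sub>R z) + s *\<^sub>R ?f' (s *\<^sub>R z) z) has_integral (1 *\<^sub>R f (1 *\<^sub>R z) - 0 *\<^sub>R f (0 *\<^sub>R z))) {0..1}"
    by (rule fundamental_theorem_of_calculus, simp, rule has_vector_derivative_at_within, rule vd)
  then have "f z = integral (cbox 0 1) (\<lambda>s. s ^ 0 *\<^sub>R f (s *\<^sub>R z) + s ^ 1 *\<^sub>R ?f' (s *\<^sub>R z) z)"
    by (simp add: integral_unique)
  also have "\<dots> = ray_int 0 f z + ray_int 1 (\<lambda>y. ?f' y z) z"
    unfolding ray_int_def by (rule integral_add[OF ray_int_integrable[OF fc, of 0 z] ray_int_integrable[of "\<lambda>y. ?f' y z" 1 z, OF f'c]])
  also have "ray_int 1 (\<lambda>y. ?f' y z) z = Re z *\<^sub>R ray_int 1 (\<lambda>y. ?f' y 1) z + Im z *\<^sub>R ray_int 1 (\<lambda>y. ?f' y \<i>) z"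
    unfolding dz ray_int_linear_comp[OF bounded_linear_scaleR_right f'c]
    by (rule ray_int_add[OF continuous_on_scaleR[OF continuous_on_const f'c] continuous_on_scaleR[OF continuous_on_const f'c]])
  finally show ?thesis .
qed

text \<open>Poincare's lemma with a remainder for the one-form \<open>a dx + b dy\<close> that need
  not be closed: the derivative of its ray primitive is the form itself plus a ray integral of its
  curl, multiplied by the area form of \<open>z\<close> and \<open>v\<close>. The remainder is
  absent in the radial direction.\<close>

lemma ray_primitive_has_derivative:
  fixes a b :: "complex \<Rightarrow> 'b::euclidean_space"
  assumes a: "Ck_on (Suc 0) UNIV a" and b: "Ck_on (Suc 0) UNIV b"
  shows "((\<lambda>z. Re z *\<^sub>R ray_int 0 a z + Im z *\<^sub>R ray_int 0 b z) has_derivative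
    (\<lambda>v. Re v *\<^sub>R a z + Im v *\<^sub>R b z + (Re z * Im v - Im z * Re v) *\<^sub>R
      ray_int 1 (\<lambda>y. frechet_derivative a (at y) \<i> - frechet_derivative b (at y) 1) z)) (at z)"
proof -
  let ?r = "\<lambda>f e. ray_int 1 (\<lambda>y. frechet_derivative f (at y) e) z"
  have split: "ray_int (Suc 0) (\<lambda>y. frechet_derivative f (at y) v) z = Re v *\<^sub>R ?r f 1 + Im v *\<^sub>R ?r f \<i>"
    if f: "Ck_on (Suc 0) UNIV f" for f :: "complex \<Rightarrow> 'b" and v
  proof -
    have c: "continuous_on UNIV (\<lambda>y. frechet_derivative f (at y) v)" for v by (rule C1_continuous_derivative[OF f])
    have "frechet_derivative f (at y) v = Re v *\<^sub>R frechet_derivative f (at y) 1 + Im v *\<^sub>R frechet_derivative f (at y) \<i>" for y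
      using linear_eq_sum_Basis[OF has_derivative_linear[OF Ck_on_has_derivative[OF f UNIV_I]], of y v]
      by (simp add: Basis_complex_def inner_complex_def)
    then show ?thesis
      unfolding ray_int_linear_comp[OF bounded_linear_scaleR_right c] One_nat_def
      by (simp only: ray_int_add[OF continuous_on_scaleR[OF continuous_on_const c] continuous_on_scaleR[OF continuous_on_const c]])
  qed
  have D: "((\<lambda>z. Re z *\<^sub>R ray_int 0 a z + Im z *\<^sub>R ray_int 0 b z) has_derivative
    (\<lambda>v. (Re z *\<^sub>R (Re v *\<^sub>R ?r a 1 + Im v *\<^sub>R ?r a \<i>) + Re v *\<^sub>R ray_int 0 a z) +
      (Im z *\<^sub>R (Re v *\<^sub>R ?r b 1 + Im v *\<^sub>R ?r b \<i>) + Im v *\<^sub>R ray_int 0 b z))) (at z)"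
    unfolding split[OF a, symmetric] split[OF b, symmetric]
    by (intro has_derivative_add has_derivative_scaleR ray_int_has_derivative[OF a] ray_int_has_derivative[OF b]
        bounded_linear_imp_has_derivative bounded_linear_Re bounded_linear_Im)
  have e: "ray_int 1 (\<lambda>y. frechet_derivative a (at y) \<i> - frechet_derivative b (at y) 1) z = ?r a \<i> - ?r b 1"
    by (rule ray_int_diff[OF C1_continuous_derivative[OF a] C1_continuous_derivative[OF b]])
  show ?thesis
    by (rule has_derivative_eq_rhs[OF D], rule ext, simp only: e, subst ray_int_radial[OF a, of z], subst ray_int_radial[OF b, of z])
      (simp add: algebra_simps)
qed

text \<open>Gronwall's argument along rays. It makes the defects of the first-order system vanish, since they
  are bounded by their own integrals along rays.\<close>

lemma ray_int_absorb:
  fixes k :: "complex \<Rightarrow> 'b::euclidean_space"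
  assumes k: "continuous_on UNIV k"
    and le: "\<And>z. z \<in> cball 0 r \<Longrightarrow> norm (k z) \<le> C * (norm z * norm (ray_int j k z))"
    and z: "z \<in> cball 0 r"
  shows "k z = 0"
proof -
  \<comment> \<open>Large enough for \<open>C' * (2 / M)\<close>, the constant from
    \<open>ray_int_bound\<close>, to be below \<open>1\<close>.\<close>
  define C' M where "C' = max C 0" and "M = 4 * (max C 0 + 1)"
  have C': "C' \<ge> 0" and M: "M > 0" and q: "C' * (2 / M) < 1"
    by (auto simp: C'_def M_def field_simps)
  have "r \<ge> 0" using z order_trans[OF norm_ge_zero[of z]] by simp
  then have ne: "cball (0::complex) r \<noteq> {}" by simp
  \<comment> \<open>The hypothesis controls \<open>k\<close> on a disc only, while
    \<open>ray_int_bound\<close> asks for a global bound. Composing with the projection onto the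
    disc supplies it and leaves the ray integrals at points of the disc unchanged.\<close>
  define \<pi> where "\<pi> = closest_point (cball (0::complex) r)"
  have \<pi>: "continuous_on UNIV \<pi>" unfolding \<pi>_def by (rule continuous_on_closest_point) (use ne in auto)
  have \<pi>in: "\<pi> y \<in> cball 0 r" for y unfolding \<pi>_def by (rule closest_point_in_set) (use ne in auto)
  have \<pi>id: "\<pi> y = y" if "y \<in> cball 0 r" for y unfolding \<pi>_def by (rule closest_point_self[OF that])
  have \<pi>n: "norm (\<pi> y) \<le> norm y" for y
    using \<pi>in[of y] \<pi>id[of y] by (cases "y \<in> cball 0 r") simp_all
  have kc: "continuous_on UNIV (\<lambda>y. k (\<pi> y))" by (rule continuous_on_UNIV_comp[OF k \<pi>])
  have eq: "ray_int j (\<lambda>y. k (\<pi> y)) y = ray_int j k y" if y: "y \<in> cball 0 r" for y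
    unfolding ray_int_def
  proof (rule integral_cong)
    fix s :: real assume s: "s \<in> cbox 0 1"
    have "norm (s *\<^sub>R y) \<le> 1 * norm y" unfolding norm_scaleR using s by (intro mult_right_mono) auto
    then have "s *\<^sub>R y \<in> cball 0 r" using y by simp
    then show "s ^ j *\<^sub>R k (\<pi> (s *\<^sub>R y)) = s ^ j *\<^sub>R k (s *\<^sub>R y)" by (simp add: \<pi>id)
  qed
  have "norm (k z) \<le> 0 / (1 - C' * (2 / M)) * weight M z"
  proof (rule weighted_absorb[OF continuous_on_subset[OF k] q _ z])
    fix c :: real assume c: "0 \<le> c" "\<forall>z\<in>cball 0 r. norm (k z) \<le> c * weight M z"
    show "\<forall>z\<in>cball 0 r. norm (k z) \<le> (0 + C' * (2 / M) * c) * weight M z"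
    proof
      fix y :: complex assume y: "y \<in> cball 0 r"
      have "norm (k (\<pi> x)) \<le> c * weight M x" for x
        by (rule order_trans[OF bspec[OF c(2) \<pi>in] mult_left_mono[OF weight_mono[OF \<pi>n] c(1)]])
      then have "norm y * norm (ray_int j (\<lambda>y. k (\<pi> y)) y) \<le> 2 / M * c * weight M y"
        by (rule ray_int_bound[OF kc _ M c(1)])
      then have "norm y * norm (ray_int j k y) \<le> 2 / M * c * weight M y" using eq[OF y] by simp
      moreover have "norm (k y) \<le> C' * (norm y * norm (ray_int j k y))"
        by (rule order_trans[OF le[OF y] mult_right_mono]) (auto simp: C'_def)
      ultimately have "norm (k y) \<le> C' * (2 / M * c * weight M y)"
        using C' mult_left_mono order_trans by blast
      then show "norm (k y) \<le> (0 + C' * (2 / M) * c) * weight M y" by (simp add: mult_ac)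
    qed
  qed simp
  then show ?thesis by simp
qed

section \<open>Perturbation of a conformal harmonic disc in coordinates\<close>

definition plane :: "'n \<Rightarrow> 'n \<Rightarrow> complex \<Rightarrow> real^'n" where
  "plane i1 i2 z = Re z *\<^sub>R axis i1 1 + Im z *\<^sub>R axis i2 1"

definition re_vec :: "complex ^ 'n \<Rightarrow> real ^ 'n" where
  "re_vec w = (\<chi> j. Re (w $ j))"

definition im_vec :: "complex ^ 'n \<Rightarrow> real ^ 'n" where
  "im_vec w = (\<chi> j. Im (w $ j))"

definition complex_vec :: "real ^ 'n \<Rightarrow> complex ^ 'n" where
  "complex_vec v = (\<chi> j. complex_of_real (v $ j))"

lemma bounded_linear_plane: "bounded_linear (plane i1 i2)"
  unfolding plane_def[abs_def]
  by (intro bounded_linear_add bounded_linear_scaleR_const bounded_linear_Re bounded_linear_Im)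

lemma bounded_linear_re_vec: "bounded_linear re_vec"
  and bounded_linear_im_vec: "bounded_linear im_vec"
  and bounded_linear_complex_vec: "bounded_linear complex_vec"
  unfolding linear_conv_bounded_linear[symmetric]
  by (simp_all add: linear_iff re_vec_def im_vec_def complex_vec_def vec_eq_iff)
    (simp add: scaleR_conv_of_real)?

text \<open>The complex bilinear extension of the metric vanishes on \<open>w\<close> iff real and
  imaginary part are orthogonal and of equal length. For \<open>w = \<partial>U/\<partial>z\<close>
  this is conformality of \<open>U\<close>, wherever its differential does not vanish.\<close>

lemma complex_quadratic_form:
  fixes A :: "real^'n^'n" and w :: "complex ^ 'n"
  assumes "\<And>v w. v \<bullet> (A *v w) = w \<bullet> (A *v v)"
  shows "(\<Sum>j\<in>UNIV. \<Sum>k\<in>UNIV. complex_of_real (A $ j $ k) * w $ j * w $ k) =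
    Complex (re_vec w \<bullet> (A *v re_vec w) - im_vec w \<bullet> (A *v im_vec w)) (2 * (re_vec w \<bullet> (A *v im_vec w)))"
proof -
  have f: "v \<bullet> (A *v u) = (\<Sum>j\<in>UNIV. \<Sum>k\<in>UNIV. A $ j $ k * v $ j * u $ k)" for v u
    unfolding inner_vec_def matrix_vector_mult_def by (simp add: sum_distrib_left mult_ac)
  have "2 * (re_vec w \<bullet> (A *v im_vec w)) = re_vec w \<bullet> (A *v im_vec w) + im_vec w \<bullet> (A *v re_vec w)"
    using assms[of "re_vec w" "im_vec w"] by simp
  then show ?thesis
    unfolding complex_eq_iff f re_vec_def im_vec_def
    by (simp add: sum.distrib[symmetric] sum_subtractf[symmetric] algebra_simps)
qed

text \<open>The real component of the argument of \<open>G\<close> is a parameter, with value \<open>0\<close> for the given disc. For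
  finiteness it is the factor of a dilation, so that \<open>G\<close> is constant at \<open>0\<close>; for semicontinuity \<open>G\<close> does
  not depend on it.\<close>

locale conformal_harmonic_family =
  fixes G :: "real \<times> (real^'n) \<Rightarrow> real^'n^'n" and D :: "(real \<times> (real^'n)) set" and i1 i2 :: 'n and R :: real
  assumes D_open: "open D" and G_smooth: "smooth_on D G" and G_posdef: "p \<in> D \<Longrightarrow> posdef (G p)"
    and i12: "i1 \<noteq> i2" and R: "R > 1"
    and base_in: "z \<in> cball 0 R \<Longrightarrow> (0, plane i1 i2 z) \<in> D"
    and base_conformal: "z \<in> cball 0 R \<Longrightarrow> G (0, plane i1 i2 z) $ i1 $ i1 = G (0, plane i1 i2 z) $ i2 $ i2"
      "z \<in> cball 0 R \<Longrightarrow> G (0, plane i1 i2 z) $ i1 $ i2 = 0"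
    and base_harmonic: "z \<in> cball 0 R \<Longrightarrow> christoffel_quad (\<lambda>x. G (0, x)) (plane i1 i2 z) (axis i1 1) +
      christoffel_quad (\<lambda>x. G (0, x)) (plane i1 i2 z) (axis i2 1) = 0"
begin

lemma G_sym: "p \<in> D \<Longrightarrow> G p $ i $ j = G p $ j $ i"
  using G_posdef by (simp add: posdef_def)

abbreviation e1 where "e1 \<equiv> axis i1 1 :: real^'n"
abbreviation e2 where "e2 \<equiv> axis i2 1 :: real^'n"

definition qa where "qa p = G p $ i2 $ i2"
definition qb :: "real \<times> (real^'n) \<Rightarrow> complex ^ 'n \<Rightarrow> complex" where
  "qb p t = (\<Sum>j\<in>- {i2}. of_real (G p $ i2 $ j) * t $ j)"
definition qc :: "real \<times> (real^'n) \<Rightarrow> complex ^ 'n \<Rightarrow> complex" where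
  "qc p t = (\<Sum>j\<in>- {i2}. \<Sum>k\<in>- {i2}. of_real (G p $ j $ k) * t $ j * t $ k)"
text \<open>Minus the reduced discriminant of the quadratic equation for the component
  \<open>i2\<close>. On the given disc it is the positive number \<open>(qa / 2)\<^sup>2\<close>, so
  the principal root is smooth nearby; \<open>qdom\<close> keeps away from its branch cut.\<close>

definition qd where "qd p t = of_real (qa p) * qc p t - (qb p t)\<^sup>2"
definition qdom where "qdom = {x. fst x \<in> D \<and> qd (fst x) (snd x) \<notin> \<real>\<^sub>\<le>\<^sub>0}"

text \<open>The null vectors of \<open>G p\<close> near \<open>(1, -\<i>, 0, \<dots>, 0) / 2\<close> are parametrized by their components
  other than the one with index \<open>i2\<close>, which is a root of \<open>qa X\<^sup>2 + 2 qb X + qc\<close>.\<close>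

definition null_vec :: "real \<times> (real^'n) \<Rightarrow> complex ^ 'n \<Rightarrow> complex ^ 'n" where
  "null_vec p t = (\<chi> j. if j = i2 then (- qb p t - \<i> * csqrt (qd p t)) / of_real (qa p) else t $ j)"

definition gam :: "real \<times> (real^'n) \<Rightarrow> real^'n \<Rightarrow> real^'n" where
  "gam p = christoffel_quad (\<lambda>x. G (fst p, x)) (snd p)"

lemma qa_pos: "p \<in> D \<Longrightarrow> qa p > 0"
  using posdef_pos[OF G_posdef, of p "axis i2 1"]
  by (simp add: qa_def inner_axis' matrix_vector_mult_basis column_def)

lemma smooth_on_G_nth:
  assumes "open S" "smooth_on S g" "\<And>x. x \<in> S \<Longrightarrow> g x \<in> D"
  shows "smooth_on S (\<lambda>x. G (g x) $ i $ j)"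
  by (intro smooth_on_vec_nth smooth_on_comp[OF _ D_open G_smooth] assms)

lemma smooth_on_qa:
  assumes "open S" "smooth_on S g" "\<And>x. x \<in> S \<Longrightarrow> g x \<in> D" shows "smooth_on S (\<lambda>x. qa (g x))"
  unfolding qa_def by (rule smooth_on_G_nth[OF assms])

lemma smooth_on_qb_qc_qd:
  assumes "open S" "smooth_on S g" "\<And>x. x \<in> S \<Longrightarrow> g x \<in> D" "smooth_on S t"
  shows "smooth_on S (\<lambda>x. qb (g x) (t x))" "smooth_on S (\<lambda>x. qc (g x) (t x))" "smooth_on S (\<lambda>x. qd (g x) (t x))"
proof -
  show b: "smooth_on S (\<lambda>x. qb (g x) (t x))" and c: "smooth_on S (\<lambda>x. qc (g x) (t x))"
    unfolding qb_def qc_def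
    by (intro smooth_on_sum smooth_on_mult smooth_on_of_real smooth_on_G_nth smooth_on_vec_nth assms | assumption)+
  show "smooth_on S (\<lambda>x. qd (g x) (t x))"
    unfolding qd_def power2_eq_square
    by (intro smooth_on_diff smooth_on_mult smooth_on_of_real smooth_on_qa b c assms | assumption)+
qed

lemma qdom_open: "open qdom"
proof -
  have "open (D \<times> (UNIV :: (complex ^ 'n) set))" using D_open by (simp add: open_Times)
  moreover have "continuous_on (D \<times> UNIV) (\<lambda>x. qd (fst x) (snd x))"
    by (intro smooth_on_continuous smooth_on_qb_qc_qd(3) calculation smooth_on_bounded_linear
        bounded_linear_fst bounded_linear_snd) auto
  ultimately have "open ((D \<times> UNIV) \<inter> (\<lambda>x. qd (fst x) (snd x)) -` (- \<real>\<^sub>\<le>\<^sub>0))"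
    by (intro continuous_open_preimage) (simp_all add: open_Compl)
  moreover have "(D \<times> UNIV) \<inter> (\<lambda>x. qd (fst x) (snd x)) -` (- \<real>\<^sub>\<le>\<^sub>0) = qdom"
    by (auto simp: qdom_def)
  ultimately show ?thesis by simp
qed

lemma smooth_on_null_vec:
  assumes S: "open S" and g: "smooth_on S g" and t: "smooth_on S t" and dom: "\<And>x. x \<in> S \<Longrightarrow> (g x, t x) \<in> qdom"
  shows "smooth_on S (\<lambda>x. null_vec (g x) (t x))"
proof -
  have gD: "g x \<in> D" if "x \<in> S" for x using dom[OF that] by (simp add: qdom_def)
  have "smooth_on S (\<lambda>x. (- qb (g x) (t x) - \<i> * csqrt (qd (g x) (t x))) / of_real (qa (g x)))"
  proof (intro smooth_on_divide smooth_on_diff smooth_on_minus smooth_on_mult smooth_on_const smooth_on_csqrt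
      smooth_on_of_real smooth_on_qa[OF S g gD] smooth_on_qb_qc_qd[OF S g gD t] S)
    show "qd (g x) (t x) \<notin> \<real>\<^sub>\<le>\<^sub>0" if "x \<in> S" for x using dom[OF that] by (simp add: qdom_def)
    show "complex_of_real (qa (g x)) \<noteq> 0" if "x \<in> S" for x using qa_pos[OF gD[OF that]] by simp
  qed
  then have "smooth_on S (\<lambda>x. if j = i2 then (- qb (g x) (t x) - \<i> * csqrt (qd (g x) (t x))) / of_real (qa (g x)) else t x $ j)" for j
    using smooth_on_vec_nth[OF S t] by (cases "j = i2") auto
  then show ?thesis unfolding null_vec_def by (rule smooth_on_vec_lambda[OF S])
qed

lemma G_slice_has_derivative:
  assumes "p \<in> D"
  shows "((\<lambda>x. G (fst p, x)) has_derivative (\<lambda>h. frechet_derivative G (at p) (0, h))) (at (snd p))"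
proof -
  have "((\<lambda>x. (fst p, x)) has_derivative (\<lambda>h. (0, h))) (at (snd p))"
    by (intro derivative_intros)
  from has_derivative_compose[OF this, of G "frechet_derivative G (at p)"] smooth_on_has_derivative[OF G_smooth assms]
  show ?thesis by simp
qed

lemma smooth_on_gam:
  assumes S: "open S" and g: "smooth_on S g" and a: "smooth_on S a" and gD: "\<And>x. x \<in> S \<Longrightarrow> g x \<in> D"
  shows "smooth_on S (\<lambda>x. gam (g x) (a x))"
proof (rule smooth_on_cong[OF _ S])
  let ?m = "\<lambda>x k i j. frechet_derivative G (at (g x)) (0, axis k 1) $ i $ j"
  let ?c = "\<lambda>x i j k. (\<Sum>l\<in>UNIV. matrix_inv (G (g x)) $ i $ l * (?m x j k l + ?m x k j l - ?m x l j k)) * (1 / 2)"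
  show "gam (g x) (a x) = (\<chi> i. \<Sum>j\<in>UNIV. \<Sum>k\<in>UNIV. ?c x i j k * a x $ j * a x $ k)" if "x \<in> S" for x
    unfolding gam_def christoffel_quad_def christoffel_sym_def metric_deriv_eq[OF G_slice_has_derivative[OF gD[OF that]]]
    by simp
  have m: "smooth_on S (\<lambda>x. ?m x k i j)" for k i j
    by (intro smooth_on_vec_nth smooth_on_frechet_apply[OF S D_open G_smooth g] smooth_on_const S gD)
  have "smooth_on S (\<lambda>x. matrix_inv (G (g x)) $ i $ l)" for i l
    by (intro smooth_on_matrix_inv S smooth_on_G_nth g gD posdef_invertible G_posdef)
  then show "smooth_on S (\<lambda>x. \<chi> i. \<Sum>j\<in>UNIV. \<Sum>k\<in>UNIV. ?c x i j k * a x $ j * a x $ k)"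
    by (intro smooth_on_vec_lambda smooth_on_sum smooth_on_mult smooth_on_diff smooth_on_add smooth_on_const
        smooth_on_vec_nth[OF S a] m S)
qed

lemma gam_scale: "gam p (r *\<^sub>R a) = r\<^sup>2 *\<^sub>R gam p a"
  unfolding gam_def christoffel_quad_def by (simp add: vec_eq_iff sum_distrib_left power2_eq_square mult_ac)

text \<open>At the chosen root \<open>X\<close> the pairing with \<open>e2\<close> is
  \<open>qa * X + qb\<close>, half the derivative of the quadratic polynomial.\<close>

lemma null_vec_pairing:
  assumes "(p, t) \<in> qdom"
  shows "(\<Sum>j\<in>UNIV. complex_of_real (G p $ i2 $ j) * null_vec p t $ j) = - \<i> * csqrt (qd p t)"
proof -
  have "qa p \<noteq> 0" using assms qa_pos[of p] by (auto simp: qdom_def)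
  have "(\<Sum>j\<in>UNIV. complex_of_real (G p $ i2 $ j) * null_vec p t $ j) =
      of_real (qa p) * null_vec p t $ i2 + (\<Sum>j\<in>UNIV - {i2}. of_real (G p $ i2 $ j) * null_vec p t $ j)"
    by (subst sum.remove[of UNIV i2]) (simp_all add: qa_def)
  also have "(\<Sum>j\<in>UNIV - {i2}. of_real (G p $ i2 $ j) * null_vec p t $ j) = qb p t"
    unfolding qb_def Compl_eq_Diff_UNIV by (intro sum.cong refl) (auto simp: null_vec_def)
  also have "of_real (qa p) * null_vec p t $ i2 = - qb p t - \<i> * csqrt (qd p t)"
    using \<open>qa p \<noteq> 0\<close> by (simp add: null_vec_def)
  finally show ?thesis by simp
qed

lemma quadratic_split:
  assumes "p \<in> D"
  shows "(\<Sum>j\<in>UNIV. \<Sum>k\<in>UNIV. complex_of_real (G p $ j $ k) * w $ j * w $ k) =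
    of_real (qa p) * (w $ i2)\<^sup>2 + 2 * qb p w * w $ i2 + qc p w"
proof -
  have row: "(\<Sum>k\<in>UNIV. complex_of_real (G p $ j $ k) * w $ j * w $ k) =
      of_real (G p $ i2 $ j) * w $ j * w $ i2 + (\<Sum>k\<in>- {i2}. of_real (G p $ j $ k) * w $ j * w $ k)" for j
    by (subst sum.remove[of UNIV i2]) (simp_all add: G_sym[OF assms, of j i2] Compl_eq_Diff_UNIV)
  have "(\<Sum>j\<in>UNIV. \<Sum>k\<in>UNIV. complex_of_real (G p $ j $ k) * w $ j * w $ k) =
      (of_real (qa p) * w $ i2 * w $ i2 + (\<Sum>k\<in>- {i2}. of_real (G p $ i2 $ k) * w $ i2 * w $ k)) +
      (\<Sum>j\<in>- {i2}. of_real (G p $ i2 $ j) * w $ j * w $ i2 + (\<Sum>k\<in>- {i2}. of_real (G p $ j $ k) * w $ j * w $ k))"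
    unfolding row by (subst sum.remove[of UNIV i2]) (simp_all add: qa_def Compl_eq_Diff_UNIV)
  also have "(\<Sum>k\<in>- {i2}. complex_of_real (G p $ i2 $ k) * w $ i2 * w $ k) = qb p w * w $ i2"
    unfolding qb_def sum_distrib_right by (intro sum.cong refl) (simp add: mult_ac)
  also have "(\<Sum>j\<in>- {i2}. of_real (G p $ i2 $ j) * w $ j * w $ i2 + (\<Sum>k\<in>- {i2}. of_real (G p $ j $ k) * w $ j * w $ k)) =
      qb p w * w $ i2 + qc p w"
    unfolding qb_def qc_def by (simp add: sum.distrib sum_distrib_right)
  finally show ?thesis by (simp add: power2_eq_square algebra_simps)
qed

lemma qb_qc_null_vec: "qb p (null_vec p t) = qb p t" "qc p (null_vec p t) = qc p t"
  unfolding qb_def qc_def by (auto intro!: sum.cong simp: null_vec_def)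

lemma null_vec_null:
  assumes "(p, t) \<in> qdom"
  defines "a \<equiv> re_vec (null_vec p t)" and "b \<equiv> im_vec (null_vec p t)"
  shows "a \<bullet> (G p *v a) = b \<bullet> (G p *v b)" "a \<bullet> (G p *v b) = 0"
proof -
  have p: "p \<in> D" using assms(1) by (simp add: qdom_def)
  have qa: "qa p \<noteq> 0" using qa_pos[OF p] by simp
  let ?X = "null_vec p t $ i2"
  have "of_real (qa p) * ?X = - qb p t - \<i> * csqrt (qd p t)" using qa by (simp add: null_vec_def)
  then have "(of_real (qa p) * ?X + qb p t)\<^sup>2 = - qd p t" by (simp add: power_mult_distrib)
  then have "of_real (qa p) * (of_real (qa p) * ?X\<^sup>2 + 2 * qb p t * ?X + qc p t) = 0"
    unfolding qd_def by (simp add: power2_eq_square algebra_simps)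
  then have "of_real (qa p) * ?X\<^sup>2 + 2 * qb p t * ?X + qc p t = 0" using qa by simp
  then have "(\<Sum>j\<in>UNIV. \<Sum>k\<in>UNIV. complex_of_real (G p $ j $ k) * null_vec p t $ j * null_vec p t $ k) = 0"
    unfolding quadratic_split[OF p] qb_qc_null_vec .
  then have "Complex (a \<bullet> (G p *v a) - b \<bullet> (G p *v b)) (2 * (a \<bullet> (G p *v b))) = 0"
    unfolding a_def b_def complex_quadratic_form[OF posdef_sym[OF G_posdef[OF p]]] .
  then show "a \<bullet> (G p *v a) = b \<bullet> (G p *v b)" "a \<bullet> (G p *v b) = 0"
    by (auto simp: complex_eq_iff)
qed

text \<open>The root is simple on \<open>qdom\<close>. The sum of squares is the determinant, up to
  a constant, of the linear system that controls the defects in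
  \<open>disc_of_solution\<close>.\<close>

lemma null_vec_nondegenerate:
  assumes "(p, t) \<in> qdom"
  shows "(re_vec (null_vec p t) \<bullet> (G p *v e2))\<^sup>2 + (im_vec (null_vec p t) \<bullet> (G p *v e2))\<^sup>2 > 0"
proof -
  have p: "p \<in> D" using assms by (simp add: qdom_def)
  have f: "v \<bullet> (G p *v e2) = (\<Sum>j\<in>UNIV. G p $ i2 $ j * v $ j)" for v
    unfolding inner_vec_def by (simp add: matrix_vector_mult_basis column_def G_sym[OF p, of _ i2] mult.commute)
  have "- \<i> * csqrt (qd p t) = Complex (re_vec (null_vec p t) \<bullet> (G p *v e2)) (im_vec (null_vec p t) \<bullet> (G p *v e2))"
    unfolding null_vec_pairing[OF assms, symmetric] f by (simp add: complex_eq_iff re_vec_def im_vec_def)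
  moreover have "csqrt (qd p t) \<noteq> 0" using assms by (auto simp: qdom_def)
  ultimately have "Complex (re_vec (null_vec p t) \<bullet> (G p *v e2)) (im_vec (null_vec p t) \<bullet> (G p *v e2)) \<noteq> 0"
    by (metis mult_eq_0_iff complex_i_not_zero neg_equal_0_iff_equal)
  then show ?thesis by (auto simp: complex_eq_iff sum_power2_gt_zero_iff)
qed

end

section \<open>Vanishing of the defects of the first-order system\<close>

lemma ray_int_cong:
  assumes "\<And>y. norm y \<le> norm z \<Longrightarrow> f y = g y"
  shows "ray_int j f z = ray_int j g z"
  unfolding ray_int_def
proof (rule integral_cong)
  fix s :: real assume "s \<in> cbox 0 1"
  then have "norm (s *\<^sub>R z) \<le> 1 * norm z" unfolding norm_scaleR by (intro mult_right_mono) auto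
  then show "s ^ j *\<^sub>R f (s *\<^sub>R z) = s ^ j *\<^sub>R g (s *\<^sub>R z)" using assms by simp
qed

lemma has_derivative_zero_on_open:
  assumes "(f has_derivative f') (at x)" "open S" "x \<in> S" "\<And>y. y \<in> S \<Longrightarrow> f y = c"
  shows "f' v = 0"
proof -
  have "((\<lambda>_. c) has_derivative f') (at x)"
    by (rule has_derivative_transform_within_open[OF assms])
  from has_derivative_unique[OF this has_derivative_const] show ?thesis by simp
qed

context conformal_harmonic_family
begin

lemma frechet_G_sym:
  assumes p: "p \<in> D"
  shows "v \<bullet> (frechet_derivative G (at p) h *v u) = u \<bullet> (frechet_derivative G (at p) h *v v)"
proof -
  have d: "((\<lambda>p. v \<bullet> (G p *v u)) has_derivative (\<lambda>h. v \<bullet> (frechet_derivative G (at p) h *v u))) (at p)" for v u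
    by (intro has_derivative_inner_right bounded_linear.has_derivative[OF bounded_bilinear.bounded_linear_left[OF bounded_bilinear_matrix_vector]]
        smooth_on_has_derivative[OF G_smooth p])
  have "((\<lambda>p. u \<bullet> (G p *v v)) has_derivative (\<lambda>h. v \<bullet> (frechet_derivative G (at p) h *v u))) (at p)"
    by (rule has_derivative_transform_within_open[OF d D_open p]) (rule posdef_sym[OF G_posdef])
  from has_derivative_unique[OF this d] show ?thesis by (rule fun_cong)
qed

text \<open>The desired relations are \<open>U\<^sub>x = 2 Re w\<close> and
  \<open>U\<^sub>y = - 2 Im w\<close>, but \<open>U\<close> is only a ray primitive of these data,
  and the equation for \<open>w\<close> is given without its component \<open>i2\<close>. The two
  real defects of that component and the failure of \<open>U\<close> to be a primitive are related
  by the derivatives of the null condition; this bounds the curl of the data by its own ray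
  integral, so it vanishes, and the other defects follow.\<close>

lemma disc_of_solution:
  fixes U :: "complex \<Rightarrow> real^'n" and t :: "complex \<Rightarrow> complex^'n" and l :: real
  defines "w \<equiv> \<lambda>z. null_vec (l, U z) (t z)"
  assumes fa: "Ck_on (Suc 0) UNIV fa" and fb: "Ck_on (Suc 0) UNIV fb"
    and U: "smooth_on (ball 0 1) U" and t: "smooth_on (ball 0 1) t"
    and Ueq: "\<And>z. U z = q + plane i1 i2 z + (Re z *\<^sub>R ray_int 0 fa z + Im z *\<^sub>R ray_int 0 fb z)"
    and dom: "\<And>z. z \<in> ball 0 1 \<Longrightarrow> ((l, U z), t z) \<in> qdom"
    and fa_eq: "\<And>z. z \<in> ball 0 1 \<Longrightarrow> fa z = 2 *\<^sub>R re_vec (w z) - e1"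
    and fb_eq: "\<And>z. z \<in> ball 0 1 \<Longrightarrow> fb z = (- 2) *\<^sub>R im_vec (w z) - e2"
    and cr: "\<And>z j. z \<in> ball 0 1 \<Longrightarrow> j \<noteq> i2 \<Longrightarrow>
      (frechet_derivative t (at z) 1 + \<i> *s frechet_derivative t (at z) \<i>) $ j =
      - 2 * complex_of_real ((gam (l, U z) (re_vec (w z)) + gam (l, U z) (im_vec (w z))) $ j)"
  shows "\<And>z. z \<in> ball 0 1 \<Longrightarrow> frechet_derivative U (at z) 1 = 2 *\<^sub>R re_vec (w z)"
    and "\<And>z. z \<in> ball 0 1 \<Longrightarrow> frechet_derivative U (at z) \<i> = (- 2) *\<^sub>R im_vec (w z)"
    and "\<And>z. z \<in> ball 0 1 \<Longrightarrow> tension (\<lambda>x. G (l, x)) U z = 0"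
proof -
  let ?B = "ball (0::complex) 1"
  define p where "p z = (l, U z)" for z
  define a b where "a z = re_vec (w z)" and "b z = im_vec (w z)" for z
  have pD: "p z \<in> D" if "z \<in> ?B" for z using dom[OF that] by (simp add: qdom_def p_def)
  have ps: "smooth_on ?B p" unfolding p_def[abs_def] by (intro smooth_on_Pair smooth_on_const U open_ball)
  have ws: "smooth_on ?B w" unfolding w_def
    using smooth_on_null_vec[OF open_ball ps t] dom by (simp add: p_def)
  have as: "smooth_on ?B a" and bs: "smooth_on ?B b"
    unfolding a_def[abs_def] b_def[abs_def]
    by (intro smooth_on_linear_comp[OF bounded_linear_re_vec] smooth_on_linear_comp[OF bounded_linear_im_vec] open_ball ws)+
  let ?U' = "\<lambda>z. frechet_derivative U (at z)" and ?t' = "\<lambda>z. frechet_derivative t (at z)"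
    and ?a' = "\<lambda>z. frechet_derivative a (at z)" and ?b' = "\<lambda>z. frechet_derivative b (at z)"
  note Ud = smooth_on_has_derivative[OF U] and td = smooth_on_has_derivative[OF t]
    and ad = smooth_on_has_derivative[OF as] and bd = smooth_on_has_derivative[OF bs]
  \<comment> \<open>\<open>k\<close> is the curl of the one-form \<open>fa dx + fb dy\<close>, and
    \<open>\<kappa>\<close> measures by how much the derivative of \<open>U\<close> deviates from
    the prescribed data.\<close>
  define k where "k y = frechet_derivative fa (at y) \<i> - frechet_derivative fb (at y) 1" for y
  define \<kappa> where "\<kappa> = ray_int 1 k"
  have kc: "continuous_on UNIV k" unfolding k_def[abs_def]
    by (intro continuous_on_diff C1_continuous_derivative[OF fa] C1_continuous_derivative[OF fb])
  have U': "?U' z v = plane i1 i2 v + (Re v *\<^sub>R fa z + Im v *\<^sub>R fb z + (Re z * Im v - Im z * Re v) *\<^sub>R \<kappa> z)" for z v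
  proof -
    have "((\<lambda>z. q + plane i1 i2 z + (Re z *\<^sub>R ray_int 0 fa z + Im z *\<^sub>R ray_int 0 fb z)) has_derivative
      (\<lambda>v. 0 + plane i1 i2 v + (Re v *\<^sub>R fa z + Im v *\<^sub>R fb z + (Re z * Im v - Im z * Re v) *\<^sub>R \<kappa> z))) (at z)"
      unfolding \<kappa>_def k_def[abs_def]
      by (intro has_derivative_add has_derivative_const bounded_linear_imp_has_derivative[OF bounded_linear_plane]
          ray_primitive_has_derivative fa fb)
    then have "(U has_derivative (\<lambda>v. 0 + plane i1 i2 v + (Re v *\<^sub>R fa z + Im v *\<^sub>R fb z + (Re z * Im v - Im z * Re v) *\<^sub>R \<kappa> z))) (at z)"
      unfolding Ueq[abs_def, symmetric] by simp
    then show ?thesis by (simp add: frechet_derivativeI)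
  qed
  have U1: "?U' z 1 = 2 *\<^sub>R a z - Im z *\<^sub>R \<kappa> z" and Ui: "?U' z \<i> = (- 2) *\<^sub>R b z + Re z *\<^sub>R \<kappa> z" if "z \<in> ?B" for z
    unfolding U' fa_eq[OF that] fb_eq[OF that] a_def b_def by (simp_all add: plane_def)
  have fa': "frechet_derivative fa (at z) v = 2 *\<^sub>R ?a' z v" if z: "z \<in> ?B" for z v
  proof -
    have "((\<lambda>z. 2 *\<^sub>R a z - e1) has_derivative (\<lambda>v. 2 *\<^sub>R ?a' z v - 0)) (at z)"
      by (intro has_derivative_diff has_derivative_scaleR_right has_derivative_const ad z)
    then have "(fa has_derivative (\<lambda>v. 2 *\<^sub>R ?a' z v - 0)) (at z)"
      by (rule has_derivative_transform_within_open[OF _ open_ball z]) (simp add: fa_eq a_def)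
    then show ?thesis by (simp add: frechet_derivativeI)
  qed
  have fb': "frechet_derivative fb (at z) v = (- 2) *\<^sub>R ?b' z v" if z: "z \<in> ?B" for z v
  proof -
    have "((\<lambda>z. (- 2) *\<^sub>R b z - e2) has_derivative (\<lambda>v. (- 2) *\<^sub>R ?b' z v - 0)) (at z)"
      by (intro has_derivative_diff has_derivative_scaleR_right has_derivative_const bd z)
    then have "(fb has_derivative (\<lambda>v. (- 2) *\<^sub>R ?b' z v - 0)) (at z)"
      by (rule has_derivative_transform_within_open[OF _ open_ball z]) (simp add: fb_eq b_def)
    then show ?thesis by (simp add: frechet_derivativeI)
  qed
  \<comment> \<open>Here \<open>P + \<i> S\<close> is
    \<open>(\<partial>\<^sub>x + \<i> \<partial>\<^sub>y) w\<close> and \<open>Q\<close> is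
    \<open>\<Gamma>(w, cnj w)\<close>, so the complete equation reads \<open>P = - 2 Q\<close> and
    \<open>S = 0\<close>.\<close>
  define P S Q where "P z = ?a' z 1 - ?b' z \<i>" and "S z = ?b' z 1 + ?a' z \<i>"
    and "Q z = gam (p z) (a z) + gam (p z) (b z)" for z
  have kS: "k z = 2 *\<^sub>R S z" if "z \<in> ?B" for z
    unfolding k_def fa'[OF that] fb'[OF that] S_def by (simp add: algebra_simps)
  have comp: "?a' z v $ j = Re (?t' z v $ j)" "?b' z v $ j = Im (?t' z v $ j)" if z: "z \<in> ?B" and j: "j \<noteq> i2" for z v j
  proof -
    have tj: "((\<lambda>z. t z $ j) has_derivative (\<lambda>v. ?t' z v $ j)) (at z)"
      by (rule bounded_linear.has_derivative[OF bounded_linear_vec_nth td[OF z]])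
    have aj: "((\<lambda>z. a z $ j) has_derivative (\<lambda>v. ?a' z v $ j)) (at z)"
      by (rule bounded_linear.has_derivative[OF bounded_linear_vec_nth ad[OF z]])
    have bj: "((\<lambda>z. b z $ j) has_derivative (\<lambda>v. ?b' z v $ j)) (at z)"
      by (rule bounded_linear.has_derivative[OF bounded_linear_vec_nth bd[OF z]])
    have eq: "(\<lambda>z. a z $ j) = (\<lambda>z. Re (t z $ j))" "(\<lambda>z. b z $ j) = (\<lambda>z. Im (t z $ j))"
      using j by (simp_all add: a_def b_def w_def re_vec_def im_vec_def null_vec_def)
    show "?a' z v $ j = Re (?t' z v $ j)"
      using fun_cong[OF has_derivative_unique[OF aj[unfolded eq] bounded_linear.has_derivative[OF bounded_linear_Re tj]]] .
    show "?b' z v $ j = Im (?t' z v $ j)"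
      using fun_cong[OF has_derivative_unique[OF bj[unfolded eq] bounded_linear.has_derivative[OF bounded_linear_Im tj]]] .
  qed
  have crj: "P z $ j = - 2 * Q z $ j" "S z $ j = 0" if z: "z \<in> ?B" and j: "j \<noteq> i2" for z j
    using cr[OF z j] unfolding P_def S_def Q_def
    by (simp_all add: comp[OF z j] complex_eq_iff a_def b_def p_def)
  \<comment> \<open>The defects of the dropped component. All other components of \<open>S\<close>
    vanish, so the curl is \<open>2 * \<sigma>\<close> times \<open>e2\<close>, and
    \<open>\<kappa>\<close> is a multiple of \<open>e2\<close> too.\<close>
  define \<sigma> \<pi> where "\<sigma> z = S z $ i2" and "\<pi> z = P z $ i2 + 2 * Q z $ i2" for z
  have S_eq: "S z = \<sigma> z *\<^sub>R e2" and P_eq: "P z = (- 2) *\<^sub>R Q z + \<pi> z *\<^sub>R e2" if z: "z \<in> ?B" for z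
    using crj[OF z] by (auto simp: vec_eq_iff axis_def \<sigma>_def \<pi>_def)
  have \<kappa>_eq: "\<kappa> z = \<kappa> z $ i2 *\<^sub>R e2" if z: "z \<in> ?B" for z
  proof -
    have "\<kappa> z $ j = 0" if j: "j \<noteq> i2" for j
    proof -
      have "\<kappa> z $ j = ray_int 1 (\<lambda>y. k y $ j) z"
        unfolding \<kappa>_def by (rule ray_int_linear_comp[OF bounded_linear_vec_nth kc])
      also have "\<dots> = ray_int 1 (\<lambda>y. 0) z"
        by (rule ray_int_cong) (use z j in \<open>auto simp: kS crj(2)\<close>)
      also have "\<dots> = 0" by (simp add: ray_int_def)
      finally show ?thesis .
    qed
    then show ?thesis by (auto simp: vec_eq_iff axis_def)
  qed
  define Gd where "Gd z h = frechet_derivative G (at (p z)) (0, h)" for z h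
  define m where "m z x y = x \<bullet> (G (p z) *v y)" for z x y
  define T where "T z h x y = x \<bullet> (Gd z h *v y)" for z h x y
  have Gdd: "((\<lambda>x. G (l, x)) has_derivative Gd z) (at (U z))" if "z \<in> ?B" for z
    using G_slice_has_derivative[OF pD[OF that]] by (simp add: p_def Gd_def[abs_def])
  have Gdl: "linear (Gd z)" if "z \<in> ?B" for z by (rule has_derivative_linear[OF Gdd[OF that]])
  have Tsym: "T z h x y = T z h y x" if "z \<in> ?B" for z h x y
    unfolding T_def Gd_def by (rule frechet_G_sym[OF pD[OF that]])
  have Tlin: "T z (h + h') x y = T z h x y + T z h' x y" "T z (c *\<^sub>R h) x y = c * T z h x y"
    "T z (h - h') x y = T z h x y - T z h' x y" if "z \<in> ?B" for z h h' c x y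
    unfolding T_def linear_add[OF Gdl[OF that]] linear_scale[OF Gdl[OF that]] linear_diff[OF Gdl[OF that]]
    by (simp_all add: matrix_vector_mult_add_rdistrib matrix_vector_mult_diff_rdistrib inner_add_right inner_diff_right
        scaleR_matrix_vector_assoc[symmetric])
  have msym: "m z x y = m z y x" if "z \<in> ?B" for z x y
    unfolding m_def by (rule posdef_sym[OF G_posdef[OF pD[OF that]]])
  have mlin: "m z x (y + y') = m z x y + m z x y'" "m z x (c *\<^sub>R y) = c * m z x y" "m z x (y - y') = m z x y - m z x y'" for z x y y' c
    unfolding m_def by (simp_all add: matrix_vector_right_distrib matrix_vector_mult_diff_distrib inner_add_right inner_diff_right matrix_vector_mult_scaleR)
  have kos: "2 * m z y (gam (p z) x) = 2 * T z x x y - T z y x x" if "z \<in> ?B" for z x y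
    using koszul[OF Gdd[OF that], of y x] posdef_invertible[OF G_posdef[OF pD[OF that]]]
    unfolding m_def T_def gam_def by (simp add: p_def)
  have md: "((\<lambda>z. m z (x z) (y z)) has_derivative
      (\<lambda>v. m z (x z) (y' v) + T z (?U' z v) (x z) (y z) + m z (y z) (x' v))) (at z)"
    if z: "z \<in> ?B" and x: "(x has_derivative x') (at z)" and y: "(y has_derivative y') (at z)" for x x' y y' z
  proof -
    have "((\<lambda>z. G (p z)) has_derivative (\<lambda>v. Gd z (?U' z v))) (at z)"
      unfolding p_def by (rule has_derivative_compose[OF Ud[OF z] Gdd[OF z]])
    from has_derivative_inner[OF x bounded_bilinear.FDERIV[OF bounded_bilinear_matrix_vector this y]]
    show ?thesis
      unfolding inner_add_right m_def[symmetric] T_def[symmetric] by (simp add: msym[OF z, of "y z"])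
  qed
  have null: "m z (a z) (a z) - m z (b z) (b z) = 0" "m z (a z) (b z) = 0" if "z \<in> ?B" for z
    using null_vec_null[OF dom[OF that]] by (simp_all add: m_def a_def b_def w_def p_def)
  have N1: "2 * m z (a z) (?a' z v) + T z (?U' z v) (a z) (a z) - 2 * m z (b z) (?b' z v) - T z (?U' z v) (b z) (b z) = 0"
    and N2: "m z (a z) (?b' z v) + T z (?U' z v) (a z) (b z) + m z (b z) (?a' z v) = 0" if z: "z \<in> ?B" for z v
    using has_derivative_zero_on_open[OF has_derivative_diff[OF md[OF z ad[OF z] ad[OF z]] md[OF z bd[OF z] bd[OF z]]] open_ball z null(1), of v]
      has_derivative_zero_on_open[OF md[OF z ad[OF z] bd[OF z]] open_ball z null(2), of v] by simp_all
  define A1 A2 where "A1 z = T z e2 (a z) (a z) - T z e2 (b z) (b z)" and "A2 z = T z e2 (a z) (b z)" for z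
  define \<alpha> \<gamma> where "\<alpha> z = m z (a z) e2" and "\<gamma> z = m z (b z) e2" for z
  \<comment> \<open>The derivatives of the two null conditions in the directions \<open>1\<close>
    and \<open>\<i>\<close> are combined in such a way that the derivatives of \<open>a\<close> and
    \<open>b\<close> enter through \<open>P\<close> and \<open>S\<close> only; \<open>kos\<close>
    then cancels \<open>Q\<close>. What remains is linear in \<open>\<pi>\<close> and
    \<open>\<sigma>\<close>, with coefficients \<open>\<alpha>\<close>, \<open>\<gamma>\<close> and
    with inhomogeneous terms proportional to \<open>\<kappa>\<close>.\<close>
  have E1: "2 * \<pi> z * \<alpha> z - 2 * \<sigma> z * \<gamma> z - Im z * \<kappa> z $ i2 * A1 z - 2 * Re z * \<kappa> z $ i2 * A2 z = 0"
    and E2: "2 * \<sigma> z * \<alpha> z + 2 * \<pi> z * \<gamma> z + Re z * \<kappa> z $ i2 * A1 z - 2 * Im z * \<kappa> z $ i2 * A2 z = 0" if z: "z \<in> ?B" for z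
  proof -
    let ?\<kappa> = "\<kappa> z $ i2"
    have T1: "T z (?U' z 1) x y = 2 * T z (a z) x y - Im z * ?\<kappa> * T z e2 x y" for x y
      unfolding U1[OF z] by (subst \<kappa>_eq[OF z]) (simp only: Tlin[OF z] mult.assoc)
    have Ti: "T z (?U' z \<i>) x y = - 2 * T z (b z) x y + Re z * ?\<kappa> * T z e2 x y" for x y
      unfolding Ui[OF z] by (subst \<kappa>_eq[OF z]) (simp only: Tlin[OF z] mult.assoc)
    have mP: "m z x (?a' z 1) - m z x (?b' z \<i>) = - 2 * (m z x (gam (p z) (a z)) + m z x (gam (p z) (b z))) + \<pi> z * m z x e2" for x
      using arg_cong[OF P_eq[OF z], of "m z x"] unfolding P_def Q_def mlin by simp
    have mS: "m z x (?b' z 1) + m z x (?a' z \<i>) = \<sigma> z * m z x e2" for x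
      using arg_cong[OF S_eq[OF z], of "m z x"] unfolding S_def mlin .
    note facts = kos[OF z, of "a z" "a z"] kos[OF z, of "a z" "b z"] kos[OF z, of "b z" "a z"] kos[OF z, of "b z" "b z"]
      mP[of "a z"] mP[of "b z"] mS[of "a z"] mS[of "b z"] Tsym[OF z, of "b z" "b z" "a z"] Tsym[OF z, of "a z" "b z" "a z"]
    show "2 * \<pi> z * \<alpha> z - 2 * \<sigma> z * \<gamma> z - Im z * ?\<kappa> * A1 z - 2 * Re z * ?\<kappa> * A2 z = 0"
      using N1[OF z, of 1] N2[OF z, of \<i>] facts unfolding T1 Ti A1_def A2_def \<alpha>_def \<gamma>_def by (simp add: algebra_simps)
    show "2 * \<sigma> z * \<alpha> z + 2 * \<pi> z * \<gamma> z + Re z * ?\<kappa> * A1 z - 2 * Im z * ?\<kappa> * A2 z = 0"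
      using N1[OF z, of \<i>] N2[OF z, of 1] facts unfolding T1 Ti A1_def A2_def \<alpha>_def \<gamma>_def by (simp add: algebra_simps)
  qed
  have nd: "(\<alpha> z)\<^sup>2 + (\<gamma> z)\<^sup>2 > 0" if z: "z \<in> ?B" for z
    using null_vec_nondegenerate[OF dom[OF z]] by (simp add: \<alpha>_def \<gamma>_def m_def a_def b_def w_def p_def)
  define c where "c z = (\<bar>\<alpha> z\<bar> + \<bar>\<gamma> z\<bar>) * (\<bar>A1 z\<bar> + 2 * \<bar>A2 z\<bar>) / ((\<alpha> z)\<^sup>2 + (\<gamma> z)\<^sup>2)" for z
  have k_le: "norm (k z) \<le> c z * (norm z * norm (\<kappa> z))" if z: "z \<in> ?B" for z
  proof -
    let ?\<kappa> = "\<kappa> z $ i2"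
    \<comment> \<open>Eliminates \<open>\<pi> z\<close> and leaves \<open>\<sigma> z\<close> with
      the coefficient \<open>2 * ((\<alpha> z)\<^sup>2 + (\<gamma> z)\<^sup>2)\<close>.\<close>
    have "\<alpha> z * (2 * \<sigma> z * \<alpha> z + 2 * \<pi> z * \<gamma> z + Re z * ?\<kappa> * A1 z - 2 * Im z * ?\<kappa> * A2 z)
        - \<gamma> z * (2 * \<pi> z * \<alpha> z - 2 * \<sigma> z * \<gamma> z - Im z * ?\<kappa> * A1 z - 2 * Re z * ?\<kappa> * A2 z) = 0"
      unfolding E1[OF z] E2[OF z] by simp
    then have "2 * \<sigma> z * ((\<alpha> z)\<^sup>2 + (\<gamma> z)\<^sup>2) =
        - ?\<kappa> * (Re z * (\<alpha> z * A1 z + 2 * \<gamma> z * A2 z) + Im z * (\<gamma> z * A1 z - 2 * \<alpha> z * A2 z))"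
      by (simp add: power2_eq_square algebra_simps)
    then have "\<bar>2 * \<sigma> z\<bar> * ((\<alpha> z)\<^sup>2 + (\<gamma> z)\<^sup>2) =
        \<bar>?\<kappa>\<bar> * \<bar>Re z * (\<alpha> z * A1 z + 2 * \<gamma> z * A2 z) + Im z * (\<gamma> z * A1 z - 2 * \<alpha> z * A2 z)\<bar>"
      using arg_cong[of _ _ abs] nd[OF z] by (metis (no_types, lifting) abs_minus_cancel abs_mult abs_of_pos)
    also have "\<bar>Re z * (\<alpha> z * A1 z + 2 * \<gamma> z * A2 z) + Im z * (\<gamma> z * A1 z - 2 * \<alpha> z * A2 z)\<bar> \<le>
        norm z * (\<bar>\<alpha> z * A1 z\<bar> + 2 * \<bar>\<gamma> z * A2 z\<bar>) + norm z * (\<bar>\<gamma> z * A1 z\<bar> + 2 * \<bar>\<alpha> z * A2 z\<bar>)"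
      by (intro order_trans[OF abs_triangle_ineq] add_mono, unfold abs_mult[of "Re z"] abs_mult[of "Im z"],
        intro mult_mono abs_Re_le_cmod, simp_all add: abs_Im_le_cmod mult_mono abs_triangle_ineq[THEN order_trans])
    also have "\<dots> = norm z * ((\<bar>\<alpha> z\<bar> + \<bar>\<gamma> z\<bar>) * (\<bar>A1 z\<bar> + 2 * \<bar>A2 z\<bar>))"
      by (simp add: abs_mult algebra_simps)
    finally have "\<bar>2 * \<sigma> z\<bar> * ((\<alpha> z)\<^sup>2 + (\<gamma> z)\<^sup>2) \<le> \<bar>?\<kappa>\<bar> * (norm z * ((\<bar>\<alpha> z\<bar> + \<bar>\<gamma> z\<bar>) * (\<bar>A1 z\<bar> + 2 * \<bar>A2 z\<bar>)))"
      by (simp add: mult_left_mono)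
    then have "\<bar>2 * \<sigma> z\<bar> \<le> c z * (norm z * \<bar>?\<kappa>\<bar>)"
      unfolding c_def using nd[OF z] by (simp add: field_simps)
    moreover have "norm (k z) = \<bar>2 * \<sigma> z\<bar>" unfolding kS[OF z] S_eq[OF z] by simp
    moreover have "norm (\<kappa> z) = \<bar>?\<kappa>\<bar>" by (subst \<kappa>_eq[OF z]) simp
    ultimately show ?thesis by simp
  qed
  have cc: "continuous_on ?B c"
  proof -
    have Gc: "continuous_on ?B (\<lambda>z. G (p z))"
      by (rule continuous_on_compose2[OF smooth_on_continuous[OF G_smooth] smooth_on_continuous[OF ps]]) (use pD in auto)
    have Hc: "continuous_on ?B (\<lambda>z. Gd z e2)"
      unfolding Gd_def
      by (rule continuous_on_compose2[OF smooth_on_continuous[OF smooth_on_frechet[OF G_smooth]] smooth_on_continuous[OF ps]]) (use pD in auto)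
    show ?thesis
      unfolding c_def[abs_def] \<alpha>_def \<gamma>_def A1_def A2_def m_def T_def
      by (intro continuous_on_divide continuous_intros bounded_bilinear.continuous_on[OF bounded_bilinear_matrix_vector]
          Gc Hc smooth_on_continuous[OF as] smooth_on_continuous[OF bs])
        (use nd[unfolded \<alpha>_def \<gamma>_def m_def, THEN less_imp_neq] in metis)
  qed
  \<comment> \<open>The factor \<open>c\<close> may be unbounded near the unit circle, so Gronwall's
    argument is run on the closed disc through \<open>z\<close>, where \<open>c\<close> is
    bounded.\<close>
  have k0: "k z = 0" if z: "z \<in> ?B" for z
  proof -
    define r where "r = norm z"
    have r: "cball 0 r \<subseteq> ?B" using z by (auto simp: r_def)
    have "compact (c ` cball 0 r)"
      by (intro compact_continuous_image continuous_on_subset[OF cc r] compact_cball)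
    then have "\<exists>C. \<forall>x\<in>c ` cball 0 r. norm x \<le> C"
      unfolding bounded_iff[symmetric] by (rule compact_imp_bounded)
    then obtain C where C: "\<forall>x\<in>c ` cball 0 r. norm x \<le> C" ..
    show ?thesis
    proof (rule ray_int_absorb[OF kc, of r C 1])
      fix y :: complex assume y: "y \<in> cball 0 r"
      then have "norm (k y) \<le> c y * (norm y * norm (\<kappa> y))" using k_le r by blast
      also have "\<dots> \<le> C * (norm y * norm (\<kappa> y))"
        using bspec[OF C imageI[OF y]] by (intro mult_right_mono) auto
      finally show "norm (k y) \<le> C * (norm y * norm (ray_int 1 k y))" by (simp add: \<kappa>_def)
    qed (simp add: r_def)
  qed
  have \<kappa>0: "\<kappa> z = 0" if z: "z \<in> ?B" for z
  proof -
    have "\<kappa> z = ray_int 1 (\<lambda>y. 0) z"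
      unfolding \<kappa>_def by (rule ray_int_cong) (use z in \<open>auto intro: k0\<close>)
    then show ?thesis by (simp add: ray_int_def)
  qed
  have S0: "S z = 0" and P0: "P z = (- 2) *\<^sub>R Q z" if z: "z \<in> ?B" for z
  proof -
    show S: "S z = 0" using kS[OF z] k0[OF z] by simp
    have "\<sigma> z = 0" using S by (simp add: \<sigma>_def)
    then have "\<pi> z * \<alpha> z = 0" "\<pi> z * \<gamma> z = 0" using E1[OF z] E2[OF z] \<kappa>0[OF z] by simp_all
    then have "\<pi> z = 0" using nd[OF z] by auto
    then show "P z = (- 2) *\<^sub>R Q z" using P_eq[OF z] by simp
  qed
  show U1': "?U' z 1 = 2 *\<^sub>R re_vec (w z)" if "z \<in> ?B" for z
    using U1[OF that] \<kappa>0[OF that] by (simp add: a_def)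
  show Ui': "?U' z \<i> = (- 2) *\<^sub>R im_vec (w z)" if "z \<in> ?B" for z
    using Ui[OF that] \<kappa>0[OF that] by (simp add: b_def)
  show "tension (\<lambda>x. G (l, x)) U z = 0" if z: "z \<in> ?B" for z
  proof -
    have "((\<lambda>z. ?U' z 1) has_derivative (\<lambda>v. 2 *\<^sub>R ?a' z v)) (at z)"
      by (rule has_derivative_transform_within_open[OF has_derivative_scaleR_right[OF ad[OF z]] open_ball z])
        (simp add: U1' a_def)
    moreover have "((\<lambda>z. ?U' z \<i>) has_derivative (\<lambda>v. (- 2) *\<^sub>R ?b' z v)) (at z)"
      by (rule has_derivative_transform_within_open[OF has_derivative_scaleR_right[OF bd[OF z]] open_ball z])
        (simp add: Ui' b_def)
    ultimately have "frechet_derivative (\<lambda>z. ?U' z 1) (at z) 1 + frechet_derivative (\<lambda>z. ?U' z \<i>) (at z) \<i> = 2 *\<^sub>R P z"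
      by (simp add: frechet_derivativeI P_def algebra_simps)
    also have "\<dots> = (- 4) *\<^sub>R Q z" by (simp add: P0[OF z])
    finally have "tension (\<lambda>x. G (l, x)) U z = (- 4) *\<^sub>R Q z + gam (p z) (2 *\<^sub>R a z) + gam (p z) ((- 2) *\<^sub>R b z)"
      unfolding tension_def U1'[OF z] Ui'[OF z] gam_def p_def a_def b_def by simp
    then show ?thesis unfolding gam_scale Q_def by (simp add: algebra_simps)
  qed
qed

end

section \<open>Initial data and the perturbation theorem\<close>

lemma matrix_vector_mult_minus: "A *v (- v) = - (A *v (v :: real^'n))" for A :: "real^'n^'m"
  using matrix_vector_mult_diff_distrib[of A 0 v] by simp

lemma csqrt_square_root:
  assumes "y\<^sup>2 = x" "Re y > 0" shows "csqrt x = y" "x \<notin> \<real>\<^sub>\<le>\<^sub>0"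
proof -
  show "csqrt x = y" using assms by (intro csqrt_unique) auto
  show "x \<notin> \<real>\<^sub>\<le>\<^sub>0"
  proof
    assume x: "x \<in> \<real>\<^sub>\<le>\<^sub>0"
    then have "Im x = 0" "Re x \<le> 0" by (auto elim: nonpos_Reals_cases)
    then have "2 * Re y * Im y = 0" "(Re y)\<^sup>2 - (Im y)\<^sup>2 \<le> 0"
      using assms(1) by (auto simp: power2_eq_square)
    moreover have "(Re y)\<^sup>2 > 0" using assms(2) by simp
    ultimately show False using assms(2) by auto
  qed
qed

context conformal_harmonic_family
begin

text \<open>The plane has \<open>\<partial>/\<partial>z\<close> derivative
  \<open>(e1 - \<i> e2) / 2\<close>; \<open>t0\<close> is this vector with the component
  \<open>i2\<close> erased, since \<open>null_vec\<close> recovers it.\<close>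

definition t0 :: "complex ^ 'n" where "t0 = (\<chi> j. if j = i1 then 1 / 2 else 0)"

definition base :: "complex \<Rightarrow> (real \<times> (real^'n)) \<times> (complex ^ 'n)" where
  "base z = ((0, plane i1 i2 z), t0)"

lemma sum_t0: "(\<Sum>k\<in>- {i2}. g k * t0 $ k) = g i1 / 2"
proof -
  have "(\<Sum>k\<in>- {i2}. g k * t0 $ k) = (\<Sum>k\<in>- {i2}. if k = i1 then g i1 / 2 else 0)"
    by (intro sum.cong refl) (simp add: t0_def)
  then show ?thesis using i12 by (simp add: sum.delta)
qed

lemma base_null:
  assumes z: "z \<in> cball 0 R"
  shows "base z \<in> qdom" "re_vec (null_vec (0, plane i1 i2 z) t0) = (1 / 2) *\<^sub>R e1"
    "im_vec (null_vec (0, plane i1 i2 z) t0) = (- 1 / 2) *\<^sub>R e2"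
proof -
  let ?p = "(0, plane i1 i2 z)"
  have p: "?p \<in> D" by (rule base_in[OF z])
  have i: "i1 \<in> - {i2}" using i12 by simp
  have b: "qb ?p t0 = 0"
    using base_conformal(2)[OF z] G_sym[OF p, of i2 i1] unfolding qb_def sum_t0 by simp
  have c: "qc ?p t0 = of_real (qa ?p) / 4"
  proof -
    have "qc ?p t0 = of_real (G ?p $ i1 $ i1) / 2 / 2"
      unfolding qc_def sum_t0 sum_divide_distrib[symmetric] ..
    then show ?thesis using base_conformal(1)[OF z] unfolding qa_def by simp
  qed
  have d: "(complex_of_real (qa ?p / 2))\<^sup>2 = qd ?p t0"
    unfolding qd_def b c by (simp add: power2_eq_square)
  have pos: "Re (complex_of_real (qa ?p / 2)) > 0" using qa_pos[OF p] by simp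
  note sq = csqrt_square_root[OF d pos]
  show "base z \<in> qdom" using sq(2) p by (simp add: base_def qdom_def)
  have "null_vec ?p t0 $ i2 = - \<i> / 2"
    using qa_pos[OF p] by (simp add: null_vec_def sq(1) b)
  then have "null_vec ?p t0 = (\<chi> j. if j = i2 then - \<i> / 2 else t0 $ j)"
    by (auto simp: null_vec_def vec_eq_iff)
  then show "re_vec (null_vec ?p t0) = (1 / 2) *\<^sub>R e1" "im_vec (null_vec ?p t0) = (- 1 / 2) *\<^sub>R e2"
    using i12 by (auto simp: re_vec_def im_vec_def vec_eq_iff t0_def axis_def)
qed

lemma tube: "\<exists>s>0. \<forall>z\<in>cball 0 R. \<forall>F. norm F \<le> s \<longrightarrow> base z + F \<in> qdom"
proof -
  have "continuous_on (cball 0 R) base"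
    unfolding base_def[abs_def]
    by (intro continuous_intros linear_continuous_on bounded_linear_plane)
  then have "compact (base ` cball 0 R)" by (rule compact_continuous_image) simp
  moreover have "base ` cball 0 R \<subseteq> qdom" using base_null(1) by blast
  ultimately obtain e where e: "e > 0" "(\<Union>x\<in>base ` cball 0 R. ball x e) \<subseteq> qdom"
    using compact_subset_open_imp_ball_epsilon_subset[OF _ qdom_open] by blast
  have "base z + F \<in> qdom" if "z \<in> cball 0 R" "norm F \<le> e / 2" for z F
  proof -
    have "base z + F \<in> ball (base z) e" using that e(1) by (simp add: dist_norm)
    then show ?thesis using e(2) that by blast
  qed
  then show ?thesis using e(1) by (intro exI[of _ "e / 2"]) auto
qed

text \<open>The second component of the system is prescribed at the centre in terms of
  \<open>w\<close>, while the wanted datum is the derivative \<open>\<eta>\<close> in direction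
  \<open>1\<close>, twice the real part of \<open>w\<close>. A null vector with that real part is
  written down explicitly and shown to be the one that \<open>null_vec\<close> selects.\<close>

lemma initial_data:
  assumes "\<epsilon> > 0"
  shows "\<exists>\<delta>>0. \<forall>l q \<eta>. \<bar>l\<bar> < \<delta> \<and> norm q < \<delta> \<and> norm (\<eta> - e1) < \<delta> \<longrightarrow>
    (\<exists>\<tau>. norm \<tau> < \<epsilon> \<and> ((l, q), t0 + \<tau>) \<in> qdom \<and> re_vec (null_vec (l, q) (t0 + \<tau>)) = (1 / 2) *\<^sub>R \<eta>)"
proof -
  define x0 where "x0 = ((0::real, 0::real^'n), e1)"
  define m where "m x u v = u \<bullet> (G (fst x) *v v)" for x :: "(real \<times> (real^'n)) \<times> (real^'n)" and u v
  \<comment> \<open>Gram-Schmidt: \<open>\<zeta>\<close> is \<open>e2\<close> made orthogonal to the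
    prescribed vector \<open>snd x\<close> and rescaled to its length, so that \<open>w\<close> is
    null with real part \<open>snd x / 2\<close>. At \<open>x0\<close> it equals
    \<open>e2\<close>.\<close>
  define \<zeta>' where "\<zeta>' x = e2 - (m x (snd x) e2 / m x (snd x) (snd x)) *\<^sub>R snd x" for x
  define \<zeta> where "\<zeta> x = sqrt (m x (snd x) (snd x) / m x (\<zeta>' x) (\<zeta>' x)) *\<^sub>R \<zeta>' x" for x
  define w where "w x = (1 / 2) *\<^sub>R complex_vec (snd x) - (\<i> / 2) *s complex_vec (\<zeta> x)" for x
  define t where "t x = (\<chi> j. if j = i2 then 0 else w x $ j)" for x
  \<comment> \<open>The square root of \<open>qd\<close> that corresponds to the root
    \<open>w x $ i2\<close>. Its real part is positive at \<open>x0\<close>, hence nearby, and this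
    identifies it with \<open>csqrt\<close>.\<close>
  define y where "y x = \<i> * (of_real (qa (fst x)) * w x $ i2 + qb (fst x) (t x))" for x
  have D0: "(0, 0) \<in> D" using base_in[of 0] R by (simp add: plane_def)
  have G0: "G (0, 0) $ i1 $ i1 = G (0, 0) $ i2 $ i2" "G (0, 0) $ i1 $ i2 = 0"
    using base_conformal[of 0] R by (simp_all add: plane_def)
  have mx0: "m x0 (axis i 1) (axis j 1) = G (0, 0) $ i $ j" for i j
    by (simp add: m_def x0_def inner_axis' matrix_vector_mult_basis column_def)
  have pos: "m x0 e1 e1 > 0" "m x0 e2 e2 > 0"
    using posdef_pos[OF G_posdef[OF D0]] by (simp_all add: m_def x0_def)
  have z0: "\<zeta>' x0 = e2" "\<zeta> x0 = e2"
    using pos mx0 G0 by (simp_all add: \<zeta>'_def \<zeta>_def, simp_all add: x0_def)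
  have w0: "w x0 $ j = (if j = i1 then 1 / 2 else 0) - (\<i> / 2) * (if j = i2 then 1 else 0)" for j
    unfolding w_def z0 by (simp add: x0_def complex_vec_def axis_def complex_eq_iff)
  have t0: "t x0 = t0" using i12 by (auto simp: t_def w0 t0_def vec_eq_iff)
  have qb0: "qb (0, 0) t0 = 0"
    using G0(2) G_sym[OF D0, of i2 i1] unfolding qb_def sum_t0 by simp
  have y0: "Re (y x0) > 0"
  proof -
    have "fst x0 = (0, 0)" by (simp add: x0_def)
    then show ?thesis using qa_pos[OF D0] i12 unfolding y_def t0 by (simp add: w0 qb0)
  qed
  have tid: "((\<lambda>x. x) \<longlongrightarrow> x0) (nhds x0)" by (rule filterlim_ident)
  have tG: "((\<lambda>x. G (fst x)) \<longlongrightarrow> G (fst x0)) (nhds x0)"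
  proof -
    have "isCont G (fst x0)"
      using smooth_on_continuous[OF G_smooth] D_open D0 by (simp add: continuous_on_eq_continuous_at x0_def)
    then show ?thesis
      by (rule isCont_tendsto_compose[OF _ tendsto_fst[OF tid]])
  qed
  have tm: "((\<lambda>x. m x (u x) (v x)) \<longlongrightarrow> m x0 (u x0) (v x0)) (nhds x0)"
    if "(u \<longlongrightarrow> u x0) (nhds x0)" "(v \<longlongrightarrow> v x0) (nhds x0)" for u v
    unfolding m_def by (intro tendsto_inner bounded_bilinear.tendsto[OF bounded_bilinear_matrix_vector] tG that)
  have ts: "(snd \<longlongrightarrow> snd x0) (nhds x0)" by (rule tendsto_snd[OF tid])
  have t\<zeta>': "(\<zeta>' \<longlongrightarrow> \<zeta>' x0) (nhds x0)"
    unfolding \<zeta>'_def[abs_def] by (intro tendsto_intros tm ts) (use pos in \<open>simp add: x0_def\<close>)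
  have t\<zeta>: "(\<zeta> \<longlongrightarrow> \<zeta> x0) (nhds x0)"
    unfolding \<zeta>_def[abs_def] by (intro tendsto_intros tm ts t\<zeta>') (use pos in \<open>simp add: z0\<close>)
  have tw: "(w \<longlongrightarrow> w x0) (nhds x0)"
    unfolding w_def[abs_def]
    by (intro tendsto_intros bounded_linear.tendsto[OF bounded_linear_complex_vec] ts t\<zeta>
        bounded_linear.tendsto[OF bounded_linear_vec_smult_right])
  have tt: "(t \<longlongrightarrow> t x0) (nhds x0)"
    unfolding t_def[abs_def]
  proof (rule tendsto_vec_lambda)
    show "((\<lambda>x. if j = i2 then 0 else w x $ j) \<longlongrightarrow> (if j = i2 then 0 else w x0 $ j)) (nhds x0)" for j
      using tendsto_vec_nth[OF tw] by (cases "j = i2") auto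
  qed
  have ty: "(y \<longlongrightarrow> y x0) (nhds x0)"
    unfolding y_def[abs_def] qa_def qb_def
    by (intro tendsto_intros tendsto_vec_nth tG tw tt)
  have "\<forall>\<^sub>F x in nhds x0. fst x \<in> D"
    using topological_tendstoD[OF tendsto_fst[OF tid] D_open] D0 by (simp add: x0_def)
  moreover have "\<forall>\<^sub>F x in nhds x0. m x (snd x) (snd x) > 0"
    by (rule order_tendstoD(1)[OF tm[OF ts ts]]) (use pos in \<open>simp add: x0_def\<close>)
  moreover have "\<forall>\<^sub>F x in nhds x0. m x (\<zeta>' x) (\<zeta>' x) > 0"
    by (rule order_tendstoD(1)[OF tm[OF t\<zeta>' t\<zeta>']]) (use pos in \<open>simp add: z0\<close>)
  moreover have "\<forall>\<^sub>F x in nhds x0. Re (y x) > 0"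
    by (rule order_tendstoD(1)[OF tendsto_Re[OF ty] y0])
  moreover have "\<forall>\<^sub>F x in nhds x0. dist (t x) t0 < \<epsilon>"
    using tendstoD[OF tt assms] by (simp add: t0)
  ultimately have "\<forall>\<^sub>F x in nhds x0. dist (t x) t0 < \<epsilon> \<and> (fst x, t x) \<in> qdom \<and> re_vec (null_vec (fst x) (t x)) = (1 / 2) *\<^sub>R snd x"
  proof eventually_elim
    case (elim x)
    let ?p = "fst x" and ?\<eta> = "snd x"
    have p: "?p \<in> D" by (rule elim(1))
    have msym: "m x u v = m x v u" for u v unfolding m_def by (rule posdef_sym[OF G_posdef[OF p]])
    have mlin: "m x u (v - v') = m x u v - m x u v'" "m x u (c *\<^sub>R v) = c * m x u v" for u v v' c
      unfolding m_def by (simp_all add: matrix_vector_mult_diff_distrib inner_diff_right matrix_vector_mult_scaleR)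
    have o: "m x ?\<eta> (\<zeta> x) = 0"
      unfolding \<zeta>_def mlin(2) using elim(2) unfolding \<zeta>'_def mlin by simp
    have e: "m x (\<zeta> x) (\<zeta> x) = m x ?\<eta> ?\<eta>"
    proof -
      let ?c = "sqrt (m x (snd x) (snd x) / m x (\<zeta>' x) (\<zeta>' x))"
      have "m x (\<zeta> x) (\<zeta> x) = ?c * m x (\<zeta> x) (\<zeta>' x)" unfolding \<zeta>_def[of x] by (rule mlin(2))
      also have "\<dots> = ?c * m x (\<zeta>' x) (\<zeta> x)" by (simp only: msym)
      also have "m x (\<zeta>' x) (\<zeta> x) = ?c * m x (\<zeta>' x) (\<zeta>' x)" unfolding \<zeta>_def[of x] by (rule mlin(2))
      finally show ?thesis using elim(2,3) by (simp add: mult.assoc[symmetric] power2_eq_square[symmetric])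
    qed
    have wr: "re_vec (w x) = (1 / 2) *\<^sub>R ?\<eta>" and wi: "im_vec (w x) = (- 1 / 2) *\<^sub>R \<zeta> x"
      by (simp_all add: w_def re_vec_def im_vec_def complex_vec_def vec_eq_iff)
    have q: "(\<Sum>j\<in>UNIV. \<Sum>k\<in>UNIV. complex_of_real (G ?p $ j $ k) * w x $ j * w x $ k) = 0"
      unfolding complex_quadratic_form[OF posdef_sym[OF G_posdef[OF p]]] wr wi
      using o e by (simp add: m_def complex_eq_iff matrix_vector_mult_scaleR matrix_vector_mult_minus)
    have bt: "qb ?p (w x) = qb ?p (t x)" "qc ?p (w x) = qc ?p (t x)"
      unfolding qb_def qc_def t_def by (auto intro!: sum.cong)
    have "of_real (qa ?p) * (of_real (qa ?p) * (w x $ i2)\<^sup>2 + 2 * qb ?p (t x) * w x $ i2 + qc ?p (t x)) = 0"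
      using q unfolding quadratic_split[OF p] bt by simp
    then have "(y x)\<^sup>2 = qd ?p (t x)"
      unfolding y_def qd_def by (simp add: power2_eq_square algebra_simps add_eq_0_iff)
    note sq = csqrt_square_root[OF this elim(4)]
    have "null_vec ?p (t x) $ i2 = w x $ i2"
      using qa_pos[OF p] by (simp add: null_vec_def sq(1)) (simp add: y_def algebra_simps)
    then have "null_vec ?p (t x) = w x" by (auto simp: null_vec_def t_def vec_eq_iff)
    then show ?case using elim(5) sq(2) p wr by (simp add: qdom_def)
  qed
  then obtain d where d: "d > 0" "\<And>x. dist x x0 < d \<Longrightarrow> dist (t x) t0 < \<epsilon> \<and> (fst x, t x) \<in> qdom \<and> re_vec (null_vec (fst x) (t x)) = (1 / 2) *\<^sub>R snd x"
    unfolding eventually_nhds_metric by blast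
  show ?thesis
  proof (intro exI[of _ "d / 3"] conjI allI impI)
    fix l :: real and q \<eta> :: "real^'n"
    assume a: "\<bar>l\<bar> < d / 3 \<and> norm q < d / 3 \<and> norm (\<eta> - e1) < d / 3"
    have "dist ((l, q), \<eta>) x0 = norm ((l, q), \<eta> - e1)" by (simp add: x0_def dist_norm)
    also have "\<dots> \<le> norm l + norm q + norm (\<eta> - e1)"
      using norm_Pair_le[of "(l, q)" "\<eta> - e1"] norm_Pair_le[of l q] by linarith
    also have "\<dots> < d" using a by simp
    finally show "\<exists>\<tau>. norm \<tau> < \<epsilon> \<and> ((l, q), t0 + \<tau>) \<in> qdom \<and> re_vec (null_vec (l, q) (t0 + \<tau>)) = (1 / 2) *\<^sub>R \<eta>"
      using d(2)[of "((l, q), \<eta>)"] by (intro exI[of _ "t ((l, q), \<eta>) - t0"]) (simp add: dist_norm)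
  qed (use d in simp)
qed

text \<open>The unknown is the deviation from \<open>base\<close>: of the parameter, of the point
  and of the free components of \<open>w\<close>. The equation is cut off away from the unit disc
  and away from the region where null vectors are parametrized; small solutions stay where the
  cut-off is \<open>1\<close>. The radius \<open>R > 1\<close> leaves room for it.\<close>

theorem nearby_discs:
  "\<exists>\<delta>>0. \<forall>l q \<eta>. \<bar>l\<bar> < \<delta> \<and> norm q < \<delta> \<and> norm (\<eta> - e1) < \<delta> \<longrightarrow>
    (\<exists>U. smooth_on (ball 0 1) U \<and> U 0 = q \<and> frechet_derivative U (at 0) 1 = \<eta> \<and>
      (\<forall>z\<in>ball 0 1. (l, U z) \<in> D \<and> frechet_derivative U (at z) 1 \<noteq> 0 \<and>
        frechet_derivative U (at z) 1 \<bullet> (G (l, U z) *v frechet_derivative U (at z) 1) =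
          frechet_derivative U (at z) \<i> \<bullet> (G (l, U z) *v frechet_derivative U (at z) \<i>) \<and>
        frechet_derivative U (at z) 1 \<bullet> (G (l, U z) *v frechet_derivative U (at z) \<i>) = 0 \<and>
        tension (\<lambda>x. G (l, x)) U z = 0))"
proof -
  obtain s0 where s0: "s0 > 0" "\<And>z F. z \<in> cball 0 R \<Longrightarrow> norm F \<le> s0 \<Longrightarrow> base z + F \<in> qdom"
    using tube by blast
  \<comment> \<open>The bound \<open>2 * s \<le> s0\<close> keeps the support of the cut-off inside
    the domain of \<open>hraw\<close>; \<open>s \<le> 1 / 8\<close> keeps the real part of the
    component \<open>i1\<close> of \<open>w\<close>, which is \<open>1 / 2\<close> for the plane,
    away from \<open>0\<close>.\<close>
  define s where "s = min s0 (1 / 4) / 2"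
  have s: "s > 0" "s \<le> 1 / 8" "2 * s \<le> s0" using s0 by (auto simp: s_def)
  \<comment> \<open>Squared norms keep the arguments of \<open>bump\<close> smooth. The first
    argument is affine in \<open>norm z\<close> squared, with value \<open>1\<close> at radius
    \<open>1\<close> and value \<open>2\<close> at radius \<open>R\<close>.\<close>
  define cut where "cut x = bump (((norm (fst x))\<^sup>2 - 1) / (R\<^sup>2 - 1) + 1) * bump ((norm (snd x))\<^sup>2 / s\<^sup>2)"
    for x :: "complex \<times> (real \<times> (real^'n)) \<times> (complex ^ 'n)"
  have R2: "R\<^sup>2 - 1 > 0" using R by (simp add: power_strict_mono[of 1 R 2, simplified])
  define K where "K = cball (0::complex) R \<times> cball (0 :: (real \<times> (real^'n)) \<times> (complex ^ 'n)) (2 * s)"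
  have cut0: "cut x = 0" if "x \<notin> K" for x
  proof -
    from that consider "norm (fst x) > R" | "norm (snd x) > 2 * s"
      by (cases x) (auto simp: K_def)
    then show ?thesis
    proof cases
      case 1
      then have "R\<^sup>2 \<le> (norm (fst x))\<^sup>2" using R by (intro power_mono) auto
      then have "((norm (fst x))\<^sup>2 - 1) / (R\<^sup>2 - 1) + 1 \<ge> 2" using R2 by (simp add: field_simps)
      then show ?thesis by (simp add: cut_def bump_eq_0)
    next
      case 2
      then have "(2 * s)\<^sup>2 \<le> (norm (snd x))\<^sup>2" using s by (intro power_mono) auto
      moreover have "2 * s\<^sup>2 \<le> (2 * s)\<^sup>2" by (simp add: power_mult_distrib)
      ultimately have "2 * s\<^sup>2 \<le> (norm (snd x))\<^sup>2" by (rule order_trans[rotated])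
      then have "(norm (snd x))\<^sup>2 / s\<^sup>2 \<ge> 2" using s by (simp add: pos_le_divide_eq)
      then show ?thesis by (simp add: cut_def bump_eq_0)
    qed
  qed
  have cut1: "cut (z, F) = 1" if "norm z \<le> 1" "norm F \<le> s" for z F
  proof -
    have "(norm z)\<^sup>2 \<le> 1" using that by (simp add: power_le_one)
    then have "((norm z)\<^sup>2 - 1) / (R\<^sup>2 - 1) + 1 \<le> 1" using R2 by (simp add: divide_le_0_iff)
    moreover have "(norm F)\<^sup>2 / s\<^sup>2 \<le> 1" using that s by (simp add: power_mono)
    ultimately show ?thesis by (simp add: cut_def bump_eq_1)
  qed
  have cuts: "smooth_on UNIV cut"
    unfolding cut_def[abs_def] divide_inverse
    by (intro smooth_on_mult smooth_on_bump smooth_on_add smooth_on_diff smooth_on_const smooth_on_norm_sq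
        smooth_on_fst smooth_on_snd smooth_on_ident open_UNIV)
  define dom where "dom = {x. base (fst x) + snd x \<in> qdom}"
  have bs: "smooth_on S (\<lambda>x. base (fst x) + snd x)" if "open S" for S :: "(complex \<times> (real \<times> (real^'n)) \<times> (complex ^ 'n)) set"
    unfolding base_def
    by (intro smooth_on_add smooth_on_Pair smooth_on_const smooth_on_linear_comp[OF bounded_linear_plane]
        smooth_on_fst smooth_on_snd smooth_on_ident that)
  have dom_open: "open dom"
  proof -
    have "open ((\<lambda>x. base (fst x) + snd x) -` qdom)"
      by (intro open_vimage qdom_open smooth_on_continuous bs open_UNIV)
    then show ?thesis by (simp add: dom_def vimage_def)
  qed
  have Kdom: "UNIV \<inter> K \<subseteq> dom" using s0(2) s by (auto simp: K_def dom_def)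
  define pt where "pt x = fst (base (fst x) + snd x)" for x
  define wv where "wv x = null_vec (pt x) (snd (base (fst x) + snd x))" for x
  \<comment> \<open>The first two entries are the partial derivatives wanted for \<open>U\<close>
    minus the plane; their zeros keep the parameter \<open>l\<close> constant. The last entry is the
    right-hand side \<open>- \<Gamma>(w, cnj w)\<close> of the equation for
    \<open>\<partial>w/\<partial>z\<^sup>-\<close>.\<close>
  define hraw where "hraw x = (((0::real, 2 *\<^sub>R re_vec (wv x) - e1), (0::real, (- 2) *\<^sub>R im_vec (wv x) - e2)),
      - complex_vec (gam (pt x) (re_vec (wv x)) + gam (pt x) (im_vec (wv x))))" for x
  have wvs: "smooth_on dom wv"
    unfolding wv_def[abs_def] pt_def
    by (rule smooth_on_null_vec[OF dom_open smooth_on_fst[OF dom_open bs[OF dom_open]] smooth_on_snd[OF dom_open bs[OF dom_open]]])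
      (simp only: dom_def mem_Collect_eq prod.collapse)
  have pts: "smooth_on dom pt" unfolding pt_def[abs_def] by (rule smooth_on_fst[OF dom_open bs[OF dom_open]])
  have ptD: "pt x \<in> D" if "x \<in> dom" for x using that by (simp add: dom_def qdom_def pt_def)
  have hraws: "smooth_on dom hraw"
    unfolding hraw_def[abs_def]
    by (intro smooth_on_Pair smooth_on_const smooth_on_diff smooth_on_linear_comp[OF bounded_linear_scaleR_right]
        smooth_on_linear_comp[OF bounded_linear_re_vec] smooth_on_linear_comp[OF bounded_linear_im_vec]
        smooth_on_minus smooth_on_linear_comp[OF bounded_linear_complex_vec] smooth_on_add smooth_on_gam pts wvs dom_open ptD)
  define h where "h x = cut x *\<^sub>R hraw x" for x
  have hs: "smooth_on UNIV h"
    unfolding h_def[abs_def]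
    by (rule smooth_on_cutoff[OF cuts open_UNIV hraws dom_open _ Kdom cut0])
      (simp add: K_def closed_Times)
  \<comment> \<open>The given plane solves the equation: its own derivatives make the first entries
    of \<open>hraw\<close> vanish, and \<open>base_harmonic\<close> removes the last one.\<close>
  have h0: "h (z, 0) = 0" for z
  proof (cases "z \<in> cball 0 R")
    case True
    have pw: "pt (z, 0) = (0, plane i1 i2 z)" "wv (z, 0) = null_vec (0, plane i1 i2 z) t0"
      by (simp_all add: pt_def wv_def base_def)
    have gz: "gam (0, plane i1 i2 z) ((1 / 2) *\<^sub>R e1) + gam (0, plane i1 i2 z) ((- 1 / 2) *\<^sub>R e2) = 0"
      using base_harmonic[OF True] unfolding gam_scale by (simp add: gam_def power2_eq_square scaleR_add_right[symmetric])
    have "hraw (z, 0) = 0"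
      unfolding hraw_def pw base_null(2,3)[OF True] gz by (simp add: complex_vec_def vec_eq_iff zero_prod_def)
    then show ?thesis by (simp add: h_def)
  next
    case False
    then show ?thesis using cut0[of "(z, 0)"] by (simp add: h_def K_def)
  qed
  have hsupp: "h (z, x) = 0" if "norm z > R \<or> norm x > 2 * s" for z x
    using cut0[of "(z, x)"] that by (auto simp: h_def K_def)
  have "R \<ge> 0" using R by simp
  from cauchy_riemann_ray_system[OF hs h0 hsupp s(1) this]
  obtain \<delta>1 where "\<delta>1 > 0 \<and> (\<forall>x0. norm x0 < \<delta>1 \<longrightarrow>
     (\<exists>F. smooth_on UNIV F \<and> (\<forall>z\<in>cball 0 R. norm (F z) < s) \<and>
      (\<forall>z. fst (F z) = fst x0 + ray_op 0 (\<lambda>z. h (z, F z)) z) \<and> snd (F 0) = snd x0 \<and>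
      (\<forall>z\<in>cball 0 R. frechet_derivative (\<lambda>z. snd (F z)) (at z) 1 +
          \<i> *s frechet_derivative (\<lambda>z. snd (F z)) (at z) \<i> = 2 *\<^sub>R snd (h (z, F z)))))" ..
  note \<delta>1 = conjunct1[OF this] and core = conjunct2[OF this, rule_format]
  obtain \<delta>2 where \<delta>2: "\<delta>2 > 0" and init: "\<And>l q \<eta>. \<bar>l\<bar> < \<delta>2 \<Longrightarrow> norm q < \<delta>2 \<Longrightarrow> norm (\<eta> - e1) < \<delta>2 \<Longrightarrow>
    \<exists>\<tau>. norm \<tau> < \<delta>1 / 3 \<and> ((l, q), t0 + \<tau>) \<in> qdom \<and> re_vec (null_vec (l, q) (t0 + \<tau>)) = (1 / 2) *\<^sub>R \<eta>"
    using initial_data[of "\<delta>1 / 3"] \<delta>1 by auto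
  show ?thesis
  proof (intro exI[of _ "min \<delta>2 (\<delta>1 / 3)"] conjI allI impI)
    show "min \<delta>2 (\<delta>1 / 3) > 0" using \<delta>1 \<delta>2 by simp
    fix l :: real and q \<eta> :: "real^'n"
    assume a: "\<bar>l\<bar> < min \<delta>2 (\<delta>1 / 3) \<and> norm q < min \<delta>2 (\<delta>1 / 3) \<and> norm (\<eta> - e1) < min \<delta>2 (\<delta>1 / 3)"
    then obtain \<tau> where \<tau>: "norm \<tau> < \<delta>1 / 3" "re_vec (null_vec (l, q) (t0 + \<tau>)) = (1 / 2) *\<^sub>R \<eta>"
      using init[of l q \<eta>] by auto
    have "norm ((l, q), \<tau>) \<le> norm l + norm q + norm \<tau>"
      using norm_Pair_le[of "(l, q)" \<tau>] norm_Pair_le[of l q] by linarith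
    also have "\<dots> < \<delta>1" using a \<tau>(1) by simp
    finally obtain F where Fs: "smooth_on UNIV F" and Fn: "\<And>z. z \<in> cball 0 R \<Longrightarrow> norm (F z) < s"
      and F1: "\<And>z. fst (F z) = (l, q) + ray_op 0 (\<lambda>z. h (z, F z)) z" and F2: "snd (F 0) = \<tau>"
      and Fcr: "\<And>z. z \<in> cball 0 R \<Longrightarrow> frechet_derivative (\<lambda>z. snd (F z)) (at z) 1 +
          \<i> *s frechet_derivative (\<lambda>z. snd (F z)) (at z) \<i> = 2 *\<^sub>R snd (h (z, F z))"
      using core[of "((l, q), \<tau>)"] unfolding fst_conv snd_conv by blast
    define f where "f z = h (z, F z)" for z
    have fs: "smooth_on UNIV f" unfolding f_def[abs_def]
      by (rule smooth_on_comp[OF open_UNIV open_UNIV hs smooth_on_Pair[OF open_UNIV smooth_on_ident[OF open_UNIV] Fs] UNIV_I])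
    define fa fb where "fa z = snd (fst (fst (f z)))" and "fb z = snd (snd (fst (f z)))" for z
    have fa: "smooth_on UNIV fa" and fb: "smooth_on UNIV fb"
      unfolding fa_def[abs_def] fb_def[abs_def] by (intro smooth_on_fst smooth_on_snd fs open_UNIV)+
    have fc: "continuous_on UNIV (\<lambda>z. fst (fst (f z)))" "continuous_on UNIV (\<lambda>z. snd (fst (f z)))"
      by (intro smooth_on_continuous smooth_on_fst smooth_on_snd fs open_UNIV)+
    have zero: "fst (fst (fst (f z))) = 0" "fst (snd (fst (f z))) = 0" for z by (simp_all add: f_def h_def hraw_def)
    have ray: "ray_op 0 f z = (0, Re z *\<^sub>R ray_int 0 fa z + Im z *\<^sub>R ray_int 0 fb z)" for z
      using ray_int_linear_comp[OF bounded_linear_fst fc(1), of 0 z] ray_int_linear_comp[OF bounded_linear_fst fc(2), of 0 z]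
        ray_int_linear_comp[OF bounded_linear_snd fc(1), of 0 z] ray_int_linear_comp[OF bounded_linear_snd fc(2), of 0 z]
      unfolding zero fa_def[symmetric] fb_def[symmetric]
      by (simp add: ray_op_def prod_eq_iff) (simp add: ray_int_def)
    define U t where "U z = plane i1 i2 z + snd (fst (F z))" and "t z = t0 + snd (F z)" for z
    have F_eq: "fst (F z) = (l, q + (Re z *\<^sub>R ray_int 0 fa z + Im z *\<^sub>R ray_int 0 fb z))" for z
      using F1[of z] unfolding f_def[symmetric] ray by simp
    have pt_eq: "base z + F z = ((l, U z), t z)" for z
      using F_eq[of z] by (simp add: base_def U_def t_def prod_eq_iff)
    have wv_eq: "wv (z, F z) = null_vec (l, U z) (t z)" "pt (z, F z) = (l, U z)" for z
      by (simp_all add: wv_def pt_def pt_eq)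
    have inR: "z \<in> cball 0 R" if "z \<in> ball 0 1" for z using that R by simp
    have dom: "((l, U z), t z) \<in> qdom" if "z \<in> ball 0 1" for z
      unfolding pt_eq[symmetric] using Fn[OF inR[OF that]] s by (intro s0(2) inR that) auto
    have f_eq: "f z = hraw (z, F z)" if "z \<in> ball 0 1" for z
      using cut1[of z "F z"] Fn[OF inR[OF that]] that by (simp add: f_def h_def)
    have Us: "smooth_on (ball 0 1) U" and ts: "smooth_on (ball 0 1) t"
      unfolding U_def[abs_def] t_def[abs_def]
      by (intro smooth_on_add smooth_on_const smooth_on_bounded_linear bounded_linear_plane smooth_on_fst smooth_on_snd
          smooth_on_subset[OF Fs] open_ball subset_UNIV)+
    have t': "frechet_derivative t (at z) = frechet_derivative (\<lambda>z. snd (F z)) (at z)" for z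
    proof -
      have "((\<lambda>z. t0 + snd (F z)) has_derivative (\<lambda>v. 0 + frechet_derivative (\<lambda>z. snd (F z)) (at z) v)) (at z)"
        by (intro has_derivative_add has_derivative_const smooth_on_has_derivative[OF smooth_on_snd[OF open_UNIV Fs]] UNIV_I)
      then show ?thesis unfolding t_def[symmetric] by (simp add: frechet_derivativeI)
    qed
    have Ueq: "U z = q + plane i1 i2 z + (Re z *\<^sub>R ray_int 0 fa z + Im z *\<^sub>R ray_int 0 fb z)" for z
      using F_eq[of z] by (simp add: U_def)
    have fa': "fa z = 2 *\<^sub>R re_vec (null_vec (l, U z) (t z)) - e1" if "z \<in> ball 0 1" for z
      unfolding fa_def f_eq[OF that] by (simp add: hraw_def wv_eq)
    have fb': "fb z = (- 2) *\<^sub>R im_vec (null_vec (l, U z) (t z)) - e2" if "z \<in> ball 0 1" for z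
      unfolding fb_def f_eq[OF that] by (simp add: hraw_def wv_eq)
    have cr: "(frechet_derivative t (at z) 1 + \<i> *s frechet_derivative t (at z) \<i>) $ j =
        - 2 * complex_of_real ((gam (l, U z) (re_vec (null_vec (l, U z) (t z))) + gam (l, U z) (im_vec (null_vec (l, U z) (t z)))) $ j)"
      if "z \<in> ball 0 1" "j \<noteq> i2" for z j
      unfolding t' Fcr[OF inR[OF that(1)]] f_def[symmetric] f_eq[OF that(1)]
      by (simp add: hraw_def wv_eq complex_vec_def) (simp add: complex_eq_iff)?
    note sol' = disc_of_solution[OF smooth_onD[OF fa] smooth_onD[OF fb] Us ts Ueq dom fa' fb' cr]
    have sol: "frechet_derivative U (at z) 1 = 2 *\<^sub>R re_vec (null_vec (l, U z) (t z))"
        "frechet_derivative U (at z) \<i> = (- 2) *\<^sub>R im_vec (null_vec (l, U z) (t z))"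
        "tension (\<lambda>x. G (l, x)) U z = 0" if "z \<in> ball 0 1" for z
      subgoal by (rule sol'(1)) (assumption | rule that)+
      subgoal by (rule sol'(2)) (assumption | rule that)+
      subgoal by (rule sol'(3)) (assumption | rule that)+
      done
    have U0: "U 0 = q" using F_eq[of 0] by (simp add: U_def plane_def)
    have "t 0 = t0 + \<tau>" by (simp add: t_def F2)
    then have U'0: "frechet_derivative U (at 0) 1 = \<eta>"
      using sol(1)[of 0] \<tau>(2) U0 by simp
    \<comment> \<open>Its component \<open>i1\<close> is \<open>1\<close> plus twice a number of
      modulus below \<open>1 / 8\<close>.\<close>
    have nz: "frechet_derivative U (at z) 1 \<noteq> 0" if z: "z \<in> ball 0 1" for z
    proof -
      have "norm (snd (F z) $ i1) \<le> norm (F z)"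
        using Finite_Cartesian_Product.norm_nth_le[of "snd (F z)" i1] norm_snd_le[of "snd (F z)" "fst (F z)"] by simp
      then have "\<bar>Re (snd (F z) $ i1)\<bar> < 1 / 8"
        using abs_Re_le_cmod[of "snd (F z) $ i1"] Fn[OF inR[OF z]] s(2) by linarith
      moreover have "frechet_derivative U (at z) 1 $ i1 = 2 * (1 / 2 + Re (snd (F z) $ i1))"
        unfolding sol(1)[OF z] using i12 by (simp add: re_vec_def null_vec_def t_def t0_def)
      ultimately have "frechet_derivative U (at z) 1 $ i1 \<noteq> 0" by auto
      then show ?thesis by auto
    qed
    show "\<exists>U. smooth_on (ball 0 1) U \<and> U 0 = q \<and> frechet_derivative U (at 0) 1 = \<eta> \<and>
      (\<forall>z\<in>ball 0 1. (l, U z) \<in> D \<and> frechet_derivative U (at z) 1 \<noteq> 0 \<and>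
        frechet_derivative U (at z) 1 \<bullet> (G (l, U z) *v frechet_derivative U (at z) 1) =
          frechet_derivative U (at z) \<i> \<bullet> (G (l, U z) *v frechet_derivative U (at z) \<i>) \<and>
        frechet_derivative U (at z) 1 \<bullet> (G (l, U z) *v frechet_derivative U (at z) \<i>) = 0 \<and>
        tension (\<lambda>x. G (l, x)) U z = 0)"
    proof (intro exI[of _ U] conjI ballI Us U0 U'0)
      fix z :: complex assume z: "z \<in> ball 0 1"
      show "(l, U z) \<in> D" using dom[OF z] by (simp add: qdom_def)
      show "frechet_derivative U (at z) 1 \<noteq> 0" by (rule nz[OF z])
      show "frechet_derivative U (at z) 1 \<bullet> (G (l, U z) *v frechet_derivative U (at z) 1) =
          frechet_derivative U (at z) \<i> \<bullet> (G (l, U z) *v frechet_derivative U (at z) \<i>)"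
        unfolding sol(1,2)[OF z] using null_vec_null(1)[OF dom[OF z]] by (simp add: matrix_vector_mult_scaleR matrix_vector_mult_minus)
      show "frechet_derivative U (at z) 1 \<bullet> (G (l, U z) *v frechet_derivative U (at z) \<i>) = 0"
        unfolding sol(1,2)[OF z] using null_vec_null(2)[OF dom[OF z]] by (simp add: matrix_vector_mult_scaleR matrix_vector_mult_minus)
      show "tension (\<lambda>x. G (l, x)) U z = 0" by (rule sol(3)[OF z])
    qed
  qed
qed

end

section \<open>Smooth maps into a Riemannian manifold\<close>

definition smooth_into ::
  "'a topology \<Rightarrow> ('a, 'n::finite) chart set \<Rightarrow> 'b::euclidean_space set \<Rightarrow> ('b \<Rightarrow> 'a) \<Rightarrow> bool" where
  "smooth_into X A S f \<longleftrightarrow> continuous_map (top_of_set S) X f \<and>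
     (\<forall>c\<in>A. smooth_on {x \<in> S. f x \<in> fst c} (\<lambda>x. snd c (f x)))"

definition tangent_map ::
  "('a, 'n::finite) chart set \<Rightarrow> ('b::euclidean_space \<Rightarrow> 'a) \<Rightarrow> 'b \<Rightarrow> 'b \<Rightarrow> ('a, 'n) tvec" where
  "tangent_map A f x e =
     (\<lambda>c. if c \<in> A \<and> f x \<in> fst c then frechet_derivative (\<lambda>w. snd c (f w)) (at x) e else 0)"

lemma differential_eq_tangent_map: "differential A u = tangent_map A u"
  by (simp add: fun_eq_iff differential_def tangent_map_def)

lemma smooth_disc_map_iff: "smooth_disc_map X A u \<longleftrightarrow> smooth_into X A unit_disc u"
  by (simp add: smooth_disc_map_def smooth_into_def)

context smooth_manifold
begin

lemma smooth_into_chart: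
  assumes "smooth_into X A S f" "c \<in> A" shows "smooth_on {x \<in> S. f x \<in> fst c} (\<lambda>x. snd c (f x))"
  using assms by (simp add: smooth_into_def)

lemma smooth_into_open:
  assumes "smooth_into X A S f" "c \<in> A" "open S" shows "open {x \<in> S. f x \<in> fst c}"
proof -
  have "openin (top_of_set S) {x \<in> topspace (top_of_set S). f x \<in> fst c}"
    using assms(1) chart_open[OF assms(2)] unfolding smooth_into_def by (intro openin_continuous_map_preimage) auto
  then show ?thesis using assms(3) by (simp add: openin_open_eq)
qed

lemma smooth_into_topspace:
  assumes "smooth_into X A S f" "x \<in> S" shows "f x \<in> topspace X"
  using assms continuous_map_image_subset_topspace unfolding smooth_into_def by fastforce

lemma ex_chart:
  assumes "p \<in> topspace X" obtains c where "c \<in> A" "p \<in> fst c"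
  using assms covers by blast

lemma smooth_into_has_derivative:
  assumes "smooth_into X A S f" "open S" "c \<in> A" "x \<in> S" "f x \<in> fst c"
  shows "((\<lambda>x. snd c (f x)) has_derivative frechet_derivative (\<lambda>x. snd c (f x)) (at x)) (at x)"
  using smooth_on_has_derivative[OF smooth_into_chart[OF assms(1,3)]] assms(4,5) by blast

lemma smooth_into_subset: "smooth_into X A S f \<Longrightarrow> T \<subseteq> S \<Longrightarrow> smooth_into X A T f"
  unfolding smooth_into_def
  by (auto intro: continuous_map_from_subtopology_mono smooth_on_subset)

lemma smooth_into_comp:
  assumes f: "smooth_into X A S f" "open S" and g: "smooth_on T g" "open T" and gS: "\<And>x. x \<in> T \<Longrightarrow> g x \<in> S"
  shows "smooth_into X A T (\<lambda>x. f (g x))"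
  unfolding smooth_into_def
proof (intro conjI ballI)
  have "continuous_map (top_of_set T) (top_of_set S) g"
    using smooth_on_continuous[OF g(1)] gS by auto
  then show "continuous_map (top_of_set T) X (\<lambda>x. f (g x))"
    using continuous_map_compose[of "top_of_set T" "top_of_set S" g X f] f(1) by (simp add: o_def smooth_into_def)
  fix c assume c: "c \<in> A"
  have o: "open {x \<in> T. f (g x) \<in> fst c}"
  proof -
    have "{x \<in> T. f (g x) \<in> fst c} = T \<inter> g -` {x \<in> S. f x \<in> fst c}" using gS by auto
    then show ?thesis
      using continuous_open_preimage[OF smooth_on_continuous[OF g(1)] g(2) smooth_into_open[OF f(1) c f(2)]] by simp
  qed
  show "smooth_on {x \<in> T. f (g x) \<in> fst c} (\<lambda>x. snd c (f (g x)))"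
    by (rule smooth_on_comp[OF o smooth_into_open[OF f(1) c f(2)] smooth_into_chart[OF f(1) c] smooth_on_subset[OF g(1)]])
      (use gS in auto)
qed

lemma tangent_map_comp:
  assumes f: "smooth_into X A S f" "open S" and g: "(g has_derivative g') (at x)" and gS: "g x \<in> S"
  shows "tangent_map A (\<lambda>x. f (g x)) x e = tangent_map A f (g x) (g' e)"
proof
  fix c
  show "tangent_map A (\<lambda>x. f (g x)) x e c = tangent_map A f (g x) (g' e) c"
  proof (cases "c \<in> A \<and> f (g x) \<in> fst c")
    case True
    then have "((\<lambda>x. snd c (f (g x))) has_derivative
        (\<lambda>e. frechet_derivative (\<lambda>x. snd c (f x)) (at (g x)) (g' e))) (at x)"
      by (intro has_derivative_compose[OF g] smooth_into_has_derivative[OF f _ gS]) auto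
    then show ?thesis using True by (simp add: tangent_map_def frechet_derivativeI)
  qed (auto simp: tangent_map_def)
qed

lemma tangent_map_in_tangent_space:
  assumes f: "smooth_into X A S f" "open S" "x \<in> S"
  shows "tangent_map A f x e \<in> tangent_space A (f x)"
  unfolding tangent_space_def mem_Collect_eq
proof (intro conjI allI impI ballI)
  show "tangent_map A f x e c = 0" if "\<not> (c \<in> A \<and> f x \<in> fst c)" for c
    using that by (auto simp: tangent_map_def)
  fix c d assume c: "c \<in> A" and d: "d \<in> A" and fx: "f x \<in> fst c \<and> f x \<in> fst d"
  have fc: "((\<lambda>x. snd c (f x)) has_derivative frechet_derivative (\<lambda>x. snd c (f x)) (at x)) (at x)"
    by (rule smooth_into_has_derivative[OF f(1,2) c f(3)]) (use fx in simp)
  have "((\<lambda>x. transition c d (snd c (f x))) has_derivative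
      (\<lambda>e. frechet_derivative (transition c d) (at (snd c (f x))) (frechet_derivative (\<lambda>x. snd c (f x)) (at x) e))) (at x)"
    by (rule has_derivative_compose[OF fc transition_has_derivative[OF c d]]) (use fx in auto)
  then have "((\<lambda>x. snd d (f x)) has_derivative
      (\<lambda>e. frechet_derivative (transition c d) (at (snd c (f x))) (frechet_derivative (\<lambda>x. snd c (f x)) (at x) e))) (at x)"
    by (rule has_derivative_transform_within_open[OF _ smooth_into_open[OF f(1) c f(2)]])
      (use f(3) fx in \<open>auto simp: transition_def chart_inv_chart[OF c]\<close>)
  then show "tangent_map A f x e d = frechet_derivative (transition c d) (at (snd c (f x))) (tangent_map A f x e c)"
    using c d fx by (simp add: tangent_map_def frechet_derivativeI)
qed

lemma tangent_space_eqI: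
  assumes "v \<in> tangent_space A p" "w \<in> tangent_space A p" "c \<in> A" "p \<in> fst c" "v c = w c"
  shows "v = w"
proof
  fix d
  show "v d = w d"
  proof (cases "d \<in> A \<and> p \<in> fst d")
    case True
    have "u d = frechet_derivative (transition c d) (at (snd c p)) (u c)" if "u \<in> tangent_space A p" for u
      using that assms(3,4) True unfolding tangent_space_def by blast
    from this[OF assms(1)] this[OF assms(2)] show ?thesis using assms(5) by simp
  next
    case False
    have "u d = 0" if "u \<in> tangent_space A p" for u
      using that False unfolding tangent_space_def by blast
    from this[OF assms(1)] this[OF assms(2)] show ?thesis by simp
  qed
qed

lemma tvec_of_coords_self:
  assumes "c \<in> A" "p \<in> fst c" shows "tvec_of_coords A c p w c = w"
proof -
  have "((\<lambda>x. x) has_derivative (\<lambda>v. v)) (at (snd c p))" by (rule has_derivative_ident)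
  then have "(transition c c has_derivative (\<lambda>v. v)) (at (snd c p))"
    by (rule has_derivative_transform_within_open[OF _ overlap_open[OF assms(1,1)]])
      (use assms in \<open>auto simp: transition_def chart_inv_chart\<close>)
  then show ?thesis using assms by (simp add: tvec_of_coords_def frechet_derivativeI)
qed

lemma tvec_of_coords_of_component:
  assumes "v \<in> tangent_space A p" "c \<in> A" "p \<in> fst c" shows "tvec_of_coords A c p (v c) = v"
  by (rule tangent_space_eqI[OF tvec_of_coords_in_tangent_space[OF assms(2,3)] assms tvec_of_coords_self[OF assms(2,3)]])

lemma tvec_of_coords_linear:
  assumes "c \<in> A" "p \<in> fst c"
  shows "tvec_of_coords A c p (v + w) = tvec_add (tvec_of_coords A c p v) (tvec_of_coords A c p w)"
    and "tvec_of_coords A c p (r *\<^sub>R v) = tvec_scale r (tvec_of_coords A c p v)"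
proof -
  have lin: "linear (frechet_derivative (transition c d) (at (snd c p)))" if "d \<in> A" "p \<in> fst d" for d
    using has_derivative_linear[OF transition_has_derivative[OF assms(1) that(1) assms(2) that(2)]] .
  show "tvec_of_coords A c p (v + w) = tvec_add (tvec_of_coords A c p v) (tvec_of_coords A c p w)"
    by (auto simp: tvec_of_coords_def tvec_add_def linear_add[OF lin])
  show "tvec_of_coords A c p (r *\<^sub>R v) = tvec_scale r (tvec_of_coords A c p v)"
    by (auto simp: tvec_of_coords_def tvec_scale_def linear_scale[OF lin])
qed

end

section \<open>Pulled-back metrics and the tension field on the manifold\<close>

context riemannian_manifold
begin

lemma metric_in_chart:
  assumes p: "c \<in> A" "p \<in> fst c" and v: "v \<in> tangent_space A p" and w: "w \<in> tangent_space A p"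
  shows "g p v w = v c \<bullet> (metric_matrix A g c (snd c p) *v w c)"
proof -
  have pX: "p \<in> topspace X" using p chart_subset by blast
  let ?T = "tvec_of_coords A c p"
  have T: "?T a \<in> tangent_space A p" for a by (rule tvec_of_coords_in_tangent_space[OF p])
  define B where "B a b = g p (?T a) (?T b)" for a b
  have l1: "linear (\<lambda>a. B a b)" for b
    unfolding linear_iff B_def tvec_of_coords_linear[OF p]
    by (simp add: metric_add[OF pX T T T] metric_scale[OF pX T T])
  have sym: "B a b = B b a" for a b unfolding B_def by (rule metric_sym[OF pX T T])
  have "B a b = a \<bullet> (metric_matrix A g c (snd c p) *v b)" for a b
  proof -
    have "B a b = (\<Sum>i\<in>UNIV. a $ i * B (axis i 1) b)" using linear_axis_sum[OF l1[of b], of a] by simp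
    also have "\<dots> = (\<Sum>i\<in>UNIV. a $ i * (\<Sum>j\<in>UNIV. B (axis i 1) (axis j 1) * b $ j))"
    proof (intro sum.cong refl arg_cong[where f="(*) _"])
      fix i
      have "B (axis i 1) b = (\<Sum>j\<in>UNIV. b $ j * B (axis j 1) (axis i 1))"
        using linear_axis_sum[OF l1[of "axis i 1"], of b] sym[of "axis i 1" b] by simp
      also have "\<dots> = (\<Sum>j\<in>UNIV. B (axis i 1) (axis j 1) * b $ j)"
        by (intro sum.cong refl) (metis sym mult.commute)
      finally show "B (axis i 1) b = (\<Sum>j\<in>UNIV. B (axis i 1) (axis j 1) * b $ j)" .
    qed
    finally show ?thesis
      unfolding inner_vec_def matrix_vector_mult_def metric_matrix_def B_def chart_inv_chart[OF p] by simp
  qed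
  from this[of "v c" "w c"] show ?thesis
    unfolding B_def tvec_of_coords_of_component[OF v p] tvec_of_coords_of_component[OF w p] .
qed

lemma metric_matrix_posdef:
  assumes c: "c \<in> A" and x: "x \<in> chart_image c" shows "posdef (metric_matrix A g c x)"
proof -
  let ?p = "chart_inv c x"
  have p: "?p \<in> fst c" by (rule chart_inv_in[OF x])
  have pX: "?p \<in> topspace X" using p chart_subset[OF c] by blast
  let ?T = "tvec_of_coords A c ?p"
  have T: "?T a \<in> tangent_space A ?p" for a by (rule tvec_of_coords_in_tangent_space[OF c p])
  have "metric_matrix A g c x $ i $ j = metric_matrix A g c x $ j $ i" for i j
    unfolding metric_matrix_def using metric_sym[OF pX T T] by simp
  moreover have "0 < v \<bullet> (metric_matrix A g c x *v v)" if "v \<noteq> 0" for v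
  proof -
    have "?T v \<noteq> tvec_zero" using tvec_of_coords_self[OF c p, of v] that by (auto simp: tvec_zero_def)
    then have "g ?p (?T v) (?T v) > 0" by (rule metric_pos[OF pX T])
    then show ?thesis
      unfolding metric_in_chart[OF c p T T] tvec_of_coords_self[OF c p] chart_chart_inv[OF x] .
  qed
  ultimately show ?thesis by (simp add: posdef_def)
qed

lemma christoffel_eq: "christoffel A g c = christoffel_sym (metric_matrix A g c)"
  by (simp add: fun_eq_iff christoffel_def christoffel_sym_def metric_partial_def metric_deriv_def)

lemma harmonic_iff_tension:
  assumes u: "smooth_into X A unit_disc u"
  shows "harmonic A g u \<longleftrightarrow> (\<forall>c\<in>A. \<forall>z\<in>unit_disc. u z \<in> fst c \<longrightarrow>
    tension (metric_matrix A g c) (\<lambda>z. snd c (u z)) z = 0)"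
proof -
  have "(\<forall>i. d_dz (d_dzbar (coord c u i)) z +
             (\<Sum>j\<in>UNIV. \<Sum>k\<in>UNIV. complex_of_real (christoffel A g c (snd c (u z)) i j k) *
                d_dz (coord c u j) z * d_dzbar (coord c u k) z) = 0) \<longleftrightarrow>
        tension (metric_matrix A g c) (\<lambda>z. snd c (u z)) z = 0"
    if c: "c \<in> A" and z: "z \<in> unit_disc" "u z \<in> fst c" for c z
  proof -
    let ?S = "{z \<in> unit_disc. u z \<in> fst c}"
    have im: "snd c (u z) \<in> chart_image c" using z by (simp add: chart_image_def)
    have H: "d_dz (d_dzbar (coord c u i)) z +
             (\<Sum>j\<in>UNIV. \<Sum>k\<in>UNIV. complex_of_real (christoffel A g c (snd c (u z)) i j k) *
                d_dz (coord c u j) z * d_dzbar (coord c u k) z) =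
        complex_of_real (tension (metric_matrix A g c) (\<lambda>z. snd c (u z)) z $ i) / 4" for i
      unfolding christoffel_eq coord_def[abs_def]
    proof (rule harmonic_expression[OF smooth_onD[OF smooth_into_chart[OF u c]] smooth_into_open[OF u c open_ball]])
      show "z \<in> ?S" using z by simp
      show "christoffel_sym (metric_matrix A g c) (snd c (u z)) i j k = christoffel_sym (metric_matrix A g c) (snd c (u z)) i k j" for j k
        by (rule christoffel_sym_commute[OF chart_image_open[OF c] im metric_matrix_posdef[OF c]])
    qed
    show ?thesis unfolding H by (simp add: vec_eq_iff)
  qed
  then show ?thesis unfolding harmonic_def by blast
qed

definition pullback :: "('b::euclidean_space \<Rightarrow> 'a) \<Rightarrow> 'b \<Rightarrow> 'b \<Rightarrow> 'b \<Rightarrow> real" where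
  "pullback f x a b = g (f x) (tangent_map A f x a) (tangent_map A f x b)"

definition pullback_matrix :: "(real^'n \<Rightarrow> 'a) \<Rightarrow> real^'n \<Rightarrow> real^'n^'n" where
  "pullback_matrix f x = (\<chi> i j. pullback f x (axis i 1) (axis j 1))"

lemma pullback_in_chart:
  assumes f: "smooth_into X A S f" "open S" "x \<in> S" and c: "c \<in> A" "f x \<in> fst c"
  shows "pullback f x a b = frechet_derivative (\<lambda>w. snd c (f w)) (at x) a \<bullet>
    (metric_matrix A g c (snd c (f x)) *v frechet_derivative (\<lambda>w. snd c (f w)) (at x) b)"
  using metric_in_chart[OF c tangent_map_in_tangent_space[OF f, of a] tangent_map_in_tangent_space[OF f, of b]] c
  by (simp add: pullback_def tangent_map_def)

lemma pullback_matrix: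
  fixes f :: "real^'n \<Rightarrow> 'a"
  assumes f: "smooth_into X A S f" "open S" "x \<in> S"
  shows "a \<bullet> (pullback_matrix f x *v b) = pullback f x a b"
proof -
  obtain c where c: "c \<in> A" "f x \<in> fst c" using ex_chart[OF smooth_into_topspace[OF f(1,3)]] .
  let ?d = "frechet_derivative (\<lambda>w. snd c (f w)) (at x)" and ?M = "metric_matrix A g c (snd c (f x))"
  have lin: "linear ?d" by (rule has_derivative_linear[OF smooth_into_has_derivative[OF f(1,2) c(1) f(3) c(2)]])
  have l1: "linear (\<lambda>a. ?d a \<bullet> v)" for v
    by (simp add: linear_iff linear_add[OF lin] linear_scale[OF lin] inner_add_left)
  have l2: "linear (\<lambda>b. v \<bullet> (?M *v ?d b))" for v
    by (simp add: linear_iff linear_add[OF lin] linear_scale[OF lin] inner_add_right matrix_vector_right_distrib matrix_vector_mult_scaleR)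
  have "pullback f x a b = (\<Sum>i\<in>UNIV. a $ i * (?d (axis i 1) \<bullet> (?M *v ?d b)))"
    unfolding pullback_in_chart[OF f c] using linear_axis_sum[OF l1[of "?M *v ?d b"], of a] by simp
  also have "\<dots> = (\<Sum>i\<in>UNIV. a $ i * (\<Sum>j\<in>UNIV. b $ j * pullback f x (axis i 1) (axis j 1)))"
    unfolding pullback_in_chart[OF f c] by (subst linear_axis_sum[OF l2, of _ b]) simp
  finally show ?thesis
    unfolding inner_vec_def matrix_vector_mult_def pullback_matrix_def by (simp add: mult.commute)
qed

lemma pullback_matrix_smooth:
  fixes f :: "real^'n \<Rightarrow> 'a"
  assumes f: "smooth_into X A S f" "open S"
  shows "smooth_on S (pullback_matrix f)"
proof (rule smooth_on_local)
  fix x assume x: "x \<in> S"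
  obtain c where c: "c \<in> A" "f x \<in> fst c" using ex_chart[OF smooth_into_topspace[OF f(1) x]] .
  let ?U = "{x \<in> S. f x \<in> fst c}"
  have o: "open ?U" by (rule smooth_into_open[OF f(1) c(1) f(2)])
  note sm = smooth_into_chart[OF f(1) c(1)]
  have m: "smooth_on ?U (\<lambda>x. metric_matrix A g c (snd c (f x)))"
    by (rule smooth_on_comp[OF o chart_image_open[OF c(1)] metric_smooth[OF c(1)] sm]) (simp add: chart_image_def)
  have "smooth_on ?U (\<lambda>x. \<chi> i j. frechet_derivative (\<lambda>w. snd c (f w)) (at x) (axis i 1) \<bullet>
    (metric_matrix A g c (snd c (f x)) *v frechet_derivative (\<lambda>w. snd c (f w)) (at x) (axis j 1)))"
    by (intro smooth_on_vec_lambda smooth_on_inner smooth_on_bilinear[OF bounded_bilinear_matrix_vector]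
        smooth_on_frechet[OF sm] m o)
  then have "smooth_on ?U (pullback_matrix f)"
    by (rule smooth_on_cong[OF _ o]) (use c in \<open>auto simp: pullback_matrix_def pullback_in_chart[OF f]\<close>)
  then show "\<exists>U. open U \<and> x \<in> U \<and> smooth_on U (pullback_matrix f)" using o x c by blast
qed

lemma pullback_matrix_posdef:
  fixes f :: "real^'n \<Rightarrow> 'a"
  assumes f: "smooth_into X A S f" "open S" "x \<in> S" and inj: "inj (tangent_map A f x)"
  shows "posdef (pullback_matrix f x)"
proof -
  have T: "tangent_map A f x a \<in> tangent_space A (f x)" for a by (rule tangent_map_in_tangent_space[OF f])
  have fX: "f x \<in> topspace X" by (rule smooth_into_topspace[OF f(1,3)])
  have "pullback_matrix f x $ i $ j = pullback_matrix f x $ j $ i" for i j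
    unfolding pullback_matrix_def pullback_def using metric_sym[OF fX T T] by simp
  moreover have "0 < v \<bullet> (pullback_matrix f x *v v)" if v: "v \<noteq> 0" for v
  proof -
    have "tangent_map A f x 0 = tvec_zero"
    proof
      fix c
      show "tangent_map A f x 0 c = tvec_zero c"
      proof (cases "c \<in> A \<and> f x \<in> fst c")
        case True
        then show ?thesis
          using linear_0[OF has_derivative_linear[OF smooth_into_has_derivative[OF f(1,2) _ f(3), of c]]]
          by (simp add: tangent_map_def tvec_zero_def)
      qed (auto simp: tangent_map_def tvec_zero_def)
    qed
    then have "tangent_map A f x v \<noteq> tvec_zero" using inj v by (metis injD)
    then show ?thesis unfolding pullback_matrix[OF f] pullback_def by (rule metric_pos[OF fX T])
  qed
  ultimately show ?thesis by (simp add: posdef_def)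
qed

text \<open>By definition of the pulled-back metric, \<open>f\<close> read in a chart is an
  isometric coordinate change, so the naturality of the tension applies with
  \<open>\<lambda>x. snd c (f x)\<close> as \<open>\<Phi>\<close>.\<close>

lemma tension_pullback:
  fixes f :: "real^'n \<Rightarrow> 'a"
  assumes f: "smooth_into X A S f" "open S" and inj: "\<And>x. x \<in> S \<Longrightarrow> inj (tangent_map A f x)"
    and v: "smooth_on T v" "open T" "z \<in> T" and vS: "\<And>z. z \<in> T \<Longrightarrow> v z \<in> S"
    and c: "c \<in> A" "f (v z) \<in> fst c"
  shows "tension (metric_matrix A g c) (\<lambda>z. snd c (f (v z))) z =
    frechet_derivative (\<lambda>x. snd c (f x)) (at (v z)) (tension (pullback_matrix f) v z)"
proof -
  let ?U = "{x \<in> S. f x \<in> fst c}" and ?W = "{z \<in> T. f (v z) \<in> fst c}"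
  have U: "open ?U" by (rule smooth_into_open[OF f(1) c(1) f(2)])
  have W: "open ?W" by (rule smooth_into_open[OF smooth_into_comp[OF f v(1,2) vS] c(1) v(2)])
  have im: "snd c (f (v z)) \<in> chart_image c" using c by (simp add: chart_image_def)
  show ?thesis
  proof (rule tension_comp[OF smooth_onD[OF smooth_into_chart[OF f(1) c(1)]] U smooth_onD[OF smooth_on_subset[OF v(1)]] W])
    show "z \<in> ?W" using v c by simp
    show "v z \<in> ?U" if "z \<in> ?W" for z using that vS by auto
    show "metric_matrix A g c differentiable at (snd c (f (v z)))"
      using smooth_on_has_derivative[OF metric_smooth[OF c(1)] im] by (rule differentiableI)
    show "pullback_matrix f differentiable at (v z)"
      using smooth_on_has_derivative[OF pullback_matrix_smooth[OF f] vS[OF v(3)]] by (rule differentiableI)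
    show "posdef (pullback_matrix f (v z))" by (rule pullback_matrix_posdef[OF f vS[OF v(3)] inj[OF vS[OF v(3)]]])
    show "posdef (metric_matrix A g c (snd c (f (v z))))" by (rule metric_matrix_posdef[OF c(1) im])
    show "a \<bullet> (pullback_matrix f y *v b) = frechet_derivative (\<lambda>x. snd c (f x)) (at y) a \<bullet>
        (metric_matrix A g c (snd c (f y)) *v frechet_derivative (\<lambda>x. snd c (f x)) (at y) b)" if "y \<in> ?U" for y a b
      using that pullback_matrix[OF f] pullback_in_chart[OF f _ c(1)] by simp
  qed auto
qed

text \<open>Transfers the whole problem to an open subset of Euclidean space. Only the differentials
  of \<open>f\<close> have to be injective, not \<open>f\<close> itself, so the image may overlap;
  the conformal factor is the logarithm of the squared length of the derivative in direction
  \<open>1\<close>.\<close>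

theorem conformal_harmonic_immersion_comp:
  fixes f :: "real^'n \<Rightarrow> 'a"
  assumes f: "smooth_into X A S f" "open S" and inj: "\<And>x. x \<in> S \<Longrightarrow> inj (tangent_map A f x)"
    and v: "smooth_on unit_disc v" and vS: "\<And>z. z \<in> unit_disc \<Longrightarrow> v z \<in> S"
    and nz: "\<And>z. z \<in> unit_disc \<Longrightarrow> frechet_derivative v (at z) 1 \<noteq> 0"
    and conf: "\<And>z. z \<in> unit_disc \<Longrightarrow>
        frechet_derivative v (at z) 1 \<bullet> (pullback_matrix f (v z) *v frechet_derivative v (at z) 1) =
          frechet_derivative v (at z) \<i> \<bullet> (pullback_matrix f (v z) *v frechet_derivative v (at z) \<i>)"
      "\<And>z. z \<in> unit_disc \<Longrightarrow>
        frechet_derivative v (at z) 1 \<bullet> (pullback_matrix f (v z) *v frechet_derivative v (at z) \<i>) = 0"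
    and harm: "\<And>z. z \<in> unit_disc \<Longrightarrow> tension (pullback_matrix f) v z = 0"
  shows "conformal_harmonic_immersion X A g (\<lambda>z. f (v z))"
proof -
  let ?v' = "\<lambda>z. frechet_derivative v (at z)" and ?G = "\<lambda>z. pullback_matrix f (v z)"
  have u: "smooth_into X A unit_disc (\<lambda>z. f (v z))" by (rule smooth_into_comp[OF f v open_ball vS])
  have d: "differential A (\<lambda>z. f (v z)) z e = tangent_map A f (v z) (?v' z e)" if "z \<in> unit_disc" for z e
    unfolding differential_eq_tangent_map
    by (rule tangent_map_comp[OF f smooth_on_has_derivative[OF v that] vS[OF that]])
  define E where "E z = ?v' z 1 \<bullet> (?G z *v ?v' z 1)" for z
  have pos: "posdef (?G z)" if "z \<in> unit_disc" for z
    by (rule pullback_matrix_posdef[OF f vS[OF that] inj[OF vS[OF that]]])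
  have Epos: "E z > 0" if "z \<in> unit_disc" for z
    unfolding E_def by (rule posdef_pos[OF pos[OF that] nz[OF that]])
  have G: "?v' z a \<bullet> (?G z *v ?v' z b) = E z * (a \<bullet> b)" if z: "z \<in> unit_disc" for z a b
  proof -
    have dv: "?v' z a = Re a *\<^sub>R ?v' z 1 + Im a *\<^sub>R ?v' z \<i>" for a
      using linear_eq_sum_Basis[OF smooth_on_linear_frechet[OF v z], of a]
      by (simp add: Basis_complex_def inner_complex_def)
    have "?v' z \<i> \<bullet> (?G z *v ?v' z 1) = 0"
      using conf(2)[OF z] posdef_sym[OF pos[OF z], of "?v' z \<i>" "?v' z 1"] by simp
    then show ?thesis
      unfolding dv[of a] dv[of b] using conf[OF z]
      by (simp add: E_def inner_add_left inner_add_right matrix_vector_right_distrib matrix_vector_mult_scaleR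
          inner_complex_def algebra_simps)
  qed
  have gE: "g (f (v z)) (differential A (\<lambda>z. f (v z)) z a) (differential A (\<lambda>z. f (v z)) z b) = E z * (a \<bullet> b)"
    if z: "z \<in> unit_disc" for z a b
    unfolding d[OF z] pullback_def[symmetric] pullback_matrix[OF f vS[OF z], symmetric] by (rule G[OF z])
  have "immersion A (\<lambda>z. f (v z))"
    unfolding immersion_def
  proof (intro ballI injI)
    fix z a b assume z: "z \<in> unit_disc" and eq: "differential A (\<lambda>z. f (v z)) z a = differential A (\<lambda>z. f (v z)) z b"
    have "?v' z a = ?v' z b" using eq unfolding d[OF z] by (rule injD[OF inj[OF vS[OF z]]])
    then have "?v' z (a - b) = 0" using linear_diff[OF smooth_on_linear_frechet[OF v z]] by simp
    then have "E z * ((a - b) \<bullet> (a - b)) = 0" using G[OF z, of "a - b" "a - b"] by simp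
    then show "a = b" using Epos[OF z] by simp
  qed
  moreover have "conformal A g (\<lambda>z. f (v z))"
    unfolding conformal_def
  proof (intro exI[of _ "\<lambda>z. ln (E z)"] conjI ballI allI)
    have "smooth_on unit_disc (\<lambda>z. ?G z)"
      by (rule smooth_on_comp[OF open_ball f(2) pullback_matrix_smooth[OF f] v vS])
    then show "smooth_on unit_disc (\<lambda>z. ln (E z))"
      unfolding E_def
      by (intro smooth_on_ln smooth_on_inner smooth_on_bilinear[OF bounded_bilinear_matrix_vector] smooth_on_frechet[OF v] open_ball)
        (use Epos in \<open>auto simp: E_def\<close>)
    show "g (f (v z)) (differential A (\<lambda>z. f (v z)) z a) (differential A (\<lambda>z. f (v z)) z b) = exp (ln (E z)) * (a \<bullet> b)"
      if "z \<in> unit_disc" for z a b using gE[OF that] Epos[OF that] by simp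
  qed
  moreover have "harmonic A g (\<lambda>z. f (v z))"
    unfolding harmonic_iff_tension[OF u]
  proof (intro ballI impI)
    fix c z assume c: "c \<in> A" "f (v z) \<in> fst c" and z: "z \<in> unit_disc"
    have eq: "tension (metric_matrix A g c) (\<lambda>z. snd c (f (v z))) z =
        frechet_derivative (\<lambda>x. snd c (f x)) (at (v z)) (tension (pullback_matrix f) v z)"
      by (rule tension_pullback[OF f _ v open_ball z _ c]) (use inj vS in auto)
    show "tension (metric_matrix A g c) (\<lambda>z. snd c (f (v z))) z = 0"
      unfolding eq harm[OF z]
      by (rule linear_0[OF has_derivative_linear[OF smooth_into_has_derivative[OF f c(1) vS[OF z] c(2)]]])
  qed
  ultimately show ?thesis unfolding conformal_harmonic_immersion_def smooth_disc_map_iff using u by blast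
qed

end

section \<open>Finiteness\<close>

lemma ex_linear_frame:
  fixes a b :: "real^'n"
  assumes i: "i1 \<noteq> i2" and ab: "independent {a, b}" "a \<noteq> b"
  obtains L :: "real^'n \<Rightarrow> real^'n" where "linear L" "inj L" "L (axis i1 1) = a" "L (axis i2 1) = b"
proof -
  obtain B where B: "{a, b} \<subseteq> B" "independent B" "span B = (UNIV :: (real^'n) set)"
    using maximal_independent_subset_extend[of "{a, b}" UNIV] ab(1) by (metis subset_UNIV top.extremum_uniqueI)
  let ?e1 = "axis i1 1 :: real^'n" and ?e2 = "axis i2 1 :: real^'n"
  have e: "?e1 \<noteq> ?e2" using i by (simp add: axis_eq_axis)
  have finB: "finite B" using B(2) by (rule independent_imp_finite)
  have "card B = DIM(real^'n)" using B(2,3) by (metis dim_UNIV dim_span_eq_card_independent)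
  then have "card (B - {a, b}) = card (Basis - {?e1, ?e2})"
    using B(1) ab(2) e finB by (simp add: card_Diff_subset axis_in_Basis_iff)
  then obtain h where h: "bij_betw h (Basis - {?e1, ?e2}) (B - {a, b})"
    using finite_same_card_bij[of "Basis - {?e1, ?e2}" "B - {a, b}"] finB by auto
  define k where "k x = (if x = ?e1 then a else if x = ?e2 then b else h x)" for x
  define L where "L x = (\<Sum>b\<in>Basis. (x \<bullet> b) *\<^sub>R k b)" for x :: "real^'n"
  have lin: "linear L"
    unfolding L_def linear_iff by (simp add: inner_add_left scaleR_add_left sum.distrib scaleR_sum_right)
  have Lb: "L b = k b" if "b \<in> Basis" for b
  proof -
    have "L b = (\<Sum>c\<in>Basis. if c = b then k c else 0)"
      unfolding L_def using that by (intro sum.cong refl) (auto simp: inner_Basis)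
    then show ?thesis using that by simp
  qed
  have "B \<subseteq> range L"
  proof
    fix x assume x: "x \<in> B"
    consider "x = a" | "x = b" | "x \<in> h ` (Basis - {?e1, ?e2})" using x h by (auto simp: bij_betw_def)
    then show "x \<in> range L"
    proof cases
      case 1 then show ?thesis using Lb[of ?e1] by (auto simp: k_def axis_in_Basis_iff)
    next
      case 2 then show ?thesis using Lb[of ?e2] e by (auto simp: k_def axis_in_Basis_iff)
    next
      case 3
      then obtain y where "y \<in> Basis" "y \<noteq> ?e1" "y \<noteq> ?e2" "x = h y" by blast
      then have "L y = x" using Lb[of y] by (simp add: k_def)
      then show ?thesis by blast
    qed
  qed
  then have "span B \<subseteq> range L" by (rule span_minimal) (simp add: lin linear_subspace_image)
  then have "inj L" using B(3) lin by (intro linear_surjective_imp_injective) auto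
  moreover have "L ?e1 = a" "L ?e2 = b" using Lb[of ?e1] Lb[of ?e2] e by (simp_all add: k_def axis_in_Basis_iff)
  ultimately show ?thesis using lin that by blast
qed

text \<open>A vector that is Euclidean orthogonal to \<open>M *v a\<close> is orthogonal to
  \<open>a\<close> in the metric \<open>M\<close>; it exists in dimension at least \<open>2\<close>,
  and rescaling equalizes the lengths.\<close>

lemma posdef_orthogonal_pair:
  fixes M :: "real^'n^'n"
  assumes M: "posdef M" and a: "a \<noteq> 0" and n: "CARD('n) \<ge> 2"
  obtains b where "independent {a, b}" "a \<noteq> b" "b \<bullet> (M *v b) = a \<bullet> (M *v a)" "a \<bullet> (M *v b) = 0"
proof -
  obtain y where y: "y \<noteq> 0" "orthogonal (M *v a) y"
    using orthogonal_to_vector_exists[of "M *v a"] n by auto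
  define c where "c = sqrt ((a \<bullet> (M *v a)) / (y \<bullet> (M *v y)))"
  have pos: "0 < a \<bullet> (M *v a)" "0 < y \<bullet> (M *v y)" using posdef_pos[OF M] a y by auto
  have c2: "c * c = (a \<bullet> (M *v a)) / (y \<bullet> (M *v y))"
    unfolding c_def using pos by (simp add: real_sqrt_mult_self)
  define b where "b = c *\<^sub>R y"
  have 1: "b \<bullet> (M *v b) = a \<bullet> (M *v a)"
    using pos c2 by (simp add: b_def matrix_vector_mult_scaleR mult.assoc[symmetric])
  have 2: "a \<bullet> (M *v b) = 0"
    using y(2) posdef_sym[OF M, of a y] by (simp add: b_def matrix_vector_mult_scaleR orthogonal_def inner_commute)
  have b0: "b \<noteq> 0" using 1 pos by auto
  have ab: "a \<noteq> k *\<^sub>R b" for k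
  proof
    assume eq: "a = k *\<^sub>R b"
    then have "a \<bullet> (M *v a) = k * (a \<bullet> (M *v b))" by (simp add: matrix_vector_mult_scaleR)
    then show False using 2 pos by simp
  qed
  have "a \<noteq> b" using ab[of 1] by simp
  moreover have "independent {a, b}"
    using ab b0 by (simp add: independent_insert span_singleton) (metis rangeE)
  ultimately show ?thesis using that 1 2 by blast
qed

lemma christoffel_quad_const: "christoffel_quad (\<lambda>x. M) y a = 0"
  by (simp add: christoffel_quad_def christoffel_sym_def metric_deriv_def vec_eq_iff)

lemma frechet_derivative_scaleR:
  assumes "f differentiable at x"
  shows "frechet_derivative (\<lambda>x. (c::real) *\<^sub>R f x) (at x) e = c *\<^sub>R frechet_derivative f (at x) e"
proof -
  have "((\<lambda>x. c *\<^sub>R f x) has_derivative (\<lambda>e. c *\<^sub>R frechet_derivative f (at x) e)) (at x)"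
    using assms unfolding frechet_derivative_works by (rule has_derivative_scaleR_right)
  then show ?thesis by (simp add: frechet_derivativeI)
qed

lemma christoffel_quad_dilation:
  fixes G :: "real^'n \<Rightarrow> real^'n^'n"
  assumes G: "G differentiable at (l *\<^sub>R y)"
  shows "christoffel_quad G (l *\<^sub>R y) (l *\<^sub>R a) = l *\<^sub>R christoffel_quad (\<lambda>x. G (l *\<^sub>R x)) y a"
proof -
  have d: "metric_deriv (\<lambda>x. G (l *\<^sub>R x)) y k i j = l * metric_deriv G (l *\<^sub>R y) k i j" for k i j
  proof -
    have G': "(G has_derivative frechet_derivative G (at (l *\<^sub>R y))) (at (l *\<^sub>R y))"
      using G by (simp add: frechet_derivative_works)
    have "((\<lambda>x. G (l *\<^sub>R x)) has_derivative (\<lambda>e. frechet_derivative G (at (l *\<^sub>R y)) (l *\<^sub>R e))) (at y)"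
      by (rule has_derivative_compose[of "\<lambda>x. l *\<^sub>R x", OF _ G']) (rule has_derivative_scaleR_right[OF has_derivative_ident])
    then show ?thesis
      unfolding metric_deriv_eq[OF G'] metric_deriv_eq[of "\<lambda>x. G (l *\<^sub>R x)"]
      using linear_scale[OF has_derivative_linear[OF G']] by (simp add: metric_deriv_eq)
  qed
  have s: "christoffel_sym (\<lambda>x. G (l *\<^sub>R x)) y i j k = l * christoffel_sym G (l *\<^sub>R y) i j k" for i j k
    unfolding christoffel_sym_def d by (simp add: sum_distrib_left algebra_simps)
  show ?thesis
    unfolding christoffel_quad_def s by (simp add: vec_eq_iff sum_distrib_left mult_ac)
qed

text \<open>A constant factor in the metric does not affect the Christoffel symbols, so
  \<open>G (l x)\<close> may stand in for the pulled-back metric \<open>l\<^sup>2 G (l x)\<close>.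
  Unlike the latter it stays nondegenerate at \<open>l = 0\<close>, where it is constant.\<close>

lemma tension_dilation:
  fixes G :: "real^'n \<Rightarrow> real^'n^'n"
  assumes v: "smooth_on S v" "open S" "z \<in> S" and G: "G differentiable at (l *\<^sub>R v z)"
  shows "tension G (\<lambda>z. l *\<^sub>R v z) z = l *\<^sub>R tension (\<lambda>x. G (l *\<^sub>R x)) v z"
proof -
  let ?v = "\<lambda>z. frechet_derivative v (at z)"
  have d: "frechet_derivative (\<lambda>z. l *\<^sub>R v z) (at y) e = l *\<^sub>R ?v y e" if "y \<in> S" for y e
    by (rule frechet_derivative_scaleR) (use smooth_on_has_derivative[OF v(1) that] in \<open>rule differentiableI\<close>)
  have d2: "frechet_derivative (\<lambda>y. frechet_derivative (\<lambda>z. l *\<^sub>R v z) (at y) e) (at z) e =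
      l *\<^sub>R frechet_derivative (\<lambda>y. ?v y e) (at z) e" for e
  proof -
    have "((\<lambda>y. ?v y e) has_derivative frechet_derivative (\<lambda>y. ?v y e) (at z)) (at z)"
      by (rule smooth_on_has_derivative[OF smooth_on_frechet[OF v(1)] v(3)])
    then have "((\<lambda>y. l *\<^sub>R ?v y e) has_derivative (\<lambda>h. l *\<^sub>R frechet_derivative (\<lambda>y. ?v y e) (at z) h)) (at z)"
      by (rule has_derivative_scaleR_right)
    then have "((\<lambda>y. frechet_derivative (\<lambda>z. l *\<^sub>R v z) (at y) e) has_derivative
        (\<lambda>h. l *\<^sub>R frechet_derivative (\<lambda>y. ?v y e) (at z) h)) (at z)"
      by (rule has_derivative_transform_within_open[OF _ v(2,3)]) (simp add: d)
    then show ?thesis by (simp add: frechet_derivativeI)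
  qed
  show ?thesis
    unfolding tension_def d2 d[OF v(3)] christoffel_quad_dilation[where G = G, OF G] by (simp add: scaleR_add_right)
qed

section \<open>Inverse charts as parametrizations\<close>

context smooth_manifold
begin

lemma chart_inv_smooth_into:
  assumes c: "c \<in> A" shows "smooth_into X A (chart_image c) (chart_inv c)"
  unfolding smooth_into_def
proof (intro conjI ballI)
  have hm: "homeomorphic_map (subtopology X (fst c)) (top_of_set (chart_image c)) (snd c)" by (rule chart_homeo[OF c])
  then obtain h where h: "homeomorphic_maps (subtopology X (fst c)) (top_of_set (chart_image c)) (snd c) h"
    using homeomorphic_map_maps by blast
  have "continuous_map (top_of_set (chart_image c)) (subtopology X (fst c)) h"
    using h by (simp add: homeomorphic_maps_def)
  then have "continuous_map (top_of_set (chart_image c)) (subtopology X (fst c)) (chart_inv c)"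
  proof (rule continuous_map_eq)
    fix x assume "x \<in> topspace (top_of_set (chart_image c))"
    then have x: "x \<in> chart_image c" by simp
    then have "h x \<in> fst c" "snd c (h x) = x"
      using h chart_subset[OF c] by (auto simp: homeomorphic_maps_def continuous_map_def Pi_iff)
    then show "h x = chart_inv c x" using chart_inv_chart[OF c] by metis
  qed
  then show "continuous_map (top_of_set (chart_image c)) X (chart_inv c)"
    by (rule continuous_map_into_fulltopology)
  fix d assume d: "d \<in> A"
  have eq: "{x \<in> chart_image c. chart_inv c x \<in> fst d} = snd c ` (fst c \<inter> fst d)"
  proof (intro set_eqI iffI)
    fix x assume x: "x \<in> {x \<in> chart_image c. chart_inv c x \<in> fst d}"
    then have "x = snd c (chart_inv c x)" "chart_inv c x \<in> fst c" using chart_chart_inv[of x c] chart_inv_in[of x c] by simp_all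
    then show "x \<in> snd c ` (fst c \<inter> fst d)" using x by blast
  qed (auto simp: chart_inv_chart[OF c] chart_image_def)
  show "smooth_on {x \<in> chart_image c. chart_inv c x \<in> fst d} (\<lambda>x. snd d (chart_inv c x))"
    using compatible[OF c d] unfolding eq transition_def o_def .
qed

lemma tangent_map_chart_inv:
  assumes c: "c \<in> A" and x: "x \<in> chart_image c"
  shows "tangent_map A (chart_inv c) x e = tvec_of_coords A c (chart_inv c x) e"
  by (simp add: fun_eq_iff tangent_map_def tvec_of_coords_def transition_def o_def chart_chart_inv[OF x])

lemma chart_inv_affine:
  fixes L :: "real^'n \<Rightarrow> real^'n" and q :: "real^'n" and c :: "('a, 'n) chart"
  defines "S \<equiv> {x. q + L x \<in> chart_image c}"
  assumes c: "c \<in> A" and L: "bounded_linear L"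
  shows "open S" and "smooth_into X A S (\<lambda>x. chart_inv c (q + L x))"
    and "x \<in> S \<Longrightarrow> tangent_map A (\<lambda>x. chart_inv c (q + L x)) x e = tvec_of_coords A c (chart_inv c (q + L x)) (L e)"
    and "x \<in> S \<Longrightarrow> inj L \<Longrightarrow> inj (tangent_map A (\<lambda>x. chart_inv c (q + L x)) x)"
proof -
  have "S = (\<lambda>x. q + L x) -` chart_image c" by (auto simp: S_def)
  then show Sopen: "open S"
    by (simp add: open_vimage[OF chart_image_open[OF c]] continuous_on_add[OF continuous_on_const linear_continuous_on[OF L]])
  have "smooth_on S (\<lambda>x. q + L x)"
    by (rule smooth_on_add[OF Sopen smooth_on_const smooth_on_bounded_linear[OF L Sopen]])
  then show "smooth_into X A S (\<lambda>x. chart_inv c (q + L x))"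
    by (rule smooth_into_comp[OF chart_inv_smooth_into[OF c] chart_image_open[OF c] _ Sopen]) (simp add: S_def)
  show t: "tangent_map A (\<lambda>x. chart_inv c (q + L x)) x e = tvec_of_coords A c (chart_inv c (q + L x)) (L e)"
    if x: "x \<in> S" for x e
  proof -
    have "((\<lambda>x. q + L x) has_derivative L) (at x)"
      using has_derivative_add[OF has_derivative_const bounded_linear.has_derivative[OF L has_derivative_ident]] by simp
    then have "tangent_map A (\<lambda>x. chart_inv c (q + L x)) x e = tangent_map A (chart_inv c) (q + L x) (L e)"
      by (rule tangent_map_comp[OF chart_inv_smooth_into[OF c] chart_image_open[OF c]]) (use x in \<open>simp add: S_def\<close>)
    also have "\<dots> = tvec_of_coords A c (chart_inv c (q + L x)) (L e)"
      by (rule tangent_map_chart_inv[OF c]) (use x in \<open>simp add: S_def\<close>)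
    finally show ?thesis .
  qed
  show "inj (tangent_map A (\<lambda>x. chart_inv c (q + L x)) x)" if x: "x \<in> S" and inj: "inj L"
  proof (rule injI)
    fix a b assume "tangent_map A (\<lambda>x. chart_inv c (q + L x)) x a = tangent_map A (\<lambda>x. chart_inv c (q + L x)) x b"
    moreover have "chart_inv c (q + L x) \<in> fst c" by (rule chart_inv_in) (use x in \<open>simp add: S_def\<close>)
    ultimately have "L a = L b" unfolding t[OF x] by (metis tvec_of_coords_self[OF c])
    then show "a = b" using inj by (simp add: injD)
  qed
qed

end

section \<open>Small discs in every direction\<close>

context riemannian_manifold
begin

lemma kobayashi_royden_less_iff:
  assumes "\<xi> \<noteq> tvec_zero"
  shows "kobayashi_royden X A g (p, \<xi>) < a \<longleftrightarrow> (\<exists>r>0. ennreal (1 / r) < a \<and>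
    (\<exists>u. conformal_harmonic_immersion X A g u \<and> u 0 = p \<and> differential A u 0 1 = tvec_scale r \<xi>))"
  using assms unfolding kobayashi_royden_def by (auto simp: Inf_less_iff)

text \<open>In the limit of infinite magnification at \<open>p\<close> the metric is constant, and
  the plane spanned by \<open>w\<close> and a vector orthogonal to it of the same length is
  conformal and harmonic. The perturbation theorem yields discs for small positive dilation factors
  \<open>l\<close>; such a factor is the radius \<open>r\<close>.\<close>

theorem ex_conformal_harmonic_immersion:
  assumes n: "CARD('n) \<ge> 2" and c: "c \<in> A" "p \<in> fst c" and w: "w \<noteq> 0"
  shows "\<exists>r>0. \<exists>u. conformal_harmonic_immersion X A g u \<and> u 0 = p \<and>
    differential A u 0 1 = tvec_scale r (tvec_of_coords A c p w)"
proof -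
  define x0 where "x0 = snd c p"
  define M where "M = metric_matrix A g c x0"
  have x0: "x0 \<in> chart_image c" using c by (simp add: x0_def chart_image_def)
  have p: "chart_inv c x0 = p" using c by (simp add: x0_def chart_inv_chart)
  have M: "posdef M" unfolding M_def by (rule metric_matrix_posdef[OF c(1) x0])
  obtain b where b: "independent {w, b}" "w \<noteq> b" "b \<bullet> (M *v b) = w \<bullet> (M *v w)" "w \<bullet> (M *v b) = 0"
    using posdef_orthogonal_pair[OF M w n] .
  obtain i1 i2 :: 'n where i: "i1 \<noteq> i2"
    using n card_le_Suc0_iff_eq[of "UNIV::'n set"] by fastforce
  obtain L :: "real^'n \<Rightarrow> real^'n" where L: "linear L" "inj L" "L (axis i1 1) = w" "L (axis i2 1) = b"
    using ex_linear_frame[OF i b(1,2)] .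
  define f where "f x = chart_inv c (x0 + L x)" for x
  define S where "S = {x. x0 + L x \<in> chart_image c}"
  have bl: "bounded_linear L" using L(1) linear_conv_bounded_linear by blast
  note S = chart_inv_affine[where q = x0, OF c(1) bl, folded S_def f_def]
  note Sopen = S(1) and f = S(2) and tf = S(3) and inj = S(4)[OF _ L(2)]
  define P where "P = pullback_matrix f"
  have P: "smooth_on S P" unfolding P_def by (rule pullback_matrix_smooth[OF f Sopen])
  have L0: "L 0 = 0" by (rule linear_0[OF L(1)])
  have S0: "0 \<in> S" using x0 L0 by (simp add: S_def)
  have f0: "f 0 = p" by (simp add: f_def L0 p)
  have P0: "P 0 $ i $ j = L (axis i 1) \<bullet> (M *v L (axis j 1))" for i j
  proof -
    have T: "tvec_of_coords A c p a \<in> tangent_space A p" for a by (rule tvec_of_coords_in_tangent_space[OF c])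
    show ?thesis
      unfolding P_def pullback_matrix_def pullback_def tf[OF S0] f0
      by (simp add: metric_in_chart[OF c T T] tvec_of_coords_self[OF c] M_def x0_def)
  qed
  \<comment> \<open>The dilated metric as a function of the pair of factor and point.\<close>
  define D where "D = {y :: real \<times> (real^'n). fst y *\<^sub>R snd y \<in> S}"
  define G where "G y = P (fst y *\<^sub>R snd y)" for y :: "real \<times> (real^'n)"
  have Dopen: "open D"
  proof -
    have "D = (\<lambda>y. fst y *\<^sub>R snd y) -` S" by (auto simp: D_def)
    then show ?thesis by (simp add: open_vimage[OF Sopen] continuous_intros)
  qed
  \<comment> \<open>At factor \<open>0\<close> the metric is \<open>P 0\<close> everywhere, so the
    conditions on the base hold over discs of any size; \<open>2\<close> is merely a radius above
    \<open>1\<close>.\<close>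
  interpret F: conformal_harmonic_family G D i1 i2 2
  proof
    show "open D" by (rule Dopen)
    have "smooth_on D (\<lambda>y. fst y *\<^sub>R snd y)"
      by (intro smooth_on_scaleR smooth_on_fst smooth_on_snd smooth_on_ident Dopen)
    then show "smooth_on D G"
      unfolding G_def[abs_def] by (rule smooth_on_comp[OF Dopen Sopen P]) (simp add: D_def)
    show "posdef (G y)" if "y \<in> D" for y
      using pullback_matrix_posdef[OF f Sopen _ inj] that by (auto simp: G_def P_def D_def)
    show "christoffel_quad (\<lambda>x. G (0, x)) (plane i1 i2 z) (axis i1 1) +
      christoffel_quad (\<lambda>x. G (0, x)) (plane i1 i2 z) (axis i2 1) = 0" for z
      by (simp add: G_def christoffel_quad_const)
  qed (use i b in \<open>auto simp: G_def D_def P0 L S0\<close>)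
  obtain \<delta> where \<delta>: "\<delta> > 0" and disc: "\<And>l q \<eta>. \<bar>l\<bar> < \<delta> \<and> norm q < \<delta> \<and> norm (\<eta> - axis i1 1) < \<delta> \<longrightarrow>
    (\<exists>U. smooth_on (ball 0 1) U \<and> U 0 = q \<and> frechet_derivative U (at 0) 1 = \<eta> \<and>
      (\<forall>z\<in>ball 0 1. (l, U z) \<in> D \<and> frechet_derivative U (at z) 1 \<noteq> 0 \<and>
        frechet_derivative U (at z) 1 \<bullet> (G (l, U z) *v frechet_derivative U (at z) 1) =
          frechet_derivative U (at z) \<i> \<bullet> (G (l, U z) *v frechet_derivative U (at z) \<i>) \<and>
        frechet_derivative U (at z) 1 \<bullet> (G (l, U z) *v frechet_derivative U (at z) \<i>) = 0 \<and>
        tension (\<lambda>x. G (l, x)) U z = 0))"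
    using F.nearby_discs by blast
  define l where "l = \<delta> / 2"
  have l: "l > 0" "\<bar>l\<bar> < \<delta>" using \<delta> by (auto simp: l_def)
  obtain U where U: "smooth_on unit_disc U" "U 0 = 0" "frechet_derivative U (at 0) 1 = axis i1 1"
    and Uz: "\<And>z. z \<in> unit_disc \<Longrightarrow> (l, U z) \<in> D \<and> frechet_derivative U (at z) 1 \<noteq> 0 \<and>
        frechet_derivative U (at z) 1 \<bullet> (G (l, U z) *v frechet_derivative U (at z) 1) =
          frechet_derivative U (at z) \<i> \<bullet> (G (l, U z) *v frechet_derivative U (at z) \<i>) \<and>
        frechet_derivative U (at z) 1 \<bullet> (G (l, U z) *v frechet_derivative U (at z) \<i>) = 0 \<and>
        tension (\<lambda>x. G (l, x)) U z = 0"
    using disc[of l 0 "axis i1 1"] l \<delta> by auto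
  define v where "v z = l *\<^sub>R U z" for z
  have v: "smooth_on unit_disc v"
    unfolding v_def[abs_def] by (rule smooth_on_linear_comp[OF bounded_linear_scaleR_right open_ball U(1)])
  have vS: "v z \<in> S" if "z \<in> unit_disc" for z using Uz[OF that] by (simp add: v_def D_def)
  have dv: "frechet_derivative v (at z) e = l *\<^sub>R frechet_derivative U (at z) e" if "z \<in> unit_disc" for z e
    unfolding v_def[abs_def]
    by (rule frechet_derivative_scaleR) (use smooth_on_has_derivative[OF U(1) that] in \<open>rule differentiableI\<close>)
  have Gv: "G (l, U z) = pullback_matrix f (v z)" for z by (simp add: G_def v_def P_def)
  have "conformal_harmonic_immersion X A g (\<lambda>z. f (v z))"
  proof (rule conformal_harmonic_immersion_comp[OF f Sopen inj v vS])
    fix z assume z: "z \<in> unit_disc"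
    note u = Uz[OF z, unfolded Gv]
    show "frechet_derivative v (at z) 1 \<noteq> 0" using u l by (simp add: dv[OF z])
    show "frechet_derivative v (at z) 1 \<bullet> (pullback_matrix f (v z) *v frechet_derivative v (at z) 1) =
          frechet_derivative v (at z) \<i> \<bullet> (pullback_matrix f (v z) *v frechet_derivative v (at z) \<i>)"
      using u by (simp add: dv[OF z] matrix_vector_mult_scaleR)
    show "frechet_derivative v (at z) 1 \<bullet> (pullback_matrix f (v z) *v frechet_derivative v (at z) \<i>) = 0"
      using u by (simp add: dv[OF z] matrix_vector_mult_scaleR)
    have "P differentiable at (l *\<^sub>R U z)"
      using smooth_on_has_derivative[OF P vS[OF z]] unfolding v_def by (rule differentiableI)
    from tension_dilation[OF U(1) open_ball z this] u
    show "tension (pullback_matrix f) v z = 0" by (simp add: v_def[abs_def] P_def G_def)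
  qed auto
  moreover have "f (v 0) = p" by (simp add: v_def U f0)
  moreover have "differential A (\<lambda>z. f (v z)) 0 1 = tvec_scale l (tvec_of_coords A c p w)"
  proof -
    have z0: "(0::complex) \<in> unit_disc" by simp
    have "differential A (\<lambda>z. f (v z)) 0 1 = tangent_map A f (v 0) (frechet_derivative v (at 0) 1)"
      unfolding differential_eq_tangent_map
      by (rule tangent_map_comp[OF f Sopen smooth_on_has_derivative[OF v z0] vS[OF z0]])
    also have "\<dots> = tvec_of_coords A c p (l *\<^sub>R w)"
      unfolding tf[OF vS[OF z0]] dv[OF z0] by (simp add: v_def U f0 linear_scale[OF L(1)] L(3))
    finally show ?thesis by (simp add: tvec_of_coords_linear(2)[OF c])
  qed
  ultimately show ?thesis using l(1) by blast
qed

corollary kobayashi_royden_finite: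
  assumes n: "CARD('n) \<ge> 2" and v: "v \<in> tangent_bundle X A"
  shows "kobayashi_royden X A g v < \<infinity>"
proof -
  obtain p \<xi> where v': "v = (p, \<xi>)" by (cases v)
  then have p: "p \<in> topspace X" "\<xi> \<in> tangent_space A p" using v by (auto simp: tangent_bundle_def)
  show ?thesis
  proof (cases "\<xi> = tvec_zero")
    case True then show ?thesis by (simp add: v' kobayashi_royden_def)
  next
    case False
    obtain c where c: "c \<in> A" "p \<in> fst c" using ex_chart[OF p(1)] .
    have \<xi>: "tvec_of_coords A c p (\<xi> c) = \<xi>" by (rule tvec_of_coords_of_component[OF p(2) c])
    have "\<xi> c \<noteq> 0"
    proof
      assume "\<xi> c = 0"
      then have "tvec_of_coords A c p (0 *\<^sub>R \<xi> c) = \<xi>" using \<xi> by simp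
      then show False using False unfolding tvec_of_coords_linear(2)[OF c] by (simp add: tvec_scale_def tvec_zero_def)
    qed
    from ex_conformal_harmonic_immersion[OF n c this] show ?thesis
      unfolding v' kobayashi_royden_less_iff[OF False] \<xi> by (auto simp: less_top[symmetric])
  qed
qed

end

section \<open>A tubular map around an immersed disc\<close>

context smooth_manifold
begin

lemma smooth_into_Un:
  assumes f: "smooth_into X A S f" "open S" and g: "smooth_into X A T f" "open T"
  shows "smooth_into X A (S \<union> T) f"
  unfolding smooth_into_def
proof (intro conjI ballI)
  show "continuous_map (top_of_set (S \<union> T)) X f"
    unfolding continuous_map
  proof (intro conjI allI impI)
    show "f ` topspace (top_of_set (S \<union> T)) \<subseteq> topspace X"
      using smooth_into_topspace[OF f(1)] smooth_into_topspace[OF g(1)] by auto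
    fix U assume U: "openin X U"
    have *: "open {x \<in> S. f x \<in> U}" if f: "smooth_into X A S f" "open S" for S
    proof -
      have "openin (top_of_set S) {x \<in> topspace (top_of_set S). f x \<in> U}"
        using f(1) U unfolding smooth_into_def by (intro openin_continuous_map_preimage) auto
      then show ?thesis using f(2) by (simp add: openin_open_eq)
    qed
    have "{x \<in> topspace (top_of_set (S \<union> T)). f x \<in> U} = {x \<in> S. f x \<in> U} \<union> {x \<in> T. f x \<in> U}" by auto
    then have "open {x \<in> topspace (top_of_set (S \<union> T)). f x \<in> U}"
      using *[OF f] *[OF g] by (simp only: open_Un)
    then show "openin (top_of_set (S \<union> T)) {x \<in> topspace (top_of_set (S \<union> T)). f x \<in> U}"
      unfolding openin_open_eq[OF open_Un[OF f(2) g(2)]] by auto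
  qed
  fix c assume c: "c \<in> A"
  have "{x \<in> S \<union> T. f x \<in> fst c} = {x \<in> S. f x \<in> fst c} \<union> {x \<in> T. f x \<in> fst c}" by auto
  then show "smooth_on {x \<in> S \<union> T. f x \<in> fst c} (\<lambda>x. snd c (f x))"
    using smooth_on_Un[OF smooth_into_open[OF f(1) c f(2)] smooth_into_open[OF g(1) c g(2)]
        smooth_into_chart[OF f(1) c] smooth_into_chart[OF g(1) c]] by simp
qed

lemma smooth_into_cong:
  assumes f: "smooth_into X A S f" "open S" and eq: "\<And>x. x \<in> S \<Longrightarrow> g x = f x"
  shows "smooth_into X A S g"
  unfolding smooth_into_def
proof (intro conjI ballI)
  show "continuous_map (top_of_set S) X g"
    by (rule continuous_map_eq[of _ _ f]) (use f(1) eq in \<open>auto simp: smooth_into_def\<close>)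
  fix c assume c: "c \<in> A"
  have "{x \<in> S. g x \<in> fst c} = {x \<in> S. f x \<in> fst c}" using eq by auto
  then show "smooth_on {x \<in> S. g x \<in> fst c} (\<lambda>x. snd c (g x))"
    using smooth_on_cong[OF smooth_into_chart[OF f(1) c] smooth_into_open[OF f(1) c f(2)], of "\<lambda>x. snd c (g x)"] eq
    by simp
qed

lemma smooth_into_slice:
  fixes f :: "'b::euclidean_space \<times> 'c::euclidean_space \<Rightarrow> 'a"
  assumes f: "smooth_into X A W f" "open W"
  shows "smooth_into X A {x. (z, x) \<in> W} (\<lambda>x. f (z, x))" "open {x. (z, x) \<in> W}"
proof -
  have "{x. (z, x) \<in> W} = Pair z -` W" by auto
  then show o: "open {x. (z, x) \<in> W}" by (simp add: open_vimage[OF f(2)] continuous_intros)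
  have "smooth_on {x. (z, x) \<in> W} (\<lambda>x. (z, x))"
    by (intro smooth_on_Pair smooth_on_const smooth_on_ident o)
  then show "smooth_into X A {x. (z, x) \<in> W} (\<lambda>x. f (z, x))"
    by (rule smooth_into_comp[OF f _ o]) simp
qed

lemma tangent_map_add:
  assumes f: "smooth_into X A S f" "open S" "x \<in> S"
  shows "tangent_map A f x (v + w) = tvec_add (tangent_map A f x v) (tangent_map A f x w)"
    and "tangent_map A f x (r *\<^sub>R v) = tvec_scale r (tangent_map A f x v)"
proof -
  have lin: "linear (frechet_derivative (\<lambda>w. snd c (f w)) (at x))" if "c \<in> A" "f x \<in> fst c" for c
    by (rule has_derivative_linear[OF smooth_into_has_derivative[OF f(1,2) that(1) f(3) that(2)]])
  show "tangent_map A f x (v + w) = tvec_add (tangent_map A f x v) (tangent_map A f x w)"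
    by (rule ext) (simp add: tangent_map_def tvec_add_def linear_add[OF lin])
  show "tangent_map A f x (r *\<^sub>R v) = tvec_scale r (tangent_map A f x v)"
    by (rule ext) (simp add: tangent_map_def tvec_scale_def linear_scale[OF lin])
qed

lemma tangent_map_cong:
  assumes f: "smooth_into X A S f" "open S" "x \<in> S" and T: "open T" "x \<in> T" "\<And>y. y \<in> T \<Longrightarrow> h y = f y"
  shows "tangent_map A h x = tangent_map A f x"
proof (intro ext)
  fix e c
  show "tangent_map A h x e c = tangent_map A f x e c"
  proof (cases "c \<in> A \<and> f x \<in> fst c")
    case True
    then have "((\<lambda>w. snd c (f w)) has_derivative frechet_derivative (\<lambda>w. snd c (f w)) (at x)) (at x)"
      by (intro smooth_into_has_derivative[OF f(1,2) _ f(3)]) auto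
    then have "((\<lambda>w. snd c (h w)) has_derivative frechet_derivative (\<lambda>w. snd c (f w)) (at x)) (at x)"
      by (rule has_derivative_transform_within_open[OF _ T(1,2)]) (simp add: T(3))
    then show ?thesis using True T(2,3) by (simp add: tangent_map_def frechet_derivativeI)
  qed (use T in \<open>auto simp: tangent_map_def\<close>)
qed

end

text \<open>The metric makes injectivity an open condition independent of charts: the determinant of
  the pulled-back matrix does not vanish.\<close>

lemma (in riemannian_manifold) inj_tangent_map_open:
  fixes f :: "real^'n \<Rightarrow> 'a"
  assumes f: "smooth_into X A S f" "open S"
  shows "open {x \<in> S. inj (tangent_map A f x)}"
proof -
  have "inj (tangent_map A f x) \<longleftrightarrow> det (pullback_matrix f x) \<noteq> 0" if x: "x \<in> S" for x
  proof
    assume "inj (tangent_map A f x)"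
    then show "det (pullback_matrix f x) \<noteq> 0"
      using posdef_invertible[OF pullback_matrix_posdef[OF f x]] by (simp add: invertible_det_nz)
  next
    assume "det (pullback_matrix f x) \<noteq> 0"
    then have ker: "v = 0" if "pullback_matrix f x *v v = 0" for v
      using that invertible_det_nz matrix_left_invertible_ker invertible_def by metis
    obtain c where c: "c \<in> A" "f x \<in> fst c" using ex_chart[OF smooth_into_topspace[OF f(1) x]] .
    let ?d = "frechet_derivative (\<lambda>w. snd c (f w)) (at x)"
    have lin: "linear ?d" by (rule has_derivative_linear[OF smooth_into_has_derivative[OF f c(1) x c(2)]])
    show "inj (tangent_map A f x)"
    proof (rule injI)
      fix v w assume "tangent_map A f x v = tangent_map A f x w"
      then have "tangent_map A f x v c = tangent_map A f x w c" by simp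
      then have d0: "?d (v - w) = 0" using c linear_diff[OF lin] by (simp add: tangent_map_def)
      have "a \<bullet> (pullback_matrix f x *v (v - w)) = 0" for a
        unfolding pullback_matrix[OF f x] pullback_in_chart[OF f x c] d0 by simp
      then have "pullback_matrix f x *v (v - w) = 0" by (metis inner_eq_zero_iff)
      then show "v = w" using ker by fastforce
    qed
  qed
  then have "{x \<in> S. inj (tangent_map A f x)} = S \<inter> (\<lambda>x. det (pullback_matrix f x)) -` (- {0})" by auto
  moreover have "continuous_on S (\<lambda>x. det (pullback_matrix f x))"
    by (intro smooth_on_continuous smooth_on_det smooth_on_vec_nth pullback_matrix_smooth f)
  ultimately show ?thesis using continuous_open_preimage[OF _ f(2)] by (metis open_Compl closed_singleton)
qed

lemma linear_perturbation_inj: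
  fixes \<alpha> \<beta> a b v :: "'a::real_inner"
  assumes "norm \<alpha> * norm a + norm \<beta> * norm b < 1" and "v + (\<alpha> \<bullet> v) *\<^sub>R a + (\<beta> \<bullet> v) *\<^sub>R b = 0"
  shows "v = 0"
proof (rule ccontr)
  assume "v \<noteq> 0"
  then have nv: "norm v > 0" by simp
  have "v = - ((\<alpha> \<bullet> v) *\<^sub>R a + (\<beta> \<bullet> v) *\<^sub>R b)" using assms(2) unfolding eq_neg_iff_add_eq_0 by (simp add: add.assoc)
  then have "norm v = norm ((\<alpha> \<bullet> v) *\<^sub>R a + (\<beta> \<bullet> v) *\<^sub>R b)" by (metis norm_minus_cancel)
  also have "\<dots> \<le> \<bar>\<alpha> \<bullet> v\<bar> * norm a + \<bar>\<beta> \<bullet> v\<bar> * norm b" by (rule order_trans[OF norm_triangle_ineq]) simp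
  also have "\<dots> \<le> (norm \<alpha> * norm v) * norm a + (norm \<beta> * norm v) * norm b"
    by (intro add_mono mult_right_mono Cauchy_Schwarz_ineq2) auto
  also have "\<dots> = (norm \<alpha> * norm a + norm \<beta> * norm b) * norm v" by (simp add: algebra_simps)
  also have "\<dots> < 1 * norm v" by (rule mult_strict_right_mono[OF assms(1) nv])
  finally show False by simp
qed

section \<open>Transport of an adapted family of maps along the disc\<close>

locale conformal_disc = riemannian_manifold X A g for X :: "'a topology" and A :: "('a, 'n::finite) chart set" and g +
  fixes u :: "complex \<Rightarrow> 'a" and i1 i2 :: 'n
  assumes u: "conformal_harmonic_immersion X A g u" and i12: "i1 \<noteq> i2"
begin

lemma u_smooth: "smooth_into X A unit_disc u"
  using u by (simp add: conformal_harmonic_immersion_def smooth_disc_map_iff)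

definition ux where "ux c w = frechet_derivative (\<lambda>w. snd c (u w)) (at w) 1"
definition uy where "uy c w = frechet_derivative (\<lambda>w. snd c (u w)) (at w) \<i>"

lemma tangent_u:
  assumes "c \<in> A" "u w \<in> fst c" shows "tangent_map A u w 1 c = ux c w" "tangent_map A u w \<i> c = uy c w"
  using assms by (simp_all add: tangent_map_def ux_def uy_def)

lemma metric_u:
  assumes c: "c \<in> A" "u w \<in> fst c" and w: "w \<in> unit_disc"
  obtains E where "E > 0" "ux c w \<bullet> (metric_matrix A g c (snd c (u w)) *v ux c w) = E"
    "uy c w \<bullet> (metric_matrix A g c (snd c (u w)) *v uy c w) = E"
    "ux c w \<bullet> (metric_matrix A g c (snd c (u w)) *v uy c w) = 0"
    "uy c w \<bullet> (metric_matrix A g c (snd c (u w)) *v ux c w) = 0"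
proof -
  obtain \<phi> where \<phi>: "\<And>v v'. g (u w) (differential A u w v) (differential A u w v') = exp (\<phi> w) * (v \<bullet> v')"
    using u w unfolding conformal_harmonic_immersion_def conformal_def by blast
  have *: "frechet_derivative (\<lambda>w. snd c (u w)) (at w) v \<bullet>
      (metric_matrix A g c (snd c (u w)) *v frechet_derivative (\<lambda>w. snd c (u w)) (at w) v') = exp (\<phi> w) * (v \<bullet> v')" for v v'
    using \<phi>[of v v'] pullback_in_chart[OF u_smooth open_ball w c, of v v']
    by (simp add: pullback_def differential_eq_tangent_map)
  show ?thesis
    using *[of 1 1] *[of \<i> \<i>] *[of 1 \<i>] *[of \<i> 1]
    by (intro that[of "exp (\<phi> w)"]) (simp_all add: ux_def uy_def inner_complex_def)
qed

text \<open>\<open>\<alpha>\<close>, \<open>\<beta>\<close> are dual to \<open>u\<^sub>x\<close>, \<open>u\<^sub>y\<close>. By the last condition the linear map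
  \<open>v \<mapsto> v + (\<alpha> w \<bullet> v) (u\<^sub>x w' - u\<^sub>x w) + (\<beta> w \<bullet> v) (u\<^sub>y w' - u\<^sub>y w)\<close>, which takes the frame at \<open>w\<close> to the
  frame at \<open>w'\<close>, is injective.\<close>

definition steerable :: "complex set \<Rightarrow> ('a, 'n) chart \<Rightarrow> (complex \<Rightarrow> real^'n) \<Rightarrow> (complex \<Rightarrow> real^'n) \<Rightarrow> bool" where
  "steerable N c \<alpha> \<beta> \<longleftrightarrow> open N \<and> N \<subseteq> unit_disc \<and> c \<in> A \<and> (\<forall>w\<in>N. u w \<in> fst c) \<and>
    smooth_on N (ux c) \<and> smooth_on N (uy c) \<and> smooth_on N \<alpha> \<and> smooth_on N \<beta> \<and>
    (\<forall>w\<in>N. \<alpha> w \<bullet> ux c w = 1 \<and> \<alpha> w \<bullet> uy c w = 0 \<and> \<beta> w \<bullet> ux c w = 0 \<and> \<beta> w \<bullet> uy c w = 1) \<and>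
    (\<forall>w\<in>N. \<forall>w'\<in>N. norm (\<alpha> w) * norm (ux c w' - ux c w) + norm (\<beta> w) * norm (uy c w' - uy c w) < 1)"

text \<open>As \<open>u\<close> is conformal, its frame is orthogonal for the metric, and lowering
  indices gives the dual covectors after normalization. The smallness condition holds with left-hand
  side \<open>0\<close> on the diagonal, so it persists on a product neighbourhood of
  \<open>(w0, w0)\<close>.\<close>

lemma ex_steerable:
  assumes w0: "w0 \<in> unit_disc" shows "\<exists>N c \<alpha> \<beta>. steerable N c \<alpha> \<beta> \<and> w0 \<in> N"
proof -
  obtain c where c: "c \<in> A" "u w0 \<in> fst c" using ex_chart[OF smooth_into_topspace[OF u_smooth w0]] .
  define U where "U = {w \<in> unit_disc. u w \<in> fst c}"
  have U: "open U" unfolding U_def by (rule smooth_into_open[OF u_smooth c(1) open_ball])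
  have s: "smooth_on U (\<lambda>w. snd c (u w))" unfolding U_def by (rule smooth_into_chart[OF u_smooth c(1)])
  have sx: "smooth_on U (ux c)" and sy: "smooth_on U (uy c)"
    unfolding ux_def[abs_def] uy_def[abs_def] by (intro smooth_on_frechet s)+
  define G where "G w = metric_matrix A g c (snd c (u w))" for w
  have sG: "smooth_on U G"
    unfolding G_def[abs_def]
    by (rule smooth_on_comp[OF U chart_image_open[OF c(1)] metric_smooth[OF c(1)] s]) (simp add: chart_image_def U_def)
  define \<alpha> \<beta> where "\<alpha> w = inverse (ux c w \<bullet> (G w *v ux c w)) *\<^sub>R (G w *v ux c w)"
    and "\<beta> w = inverse (uy c w \<bullet> (G w *v uy c w)) *\<^sub>R (G w *v uy c w)" for w
  have dual: "ux c w \<bullet> (G w *v ux c w) \<noteq> 0 \<and> uy c w \<bullet> (G w *v uy c w) \<noteq> 0 \<and>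
    \<alpha> w \<bullet> ux c w = 1 \<and> \<alpha> w \<bullet> uy c w = 0 \<and> \<beta> w \<bullet> ux c w = 0 \<and> \<beta> w \<bullet> uy c w = 1" if w: "w \<in> U" for w
  proof -
    have "u w \<in> fst c" "w \<in> unit_disc" using w by (auto simp: U_def)
    then obtain E where "E > 0" "ux c w \<bullet> (G w *v ux c w) = E" "uy c w \<bullet> (G w *v uy c w) = E"
      "ux c w \<bullet> (G w *v uy c w) = 0" "uy c w \<bullet> (G w *v ux c w) = 0"
      unfolding G_def using metric_u[OF c(1)] by blast
    then show ?thesis by (simp add: \<alpha>_def \<beta>_def inner_commute)
  qed
  have s\<alpha>: "smooth_on U \<alpha>" and s\<beta>: "smooth_on U \<beta>"
    unfolding \<alpha>_def[abs_def] \<beta>_def[abs_def]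
    by (intro smooth_on_scaleR smooth_on_inverse smooth_on_inner smooth_on_bilinear[OF bounded_bilinear_matrix_vector]
        sx sy sG U; use dual in blast)+
  define \<kappa> where "\<kappa> y = norm (\<alpha> (fst y)) * norm (ux c (snd y) - ux c (fst y)) +
    norm (\<beta> (fst y)) * norm (uy c (snd y) - uy c (fst y))" for y
  have cf: "continuous_on (U \<times> U) (\<lambda>y. f (fst y))" "continuous_on (U \<times> U) (\<lambda>y. f (snd y))"
    if "smooth_on U f" for f :: "complex \<Rightarrow> real^'n"
    by (rule continuous_on_compose2[OF smooth_on_continuous[OF that]]; auto intro: continuous_intros)+
  have "continuous_on (U \<times> U) \<kappa>"
    unfolding \<kappa>_def[abs_def] by (intro continuous_intros cf s\<alpha> s\<beta> sx sy)
  then have "open ((U \<times> U) \<inter> \<kappa> -` {..<1})"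
    by (intro continuous_open_preimage open_Times U open_lessThan)
  moreover have "(w0, w0) \<in> (U \<times> U) \<inter> \<kappa> -` {..<1}" using c w0 by (simp add: U_def \<kappa>_def)
  ultimately obtain P Q where PQ: "open P" "open Q" "(w0, w0) \<in> P \<times> Q" "P \<times> Q \<subseteq> (U \<times> U) \<inter> \<kappa> -` {..<1}"
    by (rule open_prod_elim)
  let ?N = "P \<inter> Q"
  have NU: "?N \<subseteq> U" using PQ(3,4) by blast
  have "steerable ?N c \<alpha> \<beta>"
    unfolding steerable_def
  proof (intro conjI ballI)
    show "norm (\<alpha> w) * norm (ux c w' - ux c w) + norm (\<beta> w) * norm (uy c w' - uy c w) < 1"
      if "w \<in> ?N" "w' \<in> ?N" for w w'
    proof -
      have "(w, w') \<in> P \<times> Q" using that by blast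
      then have "\<kappa> (w, w') < 1" using PQ(4) by blast
      then show ?thesis by (simp add: \<kappa>_def)
    qed
    show "?N \<subseteq> unit_disc" "\<And>w. w \<in> ?N \<Longrightarrow> u w \<in> fst c" using NU by (auto simp: U_def)
  qed (use PQ(1,2) c(1) NU dual in \<open>auto intro: smooth_on_subset[OF sx NU] smooth_on_subset[OF sy NU]
      smooth_on_subset[OF s\<alpha> NU] smooth_on_subset[OF s\<beta> NU]\<close>)
  then show ?thesis using PQ(3) by blast
qed

text \<open>A family of maps from neighbourhoods of \<open>0\<close> into the manifold which is adapted to \<open>u\<close> at
  \<open>\<sigma> z\<close>. It is transported from \<open>\<sigma> = 0\<close> to \<open>\<sigma> = id\<close> in small steps, each of which takes place in
  a single chart.\<close>

definition tube :: "complex set \<Rightarrow> (complex \<Rightarrow> complex) \<Rightarrow> bool" where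
  "tube K \<sigma> \<longleftrightarrow> (\<exists>W (\<Psi> :: complex \<times> (real^'n) \<Rightarrow> 'a). open W \<and> W \<subseteq> unit_disc \<times> UNIV \<and> K \<times> {0} \<subseteq> W \<and>
     smooth_into X A W \<Psi> \<and> (\<forall>z. (z, 0) \<in> W \<longrightarrow> \<Psi> (z, 0) = u (\<sigma> z) \<and>
       tangent_map A (\<lambda>x. \<Psi> (z, x)) 0 (axis i1 1) = tangent_map A u (\<sigma> z) 1 \<and>
       tangent_map A (\<lambda>x. \<Psi> (z, x)) 0 (axis i2 1) = tangent_map A u (\<sigma> z) \<i> \<and>
       inj (tangent_map A (\<lambda>x. \<Psi> (z, x)) 0)))"

text \<open>One step of the transport. Over the closed set \<open>F\<close> both
  \<open>\<sigma> z\<close> and \<open>\<sigma>' z\<close> stay in one steerable set, so the old map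
  can be read in a single chart, translated and turned there; elsewhere it is kept.\<close>

lemma tube_move:
  assumes t: "tube K \<sigma>" and \<sigma>: "smooth_on unit_disc \<sigma>" "\<sigma> ` unit_disc \<subseteq> unit_disc"
    and \<sigma>': "smooth_on unit_disc \<sigma>'" "\<sigma>' ` unit_disc \<subseteq> unit_disc"
    and F: "closed F" "\<And>z. z \<in> unit_disc \<Longrightarrow> z \<notin> F \<Longrightarrow> \<sigma>' z = \<sigma> z"
    and N: "steerable N c \<alpha> \<beta>" "\<And>z. z \<in> K \<inter> F \<Longrightarrow> \<sigma> z \<in> N \<and> \<sigma>' z \<in> N"
  shows "tube K \<sigma>'"
proof -
  obtain W and \<Psi> :: "complex \<times> (real^'n) \<Rightarrow> 'a" where W: "open W" "W \<subseteq> unit_disc \<times> UNIV" "K \<times> {0} \<subseteq> W"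
    and \<Psi>: "smooth_into X A W \<Psi>" and adapted: "\<And>z. (z, 0) \<in> W \<Longrightarrow> \<Psi> (z, 0) = u (\<sigma> z) \<and>
       tangent_map A (\<lambda>x. \<Psi> (z, x)) 0 (axis i1 1) = tangent_map A u (\<sigma> z) 1 \<and>
       tangent_map A (\<lambda>x. \<Psi> (z, x)) 0 (axis i2 1) = tangent_map A u (\<sigma> z) \<i> \<and>
       inj (tangent_map A (\<lambda>x. \<Psi> (z, x)) 0)"
    using t unfolding tube_def by blast
  have N': "open N" "N \<subseteq> unit_disc" "c \<in> A" "\<And>w. w \<in> N \<Longrightarrow> u w \<in> fst c"
    "smooth_on N (ux c)" "smooth_on N (uy c)" "smooth_on N \<alpha>" "smooth_on N \<beta>"
    "\<And>w. w \<in> N \<Longrightarrow> \<alpha> w \<bullet> ux c w = 1 \<and> \<alpha> w \<bullet> uy c w = 0 \<and> \<beta> w \<bullet> ux c w = 0 \<and> \<beta> w \<bullet> uy c w = 1"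
    "\<And>w w'. w \<in> N \<Longrightarrow> w' \<in> N \<Longrightarrow>
      norm (\<alpha> w) * norm (ux c w' - ux c w) + norm (\<beta> w) * norm (uy c w' - uy c w) < 1"
    using N(1) unfolding steerable_def by blast+
  note c = N'(3)
  define q where "q w = snd c (u w)" for w
  have sq: "smooth_on N q"
    unfolding q_def[abs_def] by (rule smooth_on_subset[OF smooth_into_chart[OF u_smooth c]]) (use N'(2,4) in auto)
  define V where "V = {z \<in> unit_disc. \<sigma> z \<in> N \<and> \<sigma>' z \<in> N}"
  have V: "open V"
  proof -
    have "V = (unit_disc \<inter> \<sigma> -` N) \<inter> (unit_disc \<inter> \<sigma>' -` N)" by (auto simp: V_def)
    then show ?thesis
      by (simp add: open_Int continuous_open_preimage[OF smooth_on_continuous[OF \<sigma>(1)] open_ball N'(1)]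
          continuous_open_preimage[OF smooth_on_continuous[OF \<sigma>'(1)] open_ball N'(1)])
  qed
  \<comment> \<open>Sends the frame of \<open>u\<close> at \<open>\<sigma> z\<close> to the frame at
    \<open>\<sigma>' z\<close>, because \<open>\<alpha>\<close> and \<open>\<beta>\<close> are dual
    to the former. It is the identity when the two points agree.\<close>
  define T where "T z v = v + (\<alpha> (\<sigma> z) \<bullet> v) *\<^sub>R (ux c (\<sigma>' z) - ux c (\<sigma> z)) +
    (\<beta> (\<sigma> z) \<bullet> v) *\<^sub>R (uy c (\<sigma>' z) - uy c (\<sigma> z))" for z v
  have Tlin: "bounded_linear (T z)" for z
    unfolding T_def linear_conv_bounded_linear[symmetric]
    by (simp add: linear_iff inner_add_right scaleR_add_left scaleR_add_right scaleR_right_diff_distrib scaleR_left_diff_distrib algebra_simps)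
  have T0: "T z 0 = 0" for z by (simp add: T_def)
  have Tinj: "v = v'" if "z \<in> V" "T z v = T z v'" for z v v'
  proof -
    have eq: "T z (v - v') = 0" using that(2) linear_diff[OF bounded_linear.linear[OF Tlin]] by simp
    have "v - v' = 0"
      by (rule linear_perturbation_inj[OF N'(10) eq[unfolded T_def]]) (use that in \<open>auto simp: V_def\<close>)
    then show ?thesis by simp
  qed
  \<comment> \<open>The old map in chart coordinates, recentred from \<open>\<sigma> z\<close> to
    \<open>\<sigma>' z\<close>, with the displacement transformed by \<open>T\<close>.\<close>
  define \<Theta> where "\<Theta> y = q (\<sigma>' (fst y)) + T (fst y) (snd c (\<Psi> y) - q (\<sigma> (fst y)))" for y
  define W0 where "W0 = {y \<in> W. \<Psi> y \<in> fst c} \<inter> fst -` V"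
  have W0: "open W0"
    unfolding W0_def by (intro open_Int smooth_into_open[OF \<Psi> c W(1)] open_vimage V continuous_intros)
  have comp: "smooth_on W0 (\<lambda>y. f (\<sigma> (fst y)))" "smooth_on W0 (\<lambda>y. f (\<sigma>' (fst y)))"
    if f: "smooth_on N f" for f :: "complex \<Rightarrow> real^'n"
  proof -
    have s1: "smooth_on W0 (\<lambda>y. \<sigma> (fst y))"
      by (rule smooth_on_comp[OF W0 open_ball \<sigma>(1) smooth_on_fst[OF W0 smooth_on_ident[OF W0]]])
        (auto simp: W0_def V_def)
    have s2: "smooth_on W0 (\<lambda>y. \<sigma>' (fst y))"
      by (rule smooth_on_comp[OF W0 open_ball \<sigma>'(1) smooth_on_fst[OF W0 smooth_on_ident[OF W0]]])
        (auto simp: W0_def V_def)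
    show "smooth_on W0 (\<lambda>y. f (\<sigma> (fst y)))"
      by (rule smooth_on_comp[OF W0 N'(1) f s1]) (auto simp: W0_def V_def)
    show "smooth_on W0 (\<lambda>y. f (\<sigma>' (fst y)))"
      by (rule smooth_on_comp[OF W0 N'(1) f s2]) (auto simp: W0_def V_def)
  qed
  have s\<Psi>: "smooth_on W0 (\<lambda>y. snd c (\<Psi> y))"
    by (rule smooth_on_subset[OF smooth_into_chart[OF \<Psi> c]]) (auto simp: W0_def)
  have s\<Theta>: "smooth_on W0 \<Theta>"
    unfolding \<Theta>_def[abs_def] T_def
    by (intro smooth_on_add smooth_on_diff smooth_on_scaleR smooth_on_inner comp sq N'(5-8) s\<Psi> W0)
  define W2 where "W2 = W0 \<inter> \<Theta> -` chart_image c"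
  have W2: "open W2"
    unfolding W2_def by (rule continuous_open_preimage[OF smooth_on_continuous[OF s\<Theta>] W0 chart_image_open[OF c]])
  have \<Psi>2: "smooth_into X A W2 (\<lambda>y. chart_inv c (\<Theta> y))"
    by (rule smooth_into_comp[OF chart_inv_smooth_into[OF c] chart_image_open[OF c] smooth_on_subset[OF s\<Theta>] W2])
      (auto simp: W2_def)
  define W1 where "W1 = W \<inter> fst -` (- F)"
  have W1: "open W1"
    unfolding W1_def by (intro open_Int W(1) open_vimage continuous_intros) (use F(1) in auto)
  \<comment> \<open>The new formula makes sense only where the chart reaches. Off \<open>F\<close>
    it reproduces the old map, so the pieces over \<open>W1\<close> and \<open>W2\<close> agree on
    their overlap and the union is smooth.\<close>
  define \<Psi>' where "\<Psi>' y = (if fst y \<in> F then chart_inv c (\<Theta> y) else \<Psi> y)" for y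
  have \<Psi>'1: "\<Psi>' y = \<Psi> y" if "y \<in> W1" for y using that by (simp add: W1_def \<Psi>'_def)
  have \<Psi>'2: "\<Psi>' y = chart_inv c (\<Theta> y)" if y: "y \<in> W2" for y
  proof (cases "fst y \<in> F")
    case False
    have yW: "y \<in> W" "\<Psi> y \<in> fst c" "fst y \<in> unit_disc" using y by (auto simp: W2_def W0_def V_def)
    have "\<Theta> y = snd c (\<Psi> y)" using F(2)[OF yW(3) False] by (simp add: \<Theta>_def T_def)
    then show ?thesis using False yW by (simp add: \<Psi>'_def chart_inv_chart[OF c])
  qed (simp add: \<Psi>'_def)
  have "smooth_into X A (W1 \<union> W2) \<Psi>'"
  proof (rule smooth_into_Un[OF _ W1 _ W2])
    show "smooth_into X A W1 \<Psi>'"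
      by (rule smooth_into_cong[OF smooth_into_subset[OF \<Psi>] W1 \<Psi>'1]) (auto simp: W1_def)
    show "smooth_into X A W2 \<Psi>'" by (rule smooth_into_cong[OF \<Psi>2 W2 \<Psi>'2])
  qed
  moreover have "K \<times> {0} \<subseteq> W1 \<union> W2"
  proof
    fix y assume "y \<in> K \<times> {0::real^'n}"
    then obtain z where y: "y = (z, 0)" "z \<in> K" by auto
    have yW: "(z, 0) \<in> W" using W(3) y by blast
    show "y \<in> W1 \<union> W2"
    proof (cases "z \<in> F")
      case True
      have zV: "z \<in> V" using N(2)[of z] True y yW W(2) by (auto simp: V_def)
      then have n: "\<sigma> z \<in> N" "\<sigma>' z \<in> N" by (auto simp: V_def)
      have \<Psi>z: "\<Psi> (z, 0) = u (\<sigma> z)" using adapted[OF yW] by blast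
      have "\<Theta> (z, 0) = q (\<sigma>' z)" by (simp add: \<Theta>_def \<Psi>z q_def T0)
      then show ?thesis
        using zV yW \<Psi>z N'(4)[OF n(1)] N'(4)[OF n(2)] by (simp add: y W2_def W0_def q_def chart_image_def)
    qed (use y yW in \<open>simp add: W1_def\<close>)
  qed
  moreover have "\<Psi>' (z, 0) = u (\<sigma>' z) \<and>
       tangent_map A (\<lambda>x. \<Psi>' (z, x)) 0 (axis i1 1) = tangent_map A u (\<sigma>' z) 1 \<and>
       tangent_map A (\<lambda>x. \<Psi>' (z, x)) 0 (axis i2 1) = tangent_map A u (\<sigma>' z) \<i> \<and>
       inj (tangent_map A (\<lambda>x. \<Psi>' (z, x)) 0)" if zW: "(z, 0) \<in> W1 \<union> W2" for z
  proof (cases "z \<in> F")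
    case False
    have "(z, 0) \<in> W" using zW by (auto simp: W1_def W2_def W0_def)
    moreover from this have "\<sigma>' z = \<sigma> z" using F(2) False W(2) by auto
    moreover have "(\<lambda>x. \<Psi>' (z, x)) = (\<lambda>x. \<Psi> (z, x))" using False by (simp add: \<Psi>'_def)
    ultimately show ?thesis using adapted[of z] by (simp add: \<Psi>'_def False)
  next
    case True
    then have z2: "(z, 0) \<in> W2" using zW by (auto simp: W1_def)
    then have z0: "(z, 0) \<in> W0" and zW: "(z, 0) \<in> W" and zV: "z \<in> V" by (auto simp: W2_def W0_def)
    then have n: "\<sigma> z \<in> N" "\<sigma>' z \<in> N" and zd: "z \<in> unit_disc" by (auto simp: V_def)
    note n' = N'(4)[OF n(1)] N'(4)[OF n(2)]
    have \<sigma>d: "\<sigma> z \<in> unit_disc" "\<sigma>' z \<in> unit_disc" using N'(2) n by auto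
    have \<Psi>z: "\<Psi> (z, 0) = u (\<sigma> z)" using adapted[OF zW] by blast
    have 1: "\<Psi>' (z, 0) = u (\<sigma>' z)"
      using True n' by (simp add: \<Psi>'_def \<Theta>_def \<Psi>z q_def T0 chart_inv_chart[OF c])
    have eq: "(\<lambda>x. \<Psi>' (z, x)) = (\<lambda>x. chart_inv c (\<Theta> (z, x)))" using True by (simp add: \<Psi>'_def)
    let ?S = "{x. (z, x) \<in> W2}" and ?Sold = "{x. (z, x) \<in> W}"
    have S': "smooth_into X A ?S (\<lambda>x. \<Psi>' (z, x))" and So: "open ?S"
      unfolding eq using smooth_into_slice[OF \<Psi>2 W2] by auto
    have S0': "smooth_into X A ?Sold (\<lambda>x. \<Psi> (z, x))" and S0o: "open ?Sold"
      using smooth_into_slice[OF \<Psi> W(1)] by auto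
    define D where "D = frechet_derivative (\<lambda>x. snd c (\<Psi> (z, x))) (at 0)"
    have D: "((\<lambda>x. snd c (\<Psi> (z, x))) has_derivative D) (at 0)"
      unfolding D_def by (rule smooth_into_has_derivative[OF S0' S0o c]) (use zW \<Psi>z n' in auto)
    have "((\<lambda>x. q (\<sigma>' z) + T z (snd c (\<Psi> (z, x)) - q (\<sigma> z))) has_derivative (\<lambda>e. 0 + T z (D e - 0))) (at 0)"
      by (intro has_derivative_add has_derivative_const bounded_linear.has_derivative[OF Tlin] has_derivative_diff D)
    then have "((\<lambda>x. snd c (\<Psi>' (z, x))) has_derivative (\<lambda>e. 0 + T z (D e - 0))) (at 0)"
      by (rule has_derivative_transform_within_open[OF _ So])
        (use z2 in \<open>auto simp: \<Psi>'2 W2_def \<Theta>_def intro!: chart_chart_inv[symmetric]\<close>)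
    then have comp': "tangent_map A (\<lambda>x. \<Psi>' (z, x)) 0 e c = T z (D e)" for e
      using c 1 n' by (simp add: tangent_map_def frechet_derivativeI)
    have comp0: "tangent_map A (\<lambda>x. \<Psi> (z, x)) 0 e c = D e" for e
      using c \<Psi>z n' by (simp add: tangent_map_def D_def)
    have D12: "D (axis i1 1) = ux c (\<sigma> z)" "D (axis i2 1) = uy c (\<sigma> z)"
      using adapted[OF zW] comp0[of "axis i1 1"] comp0[of "axis i2 1"] tangent_u[OF c n'(1)] by simp_all
    have mem': "tangent_map A (\<lambda>x. \<Psi>' (z, x)) 0 e \<in> tangent_space A (u (\<sigma>' z))" for e
      using tangent_map_in_tangent_space[OF S' So, of 0 e] z2 1 by simp
    have memu: "tangent_map A u (\<sigma>' z) e \<in> tangent_space A (u (\<sigma>' z))" for e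
      by (rule tangent_map_in_tangent_space[OF u_smooth open_ball \<sigma>d(2)])
    have mem0: "tangent_map A (\<lambda>x. \<Psi> (z, x)) 0 e \<in> tangent_space A (u (\<sigma> z))" for e
      using tangent_map_in_tangent_space[OF S0' S0o, of 0 e] zW \<Psi>z by simp
    have "tangent_map A (\<lambda>x. \<Psi>' (z, x)) 0 (axis i1 1) = tangent_map A u (\<sigma>' z) 1"
      by (rule tangent_space_eqI[OF mem' memu c n'(2)])
        (simp add: comp' D12 tangent_u[OF c n'(2)] T_def N'(9)[OF n(1)])
    moreover have "tangent_map A (\<lambda>x. \<Psi>' (z, x)) 0 (axis i2 1) = tangent_map A u (\<sigma>' z) \<i>"
      by (rule tangent_space_eqI[OF mem' memu c n'(2)])
        (simp add: comp' D12 tangent_u[OF c n'(2)] T_def N'(9)[OF n(1)])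
    moreover have "inj (tangent_map A (\<lambda>x. \<Psi>' (z, x)) 0)"
    proof (rule injI)
      fix e e' assume "tangent_map A (\<lambda>x. \<Psi>' (z, x)) 0 e = tangent_map A (\<lambda>x. \<Psi>' (z, x)) 0 e'"
      then have "T z (D e) = T z (D e')" by (metis comp')
      then have "D e = D e'" by (rule Tinj[OF zV])
      then have "tangent_map A (\<lambda>x. \<Psi> (z, x)) 0 e = tangent_map A (\<lambda>x. \<Psi> (z, x)) 0 e'"
        by (intro tangent_space_eqI[OF mem0 mem0 c n'(1)]) (simp add: comp0)
      then show "e = e'" using adapted[OF zW] by (simp add: inj_eq)
    qed
    ultimately show ?thesis using 1 by blast
  qed
  moreover have "W1 \<union> W2 \<subseteq> unit_disc \<times> UNIV" using W(2) by (auto simp: W1_def W2_def W0_def)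
  ultimately show ?thesis unfolding tube_def using W1 W2 by (meson open_Un)
qed

lemma tube_cong:
  assumes t: "tube K \<sigma>" and O: "open O'" "K \<subseteq> O'" and eq: "\<And>z. z \<in> O' \<Longrightarrow> \<sigma>' z = \<sigma> z"
  shows "tube K \<sigma>'"
proof -
  obtain W and \<Psi> :: "complex \<times> (real^'n) \<Rightarrow> 'a" where W: "open W" "W \<subseteq> unit_disc \<times> UNIV" "K \<times> {0} \<subseteq> W"
    and \<Psi>: "smooth_into X A W \<Psi>" and adapted: "\<And>z. (z, 0) \<in> W \<Longrightarrow> \<Psi> (z, 0) = u (\<sigma> z) \<and>
       tangent_map A (\<lambda>x. \<Psi> (z, x)) 0 (axis i1 1) = tangent_map A u (\<sigma> z) 1 \<and>
       tangent_map A (\<lambda>x. \<Psi> (z, x)) 0 (axis i2 1) = tangent_map A u (\<sigma> z) \<i> \<and>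
       inj (tangent_map A (\<lambda>x. \<Psi> (z, x)) 0)"
    using t unfolding tube_def by blast
  let ?W = "W \<inter> fst -` O'"
  have "open ?W" by (intro open_Int W open_vimage O continuous_intros)
  moreover have "smooth_into X A ?W \<Psi>" by (rule smooth_into_subset[OF \<Psi>]) auto
  moreover have "K \<times> {0} \<subseteq> ?W" using W(3) O(2) by auto
  moreover have "?W \<subseteq> unit_disc \<times> UNIV" using W(2) by auto
  ultimately show ?thesis
    unfolding tube_def by (intro exI[of _ ?W] exI[of _ \<Psi>] conjI allI impI) (use adapted eq in auto)
qed

text \<open>The start of the transport: one affine piece of a chart around \<open>u 0\<close>, the
  same for all \<open>z\<close>, whose axes \<open>i1\<close>, \<open>i2\<close> are the frame of
  \<open>u\<close> at \<open>0\<close>.\<close>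

lemma tube_const:
  assumes K: "K \<subseteq> unit_disc" shows "tube K (\<lambda>z. 0)"
proof -
  obtain N c \<alpha> \<beta> where N: "steerable N c \<alpha> \<beta>" "0 \<in> N" using ex_steerable[of 0] by auto
  then have c: "c \<in> A" "u 0 \<in> fst c"
    and dual: "\<alpha> 0 \<bullet> ux c 0 = 1" "\<alpha> 0 \<bullet> uy c 0 = 0" "\<beta> 0 \<bullet> ux c 0 = 0" "\<beta> 0 \<bullet> uy c 0 = 1"
    unfolding steerable_def by blast+
  have ne: "ux c 0 \<noteq> uy c 0" using dual by auto
  have "ux c 0 \<noteq> k *\<^sub>R uy c 0" for k
  proof
    assume "ux c 0 = k *\<^sub>R uy c 0"
    then have "\<alpha> 0 \<bullet> ux c 0 = k * (\<alpha> 0 \<bullet> uy c 0)" by simp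
    then show False using dual by simp
  qed
  moreover have "uy c 0 \<noteq> 0" using dual(4) by auto
  ultimately have "independent {ux c 0, uy c 0}"
    using ne by (simp add: independent_insert span_singleton) (metis rangeE)
  then obtain L :: "real^'n \<Rightarrow> real^'n" where L: "linear L" "inj L" "L (axis i1 1) = ux c 0" "L (axis i2 1) = uy c 0"
    using ex_linear_frame[OF i12 _ ne] by blast
  have bl: "bounded_linear L" using L(1) linear_conv_bounded_linear by blast
  let ?f = "\<lambda>x. chart_inv c (snd c (u 0) + L x)"
  define S where "S = {x. snd c (u 0) + L x \<in> chart_image c}"
  note S = chart_inv_affine[where q = "snd c (u 0)", OF c(1) bl, folded S_def]
  have L0: "L 0 = 0" by (rule linear_0[OF L(1)])
  have f0: "?f 0 = u 0" using chart_inv_chart[OF c] L0 by simp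
  have S0: "0 \<in> S" using c by (auto simp: S_def L0 chart_image_def)
  let ?W = "unit_disc \<times> S"
  have W: "open ?W" by (intro open_Times open_ball S(1))
  have "smooth_into X A ?W (\<lambda>y. ?f (snd y))"
    by (rule smooth_into_comp[OF S(2,1) smooth_on_snd[OF W smooth_on_ident[OF W]] W]) auto
  moreover have "tangent_map A ?f 0 (axis i1 1) = tangent_map A u 0 1"
    by (rule tangent_space_eqI[OF tangent_map_in_tangent_space[OF S(2,1) S0, unfolded f0]
        tangent_map_in_tangent_space[OF u_smooth open_ball] c])
      (simp_all add: S(3)[OF S0] f0 L(3) tvec_of_coords_self[OF c] tangent_u[OF c] L0 chart_inv_chart[OF c])
  moreover have "tangent_map A ?f 0 (axis i2 1) = tangent_map A u 0 \<i>"
    by (rule tangent_space_eqI[OF tangent_map_in_tangent_space[OF S(2,1) S0, unfolded f0]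
        tangent_map_in_tangent_space[OF u_smooth open_ball] c])
      (simp_all add: S(3)[OF S0] f0 L(4) tvec_of_coords_self[OF c] tangent_u[OF c] L0 chart_inv_chart[OF c])
  moreover have "inj (tangent_map A ?f 0)" by (rule S(4)[OF S0 L(2)])
  ultimately show ?thesis
    unfolding tube_def using W K S0 f0
    by (intro exI[of _ ?W] exI[of _ "\<lambda>y. ?f (snd y)"] conjI allI impI) auto
qed

text \<open>The rays \<open>s *\<^sub>R z\<close> are traversed in finitely many short time steps.
  Within one time step different \<open>z\<close> need different charts, so the advance is localized
  further, to finitely many small balls of values of \<open>z\<close> treated one after the
  other.\<close>

theorem tube_id:
  assumes \<rho>: "0 \<le> \<rho>" "\<rho> < 1" shows "tube (cball 0 \<rho>) (\<lambda>z. z)"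
proof -
  let ?K = "cball (0::complex) \<rho>"
  have Kd: "?K \<subseteq> unit_disc" using \<rho> by auto
  define \<N> where "\<N> = {N. \<exists>c \<alpha> \<beta>. steerable N c \<alpha> \<beta>}"
  have "?K \<subseteq> \<Union>\<N>" using ex_steerable Kd unfolding \<N>_def by blast
  moreover have "\<And>N. N \<in> \<N> \<Longrightarrow> open N" unfolding \<N>_def steerable_def by blast
  \<comment> \<open>A Lebesgue number of the cover by steerable sets.\<close>
  ultimately obtain e where e: "e > 0" "\<forall>x\<in>?K. \<exists>N\<in>\<N>. ball x e \<subseteq> N"
    using Heine_Borel_lemma[OF compact_cball] by metis
  have disc: "(\<lambda>z. \<tau> z *\<^sub>R z) ` unit_disc \<subseteq> unit_disc" if "\<And>z. 0 \<le> \<tau> z \<and> \<tau> z \<le> 1" for \<tau> :: "complex \<Rightarrow> real"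
  proof clarify
    fix z :: complex assume z: "z \<in> unit_disc"
    have "\<bar>\<tau> z\<bar> * norm z \<le> 1 * norm z" using that[of z] by (intro mult_right_mono) auto
    then show "\<tau> z *\<^sub>R z \<in> unit_disc" using z by simp
  qed
  have step: "tube ?K (\<lambda>z. s' *\<^sub>R z)" if t: "tube ?K (\<lambda>z. s *\<^sub>R z)" and s: "0 \<le> s" "s \<le> s'" "s' \<le> 1" "s' - s \<le> e / 4" for s s'
  proof -
    \<comment> \<open>A smooth time function \<open>\<tau>\<close> interpolates between
      \<open>s\<close> and \<open>s'\<close>. It has reached \<open>s'\<close> on the balls already
      treated; once these cover the disc, the time step is complete.\<close>
    have move: "\<exists>\<tau>. smooth_on UNIV \<tau> \<and> (\<forall>z. s \<le> \<tau> z \<and> \<tau> z \<le> s') \<and>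
        (\<forall>z. (\<exists>j\<in>J. dist j z < e / 4) \<longrightarrow> \<tau> z = s') \<and> tube ?K (\<lambda>z. \<tau> z *\<^sub>R z)"
      if "finite J" "J \<subseteq> ?K" for J
      using that
    proof (induction J)
      case empty
      show ?case by (rule exI[of _ "\<lambda>z. s"]) (use t s in auto)
    next
      case (insert j J)
      then obtain \<tau> where \<tau>: "smooth_on UNIV \<tau>" "\<And>z. s \<le> \<tau> z \<and> \<tau> z \<le> s'"
        "\<And>z j. j \<in> J \<Longrightarrow> dist j z < e / 4 \<Longrightarrow> \<tau> z = s'" "tube ?K (\<lambda>z. \<tau> z *\<^sub>R z)" by blast
      \<comment> \<open>The argument of \<open>bump\<close> is the square of
        \<open>4 * norm (z - j) / e\<close>: it is at most \<open>1\<close> within distance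
        \<open>e / 4\<close> and at least \<open>4\<close> beyond \<open>e / 2\<close>.\<close>
      define \<psi> where "\<psi> z = bump ((16 / e\<^sup>2) *\<^sub>R (norm (z - j))\<^sup>2)" for z
      have s\<psi>: "smooth_on UNIV \<psi>"
        unfolding \<psi>_def[abs_def]
        by (intro smooth_on_bump smooth_on_linear_comp[OF bounded_linear_scaleR_right] smooth_on_norm_sq smooth_on_diff
            smooth_on_ident smooth_on_const open_UNIV)
      define \<tau>' where "\<tau>' z = \<tau> z + \<psi> z * (s' - \<tau> z)" for z
      have s\<tau>': "smooth_on UNIV \<tau>'"
        unfolding \<tau>'_def[abs_def] by (intro smooth_on_add smooth_on_mult smooth_on_diff smooth_on_const s\<psi> \<tau>(1) open_UNIV)
      have \<psi>1: "\<psi> z = 1" if "dist j z < e / 4" for z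
      proof -
        have "(norm (z - j))\<^sup>2 \<le> (e / 4)\<^sup>2" using that by (intro power_mono) (auto simp: dist_norm norm_minus_commute)
        then show ?thesis unfolding \<psi>_def by (intro bump_eq_1) (use e in \<open>simp add: field_simps power2_eq_square\<close>)
      qed
      have \<psi>0: "\<psi> z = 0" if "z \<notin> cball j (e / 2)" for z
      proof -
        have "(e / 2)\<^sup>2 \<le> (norm (z - j))\<^sup>2" using that e by (intro power_mono) (auto simp: dist_norm norm_minus_commute)
        then have "16 / e\<^sup>2 * (e / 2)\<^sup>2 \<le> 16 / e\<^sup>2 * (norm (z - j))\<^sup>2" by (rule mult_left_mono) simp
        moreover have "16 / e\<^sup>2 * (e / 2)\<^sup>2 = 4" using e by (simp add: power2_eq_square)
        ultimately show ?thesis unfolding \<psi>_def by (intro bump_eq_0) simp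
      qed
      have \<tau>': "s \<le> \<tau>' z \<and> \<tau>' z \<le> s'" for z
      proof -
        have p: "0 \<le> \<psi> z" "\<psi> z \<le> 1" by (simp_all add: \<psi>_def bump_nonneg bump_le_1)
        have "0 \<le> \<psi> z * (s' - \<tau> z)" using p \<tau>(2)[of z] by simp
        moreover have "\<psi> z * (s' - \<tau> z) \<le> 1 * (s' - \<tau> z)" using p \<tau>(2)[of z] by (intro mult_right_mono) auto
        ultimately show ?thesis using \<tau>(2)[of z] by (simp add: \<tau>'_def)
      qed
      have jK: "norm j \<le> \<rho>" using insert.prems by simp
      have "norm (s *\<^sub>R j) \<le> \<rho>"
        using mult_mono[of s 1 "norm j" \<rho>] s jK by simp
      then have "s *\<^sub>R j \<in> ?K" by (simp only: mem_cball_0)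
      then obtain N where "N \<in> \<N>" and Ne: "ball (s *\<^sub>R j) e \<subseteq> N" using e(2) by blast
      then obtain c \<alpha> \<beta> where N: "steerable N c \<alpha> \<beta>" unfolding \<N>_def by blast
      \<comment> \<open>The displacement is at most \<open>e / 4\<close> in time plus
        \<open>e / 2\<close> in position, hence within the Lebesgue number.\<close>
      have near: "t *\<^sub>R z \<in> N" if "s \<le> t" "t \<le> s'" "z \<in> ?K \<inter> cball j (e / 2)" for t z
      proof -
        have z: "norm z \<le> 1" "norm (z - j) \<le> e / 2" using that(3) \<rho> by (auto simp: dist_norm norm_minus_commute)
        have "norm (t *\<^sub>R z - s *\<^sub>R j) = norm ((t - s) *\<^sub>R z + s *\<^sub>R (z - j))" by (simp add: algebra_simps)
        also have "\<dots> \<le> \<bar>t - s\<bar> * norm z + \<bar>s\<bar> * norm (z - j)" by (rule order_trans[OF norm_triangle_ineq]) simp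
        also have "\<dots> \<le> (e / 4) * 1 + 1 * (e / 2)"
          using z that s e by (intro add_mono mult_mono) auto
        also have "\<dots> < e" using e by simp
        finally show ?thesis using Ne by (auto simp: dist_norm norm_minus_commute)
      qed
      have sm: "smooth_on unit_disc (\<lambda>z. \<tau> z *\<^sub>R z)" "smooth_on unit_disc (\<lambda>z. \<tau>' z *\<^sub>R z)"
        by (intro smooth_on_scaleR smooth_on_ident open_ball smooth_on_subset[OF \<tau>(1)] smooth_on_subset[OF s\<tau>'] subset_UNIV)+
      have "tube ?K (\<lambda>z. \<tau>' z *\<^sub>R z)"
      proof (rule tube_move[OF \<tau>(4) sm(1) disc sm(2) disc closed_cball _ N])
        show "0 \<le> \<tau> z \<and> \<tau> z \<le> 1" "0 \<le> \<tau>' z \<and> \<tau>' z \<le> 1" for z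
          using \<tau>(2)[of z] \<tau>'[of z] s by auto
        show "\<tau>' z *\<^sub>R z = \<tau> z *\<^sub>R z" if "z \<notin> cball j (e / 2)" for z by (simp add: \<tau>'_def \<psi>0[OF that])
        show "\<tau> z *\<^sub>R z \<in> N \<and> \<tau>' z *\<^sub>R z \<in> N" if "z \<in> ?K \<inter> cball j (e / 2)" for z
          using near[OF _ _ that] \<tau>(2)[of z] \<tau>'[of z] by blast
      qed
      moreover have "\<tau>' z = s'" if "\<exists>j'\<in>insert j J. dist j' z < e / 4" for z
      proof -
        have "dist j z < e / 4 \<or> (\<exists>j'\<in>J. dist j' z < e / 4)" using that by blast
        then show ?thesis using \<psi>1[of z] \<tau>(3)[of _ z] by (auto simp: \<tau>'_def)
      qed
      ultimately show ?case using s\<tau>' \<tau>' by blast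
    qed
    obtain J where J: "J \<subseteq> ?K" "finite J" "?K \<subseteq> (\<Union>j\<in>J. ball j (e / 4))"
    proof (rule compactE_image[OF compact_cball, of ?K "\<lambda>j. ball j (e / 4)"])
      show "?K \<subseteq> (\<Union>j\<in>?K. ball j (e / 4))"
      proof
        fix z assume z: "z \<in> ?K"
        have "z \<in> ball z (e / 4)" using e(1) by simp
        with z show "z \<in> (\<Union>j\<in>?K. ball j (e / 4))" by (rule UN_I)
      qed
    qed auto
    obtain \<tau> where \<tau>: "\<And>z j. j \<in> J \<Longrightarrow> dist j z < e / 4 \<Longrightarrow> \<tau> z = s'" "tube ?K (\<lambda>z. \<tau> z *\<^sub>R z)"
      using move[OF J(2,1)] by blast
    show ?thesis
      by (rule tube_cong[OF \<tau>(2) _ J(3)]) (use \<tau>(1) in auto)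
  qed
  obtain n where n: "n > 0" "inverse (real n) < e / 4" using reals_Archimedean[of "e / 4"] e(1) by (metis zero_less_Suc zero_less_divide_iff zero_less_numeral)
  have "k \<le> n \<Longrightarrow> tube ?K (\<lambda>z. (real k / real n) *\<^sub>R z)" for k
  proof (induction k)
    case 0
    then show ?case using tube_const[OF Kd] by simp
  next
    case (Suc k)
    have "real (Suc k) / real n - real k / real n = inverse (real n)" using n by (simp add: field_simps)
    moreover have "tube ?K (\<lambda>z. (real k / real n) *\<^sub>R z)" using Suc by simp
    moreover have "real (Suc k) / real n \<le> 1" using Suc.prems n by simp
    moreover have "real k / real n \<le> real (Suc k) / real n" by (simp add: divide_right_mono)
    ultimately show ?case using n(2) step[of "real k / real n" "real (Suc k) / real n"] by simp
  qed
  from this[of n] show ?thesis using n(1) by simp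
qed

text \<open>Folds the family of maps into one: two coordinates select the point of the disc, the
  others move within the fibre. Adaptedness makes the differential injective along the plane, and
  openness of injectivity gives a neighbourhood.\<close>

theorem ex_tubular_map:
  assumes \<rho>: "0 < \<rho>" "\<rho> < 1"
  obtains S and f :: "real^'n \<Rightarrow> 'a" and R where "R > 1" "open S" "smooth_into X A S f"
    "\<And>x. x \<in> S \<Longrightarrow> inj (tangent_map A f x)"
    "\<And>z. z \<in> ball 0 R \<Longrightarrow> plane i1 i2 z \<in> S \<and> f (plane i1 i2 z) = u (\<rho> *\<^sub>R z)"
proof -
  \<comment> \<open>Halfway between \<open>\<rho>\<close> and \<open>1\<close>, so that
    \<open>R = \<rho>1 / \<rho>\<close> exceeds \<open>1\<close> while the transport stays inside
    the unit disc.\<close>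
  define \<rho>1 where "\<rho>1 = (1 + \<rho>) / 2"
  have \<rho>1: "0 \<le> \<rho>1" "\<rho>1 < 1" "\<rho> < \<rho>1" using \<rho> by (auto simp: \<rho>1_def)
  obtain W and \<Psi> :: "complex \<times> (real^'n) \<Rightarrow> 'a" where W: "open W" "W \<subseteq> unit_disc \<times> UNIV" "cball 0 \<rho>1 \<times> {0} \<subseteq> W"
    and \<Psi>: "smooth_into X A W \<Psi>" and adapted: "\<And>z. (z, 0) \<in> W \<Longrightarrow> \<Psi> (z, 0) = u z \<and>
       tangent_map A (\<lambda>x. \<Psi> (z, x)) 0 (axis i1 1) = tangent_map A u z 1 \<and>
       tangent_map A (\<lambda>x. \<Psi> (z, x)) 0 (axis i2 1) = tangent_map A u z \<i> \<and>
       inj (tangent_map A (\<lambda>x. \<Psi> (z, x)) 0)"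
    using tube_id[OF \<rho>1(1,2)] unfolding tube_def by blast
  define \<zeta> :: "real^'n \<Rightarrow> complex" where "\<zeta> y = Complex (y $ i1) (y $ i2)" for y
  \<comment> \<open>The coordinates \<open>i1\<close>, \<open>i2\<close> become the disc variable,
    scaled by \<open>\<rho>\<close>, and are removed from the fibre variable.\<close>
  define h where "h y = (\<rho> *\<^sub>R \<zeta> y, y - plane i1 i2 (\<zeta> y))" for y
  have "linear h"
    by (simp add: linear_iff h_def \<zeta>_def plane_def vec_eq_iff complex_eq_iff algebra_simps)
  then have h: "bounded_linear h" using linear_conv_bounded_linear by blast
  define f where "f y = \<Psi> (h y)" for y
  define S1 where "S1 = h -` W"
  have S1: "open S1" unfolding S1_def by (intro open_vimage W(1) linear_continuous_on h)
  have f: "smooth_into X A S1 f"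
    unfolding f_def[abs_def] by (rule smooth_into_comp[OF \<Psi> W(1) smooth_on_bounded_linear[OF h S1] S1]) (simp add: S1_def)
  define S where "S = {x \<in> S1. inj (tangent_map A f x)}"
  have S: "open S" unfolding S_def by (rule inj_tangent_map_open[OF f S1])
  have hp: "h (plane i1 i2 z) = (\<rho> *\<^sub>R z, 0)" for z
    using i12 by (simp add: h_def \<zeta>_def plane_def vec_eq_iff complex_eq_iff axis_def)
  have pl: "plane i1 i2 z \<in> S \<and> f (plane i1 i2 z) = u (\<rho> *\<^sub>R z)" if z: "z \<in> ball 0 (\<rho>1 / \<rho>)" for z
  proof -
    let ?w = "\<rho> *\<^sub>R z"
    have "norm ?w \<le> \<rho>1" using z \<rho> by (simp add: field_simps)
    then have wW: "(?w, 0) \<in> W" using W(3) by auto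
    have zS1: "plane i1 i2 z \<in> S1" using wW by (simp add: S1_def hp)
    let ?s = "tangent_map A (\<lambda>x. \<Psi> (?w, x)) 0"
    have slice: "smooth_into X A {x. (?w, x) \<in> W} (\<lambda>x. \<Psi> (?w, x))" "open {x. (?w, x) \<in> W}"
      by (rule smooth_into_slice[OF \<Psi> W(1)])+
    have s0: "0 \<in> {x. (?w, x) \<in> W}" using wW by simp
    have t2: "tangent_map A \<Psi> (?w, 0) (0, x) = ?s x" for x
      by (rule tangent_map_comp[OF \<Psi> W(1), symmetric]) (use wW in \<open>auto intro!: derivative_eq_intros\<close>)
    have wd: "?w \<in> unit_disc" using wW W(2) by blast
    have t1: "tangent_map A \<Psi> (?w, 0) (a, 0) = ?s (plane i1 i2 a)" for a
    proof -
      have oz: "open {z. (z, 0::real^'n) \<in> W}"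
      proof -
        have "{z. (z, 0::real^'n) \<in> W} = (\<lambda>z. (z, 0)) -` W" by auto
        then show ?thesis by (simp add: open_vimage[OF W(1)] continuous_intros)
      qed
      have "tangent_map A \<Psi> (?w, 0) (a, 0) = tangent_map A (\<lambda>z. \<Psi> (z, 0)) ?w a"
        by (rule tangent_map_comp[OF \<Psi> W(1), symmetric]) (use wW in \<open>auto intro!: derivative_eq_intros\<close>)
      also have "\<dots> = tangent_map A u ?w a"
        by (rule fun_cong[OF tangent_map_cong[OF u_smooth open_ball wd oz]]) (use wW adapted in auto)
      also have "\<dots> = tangent_map A u ?w (Re a *\<^sub>R 1 + Im a *\<^sub>R \<i>)"
        by (rule arg_cong[where f="tangent_map A u ?w"]) (simp add: complex_eq_iff)
      also have "\<dots> = tvec_add (tvec_scale (Re a) (?s (axis i1 1))) (tvec_scale (Im a) (?s (axis i2 1)))"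
        using adapted[OF wW] by (simp add: tangent_map_add[OF u_smooth open_ball wd])
      also have "\<dots> = ?s (plane i1 i2 a)" by (simp add: plane_def tangent_map_add[OF slice s0])
      finally show ?thesis .
    qed
    \<comment> \<open>By adaptedness the derivative in the disc variable equals the fibre derivative
      along the plane. Hence the differential is the injective one of the fibre map after
      multiplication of the coordinates \<open>i1\<close>, \<open>i2\<close> by
      \<open>\<rho>\<close>.\<close>
    have t: "tangent_map A f (plane i1 i2 z) e = ?s (plane i1 i2 (\<rho> *\<^sub>R \<zeta> e) + (e - plane i1 i2 (\<zeta> e)))" for e
    proof -
      have "tangent_map A f (plane i1 i2 z) e = tangent_map A \<Psi> (h (plane i1 i2 z)) (h e)"
        unfolding f_def[abs_def]
        by (rule tangent_map_comp[OF \<Psi> W(1) bounded_linear_imp_has_derivative[OF h]]) (use wW in \<open>simp add: hp\<close>)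
      also have "\<dots> = tangent_map A \<Psi> (?w, 0) ((\<rho> *\<^sub>R \<zeta> e, 0) + (0, e - plane i1 i2 (\<zeta> e)))"
        by (simp add: hp h_def[of e])
      also have "\<dots> = ?s (plane i1 i2 (\<rho> *\<^sub>R \<zeta> e) + (e - plane i1 i2 (\<zeta> e)))"
        unfolding tangent_map_add(1)[OF \<Psi> W(1) wW] t1 t2 tangent_map_add(1)[OF slice s0] by (rule refl)
      finally show ?thesis .
    qed
    have "inj (tangent_map A f (plane i1 i2 z))"
    proof (rule injI)
      fix e e' assume "tangent_map A f (plane i1 i2 z) e = tangent_map A f (plane i1 i2 z) e'"
      then have eq: "plane i1 i2 (\<rho> *\<^sub>R \<zeta> e) + (e - plane i1 i2 (\<zeta> e)) = plane i1 i2 (\<rho> *\<^sub>R \<zeta> e') + (e' - plane i1 i2 (\<zeta> e'))"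
        unfolding t using adapted[OF wW] by (simp add: inj_eq)
      have "e $ j = e' $ j" for j
        using arg_cong[OF eq, of "\<lambda>v. v $ j"] i12 \<rho> by (auto simp: plane_def \<zeta>_def axis_def split: if_splits)
      then show "e = e'" by (simp add: vec_eq_iff)
    qed
    then show ?thesis using zS1 adapted[OF wW] by (simp add: S_def f_def hp)
  qed
  show ?thesis
    by (rule that[of "\<rho>1 / \<rho>" S f]) (use \<rho> \<rho>1 S pl smooth_into_subset[OF f] in \<open>auto simp: S_def\<close>)
qed

end

section \<open>Upper semicontinuity\<close>

lemma frechet_derivative_cong_open:
  assumes "open S" "x \<in> S" "\<And>y. y \<in> S \<Longrightarrow> f y = h y"
  shows "frechet_derivative f (at x) = frechet_derivative h (at x)"
proof -
  have "(f has_derivative D) (at x) \<longleftrightarrow> (h has_derivative D) (at x)" for D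
    using has_derivative_transform_within_open[of f D x UNIV S h] has_derivative_transform_within_open[of h D x UNIV S f] assms
    by auto
  then show ?thesis by (simp add: frechet_derivative_def)
qed

lemma tension_cong:
  assumes S: "open S" "z \<in> S" and eq: "\<And>y. y \<in> S \<Longrightarrow> v y = w y"
  shows "tension G v z = tension G w z"
proof -
  have d: "frechet_derivative v (at y) = frechet_derivative w (at y)" if "y \<in> S" for y
    by (rule frechet_derivative_cong_open[OF S(1) that eq])
  have "frechet_derivative (\<lambda>y. frechet_derivative v (at y) e) (at z) =
      frechet_derivative (\<lambda>y. frechet_derivative w (at y) e) (at z)" for e
    by (rule frechet_derivative_cong_open[OF S]) (simp add: d)
  then show ?thesis by (simp add: tension_def d[OF S(2)] eq[OF S(2)])
qed

lemma christoffel_quad_scaleR: "christoffel_quad G x (r *\<^sub>R a) = r\<^sup>2 *\<^sub>R christoffel_quad G x a"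
  by (simp add: christoffel_quad_def vec_eq_iff sum_distrib_left power2_eq_square mult_ac)

lemma tension_linear:
  assumes "bounded_linear v"
  shows "tension G v z = christoffel_quad G (v z) (v 1) + christoffel_quad G (v z) (v \<i>)"
proof -
  have "frechet_derivative v (at y) = v" for y
    by (rule frechet_derivativeI[OF bounded_linear_imp_has_derivative[OF assms]])
  then show ?thesis by (simp add: tension_def)
qed

text \<open>The induced map of tangent bundles has a block triangular derivative with the invertible
  differential of \<open>\<Phi>\<close> in both diagonal blocks, so an open mapping theorem
  applies.\<close>

lemma derivative_map_open:
  fixes \<Phi> :: "'a::euclidean_space \<Rightarrow> 'a"
  assumes \<Phi>: "smooth_on S \<Phi>" "open S" "q0 \<in> S" and inj: "inj (frechet_derivative \<Phi> (at q0))"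
    and T: "open T" "T \<subseteq> S \<times> UNIV" "(q0, e0) \<in> T"
  shows "(\<Phi> q0, frechet_derivative \<Phi> (at q0) e0) \<in>
    interior ((\<lambda>y. (\<Phi> (fst y), frechet_derivative \<Phi> (at (fst y)) (snd y))) ` T)"
proof -
  let ?D = "frechet_derivative \<Phi> (at q0)"
  let ?B = "frechet_derivative (\<lambda>y. frechet_derivative \<Phi> (at y) e0) (at q0)"
  let ?H = "\<lambda>y. (\<Phi> (fst y), frechet_derivative \<Phi> (at (fst y)) (snd y))"
  have D: "linear ?D" by (rule smooth_on_linear_frechet[OF \<Phi>(1,3)])
  have B: "linear ?B" by (rule smooth_on_linear_frechet[OF smooth_on_frechet[OF \<Phi>(1)] \<Phi>(3)])
  obtain M where M: "linear M" "\<And>x. M (?D x) = x" "\<And>x. ?D (M x) = x"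
    using linear_injective_isomorphism[OF D inj] by blast
  have blM: "bounded_linear M" and blB: "bounded_linear ?B" using M B by (auto simp: linear_conv_bounded_linear)
  have o: "open (S \<times> (UNIV::'a set))" by (intro open_Times \<Phi>(2) open_UNIV)
  have sd: "((\<lambda>y. frechet_derivative \<Phi> (at (fst y)) (snd y)) has_derivative
      (\<lambda>h. frechet_derivative (\<lambda>x. frechet_derivative \<Phi> (at x) (snd y)) (at (fst y)) (fst h) + frechet_derivative \<Phi> (at (fst y)) (snd h))) (at y)"
    if "y \<in> S \<times> UNIV" for y
    by (rule frechet_apply_has_derivative[OF smooth_onD[OF \<Phi>(1)] \<Phi>(2) _ o that])
      (auto intro!: derivative_eq_intros)
  have fst': "((\<lambda>y. \<Phi> (fst y)) has_derivative (\<lambda>h. frechet_derivative \<Phi> (at (fst y)) (fst h))) (at y)"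
    if "y \<in> S \<times> (UNIV::'a set)" for y
    by (rule has_derivative_compose[OF has_derivative_fst[OF has_derivative_ident] smooth_on_has_derivative[OF \<Phi>(1)]])
      (use that in auto)
  show ?thesis
  proof (rule sussmann_open_mapping[of "S \<times> UNIV" ?H "(q0, e0)", simplified fst_conv snd_conv])
    show "continuous_on (S \<times> UNIV) ?H"
      by (intro continuous_on_Pair differentiable_imp_continuous_on differentiable_at_imp_differentiable_on)
        (use sd fst' in \<open>auto intro!: differentiableI\<close>)
    show "(?H has_derivative (\<lambda>h. (?D (fst h), ?B (fst h) + ?D (snd h)))) (at (q0, e0))"
      using has_derivative_Pair[OF fst'[of "(q0, e0)"] sd[of "(q0, e0)"]] \<Phi>(3) by simp
    \<comment> \<open>The right inverse, found by back substitution in the triangular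
      system.\<close>
    show "bounded_linear (\<lambda>k. (M (fst k), M (snd k - ?B (M (fst k)))))"
      by (intro bounded_linear_Pair bounded_linear_compose[OF blM] bounded_linear_compose[OF blB] bounded_linear_sub
          bounded_linear_fst bounded_linear_snd)
    show "(\<lambda>h. (?D (fst h), ?B (fst h) + ?D (snd h))) \<circ> (\<lambda>k. (M (fst k), M (snd k - ?B (M (fst k))))) = id"
      by (simp add: fun_eq_iff M(3))
  qed (use T \<Phi>(3) o in \<open>auto simp: interior_open\<close>)
qed

lemma (in smooth_manifold) tangent_map_inj_chart:
  assumes f: "smooth_into X A S f" "open S" "x \<in> S" and c: "c \<in> A" "f x \<in> fst c" and inj: "inj (tangent_map A f x)"
  shows "inj (frechet_derivative (\<lambda>x. snd c (f x)) (at x))"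
proof (rule injI)
  fix a b assume eq: "frechet_derivative (\<lambda>x. snd c (f x)) (at x) a = frechet_derivative (\<lambda>x. snd c (f x)) (at x) b"
  have "tangent_map A f x a = tangent_map A f x b"
    by (rule tangent_space_eqI[OF tangent_map_in_tangent_space[OF f] tangent_map_in_tangent_space[OF f] c])
      (use eq c in \<open>simp add: tangent_map_def\<close>)
  then show "a = b" by (rule injD[OF inj])
qed

text \<open>Reads off, in tubular coordinates, that the plane is conformal and harmonic for the
  pulled-back metric, because the tubular map takes it to a rescaled copy of \<open>u\<close>. These
  are the conditions on the base in \<open>conformal_harmonic_family\<close>.\<close>

lemma (in conformal_disc) tubular_base:
  assumes \<rho>: "0 < \<rho>" "\<rho> < 1" and R: "R > 1" and f: "smooth_into X A S f" "open S"
    and inj: "\<And>x. x \<in> S \<Longrightarrow> inj (tangent_map A f x)"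
    and pl: "\<And>z. z \<in> ball 0 R \<Longrightarrow> plane i1 i2 z \<in> S \<and> f (plane i1 i2 z) = u (\<rho> *\<^sub>R z)"
    and z: "z \<in> ball 0 R" "\<rho> *\<^sub>R z \<in> unit_disc"
  shows "tangent_map A f (plane i1 i2 z) (plane i1 i2 e) = tangent_map A u (\<rho> *\<^sub>R z) (\<rho> *\<^sub>R e)"
    and "pullback_matrix f (plane i1 i2 z) $ i1 $ i1 = pullback_matrix f (plane i1 i2 z) $ i2 $ i2"
    and "pullback_matrix f (plane i1 i2 z) $ i1 $ i2 = 0"
    and "christoffel_quad (pullback_matrix f) (plane i1 i2 z) (axis i1 1) +
      christoffel_quad (pullback_matrix f) (plane i1 i2 z) (axis i2 1) = 0"
proof -
  have blp: "bounded_linear (plane i1 i2)" by (rule bounded_linear_plane)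
  define T where "T = {z. z \<in> ball 0 R \<and> \<rho> *\<^sub>R z \<in> unit_disc}"
  have "T = ball 0 R \<inter> (\<lambda>z. \<rho> *\<^sub>R z) -` unit_disc" by (auto simp: T_def)
  then have T: "open T" by (simp add: open_Int open_vimage continuous_intros)
  have zT: "z \<in> T" using z by (simp add: T_def)
  have zS: "plane i1 i2 z \<in> S" using pl z by blast
  have fu: "smooth_into X A T (\<lambda>z. f (plane i1 i2 z))"
    by (rule smooth_into_comp[OF f smooth_on_bounded_linear[OF blp T] T]) (use pl in \<open>simp add: T_def\<close>)
  have t: "tangent_map A f (plane i1 i2 z) (plane i1 i2 e) = tangent_map A u (\<rho> *\<^sub>R z) (\<rho> *\<^sub>R e)" for e
  proof -
    have "tangent_map A f (plane i1 i2 z) (plane i1 i2 e) = tangent_map A (\<lambda>z. f (plane i1 i2 z)) z e"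
      by (rule tangent_map_comp[OF f bounded_linear_imp_has_derivative[OF blp] zS, symmetric])
    also have "\<dots> = tangent_map A (\<lambda>z. u (\<rho> *\<^sub>R z)) z e"
      by (rule fun_cong[OF tangent_map_cong[OF fu T zT T zT], symmetric]) (use pl in \<open>simp add: T_def\<close>)
    also have "\<dots> = tangent_map A u (\<rho> *\<^sub>R z) (\<rho> *\<^sub>R e)"
      by (rule tangent_map_comp[OF u_smooth open_ball has_derivative_scaleR_right[OF has_derivative_ident] z(2)])
    finally show ?thesis .
  qed
  then show "tangent_map A f (plane i1 i2 z) (plane i1 i2 e) = tangent_map A u (\<rho> *\<^sub>R z) (\<rho> *\<^sub>R e)" .
  obtain \<phi> where \<phi>: "\<And>v w. g (u (\<rho> *\<^sub>R z)) (differential A u (\<rho> *\<^sub>R z) v) (differential A u (\<rho> *\<^sub>R z) w) = exp (\<phi> (\<rho> *\<^sub>R z)) * (v \<bullet> w)"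
    using u z(2) unfolding conformal_harmonic_immersion_def conformal_def by blast
  have ax: "axis i1 1 = plane i1 i2 1" "axis i2 1 = plane i1 i2 \<i>" by (simp_all add: plane_def)
  have pb: "pullback f (plane i1 i2 z) (plane i1 i2 a) (plane i1 i2 b) = exp (\<phi> (\<rho> *\<^sub>R z)) * (\<rho>\<^sup>2 * (a \<bullet> b))" for a b
    unfolding pullback_def t using pl[OF z(1)] \<phi>[of "\<rho> *\<^sub>R a" "\<rho> *\<^sub>R b"]
    by (simp add: differential_eq_tangent_map power2_eq_square)
  show "pullback_matrix f (plane i1 i2 z) $ i1 $ i1 = pullback_matrix f (plane i1 i2 z) $ i2 $ i2"
    "pullback_matrix f (plane i1 i2 z) $ i1 $ i2 = 0"
    unfolding pullback_matrix_def by (simp_all add: ax pb inner_complex_def)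
  \<comment> \<open>Undoes the scaling, so that \<open>f\<close> after \<open>v\<close> is
    \<open>u\<close> itself. As \<open>v\<close> is linear, its tension consists of the two
    Christoffel terms alone.\<close>
  define v where "v y = plane i1 i2 (inverse \<rho> *\<^sub>R y)" for y
  have blv: "bounded_linear v"
    unfolding v_def[abs_def] by (rule bounded_linear_compose[OF blp bounded_linear_scaleR_right])
  define T' where "T' = unit_disc \<inter> (\<lambda>y. inverse \<rho> *\<^sub>R y) -` ball 0 R"
  have T': "open T'" unfolding T'_def by (intro open_Int open_ball open_vimage continuous_intros)
  let ?w = "\<rho> *\<^sub>R z"
  have wT': "?w \<in> T'" using z \<rho> by (simp add: T'_def)
  have vw: "v ?w = plane i1 i2 z" using \<rho> by (simp add: v_def)
  have vS: "v y \<in> S" "f (v y) = u y" if "y \<in> T'" for y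
    using pl[of "inverse \<rho> *\<^sub>R y"] that \<rho> by (auto simp: T'_def v_def)
  obtain c where c: "c \<in> A" "f (v ?w) \<in> fst c" using ex_chart[OF smooth_into_topspace[OF f(1) vS(1)[OF wT']]] .
  have fvw: "f (v ?w) = u ?w" by (rule vS(2)[OF wT'])
  have "tension (metric_matrix A g c) (\<lambda>y. snd c (f (v y))) ?w =
      frechet_derivative (\<lambda>x. snd c (f x)) (at (v ?w)) (tension (pullback_matrix f) v ?w)"
    by (rule tension_pullback[OF f inj smooth_on_bounded_linear[OF blv T'] T' wT' vS(1) c])
  moreover have "tension (metric_matrix A g c) (\<lambda>y. snd c (f (v y))) ?w = tension (metric_matrix A g c) (\<lambda>y. snd c (u y)) ?w"
    by (rule tension_cong[OF T' wT']) (simp add: vS(2))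
  moreover have "tension (metric_matrix A g c) (\<lambda>y. snd c (u y)) ?w = 0"
    using u c z(2) unfolding conformal_harmonic_immersion_def harmonic_iff_tension[OF u_smooth] fvw by blast
  ultimately have "frechet_derivative (\<lambda>x. snd c (f x)) (at (v ?w)) (tension (pullback_matrix f) v ?w) = 0" by simp
  moreover have "linear (frechet_derivative (\<lambda>x. snd c (f x)) (at (v ?w)))"
    by (rule has_derivative_linear[OF smooth_into_has_derivative[OF f c(1) vS(1)[OF wT'] c(2)]])
  moreover have "inj (frechet_derivative (\<lambda>x. snd c (f x)) (at (v ?w)))"
    by (rule tangent_map_inj_chart[OF f vS(1)[OF wT'] c inj[OF vS(1)[OF wT']]])
  ultimately have "tension (pullback_matrix f) v ?w = 0" using linear_injective_0 by blast
  then have "christoffel_quad (pullback_matrix f) (plane i1 i2 z) (inverse \<rho> *\<^sub>R axis i1 1) +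
      christoffel_quad (pullback_matrix f) (plane i1 i2 z) (inverse \<rho> *\<^sub>R axis i2 1) = 0"
    unfolding tension_linear[OF blv] vw by (simp add: v_def plane_def)
  then show "christoffel_quad (pullback_matrix f) (plane i1 i2 z) (axis i1 1) +
      christoffel_quad (pullback_matrix f) (plane i1 i2 z) (axis i2 1) = 0"
    using \<rho> unfolding christoffel_quad_scaleR scaleR_add_right[symmetric] by simp
qed

section \<open>Semicontinuity at nonzero and at zero vectors\<close>

context riemannian_manifold
begin

lemma tvec_of_coords_eq_zero_iff:
  assumes "c \<in> A" "p \<in> fst c" shows "tvec_of_coords A c p w = tvec_zero \<longleftrightarrow> w = 0"
proof
  assume "tvec_of_coords A c p w = tvec_zero"
  then show "w = 0" using tvec_of_coords_self[OF assms, of w] by (simp add: tvec_zero_def)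
next
  assume "w = 0"
  then show "tvec_of_coords A c p w = tvec_zero"
    using tvec_of_coords_linear(2)[OF assms, of 0 w] by (simp add: tvec_zero_def tvec_scale_def)
qed

lemma bundle_param_in_tangent_bundle:
  assumes "c \<in> A" "x \<in> chart_image c" shows "bundle_param A c (x, w) \<in> tangent_bundle X A"
  using tvec_of_coords_in_tangent_space[OF assms(1) chart_inv_in[OF assms(2)]] chart_subset[OF assms(1)] chart_inv_in[OF assms(2)]
  by (auto simp: bundle_param_def tangent_bundle_def)

abbreviation F where "F \<equiv> kobayashi_royden X A g"

text \<open>A disc admissible for \<open>w\<close> with radius \<open>r\<close> is admissible for
  \<open>t *\<^sub>R w\<close> with radius \<open>r / t\<close>.\<close>

lemma kobayashi_royden_scale:
  assumes c: "c \<in> A" "x \<in> chart_image c" and b: "F (bundle_param A c (x, w)) < ennreal b" and t: "t > 0"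
  shows "F (bundle_param A c (x, t *\<^sub>R w)) < ennreal (t * b)"
proof -
  let ?p = "chart_inv c x"
  have p: "?p \<in> fst c" by (rule chart_inv_in[OF c(2)])
  have b0: "b > 0" using b by (cases "b > 0") (auto simp: ennreal_neg)
  show ?thesis
  proof (cases "w = 0")
    case True
    then show ?thesis
      using tvec_of_coords_eq_zero_iff[OF c(1) p, of 0] b0 t by (simp add: bundle_param_def kobayashi_royden_def)
  next
    case False
    have nz: "tvec_of_coords A c ?p w \<noteq> tvec_zero" "tvec_of_coords A c ?p (t *\<^sub>R w) \<noteq> tvec_zero"
      using False t tvec_of_coords_eq_zero_iff[OF c(1) p] by auto
    obtain r u where r: "r > 0" "ennreal (1 / r) < ennreal b" "conformal_harmonic_immersion X A g u" "u 0 = ?p"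
      "differential A u 0 1 = tvec_scale r (tvec_of_coords A c ?p w)"
      using b unfolding bundle_param_def prod.case kobayashi_royden_less_iff[OF nz(1)] by blast
    have "1 / r < b" using r(1,2) by (simp add: ennreal_less_iff)
    then have "t * (1 / r) < t * b" using t by (rule mult_strict_left_mono)
    then have "ennreal (1 / (r / t)) < ennreal (t * b)" using r(1) t by (simp add: ennreal_less_iff)
    moreover have "differential A u 0 1 = tvec_scale (r / t) (tvec_of_coords A c ?p (t *\<^sub>R w))"
      using t unfolding r(5) tvec_of_coords_linear(2)[OF c(1) p] by (simp add: tvec_scale_def)
    ultimately show ?thesis
      unfolding bundle_param_def prod.case kobayashi_royden_less_iff[OF nz(2)] using r(1,3,4) t
      by (intro exI[of _ "r / t"]) auto
  qed
qed

text \<open>A competitor for the given vector is shrunk so little that its bound stays below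
  \<open>a\<close>. Perturbing the shrunk disc realizes an open set of 1-jets with the same factor
  \<open>\<rho> * r\<close>, hence the same bound for all nearby vectors.\<close>

lemma upper_semicontinuous_nonzero:
  assumes n: "CARD('n) \<ge> 2" and c: "c \<in> A" and x0: "x0 \<in> chart_image c" and w0: "w0 \<noteq> 0"
    and less: "F (bundle_param A c (x0, w0)) < a"
  shows "\<exists>O'. open O' \<and> (x0, w0) \<in> O' \<and> O' \<subseteq> chart_image c \<times> UNIV \<and> (\<forall>y\<in>O'. F (bundle_param A c y) < a)"
proof -
  let ?p0 = "chart_inv c x0"
  have p0: "?p0 \<in> fst c" by (rule chart_inv_in[OF x0])
  have nz: "tvec_of_coords A c ?p0 w0 \<noteq> tvec_zero" using w0 tvec_of_coords_eq_zero_iff[OF c p0] by blast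
  obtain r u where r: "r > 0" "ennreal (1 / r) < a" and u: "conformal_harmonic_immersion X A g u" "u 0 = ?p0"
    "differential A u 0 1 = tvec_scale r (tvec_of_coords A c ?p0 w0)"
    using less unfolding bundle_param_def prod.case kobayashi_royden_less_iff[OF nz] by blast
  obtain b where b: "1 / r < b" "ennreal b < a"
  proof -
    obtain y where y: "ennreal (1 / r) < y" "y < a" using dense[OF r(2)] by blast
    then obtain b where "y = ennreal b" "b \<ge> 0" by (cases y) auto
    then show ?thesis using y that[of b] r(1) by (simp add: ennreal_less_iff)
  qed
  have b0: "b > 0" using b(1) r(1) by (meson divide_pos_pos less_trans zero_less_one)
  \<comment> \<open>Then \<open>u (\<rho> *\<^sub>R z)\<close> has velocity
    \<open>\<rho> * r\<close> times the given vector at the centre, and the corresponding bound is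
    \<open>1 / (\<rho> * r) = b\<close>, which lies below \<open>a\<close>.\<close>
  define \<rho> where "\<rho> = 1 / (r * b)"
  have \<rho>: "0 < \<rho>" "\<rho> < 1" using r(1) b(1) b0 by (auto simp: \<rho>_def field_simps)
  have \<rho>r: "1 / (\<rho> * r) = b" "\<rho> * r > 0" using r(1) b0 by (auto simp: \<rho>_def)
  obtain i1 i2 :: 'n where i: "i1 \<noteq> i2"
    using n card_le_Suc0_iff_eq[of "UNIV::'n set"] by fastforce
  interpret u: conformal_disc X A g u i1 i2 by unfold_locales (use u i in auto)
  obtain S and f :: "real^'n \<Rightarrow> 'a" and R where R: "R > 1" and S: "open S" and f: "smooth_into X A S f"
    and inj: "\<And>x. x \<in> S \<Longrightarrow> inj (tangent_map A f x)"
    and pl: "\<And>z. z \<in> ball 0 R \<Longrightarrow> plane i1 i2 z \<in> S \<and> f (plane i1 i2 z) = u (\<rho> *\<^sub>R z)"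
    using u.ex_tubular_map[OF \<rho>] by metis
  \<comment> \<open>Midpoints ensure that \<open>R0\<close> exceeds \<open>1\<close> but stays below
    both \<open>R\<close>, where the tubular map describes \<open>u\<close>, and
    \<open>1 / \<rho>\<close>, beyond which \<open>\<rho> *\<^sub>R z\<close> leaves the unit
    disc.\<close>
  define R0 where "R0 = min ((1 + R) / 2) ((1 + 1 / \<rho>) / 2)"
  have R0: "R0 > 1" "R0 < R" "\<rho> * R0 < 1"
  proof -
    show "R0 > 1" using R \<rho> by (simp add: R0_def field_simps)
    show "R0 < R" using R unfolding R0_def by (intro min.strict_coboundedI1) simp
    have "R0 \<le> (1 + 1 / \<rho>) / 2" unfolding R0_def by (rule min.cobounded2)
    then have "\<rho> * R0 \<le> \<rho> * ((1 + 1 / \<rho>) / 2)" using \<rho> by (intro mult_left_mono) auto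
    also have "\<dots> = (\<rho> + 1) / 2" using \<rho> by (simp add: field_simps)
    also have "\<dots> < 1" using \<rho> by simp
    finally show "\<rho> * R0 < 1" .
  qed
  have zR: "z \<in> ball 0 R" "\<rho> *\<^sub>R z \<in> unit_disc" if "z \<in> cball 0 R0" for z
  proof -
    have "norm z \<le> R0" using that by simp
    then show "z \<in> ball 0 R" using R0(2) by simp
    have "\<rho> * norm z \<le> \<rho> * R0" using \<open>norm z \<le> R0\<close> \<rho> by (intro mult_left_mono) auto
    then have "\<rho> * norm z < 1" using R0(3) by (rule le_less_trans)
    then show "\<rho> *\<^sub>R z \<in> unit_disc" using \<rho> by simp
  qed
  note base = u.tubular_base[OF \<rho> R f S inj pl]
  define G where "G y = pullback_matrix f (snd y)" for y :: "real \<times> (real^'n)"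
  interpret Fam: conformal_harmonic_family G "UNIV \<times> S" i1 i2 R0
  proof
    show o: "open (UNIV \<times> S)" by (intro open_Times S open_UNIV)
    show "smooth_on (UNIV \<times> S) G"
      unfolding G_def[abs_def]
      by (rule smooth_on_comp[OF o S pullback_matrix_smooth[OF f S] smooth_on_snd[OF o smooth_on_ident[OF o]]]) auto
    show "posdef (G y)" if "y \<in> UNIV \<times> S" for y
      unfolding G_def by (rule pullback_matrix_posdef[OF f S _ inj]) (use that in auto)
    fix z :: complex assume z: "z \<in> cball 0 R0"
    show "(0, plane i1 i2 z) \<in> UNIV \<times> S" using pl[OF zR(1)[OF z]] by simp
    show "G (0, plane i1 i2 z) $ i1 $ i1 = G (0, plane i1 i2 z) $ i2 $ i2" "G (0, plane i1 i2 z) $ i1 $ i2 = 0"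
      "christoffel_quad (\<lambda>x. G (0, x)) (plane i1 i2 z) (axis i1 1) +
        christoffel_quad (\<lambda>x. G (0, x)) (plane i1 i2 z) (axis i2 1) = 0"
      using base(2-4)[OF _ _ zR[OF z]] by (simp_all add: G_def)
  qed (use i R0 in auto)
  obtain \<delta> where \<delta>: "\<delta> > 0" and disc: "\<And>q \<eta>. norm q < \<delta> \<and> norm (\<eta> - axis i1 1) < \<delta> \<longrightarrow>
    (\<exists>U. smooth_on (ball 0 1) U \<and> U 0 = q \<and> frechet_derivative U (at 0) 1 = \<eta> \<and>
      (\<forall>z\<in>ball 0 1. U z \<in> S \<and> frechet_derivative U (at z) 1 \<noteq> 0 \<and>
        frechet_derivative U (at z) 1 \<bullet> (pullback_matrix f (U z) *v frechet_derivative U (at z) 1) =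
          frechet_derivative U (at z) \<i> \<bullet> (pullback_matrix f (U z) *v frechet_derivative U (at z) \<i>) \<and>
        frechet_derivative U (at z) 1 \<bullet> (pullback_matrix f (U z) *v frechet_derivative U (at z) \<i>) = 0 \<and>
        tension (pullback_matrix f) U z = 0))"
  proof -
    obtain \<delta> where \<delta>: "\<delta> > 0" and d: "\<And>l q \<eta>. \<bar>l\<bar> < \<delta> \<and> norm q < \<delta> \<and> norm (\<eta> - axis i1 1) < \<delta> \<longrightarrow>
      (\<exists>U. smooth_on (ball 0 1) U \<and> U 0 = q \<and> frechet_derivative U (at 0) 1 = \<eta> \<and>
      (\<forall>z\<in>ball 0 1. (l, U z) \<in> UNIV \<times> S \<and> frechet_derivative U (at z) 1 \<noteq> 0 \<and>
        frechet_derivative U (at z) 1 \<bullet> (G (l, U z) *v frechet_derivative U (at z) 1) =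
          frechet_derivative U (at z) \<i> \<bullet> (G (l, U z) *v frechet_derivative U (at z) \<i>) \<and>
        frechet_derivative U (at z) 1 \<bullet> (G (l, U z) *v frechet_derivative U (at z) \<i>) = 0 \<and>
        tension (\<lambda>x. G (l, x)) U z = 0))"
      using Fam.nearby_discs by blast
    show ?thesis by (rule that[OF \<delta>]) (use d[of 0] \<delta> in \<open>simp add: G_def\<close>)
  qed
  define \<Phi> where "\<Phi> x = snd c (f x)" for x
  define S' where "S' = {x \<in> S. f x \<in> fst c}"
  have S': "open S'" unfolding S'_def by (rule smooth_into_open[OF f c S])
  have \<Phi>: "smooth_on S' \<Phi>" unfolding S'_def \<Phi>_def[abs_def] by (rule smooth_into_chart[OF f c])
  have pl0: "plane i1 i2 0 = 0" by (simp add: plane_def)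
  have f0: "0 \<in> S" "f 0 = ?p0" using pl[of 0] R pl0 u(2) by auto
  have S'0: "0 \<in> S'" using f0 p0 by (simp add: S'_def)
  have \<Phi>inj: "inj (frechet_derivative \<Phi> (at 0))"
    unfolding \<Phi>_def[abs_def] by (rule tangent_map_inj_chart[OF f S f0(1) c _ inj[OF f0(1)]]) (simp add: f0 p0)
  have \<Phi>x: "\<Phi> 0 = x0" unfolding \<Phi>_def f0 by (rule chart_chart_inv[OF x0])
  have \<Phi>': "frechet_derivative \<Phi> (at x) e = tangent_map A f x e c" if "x \<in> S'" for x e
    using that c by (simp add: \<Phi>_def[abs_def] tangent_map_def S'_def)
  have "frechet_derivative \<Phi> (at 0) (axis i1 1) = (\<rho> * r) *\<^sub>R w0"
  proof -
    have "tangent_map A f (plane i1 i2 0) (plane i1 i2 1) = tangent_map A u (\<rho> *\<^sub>R 0) (\<rho> *\<^sub>R 1)"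
      by (rule base(1)) (use R in auto)
    then have "tangent_map A f 0 (axis i1 1) = tangent_map A u 0 (\<rho> *\<^sub>R 1)" by (simp add: plane_def)
    also have "\<dots> = tvec_scale \<rho> (tvec_scale r (tvec_of_coords A c ?p0 w0))"
      using u(3) by (simp only: tangent_map_add(2)[OF u.u_smooth open_ball] centre_in_ball zero_less_one differential_eq_tangent_map)
    finally show ?thesis unfolding \<Phi>'[OF S'0] by (simp add: tvec_scale_def tvec_of_coords_self[OF c p0])
  qed
  \<comment> \<open>The 1-jets, in tubular coordinates, that the perturbation theorem realizes;
    \<open>H\<close> expresses them in the chart \<open>c\<close>.\<close>
  define T where "T = (S' \<inter> ball 0 \<delta>) \<times> ball (axis i1 1 :: real^'n) \<delta>"
  define H where "H y = (\<Phi> (fst y), frechet_derivative \<Phi> (at (fst y)) (snd y))" for y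
  have HT: "(x0, (\<rho> * r) *\<^sub>R w0) \<in> interior (H ` T)"
  proof -
    have "open T" unfolding T_def by (intro open_Times open_Int S' open_ball)
    moreover have "T \<subseteq> S' \<times> UNIV" "(0, axis i1 1) \<in> T" using S'0 \<delta> by (auto simp: T_def)
    ultimately have "(\<Phi> 0, frechet_derivative \<Phi> (at 0) (axis i1 1)) \<in> interior (H ` T)"
      unfolding H_def[abs_def] by (rule derivative_map_open[OF \<Phi> S' S'0 \<Phi>inj])
    then show ?thesis unfolding \<Phi>x \<open>frechet_derivative \<Phi> (at 0) (axis i1 1) = (\<rho> * r) *\<^sub>R w0\<close> .
  qed
  \<comment> \<open>The rescaling accounts for the factor \<open>\<rho> * r\<close> between a vector
    and the velocity of its disc.\<close>
  let ?O = "(chart_image c \<times> UNIV) \<inter> (\<lambda>y. (fst y, (\<rho> * r) *\<^sub>R snd y)) -` interior (H ` T)"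
  have "F (bundle_param A c (x, w)) < a" if y: "(x, w) \<in> ?O" for x w
  proof -
    have x: "x \<in> chart_image c" using y by blast
    have "(x, (\<rho> * r) *\<^sub>R w) \<in> H ` T" using y interior_subset by auto
    then obtain q \<eta> where q: "(q, \<eta>) \<in> T" "x = \<Phi> q" "(\<rho> * r) *\<^sub>R w = frechet_derivative \<Phi> (at q) \<eta>"
      by (auto simp: H_def)
    then have qS: "q \<in> S'" "q \<in> S" "f q \<in> fst c" "norm q < \<delta>" "norm (\<eta> - axis i1 1) < \<delta>"
      by (auto simp: T_def S'_def dist_norm norm_minus_commute)
    have xp: "chart_inv c x = f q" unfolding q(2) \<Phi>_def by (rule chart_inv_chart[OF c qS(3)])
    obtain U where U: "smooth_on unit_disc U" "U 0 = q" "frechet_derivative U (at 0) 1 = \<eta>"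
      and Uz: "\<And>z. z \<in> unit_disc \<Longrightarrow> U z \<in> S \<and> frechet_derivative U (at z) 1 \<noteq> 0 \<and>
        frechet_derivative U (at z) 1 \<bullet> (pullback_matrix f (U z) *v frechet_derivative U (at z) 1) =
          frechet_derivative U (at z) \<i> \<bullet> (pullback_matrix f (U z) *v frechet_derivative U (at z) \<i>) \<and>
        frechet_derivative U (at z) 1 \<bullet> (pullback_matrix f (U z) *v frechet_derivative U (at z) \<i>) = 0 \<and>
        tension (pullback_matrix f) U z = 0"
      using disc[of q \<eta>] qS by blast
    have chi: "conformal_harmonic_immersion X A g (\<lambda>z. f (U z))"
      by (rule conformal_harmonic_immersion_comp[OF f S inj U(1)]) (use Uz in auto)
    have z0: "(0::complex) \<in> unit_disc" by simp
    have "differential A (\<lambda>z. f (U z)) 0 1 = tangent_map A f (U 0) (frechet_derivative U (at 0) 1)"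
      unfolding differential_eq_tangent_map
      by (rule tangent_map_comp[OF f S smooth_on_has_derivative[OF U(1) z0]]) (use Uz[OF z0] in blast)
    then have d: "differential A (\<lambda>z. f (U z)) 0 1 = tangent_map A f q \<eta>" by (simp add: U)
    have "tangent_map A f q \<eta> = tvec_of_coords A c (f q) ((\<rho> * r) *\<^sub>R w)"
      by (rule tangent_space_eqI[OF tangent_map_in_tangent_space[OF f S qS(2)] tvec_of_coords_in_tangent_space[OF c qS(3)] c qS(3)])
        (simp add: tvec_of_coords_self[OF c qS(3)] q(3) \<Phi>'[OF qS(1)])
    then have d': "differential A (\<lambda>z. f (U z)) 0 1 = tvec_scale (\<rho> * r) (tvec_of_coords A c (f q) w)"
      unfolding d tvec_of_coords_linear(2)[OF c qS(3)] .
    show ?thesis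
    proof (cases "tvec_of_coords A c (f q) w = tvec_zero")
      case True
      then show ?thesis using b(2) by (auto simp: bundle_param_def xp kobayashi_royden_def intro: le_less_trans)
    next
      case False
      show ?thesis
        unfolding bundle_param_def prod.case xp kobayashi_royden_less_iff[OF False]
        by (intro exI[of _ "\<rho> * r"] conjI exI[of _ "\<lambda>z. f (U z)"] chi d') (use \<rho>r b(2) U in auto)
    qed
  qed
  moreover have "open ?O"
    by (intro open_Int open_Times chart_image_open c open_UNIV open_vimage open_interior continuous_intros)
  moreover have "(x0, w0) \<in> ?O" using HT x0 by simp
  ultimately show ?thesis by (intro exI[of _ ?O]) auto
qed

lemma upper_semicontinuous_zero:
  assumes n: "CARD('n) \<ge> 2" and c: "c \<in> A" and x0: "x0 \<in> chart_image c" and a: "a > 0"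
  shows "\<exists>O'. open O' \<and> (x0, 0) \<in> O' \<and> O' \<subseteq> chart_image c \<times> UNIV \<and> (\<forall>y\<in>O'. F (bundle_param A c y) < a)"
proof -
  \<comment> \<open>Within the bundle chart this is the interior of the set where \<open>F\<close>
    is below \<open>k\<close>; taking the union of all admissible open sets avoids choosing
    neighbourhoods.\<close>
  define V where "V k = \<Union>{O'. open O' \<and> O' \<subseteq> chart_image c \<times> UNIV \<and> (\<forall>y\<in>O'. F (bundle_param A c y) < ennreal (real k))}"
    for k :: nat
  have V: "open (V k)" for k unfolding V_def by (rule open_Union) blast
  have Vc: "V k \<subseteq> chart_image c \<times> UNIV" for k unfolding V_def by blast
  have VF: "F (bundle_param A c y) < ennreal (real k)" if "y \<in> V k" for y k using that unfolding V_def by blast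
  have Vmono: "V k \<subseteq> V l" if "k \<le> l" for k l
  proof -
    have "ennreal (real k) \<le> ennreal (real l)" using that by (simp add: ennreal_leI)
    then show ?thesis unfolding V_def by (intro Union_mono) (auto intro: less_le_trans)
  qed
  let ?K = "{x0} \<times> sphere (0::real^'n) 1"
  have K: "compact ?K" by (intro compact_Times) auto
  have cover: "?K \<subseteq> (\<Union>k. V k)"
  proof
    fix y assume "y \<in> ?K"
    then obtain w where y: "y = (x0, w)" "w \<noteq> 0" by force
    have "F (bundle_param A c y) < \<infinity>"
      unfolding y by (rule kobayashi_royden_finite[OF n bundle_param_in_tangent_bundle[OF c x0]])
    then have "F (bundle_param A c y) < top" by simp
    then obtain k where "F (bundle_param A c (x0, w)) < of_nat k" unfolding y using ennreal_Ex_less_of_nat by blast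
    then have "F (bundle_param A c (x0, w)) < ennreal (real k)" by (simp add: ennreal_of_nat_eq_real_of_nat)
    from upper_semicontinuous_nonzero[OF n c x0 y(2) this] show "y \<in> (\<Union>k. V k)"
      unfolding V_def y by blast
  qed
  obtain N where N: "finite N" "?K \<subseteq> (\<Union>k\<in>N. V k)"
    by (rule compactE_image[OF K V cover])
  \<comment> \<open>The inserted \<open>1\<close> keeps the later division by \<open>m\<close>
    meaningful.\<close>
  define m where "m = Max (insert 1 N)"
  have m: "k \<le> m" if "k \<in> N" for k using that N(1) by (simp add: m_def)
  have m1: "m \<ge> 1" using N(1) by (simp add: m_def)
  have "?K \<subseteq> V m" using N(2) Vmono[OF m] by blast
  \<comment> \<open>A cover by one set yields a positive distance from the compact set to its
    complement; with it the bound extends to all base points near \<open>x0\<close>.\<close>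
  then obtain e where e: "e > 0" "\<And>y. y \<in> ?K \<Longrightarrow> \<exists>G\<in>{V m}. ball y e \<subseteq> G"
    using Heine_Borel_lemma[OF K, of "{V m}"] V by (metis Union_insert Union_empty sup_bot_right singletonD)
  have near: "(x, w) \<in> V m" if "dist x0 x < e" "norm w = 1" for x w
  proof -
    have "ball (x0, w) e \<subseteq> V m" using e(2)[of "(x0, w)"] that(2) by simp
    moreover have "dist (x0, w) (x, w) = dist x0 x" by (simp add: dist_Pair_Pair)
    ultimately show ?thesis using that(1) by (auto simp: subset_eq)
  qed
  obtain s :: real where s: "s > 0" "ennreal s \<le> a"
  proof (cases a)
    case (real r)
    then show ?thesis using a that[of r] by simp
  next
    case top
    then show ?thesis using that[of 1] by simp
  qed
  \<comment> \<open>For such vectors \<open>norm w * real m\<close> is below \<open>s\<close>, and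
    \<open>s\<close> does not exceed \<open>a\<close>.\<close>
  let ?O = "ball x0 e \<times> ball (0::real^'n) (s / real m)"
  have xe: "x \<in> chart_image c" if "x \<in> ball x0 e" for x
  proof -
    obtain i :: 'n where True by blast
    have "(x, axis i 1) \<in> V m" by (rule near) (use that in auto)
    then show ?thesis using Vc by blast
  qed
  have "F (bundle_param A c (x, w)) < a" if y: "(x, w) \<in> ?O" for x w
  proof (cases "w = 0")
    case True
    have x: "x \<in> chart_image c" using y xe by blast
    show ?thesis
      using a tvec_of_coords_eq_zero_iff[OF c chart_inv_in[OF x], of w] True
      by (simp add: bundle_param_def kobayashi_royden_def)
  next
    case False
    have x: "x \<in> chart_image c" using y xe by blast
    have "(x, w /\<^sub>R norm w) \<in> V m" by (rule near) (use y False in auto)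
    then have "F (bundle_param A c (x, w /\<^sub>R norm w)) < ennreal (real m)" by (rule VF)
    from kobayashi_royden_scale[OF c x this, of "norm w"] False
    have "F (bundle_param A c (x, w)) < ennreal (norm w * real m)" by simp
    also have "norm w * real m \<le> s" using y m1 by (simp add: field_simps)
    then have "ennreal (norm w * real m) \<le> ennreal s" by (rule ennreal_leI)
    also have "ennreal s \<le> a" by (rule s(2))
    finally show ?thesis .
  qed
  moreover have "open ?O" by (intro open_Times open_ball)
  moreover have "(x0, 0) \<in> ?O" using e s m1 by auto
  ultimately show ?thesis using xe by (intro exI[of _ ?O]) auto
qed

theorem kobayashi_royden_upper_semicontinuous:
  assumes n: "CARD('n) \<ge> 2"
  shows "upper_semicontinuous_map (tangent_bundle_topology X A) F"
  unfolding upper_semicontinuous_map_def topspace_tangent_bundle_topology openin_tangent_bundle_topology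
proof (intro allI conjI ballI)
  fix a :: ennreal and c assume c: "c \<in> A"
  let ?Q = "chart_image c \<times> UNIV \<inter> bundle_param A c -` {v \<in> tangent_bundle X A. F v < a}"
  show "open ?Q"
  proof (subst open_subopen, rule ballI)
    fix y assume y: "y \<in> ?Q"
    obtain x w where xw: "y = (x, w)" by (cases y)
    have x: "x \<in> chart_image c" and less: "F (bundle_param A c (x, w)) < a" using y xw by auto
    have "a > 0" using less by (rule le_less_trans[rotated]) simp
    then have "\<exists>O'. open O' \<and> (x, w) \<in> O' \<and> O' \<subseteq> chart_image c \<times> UNIV \<and> (\<forall>y\<in>O'. F (bundle_param A c y) < a)"
      using upper_semicontinuous_nonzero[OF n c x _ less] upper_semicontinuous_zero[OF n c x \<open>a > 0\<close>] by (cases "w = 0") simp_all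
    then obtain O' where O': "open O'" "(x, w) \<in> O'" "O' \<subseteq> chart_image c \<times> UNIV" "\<forall>y\<in>O'. F (bundle_param A c y) < a"
      by blast
    have "O' \<subseteq> ?Q"
    proof
      fix z assume z: "z \<in> O'"
      then have "z \<in> chart_image c \<times> UNIV" "F (bundle_param A c z) < a" using O' by auto
      then show "z \<in> ?Q" using bundle_param_in_tangent_bundle[OF c, of "fst z" "snd z"] by auto
    qed
    then show "\<exists>T. open T \<and> y \<in> T \<and> T \<subseteq> ?Q" using O' xw by blast
  qed
qed auto

end

theorem theorem3p3:
  fixes X :: "'a topology"
    and A :: "('a, 'n::finite) chart set"
    and g :: "'a \<Rightarrow> ('a, 'n) tvec \<Rightarrow> ('a, 'n) tvec \<Rightarrow> real"
  assumes "riemannian_manifold X A g"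
    and "CARD('n) \<ge> 2"
  shows "(\<forall>v\<in>tangent_bundle X A. kobayashi_royden X A g v < \<infinity>) \<and>
         upper_semicontinuous_map (tangent_bundle_topology X A) (kobayashi_royden X A g)"
proof -
  interpret riemannian_manifold X A g by fact
  show ?thesis using kobayashi_royden_finite[OF assms(2)] kobayashi_royden_upper_semicontinuous[OF assms(2)] by blast
qed

end
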